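(* For every $K>0$, $\tilde{\mathcal F}^1\subseteq\mathcal D(\Omega_K)$, where $(\Omega_K,\mathcal D(\Omega_K))$ is the infinitesimal generator of the pruning process with state space $\mathbb H^{K,\sigma}$. Furthermore, for $\tilde\Psi=\Psi^{1,n,\tilde\Phi}\in\tilde{\mathcal F}^1$ and $\mathcal X=(T,\mu,\nu)\in\mathbb H^{K,\sigma}$, $$\Omega_K\tilde\Psi(\mathcal X)=\int_T\nu(\mathrm dv)\,\big[\tilde\Psi\big((T^v,\mu\restriction_{T^v},\nu\restriction_{T^v})\big)-\tilde\Psi(\mathcal X)\big]=-\int_{T^n}\mu^{\otimes n}(\mathrm d\underline u)\,\nu\big([\![\underline u]\!]\big)\,\tilde\Phi\big(\tau_{\mathcal X}(\underline u)\big).$$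
   Context: An $n$-pointed (rooted) metric measure space is $\mathcal X=(X,r,\rho,(u_1,\dots,u_n),\mu)$, abbreviated $(X,\underline u,\mu)$, where $(X,r)$ is a metric space, $\rho\in X$ the root, $u_1,\dots,u_n\in X$, and $\mu$ is a finite Borel measure with $(\mathrm{supp}(\mu),r)$ complete and separable (if separable but not complete, it is identified with its completion). Put $\mathrm{supp}(\mathcal X):=\mathrm{supp}(\mu)\cup\{\rho,u_1,\dots,u_n\}$. Two such spaces are equivalent if there is an isometry between their supports preserving measure, root and marked points; $\mathbb M_n$ is the set of equivalence classes. $\mathbb H_n\subseteq\mathbb M_n$ is the set of classes whose support is $0$-hyperbolic, i.e. $r(x_1,x_2)+r(x_3,x_4)\le\max\{r(x_1,x_3)+r(x_2,x_4),r(x_1,x_4)+r(x_2,x_3)\}$ for all points. Elements of $\mathbb H_n$ are always represented by $\mathbb R$-trees (connected $0$-hyperbolic spaces). In a rooted $\mathbb R$-tree $(T,r,\rho)$, $[x,y]$ is the unique path between $x,y$, $[x,y[:=[x,y]\setminus\{y\}$, and $[\![A]\!]:=\{\rho\}\cup\bigcup_{v\in A}[\rho,v]$ for a list or subset $A$ of $T$. $\|\mu\|$ is total mass, $\mu^\circ=\mu/\|\mu\|$ for $\mu\ne0$. With $R^X(x_1,x_2,\dots):=(r(x_i,x_j))_{0\le i<j}$, $x_0:=\rho$ (finite or infinite lists), put $\boldsymbol\upsilon^{\mathcal X}:=\|\mu\|\cdot(R^X)_*\big(\bigotimes_{k=1}^n\delta_{u_k}\otimes(\mu^\circ)^{\otimes\mathbb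 N}\big)$ (and $0$ if $\mu=0$) for $\mathcal X=(X,\underline u,\mu)\in\mathbb M_n$. The $n$-pointed Gromov-weak (pGw) topology: $\mathcal X_N\to\mathcal X$ iff $\boldsymbol\upsilon^{\mathcal X_N}\Rightarrow\boldsymbol\upsilon^{\mathcal X}$ weakly and $R^{X_N}(\underline u_N)\to R^X(\underline u)$ (the latter automatic if $\mu\ne0$). For a rooted $\mathbb R$-tree $T$ with finite measure $\mu$ (separable support), $\mathrm{Sk}_\mu(T):=\bigcup_{v\in\mathrm{supp}(\mu)}[\rho,v[\ \cup\{v\in T:\mu(\{v\})>0\}$ and $\mathrm{Lf}_\mu(T):=[\![\mathrm{supp}(\mu)]\!]\setminus\mathrm{Sk}_\mu(T)$. A (rooted) bi-measure $\mathbb R$-tree is $(T,\mu,\nu)$ with $(T,r,\rho)$ a rooted $\mathbb R$-tree, $\mu$ a finite Borel measure on $T$ such that $(\mathrm{supp}(\mu),r)$ is complete and separable (if separable but not complete, it is identified with its completion), and $\nu$ a ($\sigma$-finite) measure on $T$ such that $\nu([\rho,u])<\infty$ for $\mu$-a.e. $u$ and $\nu(\mathrm{Lf}_\mu(T))=0$. Two of them are equivalent if there is an isometry $\phi:[\![\mathrm{supp}(\mu)]\!]\to T'$ preserving the root with $\phi_*\mu=\mu'$ and $\phi_*(\nu\restriction_{\mathrm{Sk}_\mu(T)})=\nu'\restriction_{\mathrm{Sk}_{\mu'}(T')}$ (so $\nu$ only matters on the $\mu$-skeleton). $\mathbb H^{f,\sigma}$ is the set of equivalence classes; $\mathbb H^{K,\sigma}:=\{(T,\mu,\nu)\in\mathbb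 H^{f,\sigma}:\|\mu\|\le K\}$. For $\mathcal X=(T,\mu,\nu)\in\mathbb H^{f,\sigma}$: $\tau_{\mathcal X}(u_1,\dots,u_n):=([\![u_1,\dots,u_n]\!],(u_1,\dots,u_n),\nu\restriction_{[\![u_1,\dots,u_n]\!]})\in\mathbb H_n$ (for $\mu^{\otimes n}$-a.e. $\underline u$); $\varsigma_{\mathcal X}(\underline u):=(\tau_{\mathcal X}(u_1),\tau_{\mathcal X}(u_1,u_2),\dots)\in\prod_n\mathbb H_n$; $\varpi^{\mathcal X}:=\|\mu\|\cdot(\varsigma_{\mathcal X})_*((\mu^\circ)^{\otimes\mathbb N})$ ($:=0$ if $\mu=0$). The LWV-topology on $\mathbb H^{f,\sigma}$: $\mathcal X_N\to\mathcal X$ iff $\varpi^{\mathcal X_N}\Rightarrow\varpi^{\mathcal X}$ weakly as finite measures on $\prod_n\mathbb H_n$ with the product of pGw topologies. Pruning process. For $v\in T$ let $T^v:=\{w\in T:v\notin[\rho,w]\}$, and for a set $A\subseteq T$ let $T^A:=\bigcap_{v\in A}T^v$. For $\mathcal X=(T,\mu,\nu)\in\mathbb H^{f,\sigma}$ let $\pi^{\mathcal X}$ be a Poisson point measure on $\mathbb R_+\times T$ with intensity $\lambda\otimes\nu$ ($\lambda$ Lebesgue measure) and $\pi_t(\cdot):=\pi^{\mathcal X}([0,t]\times\cdot)$, identified with its set of atoms. The pruning process started in $X_0=\mathcal X$ is $X_t:=(T^{\pi_t},\mu\restriction_{T^{\pi_t}},\nu\restriction_{T^{\pi_t}})$, $t\ge0$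 (a pruned tree that is empty is understood as the class of the one-point tree with zero measures). Started in $\mathbb H^{K,\sigma}$ it stays there. Generator. Let $S_tG(\mathcal X):=\mathbb E^{\mathcal X}[G(X_t)]$ be the semigroup on $\mathcal C_b(\mathbb H^{K,\sigma})$ (bounded LWV-continuous functions), and $\mathcal D(S):=\{f\in\mathcal C_b(\mathbb H^{K,\sigma}):\lim_{t\to0}\|S_tf-f\|_\infty=0\}$. $\Omega_K$ is the generator of the strongly continuous contraction semigroup obtained by restricting $(S_t)$ to $\mathcal D(S)$: $\Omega_Kf=\lim_{t\to0}\frac1t(S_tf-f)$ in supremum norm, $\mathcal D(\Omega_K)$ being the set of $f$ for which the limit exists. Test functions. $\Pi_n$ is the set of functions $\Phi^{\gamma,m,\varphi}(X,\underline u,\mu):=\gamma(\|\mu\|)\int_{X^m}\varphi(R^X(\underline u,\underline v))\,\mu^{\otimes m}(\mathrm d\underline v)$ with $m\in\mathbb N_0$, $\varphi\in\mathcal C_b(\mathbb R_+^{\binom{n+m+1}2})$, $\gamma\in\mathcal C_b(\mathbb R_+)$, $\lim_{x\to\infty}x^k\gamma(x)=0$ for all $k\in\mathbb N$. For $I=\{i_1<\dots<i_k\}\subseteq\{1,\dots,n\}$, $\pi^n_I(\underline u):=(u_{i_1},\dots,u_{i_k})$ and $\pi^n_I(T,\underline u,\mu):=([\![\pi^n_I(\underline u)]\!],\pi^n_I(\underline u),\mu\restriction_{[\![\pi^n_I(\underline u)]\!]})$. $\tilde\Pi_n:=\{\prod_{I\subseteq\{1,\dots,n\}}\Phi_I\circ\pi^n_I:\Phi_I\in\Pi_{\#I}\}$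 (functions on $\mathbb H_n$). For $n\in\mathbb N$, $\tilde\Phi\in\tilde\Pi_n$, $\Psi^{1,n,\tilde\Phi}(T,\mu,\nu):=\int_{T^n}\tilde\Phi(\tau_{(T,\mu,\nu)}(\underline u))\,\mu^{\otimes n}(\mathrm d\underline u)$, and $\tilde{\mathcal F}^1:=\{\Psi^{1,n,\tilde\Phi}:n\in\mathbb N,\tilde\Phi\in\tilde\Pi_n\}$.
   Formalization: In the products defining $\tilde\Pi_n$ only non-empty $I\subseteq\{1,\dots,n\}$ are used: a factor for $I=\emptyset$ is a function of $\nu\{\rho\}$, which is not LWV-continuous ($\mu=\delta_1$, $\nu_N=\delta_{1/N}\to\delta_0$ on $[0,1]$), so the claim fails with it. *)

theory Defs
  imports "HOL-Probability.Probability"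
begin

section \<open>Topological and measure-theoretic preliminaries\<close>

definition borel_of :: "'a topology \<Rightarrow> 'a measure" where
  "borel_of X = sigma (topspace X) {U. openin X U}"

definition Cb :: "'a topology \<Rightarrow> ('a \<Rightarrow> real) set" where
  "Cb X = {f. continuous_map X euclideanreal f \<and> bounded (f ` topspace X)}"

definition weakly_converges :: "'a topology \<Rightarrow> (nat \<Rightarrow> 'a measure) \<Rightarrow> 'a measure \<Rightarrow> bool" where
  "weakly_converges X Ms M \<longleftrightarrow>
     (\<forall>f\<in>Cb X. (\<lambda>N. \<integral>x. f x \<partial>Ms N) \<longlonglongrightarrow> (\<integral>x. f x \<partial>M))"

text \<open>The topology on \<open>S\<close> specified by a notion of sequential convergence: the open sets are the
  sequentially open ones.  For a (pseudo-)metrizable topology, and both topologies below are of this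
  kind, this recovers the topology from its convergent sequences.\<close>

definition topology_of_convergence :: "'a set \<Rightarrow> ((nat \<Rightarrow> 'a) \<Rightarrow> 'a \<Rightarrow> bool) \<Rightarrow> 'a topology" where
  "topology_of_convergence S conv =
     topology (\<lambda>U. U \<subseteq> S \<and>
       (\<forall>x\<in>U. \<forall>X. range X \<subseteq> S \<and> conv X x \<longrightarrow> (\<forall>\<^sub>F N in sequentially. X N \<in> U)))"

lemma openin_topology_of_convergence:
  "openin (topology_of_convergence S conv) U \<longleftrightarrow> U \<subseteq> S \<and>
     (\<forall>x\<in>U. \<forall>X. range X \<subseteq> S \<and> conv X x \<longrightarrow> (\<forall>\<^sub>F N in sequentially. X N \<in> U))"
proof -
  have "istopology (\<lambda>U. U \<subseteq> S \<and>
       (\<forall>x\<in>U. \<forall>X. range X \<subseteq> S \<and> conv X x \<longrightarrow> (\<forall>\<^sub>F N in sequentially. X N \<in> U)))"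
    unfolding istopology_def
  proof (intro conjI allI impI ballI)
    fix U V x X
    assume U: "U \<subseteq> S \<and>
       (\<forall>x\<in>U. \<forall>X. range X \<subseteq> S \<and> conv X x \<longrightarrow> (\<forall>\<^sub>F N in sequentially. X N \<in> U))"
      and V: "V \<subseteq> S \<and>
       (\<forall>x\<in>V. \<forall>X. range X \<subseteq> S \<and> conv X x \<longrightarrow> (\<forall>\<^sub>F N in sequentially. X N \<in> V))"
    show "U \<inter> V \<subseteq> S" using U by blast
    assume x: "x \<in> U \<inter> V" and X: "range X \<subseteq> S \<and> conv X x"
    have "\<forall>\<^sub>F N in sequentially. X N \<in> U" "\<forall>\<^sub>F N in sequentially. X N \<in> V"
      using U V x X by blast+
    then show "\<forall>\<^sub>F N in sequentially. X N \<in> U \<inter> V"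
      by eventually_elim simp
  next
    fix K x X
    assume K: "\<forall>U\<in>K. U \<subseteq> S \<and>
       (\<forall>x\<in>U. \<forall>X. range X \<subseteq> S \<and> conv X x \<longrightarrow> (\<forall>\<^sub>F N in sequentially. X N \<in> U))"
    show "\<Union>K \<subseteq> S" using K by blast
    assume x: "x \<in> \<Union>K" and X: "range X \<subseteq> S \<and> conv X x"
    then obtain U where U: "U \<in> K" "x \<in> U" by blast
    then have "\<forall>\<^sub>F N in sequentially. X N \<in> U" using K X by blast
    then show "\<forall>\<^sub>F N in sequentially. X N \<in> \<Union>K"
      by eventually_elim (use U in blast)
  qed
  then show ?thesis
    by (simp add: topology_of_convergence_def topology_inverse')
qed

lemma topspace_topology_of_convergence [simp]:
  "topspace (topology_of_convergence S conv) = S"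
proof (rule antisym)
  show "topspace (topology_of_convergence S conv) \<subseteq> S"
    by (metis openin_topology_of_convergence openin_topspace)
  have "openin (topology_of_convergence S conv) S"
    by (auto simp: openin_topology_of_convergence image_subset_iff)
  then show "S \<subseteq> topspace (topology_of_convergence S conv)"
    by (rule openin_subset)
qed

definition msupp :: "'a metric \<Rightarrow> 'a measure \<Rightarrow> 'a set" where
  "msupp m \<mu> = {x \<in> mspace m. \<forall>e>0. emeasure \<mu> (mball_of m x e) > 0}"

definition total_mass :: "'a measure \<Rightarrow> real" where
  "total_mass \<mu> = measure \<mu> (space \<mu>)"

text \<open>A finite Borel measure with complete separable support.  It is required to be carried by its
  support; on a metric space of non-measurable cardinality this is automatic.\<close>

definition fin_meas_css :: "'a metric \<Rightarrow> 'a measure \<Rightarrow> bool" where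
  "fin_meas_css m \<mu> \<longleftrightarrow>
     sets \<mu> = sets (borel_of (mtopology_of m)) \<and> finite_measure \<mu> \<and>
     separable_space (subtopology (mtopology_of m) (msupp m \<mu>)) \<and>
     mcomplete_of (submetric m (msupp m \<mu>)) \<and>
     emeasure \<mu> (mspace m - msupp m \<mu>) = 0"

text \<open>Samples from \<open>\<mu>\<close> are drawn on the separable space \<open>supp \<mu>\<close>, where the product of the Borel
  \<open>\<sigma>\<close>-algebras is the Borel \<open>\<sigma>\<close>-algebra of the product (this may fail on a non-separable space).\<close>

definition on_supp :: "'a metric \<Rightarrow> 'a measure \<Rightarrow> 'a measure" where
  "on_supp m \<mu> = restrict_space \<mu> (msupp m \<mu>)"

definition on_supp_normalized :: "'a metric \<Rightarrow> 'a measure \<Rightarrow> 'a measure" where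
  "on_supp_normalized m \<mu> = scale_measure (inverse (emeasure \<mu> (space \<mu>))) (on_supp m \<mu>)"

section \<open>0-hyperbolic spaces and rooted real trees\<close>

definition zero_hyperbolic_on :: "'a metric \<Rightarrow> 'a set \<Rightarrow> bool" where
  "zero_hyperbolic_on m S \<longleftrightarrow>
     (\<forall>x1\<in>S. \<forall>x2\<in>S. \<forall>x3\<in>S. \<forall>x4\<in>S.
        mdist m x1 x2 + mdist m x3 x4
          \<le> max (mdist m x1 x3 + mdist m x2 x4) (mdist m x1 x4 + mdist m x2 x3))"

definition real_tree :: "'a metric \<Rightarrow> bool" where
  "real_tree m \<longleftrightarrow> connected_space (mtopology_of m) \<and> zero_hyperbolic_on m (mspace m)"

text \<open>\<open>[x,y]\<close>, the range of the injective path from \<open>x\<close> to \<open>y\<close>, which is unique in a real tree.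
  The part \<open>{x,y}\<close> only matters for \<open>x = y\<close>, where the path is constant.\<close>

definition seg :: "'a metric \<Rightarrow> 'a \<Rightarrow> 'a \<Rightarrow> 'a set" where
  "seg m x y = {x, y} \<union>
     \<Union>{g ` {0..1} | g. pathin (mtopology_of m) g \<and> inj_on g {0..1} \<and> g 0 = x \<and> g 1 = y}"

definition span_tree :: "'a metric \<Rightarrow> 'a \<Rightarrow> 'a set \<Rightarrow> 'a set" where
  "span_tree m \<rho> A = {\<rho>} \<union> (\<Union>v\<in>A. seg m \<rho> v)"

section \<open>Pointed metric measure spaces and the pointed Gromov-weak topology\<close>

record 'a pmm =
  p_metric :: "'a metric"
  p_root :: 'a
  p_points :: "'a list"
  p_measure :: "'a measure"

definition psupp :: "'a pmm \<Rightarrow> 'a set" where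
  "psupp X = msupp (p_metric X) (p_measure X) \<union> {p_root X} \<union> set (p_points X)"

definition pmm_spaces :: "nat \<Rightarrow> 'a pmm set" where
  "pmm_spaces n = {X. length (p_points X) = n \<and>
     p_root X \<in> mspace (p_metric X) \<and> set (p_points X) \<subseteq> mspace (p_metric X) \<and>
     fin_meas_css (p_metric X) (p_measure X)}"

definition pmm_iso :: "'a pmm \<Rightarrow> 'a pmm \<Rightarrow> bool" where
  "pmm_iso X Y \<longleftrightarrow> (\<exists>\<phi>.
     bij_betw \<phi> (psupp X) (psupp Y) \<and>
     (\<forall>x\<in>psupp X. \<forall>y\<in>psupp X. mdist (p_metric Y) (\<phi> x) (\<phi> y) = mdist (p_metric X) x y) \<and>
     \<phi> (p_root X) = p_root Y \<and> map \<phi> (p_points X) = p_points Y \<and>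
     (\<forall>B\<in>sets (p_measure Y).
        emeasure (p_measure X) {x \<in> psupp X. \<phi> x \<in> B} = emeasure (p_measure Y) B))"

definition pmm_class :: "nat \<Rightarrow> 'a pmm \<Rightarrow> 'a pmm set" where
  "pmm_class n X = {Y \<in> pmm_spaces n. pmm_iso X Y}"

definition MM :: "nat \<Rightarrow> 'a pmm set set" where
  "MM n = pmm_spaces n // {(X, Y). X \<in> pmm_spaces n \<and> Y \<in> pmm_spaces n \<and> pmm_iso X Y}"

definition HH :: "nat \<Rightarrow> 'a pmm set set" where
  "HH n = {c \<in> MM n. \<forall>X\<in>c. zero_hyperbolic_on (p_metric X) (psupp X)}"

definition class_rep :: "'b set \<Rightarrow> 'b" where
  "class_rep c = (SOME X. X \<in> c)"

text \<open>Distance matrices are indexed by pairs \<open>i < j\<close>, position \<open>0\<close> being the root.\<close>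

definition pairs_upto :: "nat \<Rightarrow> (nat \<times> nat) set" where
  "pairs_upto k = {(i, j). i < j \<and> j \<le> k}"

definition all_pairs :: "(nat \<times> nat) set" where
  "all_pairs = {(i, j). i < j}"

definition matrix_top :: "(nat \<times> nat) set \<Rightarrow> (nat \<times> nat \<Rightarrow> real) topology" where
  "matrix_top I = product_topology (\<lambda>_. top_of_set {0..}) I"

text \<open>The sequence \<open>\<rho>, u\<^sub>1, \<dots>, u\<^sub>n, v\<^sub>0, v\<^sub>1, \<dots>\<close>\<close>

definition points_then :: "'a pmm \<Rightarrow> (nat \<Rightarrow> 'a) \<Rightarrow> nat \<Rightarrow> 'a" where
  "points_then X v k =
     (if k = 0 then p_root X
      else if k \<le> length (p_points X) then p_points X ! (k - 1)
      else v (k - 1 - length (p_points X)))"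

definition dist_matrix :: "(nat \<times> nat) set \<Rightarrow> 'a pmm \<Rightarrow> (nat \<Rightarrow> 'a) \<Rightarrow> nat \<times> nat \<Rightarrow> real" where
  "dist_matrix I X v =
     (\<lambda>(i, j)\<in>I. mdist (p_metric X) (points_then X v i) (points_then X v j))"

definition upsilon :: "'a pmm \<Rightarrow> (nat \<times> nat \<Rightarrow> real) measure" where
  "upsilon X =
     (if total_mass (p_measure X) = 0 then null_measure (borel_of (matrix_top all_pairs))
      else scale_measure (ennreal (total_mass (p_measure X)))
        (distr (Pi\<^sub>M UNIV (\<lambda>_. on_supp_normalized (p_metric X) (p_measure X)))
           (borel_of (matrix_top all_pairs)) (dist_matrix all_pairs X)))"

text \<open>\<open>R\<^sup>X(u)\<close> on the marked points alone; no sampled point is involved for pairs up to \<open>n\<close>.\<close>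

definition point_matrix :: "'a pmm \<Rightarrow> nat \<times> nat \<Rightarrow> real" where
  "point_matrix X = dist_matrix (pairs_upto (length (p_points X))) X (\<lambda>_. p_root X)"

definition pGw_converges :: "nat \<Rightarrow> (nat \<Rightarrow> 'a pmm set) \<Rightarrow> 'a pmm set \<Rightarrow> bool" where
  "pGw_converges n c d \<longleftrightarrow>
     weakly_converges (matrix_top all_pairs) (\<lambda>N. upsilon (class_rep (c N))) (upsilon (class_rep d)) \<and>
     (\<forall>p\<in>pairs_upto n. (\<lambda>N. point_matrix (class_rep (c N)) p) \<longlonglongrightarrow> point_matrix (class_rep d) p)"

definition pGw :: "nat \<Rightarrow> 'a pmm set topology" where
  "pGw n = topology_of_convergence (MM n) (pGw_converges n)"

definition HH_seq_top :: "(nat \<Rightarrow> 'a pmm set) topology" where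
  "HH_seq_top = product_topology (\<lambda>n. subtopology (pGw n) (HH n)) {1..}"

section \<open>Bi-measure real trees and the LWV-topology\<close>

record 'a bmt =
  b_metric :: "'a metric"
  b_root :: 'a
  b_mu :: "'a measure"
  b_nu :: "'a measure"

definition b_supp :: "'a bmt \<Rightarrow> 'a set" where
  "b_supp X = msupp (b_metric X) (b_mu X)"

definition b_span :: "'a bmt \<Rightarrow> 'a set \<Rightarrow> 'a set" where
  "b_span X A = span_tree (b_metric X) (b_root X) A"

definition b_mass :: "'a bmt \<Rightarrow> real" where
  "b_mass X = total_mass (b_mu X)"

definition skeleton :: "'a bmt \<Rightarrow> 'a set" where
  "skeleton X = (\<Union>v\<in>b_supp X. seg (b_metric X) (b_root X) v - {v})
     \<union> {v \<in> mspace (b_metric X). emeasure (b_mu X) {v} > 0}"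

definition leaves :: "'a bmt \<Rightarrow> 'a set" where
  "leaves X = b_span X (b_supp X) - skeleton X"

definition bm_trees :: "'a bmt set" where
  "bm_trees = {X.
     real_tree (b_metric X) \<and> b_root X \<in> mspace (b_metric X) \<and>
     fin_meas_css (b_metric X) (b_mu X) \<and>
     sets (b_nu X) = sets (borel_of (mtopology_of (b_metric X))) \<and>
     sigma_finite_measure (b_nu X) \<and>
     (AE u in b_mu X. emeasure (b_nu X) (seg (b_metric X) (b_root X) u) < \<infinity>) \<and>
     emeasure (b_nu X) (leaves X) = 0}"

text \<open>Equivalence of bi-measure trees.  If the support of \<open>Y\<close> is complete but that of \<open>X\<close> is only
  separable, the condition says that \<open>Y\<close> is equivalent to the completion of \<open>X\<close>:
  \<open>supp \<mu>\<^sub>Y\<close> is then the closure of the image of \<open>supp \<mu>\<^sub>X\<close>, and passing to the completion does not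
  change the skeleton.\<close>

definition bm_iso :: "'a bmt \<Rightarrow> 'a bmt \<Rightarrow> bool" where
  "bm_iso X Y \<longleftrightarrow> (\<exists>\<phi>.
     \<phi> ` b_span X (b_supp X) \<subseteq> mspace (b_metric Y) \<and>
     (\<forall>x\<in>b_span X (b_supp X). \<forall>y\<in>b_span X (b_supp X).
        mdist (b_metric Y) (\<phi> x) (\<phi> y) = mdist (b_metric X) x y) \<and>
     \<phi> (b_root X) = b_root Y \<and>
     (\<forall>B\<in>sets (b_mu Y).
        emeasure (b_mu X) {x \<in> b_span X (b_supp X). \<phi> x \<in> B} = emeasure (b_mu Y) B) \<and>
     (\<forall>B\<in>sets (b_nu Y).
        emeasure (b_nu X) {x \<in> skeleton X. \<phi> x \<in> B} = emeasure (b_nu Y) (B \<inter> skeleton Y)))"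

text \<open>The class of a possibly incomplete tree (such as a pruned one) is that of its completion.\<close>

definition bm_class :: "'a bmt \<Rightarrow> 'a bmt set" where
  "bm_class X = {Y \<in> bm_trees. bm_iso X Y}"

definition Hfs :: "'a bmt set set" where
  "Hfs = bm_trees // {(X, Y). X \<in> bm_trees \<and> Y \<in> bm_trees \<and> bm_iso X Y}"

definition HKs :: "real \<Rightarrow> 'a bmt set set" where
  "HKs K = {c \<in> Hfs. \<forall>X\<in>c. b_mass X \<le> K}"

text \<open>\<open>\<tau>(u\<^sub>1,\<dots>,u\<^sub>n)\<close>.  On the null set of lists spanning infinite \<open>\<nu>\<close>-mass the measure is
  set to \<open>0\<close> so that \<open>\<tau>\<close> takes values in \<open>HH n\<close> everywhere.\<close>

definition tau_rep :: "'a bmt \<Rightarrow> 'a list \<Rightarrow> 'a pmm" where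
  "tau_rep X us =
     (let S = b_span X (set us); \<kappa> = restrict_space (b_nu X) S in
      \<lparr>p_metric = submetric (b_metric X) S, p_root = b_root X, p_points = us,
       p_measure = (if emeasure (b_nu X) S < \<infinity> then \<kappa> else null_measure \<kappa>)\<rparr>)"

definition prefix_list :: "nat \<Rightarrow> (nat \<Rightarrow> 'a) \<Rightarrow> 'a list" where
  "prefix_list n u = map u [0..<n]"

definition varsigma :: "'a bmt \<Rightarrow> (nat \<Rightarrow> 'a) \<Rightarrow> (nat \<Rightarrow> 'a pmm set)" where
  "varsigma X u = (\<lambda>n\<in>{1..}. pmm_class n (tau_rep X (prefix_list n u)))"

definition varpi :: "'a bmt \<Rightarrow> (nat \<Rightarrow> 'a pmm set) measure" where
  "varpi X =
     (if b_mass X = 0 then null_measure (borel_of HH_seq_top)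
      else scale_measure (ennreal (b_mass X))
        (distr (Pi\<^sub>M UNIV (\<lambda>_. on_supp_normalized (b_metric X) (b_mu X)))
           (borel_of HH_seq_top) (varsigma X)))"

definition LWV :: "'a bmt set topology" where
  "LWV = topology_of_convergence Hfs
     (\<lambda>c d. weakly_converges HH_seq_top (\<lambda>N. varpi (class_rep (c N))) (varpi (class_rep d)))"

section \<open>The pruning process and its generator\<close>

definition poisson_point_measure ::
  "'w measure \<Rightarrow> ('w \<Rightarrow> 'b measure) \<Rightarrow> 'b measure \<Rightarrow> bool" where
  "poisson_point_measure P N M \<longleftrightarrow>
     prob_space P \<and>
     (\<forall>\<omega>\<in>space P. sets (N \<omega>) = sets M \<and>
        (\<forall>A\<in>sets M. emeasure (N \<omega>) A \<in> range ennreal_of_enat)) \<and>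
     (\<forall>A\<in>sets M. (\<lambda>\<omega>. emeasure (N \<omega>) A) \<in> borel_measurable P) \<and>
     (\<forall>A\<in>sets M. emeasure M A < \<infinity> \<longrightarrow>
        (\<forall>k::nat. measure P {\<omega> \<in> space P. emeasure (N \<omega>) A = of_nat k}
           = exp (- measure M A) * measure M A ^ k / fact k)) \<and>
     (\<forall>A\<in>sets M. emeasure M A = \<infinity> \<longrightarrow> (AE \<omega> in P. emeasure (N \<omega>) A = \<infinity>)) \<and>
     (\<forall>(I::nat set) A. finite I \<and> A ` I \<subseteq> sets M \<and> disjoint_family_on A I \<longrightarrow>
        prob_space.indep_vars P (\<lambda>_. borel) (\<lambda>i \<omega>. emeasure (N \<omega>) (A i)) I)"

definition pruning_intensity :: "'a bmt \<Rightarrow> (real \<times> 'a) measure" where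
  "pruning_intensity X = restrict_space lborel {0..} \<Otimes>\<^sub>M b_nu X"

definition atoms_upto :: "'a bmt \<Rightarrow> real \<Rightarrow> (real \<times> 'a) measure \<Rightarrow> 'a set" where
  "atoms_upto X t \<pi> = {v \<in> mspace (b_metric X). emeasure \<pi> ({0..t} \<times> {v}) > 0}"

definition remaining :: "'a bmt \<Rightarrow> 'a set \<Rightarrow> 'a set" where
  "remaining X A = {w \<in> mspace (b_metric X). \<forall>v\<in>A. v \<notin> seg (b_metric X) (b_root X) w}"

definition prune :: "'a bmt \<Rightarrow> 'a set \<Rightarrow> 'a bmt" where
  "prune X A =
     (let S = remaining X A in
      if S = {}
      then \<lparr>b_metric = submetric (b_metric X) {b_root X}, b_root = b_root X,
            b_mu = null_measure (count_space {b_root X}),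
            b_nu = null_measure (count_space {b_root X})\<rparr>
      else \<lparr>b_metric = submetric (b_metric X) S, b_root = b_root X,
            b_mu = restrict_space (b_mu X) S, b_nu = restrict_space (b_nu X) S\<rparr>)"

text \<open>In what follows \<open>N X\<close>, defined on the probability space \<open>P X\<close>, is a Poisson point measure
  with intensity \<open>pruning_intensity X\<close>.  Expectations are taken over the completion of \<open>P X\<close>, since the
  pruned tree is only controlled off a null set (where \<open>N X \<omega>\<close> could have uncountably many
  atoms).\<close>

definition pruning_semigroup ::
  "('a bmt \<Rightarrow> 'w measure) \<Rightarrow> ('a bmt \<Rightarrow> 'w \<Rightarrow> (real \<times> 'a) measure) \<Rightarrow> real \<Rightarrow>
   ('a bmt set \<Rightarrow> real) \<Rightarrow> 'a bmt set \<Rightarrow> real" where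
  "pruning_semigroup P N t G c =
     (let X = class_rep c in
      \<integral>\<omega>. G (bm_class (prune X (atoms_upto X t (N X \<omega>)))) \<partial>completion (P X))"

definition strong_domain ::
  "('a bmt \<Rightarrow> 'w measure) \<Rightarrow> ('a bmt \<Rightarrow> 'w \<Rightarrow> (real \<times> 'a) measure) \<Rightarrow> real \<Rightarrow>
   ('a bmt set \<Rightarrow> real) set" where
  "strong_domain P N K =
     {f \<in> Cb (subtopology LWV (HKs K)).
        uniform_limit (HKs K) (\<lambda>t. pruning_semigroup P N t f) f (at_right 0)}"

definition is_generator_value ::
  "('a bmt \<Rightarrow> 'w measure) \<Rightarrow> ('a bmt \<Rightarrow> 'w \<Rightarrow> (real \<times> 'a) measure) \<Rightarrow> real \<Rightarrow>
   ('a bmt set \<Rightarrow> real) \<Rightarrow> ('a bmt set \<Rightarrow> real) \<Rightarrow> bool" where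
  "is_generator_value P N K f g \<longleftrightarrow>
     f \<in> strong_domain P N K \<and> g \<in> strong_domain P N K \<and>
     uniform_limit (HKs K) (\<lambda>t c. (pruning_semigroup P N t f c - f c) / t) g (at_right 0)"

definition generator_domain ::
  "('a bmt \<Rightarrow> 'w measure) \<Rightarrow> ('a bmt \<Rightarrow> 'w \<Rightarrow> (real \<times> 'a) measure) \<Rightarrow> real \<Rightarrow>
   ('a bmt set \<Rightarrow> real) set" where
  "generator_domain P N K = {f. \<exists>g. is_generator_value P N K f g}"

text \<open>Only the values on \<open>HKs K\<close> are meaningful; there they are unique.\<close>

definition generator ::
  "('a bmt \<Rightarrow> 'w measure) \<Rightarrow> ('a bmt \<Rightarrow> 'w \<Rightarrow> (real \<times> 'a) measure) \<Rightarrow> real \<Rightarrow>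
   ('a bmt set \<Rightarrow> real) \<Rightarrow> ('a bmt set \<Rightarrow> real)" where
  "generator P N K f = (SOME g. is_generator_value P N K f g)"

section \<open>Test functions\<close>

definition Phi_fun ::
  "(real \<Rightarrow> real) \<Rightarrow> nat \<Rightarrow> ((nat \<times> nat \<Rightarrow> real) \<Rightarrow> real) \<Rightarrow> 'a pmm \<Rightarrow> real" where
  "Phi_fun \<gamma> m \<phi> X =
     \<gamma> (total_mass (p_measure X)) *
     (\<integral>v. \<phi> (dist_matrix (pairs_upto (length (p_points X) + m)) X v)
        \<partial>Pi\<^sub>M {..<m} (\<lambda>_. on_supp (p_metric X) (p_measure X)))"

definition Pi_test :: "nat \<Rightarrow> ('a pmm \<Rightarrow> real) set" where
  "Pi_test n = {Phi_fun \<gamma> m \<phi> | \<gamma> m \<phi>.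
     \<phi> \<in> Cb (matrix_top (pairs_upto (n + m))) \<and>
     \<gamma> \<in> Cb (top_of_set {0..}) \<and>
     (\<forall>k::nat. ((\<lambda>x. x ^ k * \<gamma> x) \<longlongrightarrow> 0) at_top)}"

text \<open>Marked points are indexed from \<open>0\<close>, so index sets are subsets of \<open>{..<n}\<close>.
  In \<open>Pi_tilde\<close> they are non-empty (\<open>I = {i\<^sub>1 < \<dots> < i\<^sub>k}\<close>, \<open>k \<ge> 1\<close>): a factor for \<open>I = {}\<close> would be a function
  of \<open>\<nu>{\<rho>}\<close>, which is not LWV-continuous.\<close>

definition project_points :: "nat set \<Rightarrow> 'a pmm \<Rightarrow> 'a pmm" where
  "project_points I X =
     (let us = nths (p_points X) I; S = span_tree (p_metric X) (p_root X) (set us) in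
      \<lparr>p_metric = submetric (p_metric X) S, p_root = p_root X, p_points = us,
       p_measure = restrict_space (p_measure X) S\<rparr>)"

definition Pi_tilde :: "nat \<Rightarrow> ('a pmm \<Rightarrow> real) set" where
  "Pi_tilde n = {\<lambda>X. \<Prod>I\<in>Pow {..<n} - {{}}. \<Phi> I (project_points I X) | \<Phi>.
     \<forall>I\<in>Pow {..<n} - {{}}. \<Phi> I \<in> Pi_test (card I)}"

definition Psi1 :: "nat \<Rightarrow> ('a pmm \<Rightarrow> real) \<Rightarrow> 'a bmt set \<Rightarrow> real" where
  "Psi1 n \<Phi> c =
     (let X = class_rep c in
      \<integral>u. \<Phi> (tau_rep X (prefix_list n u)) \<partial>Pi\<^sub>M {..<n} (\<lambda>_. on_supp (b_metric X) (b_mu X)))"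

definition F1_tilde :: "('a bmt set \<Rightarrow> real) set" where
  "F1_tilde = {Psi1 n \<Phi> | n \<Phi>. 1 \<le> n \<and> \<Phi> \<in> Pi_tilde n}"

text \<open>Universe of points for representatives.  Every class of bi-measure trees, and every class of
  pointed metric measure spaces, has a representative whose points lie in this type: supports (and
  the subtrees they span) are separable, so that \<open>x \<mapsto> (r(x,d\<^sub>k))\<^sub>k\<close> with a dense
  sequence \<open>d\<close> is injective.  The metric on a carrier is arbitrary.\<close>

type_synonym point = "nat \<Rightarrow> real"

end

theory Submission
  imports Defs
begin

text \<open>Given sampled points \<open>u\<close>, all of them survive the pruning up to time \<open>t\<close> iff no cut point has fallen on the
  subtree they span, an event of probability \<open>exp (- t * \<nu>(span u))\<close>; surviving points span the same subtree as
  before.  By Fubini, \<open>S\<^sub>t\<close> therefore multiplies the integrand \<open>\<Phi> \<circ> \<tau>\<close> of a test function by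
  \<open>exp (- t * \<nu>(span u))\<close>.  Since \<open>\<Phi>\<close> decays faster than any power of the masses \<open>\<nu>[\<rho>,u\<^sub>i]\<close>, the expansion of the
  exponential is uniform on \<open>HKs K\<close> and its derivative at \<open>0\<close> is the integral of \<open>- \<nu>(span u) \<Phi>(\<tau> u)\<close>.  This
  derivative is again LWV-continuous, being a uniform limit of test functions.  A second use of Fubini,
  \<open>\<nu>(span u) = \<integral> 1{v \<in> span u} \<nu>(dv)\<close>, turns it into the integral over single cuts \<open>v\<close>.\<close>

section \<open>Topologies generated by countably many functions\<close>

text \<open>The obstacle is LWV-continuity. A factor with index set I sees \<nu> restricted to the
  subtree of the points in I, and this restriction is not a continuous function of the n-pointed
  tree. It is softened by a cut-off. The error compares the n-th coordinate of
  \<open>varsigma\<close> with the subtree of I, which is not a coordinate; as the sample is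
  exchangeable, a permutation makes it the coordinate with index card I, and the mean error becomes
  the integral of a continuous function against \<open>varpi\<close>. So it converges along with the
  trees, and smallness at the limit is enough. The pGw topology is given by convergent sequences,
  while \<open>varpi\<close> lives on Borel sets; countably many generating functions, built from
  tents, make the sampling maps measurable. Points are handled through distances to fixed points,
  since the whole tree need not be separable. Fubini needs survival to be jointly measurable in
  sample and cuts. A pruned tree need not be complete, so sampling is developed without
  completeness, and the completion serves only to find a representative of the class.\<close>

lemma space_borel_of [simp]: "space (borel_of X) = topspace X"
  by (simp add: borel_of_def space_measure_of_conv)

lemma sets_borel_of: "sets (borel_of X) = sigma_sets (topspace X) {U. openin X U}"
  unfolding borel_of_def by (rule sets_measure_of) (auto dest: openin_subset)

lemma borel_of_open: "openin X U \<Longrightarrow> U \<in> sets (borel_of X)"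
  by (auto simp: sets_borel_of)

lemma borel_of_closed:
  assumes "closedin X C" shows "C \<in> sets (borel_of X)"
proof -
  have "topspace X - (topspace X - C) \<in> sets (borel_of X)"
    using borel_of_open[of X "topspace X - C"] assms sets.compl_sets[of "topspace X - C" "borel_of X"]
    by (auto simp: closedin_def)
  moreover have "topspace X - (topspace X - C) = C"
    using closedin_subset[OF assms] by blast
  ultimately show ?thesis by simp
qed

lemma borel_of_continuous_map:
  assumes "continuous_map X euclideanreal f"
  shows "f \<in> borel_measurable (borel_of X)"
proof (rule borel_measurableI)
  fix S :: "real set" assume "open S"
  then have "openin X {x \<in> topspace X. f x \<in> S}"
    using assms by (auto simp: continuous_map_def)
  moreover have "f -` S \<inter> space (borel_of X) = {x \<in> topspace X. f x \<in> S}" by auto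
  ultimately show "f -` S \<inter> space (borel_of X) \<in> sets (borel_of X)"
    by (metis borel_of_open)
qed

text \<open>Says that X is the initial topology of the functions F. With a countable index type this
  takes the place of metrizability: it passes to subtopologies and products and gives measurability
  into \<open>borel_of X\<close>.\<close>

definition generated_by :: "'a topology \<Rightarrow> ('i \<Rightarrow> 'a \<Rightarrow> real) \<Rightarrow> bool" where
  "generated_by X F \<longleftrightarrow> (\<forall>i. continuous_map X euclideanreal (F i)) \<and>
     (\<forall>U x. openin X U \<longrightarrow> x \<in> U \<longrightarrow>
        (\<exists>J e. finite J \<and> 0 < e \<and> (\<forall>y\<in>topspace X. (\<forall>j\<in>J. \<bar>F j y - F j x\<bar> < e) \<longrightarrow> y \<in> U)))"

lemma generated_byD:
  assumes "generated_by X F" "openin X U" "x \<in> U"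
  obtains J e where "finite J" "0 < e" "\<And>y. y \<in> topspace X \<Longrightarrow> (\<And>j. j \<in> J \<Longrightarrow> \<bar>F j y - F j x\<bar> < e) \<Longrightarrow> y \<in> U"
  using assms unfolding generated_by_def by metis

lemma generated_by_continuous: "generated_by X F \<Longrightarrow> continuous_map X euclideanreal (F i)"
  by (simp add: generated_by_def)

lemma rat_near: "0 < e \<Longrightarrow> \<exists>q. \<bar>x - of_rat q\<bar> < (e::real)"
proof -
  assume "0 < e"
  then obtain q where "x < of_rat q" "of_rat q < x + e" using of_rat_dense[of x "x + e"] by auto
  then show ?thesis by (intro exI[of _ q]) linarith
qed

text \<open>An open set is the union of those basic sets inside it that are cut out by finitely many
  conditions with rational data. There are only countably many of these because the index type is
  countable.\<close>

lemma measurable_into_generated: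
  fixes F :: "'i::countable \<Rightarrow> 'a \<Rightarrow> real"
  assumes gen: "generated_by X F" and f: "\<And>\<omega>. \<omega> \<in> space M \<Longrightarrow> f \<omega> \<in> topspace X"
    and meas: "\<And>i. (\<lambda>\<omega>. F i (f \<omega>)) \<in> borel_measurable M"
  shows "f \<in> measurable M (borel_of X)"
  unfolding borel_of_def
proof (rule measurable_measure_of)
  show "{U. openin X U} \<subseteq> Pow (topspace X)" by (auto dest: openin_subset)
  show "f \<in> space M \<rightarrow> topspace X" using f by auto
next
  fix U assume "U \<in> {U. openin X U}"
  then have U: "openin X U" by simp
  \<comment> \<open>A code lists pairs of a function index and a rational centre, together with one
    rational radius, so that the codes form a countable type.\<close>
  define B where "B c = {y \<in> topspace X. \<forall>(j, q)\<in>set (fst c). \<bar>F j y - of_rat q\<bar> < of_rat (snd c)}"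
    for c :: "('i \<times> rat) list \<times> rat"
  have "f -` U \<inter> space M = (\<Union>c\<in>{c. B c \<subseteq> U}. {\<omega>\<in>space M. f \<omega> \<in> B c})"
  proof (intro equalityI subsetI)
    fix \<omega> assume \<omega>: "\<omega> \<in> f -` U \<inter> space M"
    then obtain J e where J: "finite J" "0 < e"
      "\<And>y. y \<in> topspace X \<Longrightarrow> (\<And>j. j \<in> J \<Longrightarrow> \<bar>F j y - F j (f \<omega>)\<bar> < e) \<Longrightarrow> y \<in> U"
      using generated_byD[OF gen U, of "f \<omega>"] by auto
    \<comment> \<open>Radius below e / 2: a value within e' of the rational centre is then within e
      of the value at \<open>f \<omega>\<close>.\<close>
    obtain e' where e': "0 < (of_rat e' :: real)" "of_rat e' < e / 2"
      using of_rat_dense[of 0 "e/2"] \<open>0 < e\<close> by auto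
    have "\<forall>j. \<exists>q. \<bar>F j (f \<omega>) - of_rat q\<bar> < of_rat e'" using rat_near[OF e'(1)] by blast
    from choice[OF this] obtain q where q: "\<And>j. \<bar>F j (f \<omega>) - of_rat (q j)\<bar> < of_rat e'"
      by blast
    obtain js where js: "set js = J" using finite_list[OF J(1)] by blast
    let ?c = "(map (\<lambda>j. (j, q j)) js, e')"
    have "B ?c \<subseteq> U"
    proof
      fix y assume y: "y \<in> B ?c"
      show "y \<in> U"
      proof (rule J(3))
        show "y \<in> topspace X" using y by (simp add: B_def)
        fix j assume "j \<in> J"
        then have "\<bar>F j y - of_rat (q j)\<bar> < of_rat e'"
          using y js by (auto simp: B_def)
        then show "\<bar>F j y - F j (f \<omega>)\<bar> < e"
          using q[of j] e'(2) by linarith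
      qed
    qed
    moreover have "f \<omega> \<in> B ?c" using f \<omega> q by (auto simp: B_def)
    ultimately show "\<omega> \<in> (\<Union>c\<in>{c. B c \<subseteq> U}. {\<omega>\<in>space M. f \<omega> \<in> B c})"
      using \<omega> by blast
  qed auto
  moreover have "{\<omega>\<in>space M. f \<omega> \<in> B c} \<in> sets M" for c
  proof -
    have "{\<omega>\<in>space M. f \<omega> \<in> B c} =
      {\<omega>\<in>space M. \<forall>p\<in>set (fst c). \<bar>F (fst p) (f \<omega>) - of_rat (snd p)\<bar> < of_rat (snd c)}"
      using f by (auto simp: B_def split: prod.splits)
    also have "\<dots> \<in> sets M"
      using meas by measurable
    finally show ?thesis .
  qed
  ultimately show "f -` U \<inter> space M \<in> sets M"
    by (auto intro!: sets.countable_UN'')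
qed

text \<open>Sequential continuity is enough, since open means sequentially open in this
  topology.\<close>

lemma continuous_map_topology_of_convergence:
  fixes f :: "'a \<Rightarrow> real"
  assumes "\<And>X x. range X \<subseteq> S \<Longrightarrow> x \<in> S \<Longrightarrow> conv X x \<Longrightarrow> (\<lambda>N. f (X N)) \<longlonglongrightarrow> f x"
  shows "continuous_map (topology_of_convergence S conv) euclideanreal f"
  unfolding continuous_map_def
proof (intro conjI allI impI)
  fix U assume "openin euclideanreal U"
  then have "open U" by simp
  show "openin (topology_of_convergence S conv) {x \<in> topspace (topology_of_convergence S conv). f x \<in> U}"
    unfolding openin_topology_of_convergence topspace_topology_of_convergence
  proof (intro conjI ballI allI impI)
    fix x X assume x: "x \<in> {x \<in> S. f x \<in> U}" and X: "range X \<subseteq> S \<and> conv X x"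
    then have "(\<lambda>N. f (X N)) \<longlonglongrightarrow> f x" using assms by auto
    then have "\<forall>\<^sub>F N in sequentially. f (X N) \<in> U"
      using \<open>open U\<close> x topological_tendstoD by auto
    then show "\<forall>\<^sub>F N in sequentially. X N \<in> {x \<in> S. f x \<in> U}"
      by eventually_elim (use X in auto)
  qed auto
qed simp

text \<open>If an open set contained no basic neighbourhood of x, it would miss points
  \<open>y N\<close> agreeing with x up to 1/(N+1) in all functions with code below N. These
  converge to x by hypothesis, so they must enter the set.\<close>

lemma generated_by_topology_of_convergence:
  fixes F :: "'i::countable \<Rightarrow> 'a \<Rightarrow> real"
  assumes conv: "\<And>X x. range X \<subseteq> S \<Longrightarrow> x \<in> S \<Longrightarrow> conv X x \<longleftrightarrow> (\<forall>i. (\<lambda>N. F i (X N)) \<longlonglongrightarrow> F i x)"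
  shows "generated_by (topology_of_convergence S conv) F"
  unfolding generated_by_def topspace_topology_of_convergence
proof (intro conjI allI impI)
  fix i show "continuous_map (topology_of_convergence S conv) euclideanreal (F i)"
    by (rule continuous_map_topology_of_convergence) (use conv in blast)
next
  fix U x assume U: "openin (topology_of_convergence S conv) U" and x: "x \<in> U"
  show "\<exists>J e. finite J \<and> 0 < e \<and> (\<forall>y\<in>S. (\<forall>j\<in>J. \<bar>F j y - F j x\<bar> < e) \<longrightarrow> y \<in> U)"
  proof (rule ccontr)
    assume neg: "\<not> ?thesis"
    have "\<exists>y\<in>S. (\<forall>j\<in>{j. to_nat j < N}. \<bar>F j y - F j x\<bar> < 1 / real (Suc N)) \<and> y \<notin> U" for N
    proof -
      have "finite {j::'i. to_nat j < N}"
        using finite_vimageI[of "{..<N}" "to_nat :: 'i \<Rightarrow> nat"] by (simp add: vimage_def)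
      moreover have "0 < 1 / real (Suc N)" by simp
      ultimately show ?thesis using neg by blast
    qed
    then obtain y where y: "\<And>N. y N \<in> S" "\<And>N j. to_nat j < N \<Longrightarrow> \<bar>F j (y N) - F j x\<bar> < 1 / real (Suc N)"
      "\<And>N. y N \<notin> U"
      by (metis (no_types, lifting) mem_Collect_eq)
    have xS: "x \<in> S" using U x by (auto simp: openin_topology_of_convergence)
    have "(\<lambda>N. F j (y N)) \<longlonglongrightarrow> F j x" for j
    proof (rule Lim_transform_bound[THEN Lim_null[THEN iffD2]])
      show "\<forall>\<^sub>F N in sequentially. norm (F j (y N) - F j x) \<le> norm (1 / real (Suc N))"
        using eventually_gt_at_top[of "to_nat j"]
        by eventually_elim (use y(2)[of j] in \<open>simp add: less_imp_le\<close>)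
      show "(\<lambda>N. 1 / real (Suc N)) \<longlonglongrightarrow> 0"
        using LIMSEQ_inverse_real_of_nat by (simp add: inverse_eq_divide)
    qed
    then have "conv y x" using conv[of y x] y(1) xS by auto
    then have "\<forall>\<^sub>F N in sequentially. y N \<in> U"
      using U x y(1) unfolding openin_topology_of_convergence by blast
    then show False using y(3) by simp
  qed
qed

lemma generated_by_subtopology:
  assumes "generated_by X F" shows "generated_by (subtopology X S) F"
  unfolding generated_by_def
proof (intro conjI allI impI)
  fix i show "continuous_map (subtopology X S) euclideanreal (F i)"
    using assms by (simp add: continuous_map_from_subtopology generated_by_continuous)
next
  fix U x assume "openin (subtopology X S) U" "x \<in> U"
  then obtain V where V: "openin X V" "U = V \<inter> S" "x \<in> V" by (auto simp: openin_subtopology)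
  then obtain J e where J: "finite J" "0 < e" "\<And>y. y \<in> topspace X \<Longrightarrow> (\<And>j. j \<in> J \<Longrightarrow> \<bar>F j y - F j x\<bar> < e) \<Longrightarrow> y \<in> V"
    using generated_byD[OF assms] by metis
  then show "\<exists>J e. finite J \<and> 0 < e \<and> (\<forall>y\<in>topspace (subtopology X S). (\<forall>j\<in>J. \<bar>F j y - F j x\<bar> < e) \<longrightarrow> y \<in> U)"
    using V by (intro exI[of _ J] exI[of _ e]) auto
qed

text \<open>The families of all factors are joined under the index type of pairs. An index outside L
  contributes the constant 0, so that one type serves whatever L is.\<close>

lemma generated_by_product:
  assumes gen: "\<And>l. l \<in> L \<Longrightarrow> generated_by (X l) (F l)"
  shows "generated_by (product_topology X L) (\<lambda>(l, i) c. if l \<in> L then F l i (c l) else 0)"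
  unfolding generated_by_def
proof (intro conjI allI impI)
  fix p show "continuous_map (product_topology X L) euclideanreal
      ((\<lambda>(l, i) c. if l \<in> L then F l i (c l) else 0) p)"
  proof (cases p)
    case (Pair l i)
    show ?thesis
    proof (cases "l \<in> L")
      case True
      have "continuous_map (product_topology X L) euclideanreal (F l i \<circ> (\<lambda>c. c l))"
        using generated_by_continuous[OF gen[OF True], of i]
        by (rule continuous_map_compose[OF continuous_map_product_projection[OF True]])
      then show ?thesis using True Pair by (simp add: comp_def)
    qed (use Pair in simp)
  qed
next
  fix U x assume U: "openin (product_topology X L) U" "x \<in> U"
  then obtain V where V: "finite {l \<in> L. V l \<noteq> topspace (X l)}" "\<And>l. l \<in> L \<Longrightarrow> openin (X l) (V l)"
    "x \<in> Pi\<^sub>E L V" "Pi\<^sub>E L V \<subseteq> U"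
    by (auto simp: openin_product_topology_alt)
  let ?K = "{l \<in> L. V l \<noteq> topspace (X l)}"
  have "\<exists>J e. finite J \<and> 0 < e \<and> (\<forall>y\<in>topspace (X l). (\<forall>j\<in>J. \<bar>F l j y - F l j (x l)\<bar> < e) \<longrightarrow> y \<in> V l)"
    if "l \<in> L" for l
    using gen[OF that] V(2)[OF that] V(3) that unfolding generated_by_def by (auto simp: PiE_iff)
  then obtain J e where J: "\<And>l. l \<in> L \<Longrightarrow> finite (J l)" "\<And>l. l \<in> L \<Longrightarrow> 0 < e l"
    "\<And>l y. l \<in> L \<Longrightarrow> y \<in> topspace (X l) \<Longrightarrow> (\<forall>j\<in>J l. \<bar>F l j y - F l j (x l)\<bar> < e l) \<Longrightarrow> y \<in> V l"
    by metis
  \<comment> \<open>The 1 keeps the set non-empty when no coordinate is restricted.\<close>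
  let ?e = "Min (insert 1 (e ` ?K))"
  have e: "0 < ?e" using V(1) J(2) by (subst Min_gr_iff) auto
  have le: "?e \<le> e l" if "l \<in> ?K" for l using V(1) that by (intro Min_le) auto
  show "\<exists>J e. finite J \<and> 0 < e \<and> (\<forall>y\<in>topspace (product_topology X L).
      (\<forall>j\<in>J. \<bar>(\<lambda>(l, i) c. if l \<in> L then F l i (c l) else 0) j y
        - (\<lambda>(l, i) c. if l \<in> L then F l i (c l) else 0) j x\<bar> < e) \<longrightarrow> y \<in> U)"
  proof (intro exI[of _ "Sigma ?K J"] exI[of _ ?e] conjI ballI impI)
    show "finite (Sigma ?K J)" using V(1) J(1) by auto
    show "0 < ?e" by (rule e)
    fix y assume y: "y \<in> topspace (product_topology X L)"
      and h: "\<forall>j\<in>Sigma ?K J. \<bar>(\<lambda>(l, i) c. if l \<in> L then F l i (c l) else 0) j y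
        - (\<lambda>(l, i) c. if l \<in> L then F l i (c l) else 0) j x\<bar> < ?e"
    have "y l \<in> V l" if l: "l \<in> L" for l
    proof (cases "V l = topspace (X l)")
      case True then show ?thesis using y l by auto
    next
      case False
      then have K: "l \<in> ?K" using l by simp
      show ?thesis
      proof (rule J(3)[OF l])
        show "y l \<in> topspace (X l)" using y l by auto
        show "\<forall>j\<in>J l. \<bar>F l j (y l) - F l j (x l)\<bar> < e l"
          using h K le[OF K] by (fastforce simp: Sigma_def)
      qed
    qed
    then have "y \<in> Pi\<^sub>E L V" using y by (auto simp: PiE_iff)
    then show "y \<in> U" using V(4) by blast
  qed
qed

lemma generated_by_top_of_set: "generated_by (top_of_set S) (\<lambda>(_::unit) x::real. x)"
  unfolding generated_by_def
proof (intro conjI allI impI)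
  fix U x assume "openin (top_of_set S) U" "x \<in> U"
  then obtain e where "e > 0" "ball x e \<inter> S \<subseteq> U" by (auto simp: openin_contains_ball)
  then show "\<exists>J e. finite J \<and> 0 < e \<and> (\<forall>y\<in>topspace (top_of_set S). (\<forall>j\<in>J::unit set. \<bar>y - x\<bar> < e) \<longrightarrow> y \<in> U)"
    by (intro exI[of _ UNIV] exI[of _ e]) (auto simp: dist_real_def abs_minus_commute subset_iff)
qed simp

lemma generated_by_matrix_top:
  "generated_by (matrix_top I) (\<lambda>(l, _::unit) c. if l \<in> I then c l else 0)"
  unfolding matrix_top_def by (rule generated_by_product) (rule generated_by_top_of_set)

section \<open>A countable convergence-determining class\<close>

text \<open>A bump of height |q| and slope k around the rational values listed in ps. The data are
  rational or natural so that the bumps form a countable family; |q| keeps every code non-negative,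
  and \<open>([], 0, 1)\<close> encodes the constant 1.\<close>

definition tent :: "('i \<Rightarrow> 'a \<Rightarrow> real) \<Rightarrow> ('i \<times> rat) list \<times> nat \<times> rat \<Rightarrow> 'a \<Rightarrow> real" where
  "tent F c x = (case c of (ps, k, q) \<Rightarrow>
     \<bar>of_rat q\<bar> * max 0 (1 - real k * (\<Sum>p\<leftarrow>ps. \<bar>F (fst p) x - of_rat (snd p)\<bar>)))"

primrec tents :: "('i \<Rightarrow> 'a \<Rightarrow> real) \<Rightarrow> (('i \<times> rat) list \<times> nat \<times> rat) list \<Rightarrow> 'a \<Rightarrow> real" where
  "tents F [] x = 0"
| "tents F (c # cs) x = max (tent F c x) (tents F cs x)"

lemma tents_nonneg: "0 \<le> tents F cs x"
  by (induction cs) (auto simp: le_max_iff_disj)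

lemma tent_le: "tent F (ps, k, q) x \<le> \<bar>of_rat q\<bar>"
proof -
  have "0 \<le> (\<Sum>p\<leftarrow>ps. \<bar>F (fst p) x - of_rat (snd p)\<bar>)" by (rule sum_list_nonneg) auto
  then have "max 0 (1 - real k * (\<Sum>p\<leftarrow>ps. \<bar>F (fst p) x - of_rat (snd p)\<bar>)) \<le> 1"
    by (simp add: mult_nonneg_nonneg)
  then have "\<bar>of_rat q\<bar> * max 0 (1 - real k * (\<Sum>p\<leftarrow>ps. \<bar>F (fst p) x - of_rat (snd p)\<bar>)) \<le> \<bar>of_rat q\<bar> * 1"
    by (intro mult_left_mono) auto
  then show ?thesis by (simp add: tent_def)
qed

lemma tents_bounded: "\<exists>B. \<forall>x. tents F cs x \<le> B"
proof (induction cs)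
  case (Cons c cs)
  then obtain B where "\<And>x. tents F cs x \<le> B" by blast
  moreover obtain ps k q where "c = (ps, k, q)" by (cases c) auto
  ultimately have "tents F (c # cs) x \<le> max B \<bar>of_rat q\<bar>" for x
    using tent_le[of F ps k q x] by (smt (verit, best) tents.simps(2))
  then show ?case by blast
qed auto

lemma tents_ge: "c \<in> set cs \<Longrightarrow> tent F c x \<le> tents F cs x"
  by (induction cs) (auto simp: le_max_iff_disj)

lemma tents_le: "(\<And>c. c \<in> set cs \<Longrightarrow> tent F c x \<le> b) \<Longrightarrow> 0 \<le> b \<Longrightarrow> tents F cs x \<le> b"
  by (induction cs) auto

lemma continuous_map_tent:
  assumes "\<And>i. continuous_map X euclideanreal (F i)"
  shows "continuous_map X euclideanreal (tent F c)"
proof -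
  obtain ps k q where fields: "c = (ps, k, q)" by (cases c) auto
  have *: "continuous_map X euclideanreal (\<lambda>x. \<Sum>p\<leftarrow>ps. \<bar>F (fst p) x - of_rat (snd p)\<bar>)"
  proof (induction ps)
    case (Cons p ps)
    then show ?case using assms by (auto intro!: continuous_map_add continuous_map_real_abs continuous_map_diff)
  qed auto
  have "tent F c = (\<lambda>x. \<bar>of_rat q\<bar> * max 0 (1 - real k * (\<Sum>p\<leftarrow>ps. \<bar>F (fst p) x - of_rat (snd p)\<bar>)))"
    by (auto simp: fields tent_def fun_eq_iff)
  then show ?thesis
    by (auto intro!: continuous_map_real_mult continuous_map_real_max continuous_map_diff *)
qed

lemma continuous_map_tents:
  assumes "\<And>i. continuous_map X euclideanreal (F i)"
  shows "continuous_map X euclideanreal (tents F cs)"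
proof (induction cs)
  case (Cons c cs)
  then show ?case using continuous_map_tent[of X F c, OF assms]
    by (simp add: continuous_map_real_max)
qed auto

lemma tents_Cb:
  assumes "generated_by X F" shows "tents F cs \<in> Cb X"
proof -
  obtain B where "\<And>x. tents F cs x \<le> B" using tents_bounded by blast
  then have "bounded (tents F cs ` topspace X)"
    using tents_nonneg[of F cs] by (auto simp: bounded_iff intro!: exI[of _ B])
  then show ?thesis
    using continuous_map_tents[of X F cs] generated_by_continuous[OF assms] by (simp add: Cb_def)
qed

text \<open>The tent has height just below f x and is steep enough to vanish where f may fall below
  that height. Its centre has rational values so close to those at x that little height is lost
  there.\<close>

lemma tent_approx:
  assumes gen: "generated_by X F" and f: "continuous_map X euclideanreal f"
    and nonneg: "\<And>y. y \<in> topspace X \<Longrightarrow> 0 \<le> f y" and x: "x \<in> topspace X" and e: "0 < e"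
  shows "\<exists>c. (\<forall>y\<in>topspace X. tent F c y \<le> f y) \<and> f x - e < tent F c x"
proof (cases "f x - e / 2 \<le> 0")
  case True
  then show ?thesis using e nonneg
    by (intro exI[of _ "([], 0, 0)"]) (auto simp: tent_def)
next
  case False
  obtain q where q: "f x - e / 2 < of_rat q" "of_rat q < f x" using of_rat_dense[of "f x - e/2" "f x"] e by auto
  have q0: "0 < (of_rat q :: real)" using q False by linarith
  have op: "openin X {y \<in> topspace X. f y \<in> {of_rat q<..}}"
    using openin_continuous_map_preimage[OF f, of "{of_rat q<..}"] by simp
  have xin: "x \<in> {y \<in> topspace X. f y \<in> {of_rat q<..}}" using x q by simp
  obtain J d where J: "finite J" "0 < d"
    "\<And>y. y \<in> topspace X \<Longrightarrow> (\<And>j. j \<in> J \<Longrightarrow> \<bar>F j y - F j x\<bar> < d) \<Longrightarrow> y \<in> {y \<in> topspace X. f y \<in> {of_rat q<..}}"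
    by (rule generated_byD[OF gen op xin]) blast
  obtain js where js: "set js = J" using finite_list[OF J(1)] by blast
  \<comment> \<open>Off the neighbourhood some coordinate differs from that of x by at least d,
    hence from its rational centre by at least d / 2. A slope above 2 / d brings the tent to 0
    there.\<close>
  obtain k :: nat where k: "real k > 2 / d" using reals_Archimedean2 by blast
  have k0: "0 < real k" using k J(2) by (meson divide_pos_pos less_trans zero_less_numeral)
  have kd: "real k * (d / 2) \<ge> 1" using k J(2) by (simp add: field_simps)
  \<comment> \<open>The product of b and \<eta> bounds the height lost at x when every centre is off
    by at most \<eta>; the summand 1 keeps b positive if no coordinate is used.\<close>
  define b where "b = of_rat q * real k * (real (length js) + 1)"
  have b: "0 < b" using q0 k0 by (simp add: b_def)
  define \<eta> where "\<eta> = min (d / 2) (e / (2 * b))"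
  have \<eta>: "0 < \<eta>" using J(2) e b by (auto simp: \<eta>_def)
  have "\<forall>j. \<exists>a. \<bar>F j x - of_rat a\<bar> < \<eta>" using rat_near[OF \<eta>] by blast
  from choice[OF this] obtain a where a: "\<And>j. \<bar>F j x - of_rat (a j)\<bar> < \<eta>" by blast
  let ?ps = "map (\<lambda>j. (j, a j)) js"
  show ?thesis
  proof (intro exI[of _ "(?ps, k, q)"] conjI ballI)
    fix y assume y: "y \<in> topspace X"
    show "tent F (?ps, k, q) y \<le> f y"
    proof (cases "\<forall>j\<in>J. \<bar>F j y - F j x\<bar> < d")
      case True
      then have "of_rat q < f y" using J(3)[OF y] by auto
      then show ?thesis using tent_le[of F ?ps k q y] q0 by simp
    next
      case False
      then obtain j where j: "j \<in> J" "d \<le> \<bar>F j y - F j x\<bar>" by auto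
      have "d / 2 \<le> \<bar>F j y - of_rat (a j)\<bar>" using j(2) a[of j] unfolding \<eta>_def by linarith
      also have "\<dots> \<le> (\<Sum>p\<leftarrow>?ps. \<bar>F (fst p) y - of_rat (snd p)\<bar>)"
        using j(1) js by (intro member_le_sum_list) (auto simp: o_def image_iff)
      finally have "1 \<le> real k * (\<Sum>p\<leftarrow>?ps. \<bar>F (fst p) y - of_rat (snd p)\<bar>)"
        using kd k0 by (meson mult_left_mono order_trans less_imp_le)
      then have "tent F (?ps, k, q) y = 0" by (simp add: tent_def)
      then show ?thesis using nonneg[OF y] by simp
    qed
  next
    have "(\<Sum>p\<leftarrow>?ps. \<bar>F (fst p) x - of_rat (snd p)\<bar>) \<le> (\<Sum>j\<leftarrow>js. \<eta>)"
      unfolding map_map o_def fst_conv snd_conv using a by (intro sum_list_mono) (auto intro: less_imp_le)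
    also have "\<dots> = real (length js) * \<eta>" by (simp add: sum_list_triv)
    finally have "real k * (\<Sum>p\<leftarrow>?ps. \<bar>F (fst p) x - of_rat (snd p)\<bar>) \<le> real k * (real (length js) * \<eta>)"
      using k0 by (intro mult_left_mono) auto
    then have "of_rat q * (1 - real k * (real (length js) * \<eta>)) \<le> tent F (?ps, k, q) x"
      using q0 unfolding tent_def by (simp add: mult_left_mono le_max_iff_disj)
    moreover have "of_rat q * real k * (real (length js) * \<eta>) < e / 2"
    proof -
      have "of_rat q * real k * (real (length js) * \<eta>) < of_rat q * real k * ((real (length js) + 1) * \<eta>)"
        using q0 k0 \<eta> by (intro mult_strict_left_mono) auto
      also have "\<dots> = b * \<eta>" by (simp add: b_def)
      also have "\<dots> \<le> b * (e / (2 * b))" using b by (intro mult_left_mono) (auto simp: \<eta>_def)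
      also have "\<dots> = e / 2" using b by simp
      finally show ?thesis .
    qed
    ultimately show "f x - e < tent F (?ps, k, q) x" using q(1) by (simp add: algebra_simps)
  qed
qed

section \<open>Weak convergence tested on tents\<close>

lemma Cb_integrable:
  assumes "f \<in> Cb X" "finite_measure M" "sets M = sets (borel_of X)"
  shows "integrable M f"
proof -
  interpret finite_measure M by fact
  have "f \<in> borel_measurable M"
    using assms borel_of_continuous_map[of X f] measurable_cong_sets[OF assms(3) refl]
    by (auto simp: Cb_def)
  moreover have "space M = topspace X" using sets_eq_imp_space_eq[OF assms(3)] by simp
  moreover obtain B where "\<And>x. x \<in> topspace X \<Longrightarrow> \<bar>f x\<bar> \<le> B"
    using assms(1) by (auto simp: Cb_def bounded_iff)
  ultimately show ?thesis by (intro integrable_const_bound[of _ B]) auto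
qed

text \<open>Lower half of weak convergence. The maxima \<open>g n\<close> of the first n tents below
  f increase to f, so one of them nearly attains the integral of f against M, and convergence on
  that single function bounds the integrals against \<open>Ms N\<close> from below.\<close>

lemma tents_liminf:
  fixes F :: "'i::countable \<Rightarrow> 'a \<Rightarrow> real"
  assumes gen: "generated_by X F" and fin: "\<And>N. finite_measure (Ms N)" "finite_measure M"
    and sets: "\<And>N. sets (Ms N) = sets (borel_of X)" "sets M = sets (borel_of X)"
    and lim: "\<And>cs. (\<lambda>N. \<integral>x. tents F cs x \<partial>Ms N) \<longlonglongrightarrow> (\<integral>x. tents F cs x \<partial>M)"
    and f: "f \<in> Cb X" and nonneg: "\<And>y. y \<in> topspace X \<Longrightarrow> 0 \<le> f y" and e: "0 < e"
  shows "\<forall>\<^sub>F N in sequentially. (\<integral>x. f x \<partial>M) - e < (\<integral>x. f x \<partial>Ms N)"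
proof -
  have spM: "space M = topspace X" and spMs: "\<And>N. space (Ms N) = topspace X"
    using sets_eq_imp_space_eq[OF sets(1)] sets_eq_imp_space_eq[OF sets(2)] by simp_all
  have cont: "continuous_map X euclideanreal f" using f by (simp add: Cb_def)
  define C where "C = {c. \<forall>y\<in>topspace X. tent F c y \<le> f y}"
  define g where "g n = filter (\<lambda>c. c \<in> C) (map from_nat [0..<n])" for n
  have g_le: "tents F (g n) y \<le> f y" if "y \<in> topspace X" for n y
    using that nonneg by (intro tents_le) (auto simp: g_def C_def)
  have "(\<lambda>n. tents F (g n) x) \<longlonglongrightarrow> f x" if x: "x \<in> topspace X" for x
  proof (rule LIMSEQ_I)
    fix r :: real assume "0 < r"
    then obtain c where c: "c \<in> C" "f x - r < tent F c x"
      using tent_approx[OF gen cont nonneg x] unfolding C_def by blast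
    show "\<exists>n0. \<forall>n\<ge>n0. norm (tents F (g n) x - f x) < r"
    proof (intro exI allI impI)
      fix n assume "Suc (to_nat c) \<le> n"
      then have "c \<in> set (g n)" using c(1) unfolding g_def
        by (auto simp: image_iff intro!: bexI[of _ "to_nat c"])
      then have "f x - r < tents F (g n) x" using c(2) tents_ge[of c "g n" F x] by linarith
      then show "norm (tents F (g n) x - f x) < r" using g_le[OF x, of n] by simp
    qed
  qed
  moreover obtain B where B: "\<And>x. x \<in> topspace X \<Longrightarrow> \<bar>f x\<bar> \<le> B"
    using f by (auto simp: Cb_def bounded_iff)
  interpret M: finite_measure M by fact
  have "(\<lambda>n. \<integral>x. tents F (g n) x \<partial>M) \<longlonglongrightarrow> (\<integral>x. f x \<partial>M)"
  proof (rule integral_dominated_convergence[where w="\<lambda>_. B"])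
    show "f \<in> borel_measurable M" using Cb_integrable[OF f fin(2) sets(2)] by simp
    show "tents F (g n) \<in> borel_measurable M" for n
      using Cb_integrable[OF tents_Cb[OF gen] fin(2) sets(2)] by simp
    show "AE x in M. (\<lambda>n. tents F (g n) x) \<longlonglongrightarrow> f x" using calculation spM by auto
    show "AE x in M. norm (tents F (g n) x) \<le> B" for n
    proof (rule AE_I2)
      fix x assume "x \<in> space M"
      then show "norm (tents F (g n) x) \<le> B"
        using g_le[of x n] B[of x] tents_nonneg[of F "g n" x] spM by simp
    qed
  qed simp
  then have "\<forall>\<^sub>F n in sequentially. (\<integral>x. f x \<partial>M) - e / 2 < (\<integral>x. tents F (g n) x \<partial>M)"
    by (rule order_tendstoD) (use e in simp)
  then obtain n where n: "(\<integral>x. f x \<partial>M) - e / 2 < (\<integral>x. tents F (g n) x \<partial>M)"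
    by (meson eventually_happens sequentially_bot)
  have "\<forall>\<^sub>F N in sequentially. (\<integral>x. tents F (g n) x \<partial>M) - e / 2 < (\<integral>x. tents F (g n) x \<partial>Ms N)"
    by (rule order_tendstoD[OF lim]) (use e in simp)
  then show ?thesis
  proof eventually_elim
    case (elim N)
    have "(\<integral>x. tents F (g n) x \<partial>Ms N) \<le> (\<integral>x. f x \<partial>Ms N)"
      using Cb_integrable[OF tents_Cb[OF gen] fin(1) sets(1)] Cb_integrable[OF f fin(1) sets(1)] g_le spMs
      by (intro integral_mono) auto
    then show ?case using elim n by linarith
  qed
qed

text \<open>The lower bound applied to B + f and to B - f, both non-negative, gives the two sides.
  The total masses converge because the constant 1 is itself a tent.\<close>

lemma weakly_converges_tents:
  fixes F :: "'i::countable \<Rightarrow> 'a \<Rightarrow> real"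
  assumes gen: "generated_by X F" and fin: "\<And>N. finite_measure (Ms N)" "finite_measure M"
    and sets: "\<And>N. sets (Ms N) = sets (borel_of X)" "sets M = sets (borel_of X)"
  shows "weakly_converges X Ms M \<longleftrightarrow>
    (\<forall>cs. (\<lambda>N. \<integral>x. tents F cs x \<partial>Ms N) \<longlonglongrightarrow> (\<integral>x. tents F cs x \<partial>M))"
proof
  assume "weakly_converges X Ms M"
  then show "\<forall>cs. (\<lambda>N. \<integral>x. tents F cs x \<partial>Ms N) \<longlonglongrightarrow> (\<integral>x. tents F cs x \<partial>M)"
    using tents_Cb[OF gen] by (auto simp: weakly_converges_def)
next
  assume lim: "\<forall>cs. (\<lambda>N. \<integral>x. tents F cs x \<partial>Ms N) \<longlonglongrightarrow> (\<integral>x. tents F cs x \<partial>M)"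
  note liminf = tents_liminf[OF gen fin sets lim[rule_format]]
  show "weakly_converges X Ms M"
    unfolding weakly_converges_def
  proof
    fix f assume f: "f \<in> Cb X"
    then obtain B where B: "\<And>x. x \<in> topspace X \<Longrightarrow> \<bar>f x\<bar> \<le> B" "B > 0"
      by (auto simp: Cb_def bounded_pos)
    have *: "continuous_map X euclideanreal f" using f by (simp add: Cb_def)
    have B': "\<bar>B + f x\<bar> \<le> 2 * B" "\<bar>B - f x\<bar> \<le> 2 * B" "0 \<le> B + f x" "0 \<le> B - f x"
      if "x \<in> topspace X" for x
      using B(1)[OF that] by linarith+
    have Cb: "(\<lambda>x. B + f x) \<in> Cb X" "(\<lambda>x. B - f x) \<in> Cb X" "(\<lambda>x. B) \<in> Cb X"
      using * B' B(2) by (auto simp: Cb_def bounded_iff intro!: continuous_map_add continuous_map_diff exI[of _ "2*B"])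
    have one: "(\<lambda>N. \<integral>x. B \<partial>Ms N) \<longlonglongrightarrow> (\<integral>x. B \<partial>M)"
    proof -
      have "(\<lambda>N. B * (\<integral>x. tents F [([], 0, 1)] x \<partial>Ms N)) \<longlonglongrightarrow> B * (\<integral>x. tents F [([], 0, 1)] x \<partial>M)"
        using lim by (intro tendsto_mult_left) blast
      then show ?thesis by (simp add: tent_def mult.commute)
    qed
    note int = Cb_integrable[OF _ fin(1) sets(1)] Cb_integrable[OF _ fin(2) sets(2)]
    show "(\<lambda>N. \<integral>x. f x \<partial>Ms N) \<longlonglongrightarrow> (\<integral>x. f x \<partial>M)"
    proof (rule tendstoI)
      fix e :: real assume e: "0 < e"
      have "\<forall>\<^sub>F N in sequentially. (\<integral>x. B + f x \<partial>M) - e / 2 < (\<integral>x. B + f x \<partial>Ms N)"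
        using B' e by (intro liminf Cb) auto
      moreover have "\<forall>\<^sub>F N in sequentially. (\<integral>x. B - f x \<partial>M) - e / 2 < (\<integral>x. B - f x \<partial>Ms N)"
        using B' e by (intro liminf Cb) auto
      moreover have "\<forall>\<^sub>F N in sequentially. dist (\<integral>x. B \<partial>Ms N) (\<integral>x. B \<partial>M) < e / 2"
        using tendstoD[OF one, of "e/2"] e by simp
      ultimately show "\<forall>\<^sub>F N in sequentially. dist (\<integral>x. f x \<partial>Ms N) (\<integral>x. f x \<partial>M) < e"
      proof eventually_elim
        case (elim N)
        have "(\<integral>x. B + f x \<partial>Ms N) = (\<integral>x. B \<partial>Ms N) + (\<integral>x. f x \<partial>Ms N)"
          "(\<integral>x. B - f x \<partial>Ms N) = (\<integral>x. B \<partial>Ms N) - (\<integral>x. f x \<partial>Ms N)"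
          "(\<integral>x. B + f x \<partial>M) = (\<integral>x. B \<partial>M) + (\<integral>x. f x \<partial>M)"
          "(\<integral>x. B - f x \<partial>M) = (\<integral>x. B \<partial>M) - (\<integral>x. f x \<partial>M)"
          using Cb(3) f int by (auto intro!: Bochner_Integration.integral_add Bochner_Integration.integral_diff)
        then show ?case using elim unfolding dist_real_def by linarith
      qed
    qed
  qed
qed

section \<open>Segments of real trees\<close>

lemma mdist_self [simp]: "x \<in> mspace m \<Longrightarrow> mdist m x x = 0"
  by simp

lemma continuous_map_mdist_right:
  assumes "a \<in> mspace m" shows "continuous_map (mtopology_of m) euclideanreal (\<lambda>z. mdist m z a)"
proof -
  have "mdist m a = (\<lambda>z. mdist m z a)" by (rule ext) (rule mdist_commute)
  then show ?thesis using continuous_on_mdist[OF assms] by simp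
qed

lemma continuous_map_mdist_left:
  assumes "a \<in> mspace m" shows "continuous_map (mtopology_of m) euclideanreal (\<lambda>z. mdist m a z)"
  using continuous_on_mdist[OF assms] .

lemma openin_mtopology_of:
  "openin (mtopology_of m) U \<longleftrightarrow> U \<subseteq> mspace m \<and> (\<forall>x\<in>U. \<exists>e>0. \<forall>y\<in>mspace m. mdist m x y < e \<longrightarrow> y \<in> U)"
proof -
  interpret Metric_space "mspace m" "mdist m" by simp
  show ?thesis
    unfolding mtopology_of_def openin_mtopology subset_iff in_mball by blast
qed

lemma openin_mball_of: "openin (mtopology_of m) (mball_of m x e)"
  by (simp add: mball_of_def mtopology_of_def Metric_space.openin_mball)

lemma zero_hyp4:
  assumes "zero_hyperbolic_on m S" "x \<in> S" "y \<in> S" "z \<in> S" "w \<in> S"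
  shows "mdist m x y + mdist m z w \<le> max (mdist m x z + mdist m y w) (mdist m x w + mdist m y z)"
  using assms unfolding zero_hyperbolic_on_def by blast

text \<open>The two sides of a point \<open>p\<close> of a geodesic from \<open>x\<close> to \<open>y\<close>, at distance \<open>s\<close> from \<open>x\<close>, are
  distinguished by whether the Gromov product of \<open>y\<close> and \<open>z\<close> at \<open>x\<close> exceeds \<open>s\<close>; off \<open>p\<close>, both are open.\<close>

lemma connected_hits_geodesic:
  assumes hyp: "zero_hyperbolic_on m (mspace m)" and C: "connectedin (mtopology_of m) C"
    and xy: "x \<in> C" "y \<in> C" and s: "0 \<le> s" "s < mdist m x y"
  obtains p where "p \<in> C" "mdist m x p = s" "mdist m p y = mdist m x y - s"
proof -
  note d = mdist_commute[of m]
  have CM: "C \<subseteq> mspace m" using connectedin_subset_topspace[OF C] by simp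
  then have xyM: "x \<in> mspace m" "y \<in> mspace m" using xy by auto
  \<comment> \<open>Twice the Gromov product of y and z at x, that is, twice the height at which z
    branches off a geodesic from x to y.\<close>
  define gr where "gr z = mdist m y x + mdist m z x - mdist m y z" for z
  have cont: "continuous_map (mtopology_of m) euclideanreal gr"
    unfolding gr_def using xyM
    by (intro continuous_map_add continuous_map_diff continuous_map_mdist_right continuous_map_mdist_left)
       auto
  show thesis
  proof (rule ccontr)
    assume neg: "\<not> thesis"
    let ?U = "{z \<in> mspace m. gr z > 2 * s}" and ?V = "{z \<in> mspace m. gr z \<le> 2 * s \<and> \<not> (gr z = 2 * s \<and> mdist m x z = s)}"
    have "openin (mtopology_of m) ?U"
      using openin_continuous_map_preimage[OF cont, of "{2 * s<..}"] by simp
    moreover have "openin (mtopology_of m) ?V"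
      unfolding openin_mtopology_of
    proof (intro conjI ballI)
      fix z assume z: "z \<in> ?V"
      then have zM: "z \<in> mspace m" by simp
      show "\<exists>e>0. \<forall>w\<in>mspace m. mdist m z w < e \<longrightarrow> w \<in> ?V"
      proof (cases "gr z < 2 * s")
        case True
        have "\<exists>e>0. \<forall>w\<in>mspace m. mdist m z w < e \<longrightarrow> w \<in> {z \<in> mspace m. gr z \<in> {..<2 * s}}"
          using openin_continuous_map_preimage[OF cont, of "{..<2 * s}"] True zM
          unfolding openin_mtopology_of by auto
        then show ?thesis by (smt (verit, best) lessThan_iff mem_Collect_eq)
      next
        case False
        then have g: "gr z = 2 * s" "mdist m x z \<noteq> s" using z by auto
        have gt: "mdist m x z > s"
          using g mdist_triangle[OF xyM(2) zM xyM(1)] mdist_triangle[OF zM xyM(1,2)]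
            mdist_triangle[OF xyM(2,1) zM] d[of z x] d[of y z] d[of y x] unfolding gr_def by linarith
        show ?thesis
        proof (intro exI[of _ "mdist m x z - s"] conjI ballI impI)
          fix w assume w: "w \<in> mspace m" "mdist m z w < mdist m x z - s"
          have t: "mdist m x z \<le> mdist m x w + mdist m w z" "mdist m x w \<le> mdist m x z + mdist m z w"
            using mdist_triangle w zM xyM by metis+
          \<comment> \<open>\<open>mdist m x z - s\<close> plays the distance from z to its branch
            point. As w is closer to z than that, it branches off at the same place; the four-point
            condition in two arrangements expresses this.\<close>
          have h: "mdist m x z + mdist m y w \<le> max (mdist m x y + mdist m z w) (mdist m x w + mdist m z y)"
            "mdist m x w + mdist m z y \<le> max (mdist m x z + mdist m w y) (mdist m x y + mdist m w z)"
            using zero_hyp4[OF hyp xyM(1) zM xyM(2) w(1)] zero_hyp4[OF hyp xyM(1) w(1) zM xyM(2)] by auto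
          have "gr w \<le> 2 * s" "mdist m x w > s"
            using t h g w(2) gt d[of z w] d[of z y] d[of x y] d[of w x] d[of z x] d[of w y] unfolding gr_def by linarith+
          then show "w \<in> ?V" using w(1) by auto
        qed (use gt in simp)
      qed
    qed auto
    moreover have "C \<subseteq> ?U \<union> ?V"
    proof
      fix z assume z: "z \<in> C"
      have "\<not> (gr z = 2 * s \<and> mdist m x z = s)"
      proof
        assume h: "gr z = 2 * s \<and> mdist m x z = s"
        then have "mdist m z y = mdist m x y - s"
          using d[of z x] d[of z y] d[of x y] unfolding gr_def by linarith
        then show False using neg that z h by blast
      qed
      then show "z \<in> ?U \<union> ?V" using z CM by auto
    qed
    moreover have "?U \<inter> ?V \<inter> C = {}" by auto
    moreover have "y \<in> ?U \<inter> C" using xyM xy s d[of y x] by (simp add: gr_def)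
    moreover have "x \<in> ?V \<inter> C"
    proof -
      have "\<not> (s = 0)" using neg that[of x] xy xyM by auto
      then show ?thesis using xyM xy s by (auto simp: gr_def)
    qed
    ultimately show False using C unfolding connectedin by blast
  qed
qed

text \<open>The metric interval. Unlike \<open>seg\<close> it is an equation between distances; the
  two agree in a real tree (\<open>seg_eq_geod\<close>).\<close>

definition geod :: "'a metric \<Rightarrow> 'a \<Rightarrow> 'a \<Rightarrow> 'a set" where
  "geod m x y = {z \<in> mspace m. mdist m x z + mdist m z y = mdist m x y}"

text \<open>One instance of the four-point condition, x and y against z and w, makes the interval
  isometric to a subset of the real line.\<close>

lemma geod_dist:
  assumes hyp: "zero_hyperbolic_on m (mspace m)" and xy: "x \<in> mspace m" "y \<in> mspace m"
    and z: "z \<in> geod m x y" and w: "w \<in> geod m x y"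
  shows "mdist m z w = \<bar>mdist m x z - mdist m x w\<bar>"
proof -
  have M: "z \<in> mspace m" "w \<in> mspace m" using z w by (auto simp: geod_def)
  have "mdist m x y + mdist m z w \<le> max (mdist m x z + mdist m y w) (mdist m x w + mdist m y z)"
    using zero_hyp4[OF hyp xy M] .
  moreover have "mdist m x z \<le> mdist m x w + mdist m w z" "mdist m x w \<le> mdist m x z + mdist m z w"
    using mdist_triangle M xy by metis+
  moreover have "mdist m x z + mdist m z y = mdist m x y" "mdist m x w + mdist m w y = mdist m x y"
    using z w by (auto simp: geod_def)
  ultimately show ?thesis
    using mdist_commute[of m y w] mdist_commute[of m y z] mdist_commute[of m w z] by linarith
qed

lemma geod_unique:
  assumes hyp: "zero_hyperbolic_on m (mspace m)" and xy: "x \<in> mspace m" "y \<in> mspace m"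
    and z: "z \<in> geod m x y" and w: "w \<in> geod m x y" and "mdist m x z = mdist m x w"
  shows "z = w"
  using geod_dist[OF assms(1-5)] assms(6) z w mdist_zero[of z m w] by (auto simp: geod_def)

lemma real_tree_point:
  assumes t: "real_tree m" and xy: "x \<in> mspace m" "y \<in> mspace m" and s: "0 \<le> s" "s \<le> mdist m x y"
  obtains p where "p \<in> geod m x y" "mdist m x p = s"
proof (cases "s = mdist m x y")
  \<comment> \<open>The endpoint is separate: the connectedness argument cuts at height s and needs
    y strictly beyond it.\<close>
  case True
  have "y \<in> geod m x y" using xy by (simp add: geod_def)
  from that[OF this True[symmetric]] show ?thesis .
next
  case False
  have "connectedin (mtopology_of m) (mspace m)" "zero_hyperbolic_on m (mspace m)"
    using t connectedin_topspace[of "mtopology_of m"] by (simp_all add: real_tree_def)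
  then obtain p where "p \<in> mspace m" "mdist m x p = s" "mdist m p y = mdist m x y - s"
    using connected_hits_geodesic[of m "mspace m" x y s] xy s False by (metis order_le_less)
  then show ?thesis using that[of p] by (simp add: geod_def)
qed

lemma geod_path:
  assumes t: "real_tree m" and xy: "x \<in> mspace m" "y \<in> mspace m"
  obtains g where "pathin (mtopology_of m) g" "g 0 = x" "g 1 = y" "g ` {0..1} = geod m x y"
    "x \<noteq> y \<Longrightarrow> inj_on g {0..1}"
proof -
  let ?D = "mdist m x y"
  have hyp: "zero_hyperbolic_on m (mspace m)" using t by (simp add: real_tree_def)
  have "\<exists>p. p \<in> geod m x y \<and> mdist m x p = s * ?D" if "s \<in> {0..1}" for s
    using real_tree_point[OF t xy, of "s * ?D"] that
    by (metis atLeastAtMost_iff mdist_nonneg mult_left_le_one_le mult_nonneg_nonneg)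
  then obtain g where g: "\<And>s. s \<in> {0..1} \<Longrightarrow> g s \<in> geod m x y" "\<And>s. s \<in> {0..1} \<Longrightarrow> mdist m x (g s) = s * ?D"
    by metis
  have gM: "g s \<in> mspace m" if "s \<in> {0..1}" for s using g(1)[OF that] by (simp add: geod_def)
  have gd: "mdist m (g s) (g s') = \<bar>s - s'\<bar> * ?D" if "s \<in> {0..1}" "s' \<in> {0..1}" for s s'
    using geod_dist[OF hyp xy g(1)[OF that(1)] g(1)[OF that(2)]] g(2) that
    by (simp add: abs_mult flip: left_diff_distrib)
  have xyg: "x \<in> geod m x y" "y \<in> geod m x y" using xy by (auto simp: geod_def)
  have "pathin (mtopology_of m) g"
    unfolding pathin_def
  proof -
    have *: "subtopology euclideanreal {0..1} = mtopology_of (submetric euclidean_metric {0..1})"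
      by (simp add: mtopology_of_submetric)
    have "Lipschitz_continuous_map (submetric euclidean_metric {0..1}) m g"
      unfolding Lipschitz_continuous_map_def
      using gM gd by (auto intro!: exI[of _ ?D] simp: dist_real_def mult.commute)
    then show "continuous_map (subtopology euclideanreal {0..1}) (mtopology_of m) g"
      unfolding * by (rule Lipschitz_continuous_imp_continuous_map)
  qed
  moreover have "g 0 = x" using g(2)[of 0] gM[of 0] xy by simp
  moreover have "g 1 = y" using geod_unique[OF hyp xy g(1)[of 1] xyg(2)] g(2)[of 1] by simp
  moreover have "g ` {0..1} = geod m x y"
  proof (intro equalityI subsetI)
    fix z assume z: "z \<in> geod m x y"
    show "z \<in> g ` {0..1}"
    proof (cases "?D = 0")
      case True
      then have "mdist m x z = 0" using z by (simp add: geod_def) (smt (verit) mdist_nonneg)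
      then have "z = x" using z xy by (simp add: geod_def)
      then show ?thesis using \<open>g 0 = x\<close> by force
    next
      case False
      then have D: "?D > 0" by (smt (verit) mdist_nonneg)
      have le: "mdist m x z \<le> ?D" using z mdist_nonneg[of m z y] unfolding geod_def mem_Collect_eq by linarith
      then have s: "mdist m x z / ?D \<in> {0..1}" using D by simp
      have "z = g (mdist m x z / ?D)"
        by (rule geod_unique[OF hyp xy z g(1)[OF s]]) (use g(2)[OF s] D in simp)
      then show ?thesis using s by blast
    qed
  qed (use g(1) in blast)
  moreover have "inj_on g {0..1}" if "x \<noteq> y"
  proof (rule inj_onI)
    fix s s' :: real assume h: "s \<in> {0..1}" "s' \<in> {0..1}" "g s = g s'"
    have "?D \<noteq> 0" using xy that by simp
    then show "s = s'" using gd[OF h(1,2)] unfolding h(3) mdist_self[OF gM[OF h(2)]] by simp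
  qed
  ultimately show thesis using that by blast
qed

text \<open>The branch point of q. Its distance from x is the Gromov product of y and q at x, the
  only value compatible with both equations.\<close>

lemma real_tree_projection:
  assumes t: "real_tree m" and xy: "x \<in> mspace m" "y \<in> mspace m" and q: "q \<in> mspace m"
  obtains p where "p \<in> geod m x y" "mdist m x q = mdist m x p + mdist m p q" "mdist m q y = mdist m q p + mdist m p y"
proof -
  have hyp: "zero_hyperbolic_on m (mspace m)" using t by (simp add: real_tree_def)
  define s where "s = (mdist m x y + mdist m x q - mdist m q y) / 2"
  have tri: "mdist m q y \<le> mdist m q x + mdist m x y" "mdist m x q \<le> mdist m x y + mdist m y q" "mdist m x y \<le> mdist m x q + mdist m q y"
    using mdist_triangle xy q by metis+
  have "0 \<le> s" "s \<le> mdist m x y" using tri mdist_commute[of m q] by (auto simp: s_def)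
  then obtain p where p: "p \<in> geod m x y" "mdist m x p = s" using real_tree_point[OF t xy] by blast
  then have pM: "p \<in> mspace m" by (simp add: geod_def)
  have "mdist m x y + mdist m p q \<le> max (mdist m x p + mdist m y q) (mdist m x q + mdist m y p)"
    using zero_hyp4[OF hyp xy pM q] .
  moreover have "mdist m x q \<le> mdist m x p + mdist m p q" "mdist m q y \<le> mdist m q p + mdist m p y"
    using mdist_triangle xy q pM by metis+
  moreover have "mdist m x p + mdist m p y = mdist m x y" using p(1) by (simp add: geod_def)
  moreover have "2 * mdist m x p = mdist m x y + mdist m x q - mdist m q y" using p(2) by (simp add: s_def)
  ultimately have "mdist m x q = mdist m x p + mdist m p q" "mdist m q y = mdist m q p + mdist m p y"
    using mdist_commute[of m y q] mdist_commute[of m y p] mdist_commute[of m q p] by linarith+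
  then show thesis using that[OF p(1)] by blast
qed

text \<open>\<open>connected_hits_geodesic\<close> puts into C a point at each distance from x below
  that of y, and a geodesic has only one such point.\<close>

lemma connected_contains_geod:
  assumes hyp: "zero_hyperbolic_on m (mspace m)" and C: "connectedin (mtopology_of m) C"
    and xy: "x \<in> C" "y \<in> C"
  shows "geod m x y \<subseteq> C"
proof
  fix z assume z: "z \<in> geod m x y"
  have xyM: "x \<in> mspace m" "y \<in> mspace m" using xy connectedin_subset_topspace[OF C] by auto
  show "z \<in> C"
  proof (cases "mdist m x z < mdist m x y")
    case True
    then obtain p where p: "p \<in> C" "mdist m x p = mdist m x z" "mdist m p y = mdist m x y - mdist m x z"
      using connected_hits_geodesic[OF hyp C xy, of "mdist m x z"] by auto
    have "p \<in> geod m x y" using p connectedin_subset_topspace[OF C] by (auto simp: geod_def)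
    then have "p = z" using geod_unique[OF hyp xyM _ z] p by simp
    then show ?thesis using p by simp
  next
    case False
    then have "mdist m z y \<le> 0" using z by (auto simp: geod_def)
    then have "mdist m z y = 0" using mdist_nonneg[of m z y] by linarith
    then show ?thesis using z xyM xy by (simp add: geod_def)
  qed
qed

lemma seg_eq_geod:
  assumes t: "real_tree m" and xy: "x \<in> mspace m" "y \<in> mspace m"
  shows "seg m x y = geod m x y"
proof (intro equalityI subsetI)
  have hyp: "zero_hyperbolic_on m (mspace m)" using t by (simp add: real_tree_def)
  fix z assume "z \<in> seg m x y"
  then consider "z = x" | "z = y" |
    h where "pathin (mtopology_of m) h" "inj_on h {0..1}" "h 0 = x" "h 1 = y" "z \<in> h ` {0..1}"
    unfolding seg_def by auto
  then show "z \<in> geod m x y"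
  proof cases
    case 3
    then obtain t0 where t0: "t0 \<in> {0..1}" "z = h t0" by blast
    have zM: "z \<in> mspace m" using path_image_subset_topspace[OF 3(1)] t0 by auto
    obtain p where p: "p \<in> geod m x y" "mdist m x z = mdist m x p + mdist m p z" "mdist m z y = mdist m z p + mdist m p y"
      using real_tree_projection[OF t xy zM] by blast
    have cont: "continuous_map (top_of_set {0..1}) (mtopology_of m) h"
      using 3(1) by (simp add: pathin_def)
    have conn: "connectedin (mtopology_of m) (h ` {a..b})" if "0 \<le> a" "b \<le> 1" for a b
      using that by (intro connectedin_continuous_map_image[OF cont]) (auto simp: connectedin_subtopology)
    \<comment> \<open>The projection p of z = h t0 lies on the geodesics from x to z and from z to
      y, hence on both halves of the path. Injectivity then leaves only p = z.\<close>
    have "p \<in> h ` {0..t0}"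
      using connected_contains_geod[OF hyp conn[of 0 t0], of x z] t0 3 p by (auto simp: geod_def)
    moreover have "p \<in> h ` {t0..1}"
      using connected_contains_geod[OF hyp conn[of t0 1], of z y] t0 3 p by (auto simp: geod_def)
    ultimately obtain t1 t2 where "t1 \<in> {0..t0}" "t2 \<in> {t0..1}" "p = h t1" "p = h t2" by blast
    then have "t1 = t0" using inj_onD[OF 3(2), of t1 t2] t0 by auto
    then show ?thesis using p \<open>p = h t1\<close> t0 by simp
  qed (use xy in \<open>auto simp: geod_def\<close>)
next
  fix z assume z: "z \<in> geod m x y"
  obtain g where g: "pathin (mtopology_of m) g" "g 0 = x" "g 1 = y" "g ` {0..1} = geod m x y"
    "x \<noteq> y \<Longrightarrow> inj_on g {0..1}" using geod_path[OF t xy] by blast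
  show "z \<in> seg m x y"
  proof (cases "x = y")
    case True
    then have "mdist m x z + mdist m z x = 0" using z xy by (simp add: geod_def)
    then have "mdist m x z = 0" using mdist_nonneg[of m x z] mdist_nonneg[of m z x] by linarith
    then show ?thesis using z xy by (simp add: geod_def seg_def)
  next
    case False
    then show ?thesis using g z unfolding seg_def by blast
  qed
qed

lemma compactin_geod:
  assumes t: "real_tree m" and xy: "x \<in> mspace m" "y \<in> mspace m"
  shows "compactin (mtopology_of m) (geod m x y)"
proof -
  obtain g where g: "pathin (mtopology_of m) g" "g ` {0..1} = geod m x y"
    using geod_path[OF t xy] by metis
  have "compactin (mtopology_of m) (g ` {0..1})"
    using g(1) unfolding pathin_def
    by (rule image_compactin[rotated]) (auto simp: compactin_subtopology)
  then show ?thesis using g(2) by simp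
qed

lemma connectedin_geod:
  assumes t: "real_tree m" and xy: "x \<in> mspace m" "y \<in> mspace m"
  shows "connectedin (mtopology_of m) (geod m x y)"
proof -
  obtain g where g: "pathin (mtopology_of m) g" "g ` {0..1} = geod m x y"
    using geod_path[OF t xy] by metis
  have "connectedin (mtopology_of m) (g ` {0..1})"
    using g(1) unfolding pathin_def
    by (rule connectedin_continuous_map_image) (auto simp: connectedin_subtopology)
  then show ?thesis using g(2) by simp
qed

section \<open>Rooted real trees\<close>

locale rtree =
  fixes m :: "'a metric" and r :: 'a
  assumes tree: "real_tree m" and root: "r \<in> mspace m"
begin

abbreviation "M \<equiv> mspace m"
abbreviation "d \<equiv> mdist m"
abbreviation "T \<equiv> mtopology_of m"

lemma hyp: "zero_hyperbolic_on m M"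
  using tree by (simp add: real_tree_def)

lemma d4: "x \<in> M \<Longrightarrow> y \<in> M \<Longrightarrow> z \<in> M \<Longrightarrow> w \<in> M \<Longrightarrow> d x y + d z w \<le> max (d x z + d y w) (d x w + d y z)"
  using zero_hyp4[OF hyp] .

lemma seg_iff: "v \<in> M \<Longrightarrow> z \<in> seg m r v \<longleftrightarrow> z \<in> M \<and> d r z + d z v = d r v"
  using seg_eq_geod[OF tree root] by (auto simp: geod_def)

lemma seg_geod: "v \<in> M \<Longrightarrow> seg m r v = geod m r v"
  using seg_eq_geod[OF tree root] .

lemma seg_sub: "v \<in> M \<Longrightarrow> seg m r v \<subseteq> M"
  using seg_iff by blast

lemma seg_root: "v \<in> M \<Longrightarrow> r \<in> seg m r v"
  using seg_iff root by auto

lemma seg_end: "v \<in> M \<Longrightarrow> v \<in> seg m r v"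
  using seg_iff by auto

lemma seg_trans: "v \<in> M \<Longrightarrow> w \<in> seg m r v \<Longrightarrow> z \<in> seg m r w \<Longrightarrow> z \<in> seg m r v"
  using seg_iff[of v w] seg_iff[of w z] seg_iff[of v z] mdist_triangle[of z m w v] mdist_triangle[of r m z v] root
  by auto

text \<open>Moving the endpoint of a root segment by less than its distance to w keeps w strictly
  below it. So half-open root segments are covered by those with endpoints in a dense set, the
  source of all countable decompositions of the tree.\<close>

lemma seg_stable:
  assumes "v \<in> M" "v' \<in> M" "w \<in> seg m r v" "d v v' < d w v"
  shows "w \<in> seg m r v'" "w \<noteq> v'"
proof -
  have w: "w \<in> M" "d r w + d w v = d r v" using assms seg_iff by auto
  have "d r w + d v v' < d r v" using w assms by simp
  moreover have "d v' w + d r v \<le> max (d v' r + d w v) (d v' v + d w r)"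
    using d4[OF assms(2) w(1) root assms(1)] .
  moreover have "d r v' \<le> d r w + d w v'" using mdist_triangle root w(1) assms(2) by metis
  ultimately have "d r w + d w v' = d r v'"
    using w mdist_commute[of m v' w] mdist_commute[of m v' r] mdist_commute[of m v' v] mdist_commute[of m w r]
      mdist_nonneg[of m w v'] by linarith
  then show "w \<in> seg m r v'" using assms(2) w(1) seg_iff by simp
  show "w \<noteq> v'" using assms(4) mdist_commute[of m] by auto
qed

lemma seg_unique: "v \<in> M \<Longrightarrow> z \<in> seg m r v \<Longrightarrow> w \<in> seg m r v \<Longrightarrow> d r z = d r w \<Longrightarrow> z = w"
  using geod_unique[OF hyp root] seg_geod by simp

text \<open>Two root segments share exactly the part up to the Gromov product of their endpoints at
  the root. The order of the tree thus becomes an inequality between distances, which is how it is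
  made measurable.\<close>

lemma seg_Int:
  assumes "u \<in> M" "v \<in> M" "x \<in> seg m r v"
  shows "x \<in> seg m r u \<longleftrightarrow> 2 * d r x \<le> d r u + d r v - d u v"
proof -
  have x: "x \<in> M" "d r x + d x v = d r v" using assms seg_iff by auto
  have 1: "d u x + d r v \<le> max (d u r + d x v) (d u v + d x r)" using d4[OF assms(1) x(1) root assms(2)] .
  have 2: "d r u \<le> d r x + d x u" "d u v \<le> d u x + d x v" "d x u \<le> d x v + d v u" "d r v \<le> d r u + d u v"
    using mdist_triangle root x(1) assms by metis+
  have "d r x + d x u = d r u \<longleftrightarrow> 2 * d r x \<le> d r u + d r v - d u v"
    using 1 2 x(2) mdist_commute[of m u x] mdist_commute[of m u r] mdist_commute[of m x r] mdist_commute[of m v u]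
    by linarith
  then show ?thesis using x(1) assms(1) seg_iff by simp
qed

lemma compactin_seg: "v \<in> M \<Longrightarrow> compactin T (seg m r v)"
  using compactin_geod[OF tree root] seg_geod by simp

lemma connectedin_seg: "v \<in> M \<Longrightarrow> connectedin T (seg m r v)"
  using connectedin_geod[OF tree root] seg_geod by simp

lemma hausdorff: "Hausdorff_space T"
  unfolding mtopology_of_def by (simp add: Metric_space.Hausdorff_space_mtopology)

lemma closedin_seg: "v \<in> M \<Longrightarrow> closedin T (seg m r v)"
  using compactin_imp_closedin[OF hausdorff compactin_seg] .

lemma cont_dist: "a \<in> M \<Longrightarrow> continuous_map T euclideanreal (\<lambda>z. d z a)" "a \<in> M \<Longrightarrow> continuous_map T euclideanreal (\<lambda>z. d a z)"
  using continuous_map_mdist_right[of a m] by (simp_all add: mdist_commute[of m a])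

text \<open>The points cut off by v form a closed set, so countably many cuts leave a Borel
  set.\<close>

lemma closedin_above:
  assumes v: "v \<in> M" shows "closedin T {w \<in> M. v \<in> seg m r w}"
proof -
  have "{w \<in> M. v \<in> seg m r w} = {w \<in> topspace T. d r v + d v w - d r w \<in> {0}}"
    using v seg_iff by auto
  moreover have "closedin T \<dots>"
    by (rule closedin_continuous_map_preimage[of T euclideanreal])
      (use v root in \<open>auto intro!: continuous_map_add continuous_map_diff cont_dist\<close>)
  ultimately show ?thesis by simp
qed

text \<open>A set closed towards the root is a union of connected segments through r. Its segments
  are unchanged because they are metric intervals.\<close>

lemma subtree:
  assumes S: "S \<subseteq> M" "r \<in> S" "\<And>w. w \<in> S \<Longrightarrow> seg m r w \<subseteq> S"
  shows "rtree (submetric m S) r" "\<And>w. w \<in> S \<Longrightarrow> seg (submetric m S) r w = seg m r w"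
proof -
  have "S = \<Union>((\<lambda>w. seg m r w) ` S)" using S seg_end by fastforce
  moreover have "connectedin T (\<Union>((\<lambda>w. seg m r w) ` S))"
  proof (rule connectedin_Union)
    have "r \<in> \<Inter>((\<lambda>w. seg m r w) ` S)" using S seg_root by auto
    then show "\<Inter>((\<lambda>w. seg m r w) ` S) \<noteq> {}" by blast
  qed (use S connectedin_seg in auto)
  ultimately have "connected_space (mtopology_of (submetric m S))"
    by (simp add: mtopology_of_submetric connectedin_def)
  moreover have "zero_hyperbolic_on (submetric m S) (mspace (submetric m S))"
    using hyp by (auto simp: zero_hyperbolic_on_def)
  ultimately show rt: "rtree (submetric m S) r"
    using S by unfold_locales (auto simp: real_tree_def)
  fix w assume w: "w \<in> S"
  show "seg (submetric m S) r w = seg m r w"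
  proof -
    have "w \<in> M" "seg m r w \<subseteq> S" using w S by auto
    then show ?thesis using rtree.seg_iff[OF rt, of w] seg_iff[of w] w by auto
  qed
qed

lemma span_iff: "A \<subseteq> M \<Longrightarrow> x \<in> span_tree m r A \<longleftrightarrow> x = r \<or> (\<exists>v\<in>A. x \<in> seg m r v)"
  by (auto simp: span_tree_def)

lemma span_sub: "A \<subseteq> M \<Longrightarrow> span_tree m r A \<subseteq> M"
  using root seg_sub by (auto simp: span_tree_def)

lemma seg_root_root: "seg m r r = {r}"
proof -
  have "d r r = 0" using root by simp
  then have "x \<in> seg m r r \<longleftrightarrow> x = r" for x
    using seg_iff[OF root, of x] mdist_nonneg[of m r x] mdist_nonneg[of m x r] mdist_zero[OF root, of x] root
    by (smt (verit, best))
  then show ?thesis by blast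
qed

lemma span_down:
  assumes "A \<subseteq> M" "w \<in> span_tree m r A" shows "seg m r w \<subseteq> span_tree m r A"
proof -
  consider "w = r" | v where "v \<in> A" "w \<in> seg m r v" using assms by (auto simp: span_tree_def)
  then show ?thesis
  proof cases
    case 1 then show ?thesis by (simp add: seg_root_root span_tree_def)
  next
    case 2
    then have "seg m r w \<subseteq> seg m r v" using seg_trans[of v w] assms(1) by blast
    then show ?thesis using 2 by (auto simp: span_tree_def)
  qed
qed

lemma span_root: "r \<in> span_tree m r A"
  by (simp add: span_tree_def)

lemma span_end: "A \<subseteq> M \<Longrightarrow> A \<subseteq> span_tree m r A"
  using seg_end by (auto simp: span_tree_def)

lemma compactin_span: "finite A \<Longrightarrow> A \<subseteq> M \<Longrightarrow> compactin T (span_tree m r A)"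
  unfolding span_tree_def using root
  by (intro compactin_Un compactin_Union) (auto intro: compactin_seg simp: finite_imp_compactin)

lemma closedin_span: "finite A \<Longrightarrow> A \<subseteq> M \<Longrightarrow> closedin T (span_tree m r A)"
  using compactin_imp_closedin[OF hausdorff compactin_span] .

lemma span_submetric:
  assumes S: "S \<subseteq> M" "r \<in> S" "\<And>w. w \<in> S \<Longrightarrow> seg m r w \<subseteq> S" and A: "A \<subseteq> S"
  shows "span_tree (submetric m S) r A = span_tree m r A"
  using subtree(2)[OF S] A by (auto simp: span_tree_def subset_iff)

end

section \<open>Products of a measure with itself\<close>

lemma product_sigma_finiteI: "sigma_finite_measure M \<Longrightarrow> product_sigma_finite (\<lambda>_. M)"
  by (simp add: product_sigma_finite_def)

text \<open>Stated for \<sigma>-finite measures because samples are drawn from \<nu> as well as from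
  \<mu>.\<close>

lemma distr_PiM_map:
  assumes \<phi>: "\<phi> \<in> measurable M M'" and M: "sigma_finite_measure M" and M': "sigma_finite_measure M'"
    and d: "distr M M' \<phi> = M'" and I: "finite I"
  shows "distr (Pi\<^sub>M I (\<lambda>_. M)) (Pi\<^sub>M I (\<lambda>_. M')) (\<lambda>v. \<lambda>i\<in>I. \<phi> (v i)) = Pi\<^sub>M I (\<lambda>_. M')"
proof -
  interpret M: product_sigma_finite "\<lambda>_. M" using M by (rule product_sigma_finiteI)
  interpret M': product_sigma_finite "\<lambda>_. M'" using M' by (rule product_sigma_finiteI)
  have meas: "(\<lambda>v. \<lambda>i\<in>I. \<phi> (v i)) \<in> measurable (Pi\<^sub>M I (\<lambda>_. M)) (Pi\<^sub>M I (\<lambda>_. M'))"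
    using \<phi> by measurable
  show ?thesis
  proof (rule M'.PiM_eqI[OF I])
    fix A assume A: "\<And>i. i \<in> I \<Longrightarrow> A i \<in> sets M'"
    have "emeasure (distr (Pi\<^sub>M I (\<lambda>_. M)) (Pi\<^sub>M I (\<lambda>_. M')) (\<lambda>v. \<lambda>i\<in>I. \<phi> (v i))) (Pi\<^sub>E I A)
      = emeasure (Pi\<^sub>M I (\<lambda>_. M)) ((\<lambda>v. \<lambda>i\<in>I. \<phi> (v i)) -` Pi\<^sub>E I A \<inter> space (Pi\<^sub>M I (\<lambda>_. M)))"
      using A I by (intro emeasure_distr meas sets_PiM_I_finite) auto
    also have "(\<lambda>v. \<lambda>i\<in>I. \<phi> (v i)) -` Pi\<^sub>E I A \<inter> space (Pi\<^sub>M I (\<lambda>_. M)) = Pi\<^sub>E I (\<lambda>i. \<phi> -` A i \<inter> space M)"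
      by (auto simp: space_PiM PiE_iff)
    also have "emeasure (Pi\<^sub>M I (\<lambda>_. M)) \<dots> = (\<Prod>i\<in>I. emeasure M (\<phi> -` A i \<inter> space M))"
      using A I \<phi> by (intro M.emeasure_PiM) (auto intro: measurable_sets)
    also have "\<dots> = (\<Prod>i\<in>I. emeasure M' (A i))"
    proof (rule prod.cong[OF refl])
      fix i assume i: "i \<in> I"
      show "emeasure M (\<phi> -` A i \<inter> space M) = emeasure M' (A i)"
        using emeasure_distr[OF \<phi> A[OF i]] unfolding d by simp
    qed
    finally show "emeasure (distr (Pi\<^sub>M I (\<lambda>_. M)) (Pi\<^sub>M I (\<lambda>_. M')) (\<lambda>v. \<lambda>i\<in>I. \<phi> (v i))) (Pi\<^sub>E I A)
      = (\<Prod>i\<in>I. emeasure M' (A i))" .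
  qed simp
qed

lemma integral_PiM_map:
  fixes f :: "_ \<Rightarrow> real"
  assumes \<phi>: "\<phi> \<in> measurable M M'" and M: "sigma_finite_measure M" and M': "sigma_finite_measure M'"
    and d: "distr M M' \<phi> = M'" and I: "finite I" and f: "f \<in> borel_measurable (Pi\<^sub>M I (\<lambda>_. M'))"
  shows "(\<integral>v. f v \<partial>Pi\<^sub>M I (\<lambda>_. M')) = (\<integral>v. f (\<lambda>i\<in>I. \<phi> (v i)) \<partial>Pi\<^sub>M I (\<lambda>_. M))"
  by (subst distr_PiM_map[OF \<phi> M M' d I, symmetric], rule integral_distr) (use \<phi> f in measurable)

lemma sigma_finite_density_indicator:
  assumes "sigma_finite_measure M" "S \<in> sets M"
  shows "sigma_finite_measure (density M (indicator S))"
proof -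
  interpret sigma_finite_measure M by fact
  obtain A where A: "countable A" "A \<subseteq> sets M" "\<Union>A = space M" "\<forall>a\<in>A. emeasure M a \<noteq> \<infinity>"
    using sigma_finite_countable by blast
  have "emeasure (density M (indicator S)) a \<le> emeasure M a" if "a \<in> sets M" for a
  proof -
    have "emeasure (density M (indicator S)) a = emeasure M (S \<inter> a)"
      using that assms(2) by (rule emeasure_restricted[rotated])
    also have "\<dots> \<le> emeasure M a" using that by (intro emeasure_mono) auto
    finally show ?thesis .
  qed
  then have "\<forall>a\<in>A. emeasure (density M (indicator S)) a \<noteq> \<infinity>"
    using A by (metis (no_types, lifting) infinity_ennreal_def neq_top_trans subset_eq)
  then show ?thesis using A by unfold_locales (auto intro!: exI[of _ A])
qed

lemma distr_restrict_space:
  assumes "S \<in> sets M"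
  shows "distr (restrict_space M S) M (\<lambda>x. x) = density M (indicator S)"
proof (rule measure_eqI)
  fix A assume "A \<in> sets (distr (restrict_space M S) M (\<lambda>x. x))"
  then have A: "A \<in> sets M" by simp
  have sp: "space (restrict_space M S) = S" using assms sets.sets_into_space[OF assms] by (auto simp: space_restrict_space)
  have "emeasure (distr (restrict_space M S) M (\<lambda>x. x)) A = emeasure (restrict_space M S) (A \<inter> S)"
    using A by (subst emeasure_distr) (auto simp: sp intro: measurable_restrict_space1)
  also have "\<dots> = emeasure M (A \<inter> S)"
    using assms by (intro emeasure_restrict_space) auto
  finally show "emeasure (distr (restrict_space M S) M (\<lambda>x. x)) A = emeasure (density M (indicator S)) A"
    using A assms by (simp add: emeasure_restricted Int_commute)
qed simp

lemma sigma_finite_restrict: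
  assumes "sigma_finite_measure M" "S \<in> sets M"
  shows "sigma_finite_measure (restrict_space M S)"
  using sigma_finite_measure_restrict_space[OF assms] .

lemma PiM_density_indicator:
  assumes M: "sigma_finite_measure M" and S: "S \<in> sets M" and I: "finite I"
  shows "Pi\<^sub>M I (\<lambda>_. density M (indicator S)) = density (Pi\<^sub>M I (\<lambda>_. M)) (\<lambda>v. \<Prod>i\<in>I. indicator S (v i))"
proof -
  interpret M: product_sigma_finite "\<lambda>_. M" using M by (rule product_sigma_finiteI)
  interpret D: product_sigma_finite "\<lambda>_. density M (indicator S)"
    using sigma_finite_density_indicator[OF M S] by (rule product_sigma_finiteI)
  have meas: "(\<lambda>v. \<Prod>i\<in>I. indicator S (v i) :: ennreal) \<in> borel_measurable (Pi\<^sub>M I (\<lambda>_. M))"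
    using S by measurable
  show ?thesis
  proof (rule D.PiM_eqI[OF I, symmetric])
    show "sets (density (Pi\<^sub>M I (\<lambda>_. M)) (\<lambda>v. \<Prod>i\<in>I. indicator S (v i))) = sets (Pi\<^sub>M I (\<lambda>_. density M (indicator S)))"
      unfolding sets_density by (rule sets_PiM_cong) simp_all
    fix A assume A: "\<And>i. i \<in> I \<Longrightarrow> A i \<in> sets (density M (indicator S))"
    then have A': "\<And>i. i \<in> I \<Longrightarrow> A i \<in> sets M" by simp
    have "emeasure (density (Pi\<^sub>M I (\<lambda>_. M)) (\<lambda>v. \<Prod>i\<in>I. indicator S (v i))) (Pi\<^sub>E I A)
      = (\<integral>\<^sup>+v. (\<Prod>i\<in>I. indicator S (v i)) * indicator (Pi\<^sub>E I A) v \<partial>Pi\<^sub>M I (\<lambda>_. M))"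
      using A' I by (intro emeasure_density meas sets_PiM_I_finite) auto
    also have "\<dots> = (\<integral>\<^sup>+v. (\<Prod>i\<in>I. indicator S (v i) * indicator (A i) (v i)) \<partial>Pi\<^sub>M I (\<lambda>_. M))"
    proof (intro nn_integral_cong)
      fix v assume v: "v \<in> space (Pi\<^sub>M I (\<lambda>_. M))"
      have "indicator (Pi\<^sub>E I A) v = (\<Prod>i\<in>I. indicator (A i) (v i) :: ennreal)"
      proof (cases "v \<in> Pi\<^sub>E I A")
        case False
        then obtain i where "i \<in> I" "v i \<notin> A i" using v by (auto simp: space_PiM PiE_iff)
        then have "(\<Prod>i\<in>I. indicator (A i) (v i) :: ennreal) = 0"
          using I by (intro prod_zero bexI[of _ i]) auto
        then show ?thesis using False by simp
      qed (auto simp: PiE_iff)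
      then show "(\<Prod>i\<in>I. indicator S (v i)) * indicator (Pi\<^sub>E I A) v = (\<Prod>i\<in>I. indicator S (v i) * indicator (A i) (v i) :: ennreal)"
        by (simp add: prod.distrib)
    qed
    also have "\<dots> = (\<Prod>i\<in>I. \<integral>\<^sup>+x. indicator S x * indicator (A i) x \<partial>M)"
      using A' S I by (intro M.product_nn_integral_prod) auto
    also have "\<dots> = (\<Prod>i\<in>I. emeasure (density M (indicator S)) (A i))"
      using A' S by (intro prod.cong refl) (simp add: emeasure_density)
    finally show "emeasure (density (Pi\<^sub>M I (\<lambda>_. M)) (\<lambda>v. \<Prod>i\<in>I. indicator S (v i))) (Pi\<^sub>E I A)
      = (\<Prod>i\<in>I. emeasure (density M (indicator S)) (A i))" .
  qed
qed

text \<open>Moves the restriction from the space into the integrand. Samples from different subtrees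
  become integrals over one space, which is what makes them measurable in the subtree.\<close>

lemma integral_PiM_restrict:
  fixes f :: "_ \<Rightarrow> real"
  assumes M: "sigma_finite_measure M" and S: "S \<in> sets M" and I: "finite I"
    and f: "f \<in> borel_measurable (Pi\<^sub>M I (\<lambda>_. M))"
  shows "(\<integral>v. f v \<partial>Pi\<^sub>M I (\<lambda>_. restrict_space M S)) = (\<integral>v. (\<Prod>i\<in>I. indicator S (v i)) * f v \<partial>Pi\<^sub>M I (\<lambda>_. M))"
proof -
  \<comment> \<open>The density measure gives the same integrals as
    \<open>restrict_space M S\<close> but lives on the whole space of M.\<close>
  let ?D = "density M (indicator S)"
  have meas: "(\<lambda>v. \<Prod>i\<in>I. indicator S (v i) :: real) \<in> borel_measurable (Pi\<^sub>M I (\<lambda>_. M))"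
    using S by measurable
  have "(\<integral>v. (\<Prod>i\<in>I. indicator S (v i)) * f v \<partial>Pi\<^sub>M I (\<lambda>_. M))
     = (\<integral>v. f v \<partial>density (Pi\<^sub>M I (\<lambda>_. M)) (\<lambda>v. ennreal (\<Prod>i\<in>I. indicator S (v i))))"
    using f meas by (subst integral_density) (auto intro!: prod_nonneg)
  also have "density (Pi\<^sub>M I (\<lambda>_. M)) (\<lambda>v. ennreal (\<Prod>i\<in>I. indicator S (v i))) = Pi\<^sub>M I (\<lambda>_. ?D)"
    using PiM_density_indicator[OF M S I] by (simp add: ennreal_indicator flip: prod_ennreal)
  also have "(\<integral>v. f v \<partial>\<dots>) = (\<integral>v. f (\<lambda>i\<in>I. v i) \<partial>Pi\<^sub>M I (\<lambda>_. restrict_space M S))"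
  proof (rule integral_PiM_map[where \<phi>="\<lambda>x. x"])
    show "(\<lambda>x. x) \<in> measurable (restrict_space M S) ?D"
      by (simp add: measurable_cong_sets[OF refl sets_density] measurable_restrict_space1)
    have "distr (restrict_space M S) ?D (\<lambda>x. x) = distr (restrict_space M S) M (\<lambda>x. x)"
      by (intro distr_cong) auto
    then show "distr (restrict_space M S) ?D (\<lambda>x. x) = ?D"
      using distr_restrict_space[OF S] by simp
    show "f \<in> borel_measurable (Pi\<^sub>M I (\<lambda>_. ?D))"
    proof -
      have "sets (Pi\<^sub>M I (\<lambda>_. ?D)) = sets (Pi\<^sub>M I (\<lambda>_. M))" by (rule sets_PiM_cong) simp_all
      then show ?thesis using f measurable_cong_sets by blast
    qed
  qed (use M S I sigma_finite_restrict sigma_finite_density_indicator in auto)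
  also have "\<dots> = (\<integral>v. f v \<partial>Pi\<^sub>M I (\<lambda>_. restrict_space M S))"
  proof (rule Bochner_Integration.integral_cong[OF refl])
    fix v assume "v \<in> space (Pi\<^sub>M I (\<lambda>_. restrict_space M S))"
    then show "f (\<lambda>i\<in>I. v i) = f v" by (simp add: space_PiM PiE_restrict)
  qed
  finally show ?thesis by simp
qed

lemma PiM_scale:
  assumes M: "finite_measure M" and c: "c < \<top>" and I: "finite I"
  shows "Pi\<^sub>M I (\<lambda>_. scale_measure c M) = scale_measure (c ^ card I) (Pi\<^sub>M I (\<lambda>_. M))"
proof -
  interpret finite_measure M by fact
  interpret M: product_sigma_finite "\<lambda>_. M" by unfold_locales
  interpret c: finite_measure "scale_measure c M"
    using c by (intro finite_measureI) (simp add: space_scale_measure ennreal_mult_eq_top_iff)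
  interpret C: product_sigma_finite "\<lambda>_. scale_measure c M" by unfold_locales
  show ?thesis
  proof (rule C.PiM_eqI[OF I, symmetric])
    show "sets (scale_measure (c ^ card I) (Pi\<^sub>M I (\<lambda>_. M))) = sets (Pi\<^sub>M I (\<lambda>_. scale_measure c M))"
      unfolding sets_scale_measure by (rule sets_PiM_cong) simp_all
    fix A assume "\<And>i. i \<in> I \<Longrightarrow> A i \<in> sets (scale_measure c M)"
    then have "emeasure (Pi\<^sub>M I (\<lambda>_. M)) (Pi\<^sub>E I A) = (\<Prod>i\<in>I. emeasure M (A i))"
      using I by (intro M.emeasure_PiM) auto
    then show "emeasure (scale_measure (c ^ card I) (Pi\<^sub>M I (\<lambda>_. M))) (Pi\<^sub>E I A) = (\<Prod>i\<in>I. emeasure (scale_measure c M) (A i))"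
      by (simp add: prod.distrib)
  qed
qed

lemma integral_scale_measure':
  fixes f :: "'a \<Rightarrow> real"
  assumes f: "f \<in> borel_measurable M" and c: "0 \<le> c"
  shows "(\<integral>x. f x \<partial>scale_measure (ennreal c) M) = c * (\<integral>x. f x \<partial>M)"
proof -
  have "scale_measure (ennreal c) M = density M (\<lambda>_. ennreal c)"
    by (rule measure_eqI) (auto simp: emeasure_density nn_integral_cmult_indicator)
  then have "(\<integral>x. f x \<partial>scale_measure (ennreal c) M) = (\<integral>x. c * f x \<partial>M)"
    using f c by (simp add: integral_density)
  then show ?thesis by simp
qed

lemma prob_space_normalize:
  assumes "finite_measure M" "measure M (space M) \<noteq> 0"
  shows "prob_space (scale_measure (inverse (emeasure M (space M))) M)"
proof -
  interpret finite_measure M by fact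
  have "emeasure M (space M) \<noteq> 0" "emeasure M (space M) \<noteq> \<top>"
    using assms(2) emeasure_finite by (auto simp: measure_def)
  then have "inverse (emeasure M (space M)) * emeasure M (space M) = 1"
    using ennreal_divide_self[of "emeasure M (space M)"]
    unfolding divide_ennreal_def mult.commute[of "inverse _"] less_top by blast
  then show ?thesis
    by (intro prob_spaceI) (simp only: space_scale_measure emeasure_scale_measure)
qed

text \<open>Test functions integrate over finitely many unnormalised samples, \<open>upsilon\<close>
  and \<open>varpi\<close> over infinitely many normalised ones. The two differ by one factor c for
  each sample used.\<close>

lemma integral_PiM_normalize:
  fixes f :: "_ \<Rightarrow> real"
  assumes fin: "finite_measure M" and c: "measure M (space M) = c" "c \<noteq> 0" and J: "finite J"
    and f: "f \<in> borel_measurable (Pi\<^sub>M J (\<lambda>_. M))"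
  shows "c ^ card J * (\<integral>v. f (\<lambda>i\<in>J. v i) \<partial>Pi\<^sub>M UNIV (\<lambda>_. scale_measure (inverse (emeasure M (space M))) M))
    = (\<integral>v. f v \<partial>Pi\<^sub>M J (\<lambda>_. M))"
proof -
  interpret finite_measure M by fact
  let ?N = "scale_measure (inverse (emeasure M (space M))) M"
  have c0: "0 < c" using c measure_nonneg[of M "space M"] by linarith
  have "emeasure M (space M) = ennreal c" using c by (simp add: emeasure_eq_measure)
  then have inv: "inverse (emeasure M (space M)) = ennreal (1 / c)" using c0 by (simp add: inverse_ennreal inverse_eq_divide)
  have "prob_space ?N" using prob_space_normalize[OF fin] c by simp
  then interpret N: product_prob_space "\<lambda>_. ?N" UNIV
    by (simp add: product_prob_space_def product_prob_space_axioms_def product_sigma_finite_def prob_space_imp_sigma_finite)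
  have sets: "sets (Pi\<^sub>M J (\<lambda>_. ?N)) = sets (Pi\<^sub>M J (\<lambda>_. M))" by (intro sets_PiM_cong) auto
  have f': "f \<in> borel_measurable (Pi\<^sub>M J (\<lambda>_. ?N))" using f by (simp add: measurable_cong_sets[OF sets refl])
  have "(\<integral>v. f (\<lambda>i\<in>J. v i) \<partial>Pi\<^sub>M UNIV (\<lambda>_. ?N)) = (\<integral>v. f v \<partial>distr (Pi\<^sub>M UNIV (\<lambda>_. ?N)) (Pi\<^sub>M J (\<lambda>_. ?N)) (\<lambda>x. restrict x J))"
    using f' by (subst integral_distr) (auto intro: measurable_restrict_subset)
  also have "\<dots> = (\<integral>v. f v \<partial>Pi\<^sub>M J (\<lambda>_. ?N))"
    using J by (subst N.distr_PiM_restrict_finite) auto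
  also have "Pi\<^sub>M J (\<lambda>_. ?N) = scale_measure (ennreal ((1 / c) ^ card J)) (Pi\<^sub>M J (\<lambda>_. M))"
    using PiM_scale[OF fin _ J, of "inverse (emeasure M (space M))"] c0 by (simp add: inv ennreal_power)
  also have "(\<integral>v. f v \<partial>\<dots>) = (1 / c) ^ card J * (\<integral>v. f v \<partial>Pi\<^sub>M J (\<lambda>_. M))"
    using f c0 by (intro integral_scale_measure') auto
  finally have "(\<integral>v. f (\<lambda>i\<in>J. v i) \<partial>Pi\<^sub>M UNIV (\<lambda>_. ?N)) = (1 / c) ^ card J * (\<integral>v. f v \<partial>Pi\<^sub>M J (\<lambda>_. M))" .
  moreover have "c ^ card J * (1 / c) ^ card J = 1" using c0 by (simp flip: power_mult_distrib)
  ultimately show ?thesis by (metis mult.assoc mult_1)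
qed

lemma finite_measure_PiM:
  assumes "finite_measure M" "finite I"
  shows "finite_measure (Pi\<^sub>M I (\<lambda>_. M))" "measure (Pi\<^sub>M I (\<lambda>_. M)) (space (Pi\<^sub>M I (\<lambda>_. M))) = measure M (space M) ^ card I"
proof -
  interpret finite_measure M by fact
  interpret M: product_sigma_finite "\<lambda>_. M" by unfold_locales
  have *: "emeasure (Pi\<^sub>M I (\<lambda>_. M)) (space (Pi\<^sub>M I (\<lambda>_. M))) = ennreal (measure M (space M) ^ card I)"
    unfolding space_PiM using assms(2)
    by (subst M.emeasure_PiM) (auto simp: emeasure_eq_measure ennreal_power)
  then show "finite_measure (Pi\<^sub>M I (\<lambda>_. M))" by (intro finite_measureI) simp
  show "measure (Pi\<^sub>M I (\<lambda>_. M)) (space (Pi\<^sub>M I (\<lambda>_. M))) = measure M (space M) ^ card I"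
    by (simp add: measure_def *)
qed

lemma AE_PiM_components:
  assumes "sigma_finite_measure M" "finite I" "AE x in M. Q x"
  shows "AE v in Pi\<^sub>M I (\<lambda>_. M). \<forall>i\<in>I. Q (v i)"
proof -
  interpret M: product_sigma_finite "\<lambda>_. M" using assms(1) by (rule product_sigma_finiteI)
  obtain N where N: "N \<in> null_sets M" "{x \<in> space M. \<not> Q x} \<subseteq> N"
    using assms(3) by (auto elim!: AE_E)
  have "AE v in Pi\<^sub>M I (\<lambda>_. M). Q (v i)" if i: "i \<in> I" for i
  proof (rule AE_I)
    let ?E = "Pi\<^sub>E I (\<lambda>j. if j = i then N else space M)"
    show "{v \<in> space (Pi\<^sub>M I (\<lambda>_. M)). \<not> Q (v i)} \<subseteq> ?E"
      using N(2) i by (auto simp: space_PiM PiE_iff extensional_def)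
    have "emeasure (Pi\<^sub>M I (\<lambda>_. M)) ?E = (\<Prod>j\<in>I. emeasure M (if j = i then N else space M))"
      using N assms(2) by (intro M.emeasure_PiM) auto
    also have "\<dots> = 0" using N i assms(2) by (intro prod_zero) auto
    finally show "emeasure (Pi\<^sub>M I (\<lambda>_. M)) ?E = 0" .
    show "?E \<in> sets (Pi\<^sub>M I (\<lambda>_. M))" using N assms(2) by (intro sets_PiM_I_finite) auto
  qed
  then show ?thesis using assms(2) by (simp add: AE_finite_all)
qed

section \<open>Separable sets and supports\<close>

text \<open>Refers to distances inside S only, so it carries over to every submetric containing
  S.\<close>

definition separable_in :: "'a metric \<Rightarrow> 'a set \<Rightarrow> bool" where
  "separable_in m S \<longleftrightarrow> (\<exists>C. countable C \<and> C \<subseteq> S \<and> (\<forall>x\<in>S. \<forall>e>0. \<exists>c\<in>C. mdist m x c < e))"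

lemma separable_inE:
  assumes "separable_in m S"
  obtains C where "countable C" "C \<subseteq> S" "\<And>x e. x \<in> S \<Longrightarrow> 0 < e \<Longrightarrow> \<exists>c\<in>C. mdist m x c < e"
  using assms unfolding separable_in_def by blast

lemma separable_space_iff:
  assumes "S \<subseteq> mspace m"
  shows "separable_space (subtopology (mtopology_of m) S) \<longleftrightarrow> separable_in m S"
proof -
  have cl: "subtopology (mtopology_of m) S closure_of C = {x \<in> S. \<forall>e>0. \<exists>c\<in>C. mdist m x c < e}" if "C \<subseteq> S" for C
    using that assms Metric_space.metric_closure_of[of "mspace m" "mdist m" C]
    by (auto simp: closure_of_subtopology mtopology_of_def Int_absorb1 Metric_space.in_mball subset_iff)
  have "topspace (subtopology (mtopology_of m) S) = S" using assms by auto
  then show ?thesis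
    unfolding separable_space_def separable_in_def
    by (simp only:) (intro ex_cong1 conj_cong refl, simp only: cl, blast)
qed

lemma separable_in_subset:
  assumes S: "separable_in m S" and R: "R \<subseteq> S" and M: "S \<subseteq> mspace m"
  shows "separable_in m R"
proof -
  obtain C where C: "countable C" "C \<subseteq> S" "\<And>x e. x \<in> S \<Longrightarrow> 0 < e \<Longrightarrow> \<exists>c\<in>C. mdist m x c < e"
    using separable_inE[OF S] by blast
  \<comment> \<open>Points of C need not lie in R. Whenever R has a point within 1/(k+1) of c, one
    such point represents the pair (c, k).\<close>
  define P where "P = {(c, k::nat). c \<in> C \<and> (\<exists>x\<in>R. mdist m x c < 1 / real (Suc k))}"
  define g where "g p = (SOME x. x \<in> R \<and> mdist m x (fst p) < 1 / real (Suc (snd p)))" for p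
  have g: "g p \<in> R \<and> mdist m (g p) (fst p) < 1 / real (Suc (snd p))" if "p \<in> P" for p
    unfolding g_def by (rule someI_ex) (use that in \<open>auto simp: P_def\<close>)
  have "P \<subseteq> C \<times> UNIV" by (auto simp: P_def)
  then have "countable (g ` P)" using C(1) by (meson countable_SIGMA countable_image countable_subset countableI_type)
  moreover have "\<exists>c\<in>g ` P. mdist m x c < e" if x: "x \<in> R" and e: "0 < e" for x e
  proof -
    obtain k where k: "1 / real (Suc k) < e / 2" using e nat_approx_posE[of "e/2"] by auto
    obtain c where c: "c \<in> C" "mdist m x c < 1 / real (Suc k)" using C(3)[of x "1 / real (Suc k)"] x R by auto
    then have p: "(c, k) \<in> P" using x by (auto simp: P_def)
    have "mdist m x (g (c, k)) \<le> mdist m x c + mdist m c (g (c, k))"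
      using x R M C(2) c(1) g[OF p] by (intro mdist_triangle) auto
    then have "mdist m x (g (c, k)) < e"
      using c(2) g[OF p] k mdist_commute[of m c] by simp
    then show ?thesis using p by blast
  qed
  ultimately show ?thesis unfolding separable_in_def using g by (intro exI[of _ "g ` P"]) auto
qed

lemma separable_in_UN:
  assumes "countable A" "\<And>a. a \<in> A \<Longrightarrow> separable_in m (S a)"
  shows "separable_in m (\<Union>a\<in>A. S a)"
proof -
  have "\<forall>a\<in>A. \<exists>C. countable C \<and> C \<subseteq> S a \<and> (\<forall>x\<in>S a. \<forall>e>0. \<exists>c\<in>C. mdist m x c < e)"
    using assms(2) unfolding separable_in_def by blast
  then obtain C where C: "\<And>a. a \<in> A \<Longrightarrow> countable (C a) \<and> C a \<subseteq> S a \<and> (\<forall>x\<in>S a. \<forall>e>0. \<exists>c\<in>C a. mdist m x c < e)"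
    by metis
  show ?thesis unfolding separable_in_def
    by (rule exI[of _ "\<Union>a\<in>A. C a"]) (use C assms(1) in \<open>fastforce intro: countable_UN\<close>)
qed

lemma separable_in_Un: "separable_in m A \<Longrightarrow> separable_in m B \<Longrightarrow> separable_in m (A \<union> B)"
  using separable_in_UN[of "{True, False}" m "\<lambda>b. if b then A else B"] by (simp add: Un_commute)

lemma separable_in_compactin:
  assumes "compactin (mtopology_of m) S"
  shows "separable_in m S"
proof -
  interpret Metric_space "mspace m" "mdist m" by simp
  have "mtotally_bounded S"
    using assms compactin_imp_mtotally_bounded by (simp add: mtopology_of_def)
  then have "\<forall>n. \<exists>K. finite K \<and> K \<subseteq> S \<and> S \<subseteq> (\<Union>x\<in>K. mball x (1 / real (Suc n)))"
    unfolding mtotally_bounded_def by simp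
  then obtain K where K: "\<And>n. finite (K n)" "\<And>n. K n \<subseteq> S" "\<And>n. S \<subseteq> (\<Union>x\<in>K n. mball x (1 / real (Suc n)))"
    by metis
  have "\<exists>c\<in>\<Union>(range K). mdist m x c < e" if x: "x \<in> S" and e: "0 < e" for x e
  proof -
    obtain n where n: "1 / real (Suc n) < e" using e nat_approx_posE by blast
    then show ?thesis using K(3)[of n] x mdist_commute[of m x] by force
  qed
  then show ?thesis unfolding separable_in_def using K by (intro exI[of _ "\<Union>(range K)"]) (auto intro!: countable_UN simp: countable_finite subset_eq)
qed

text \<open>A distance is below a iff the distances of both points to some c in a countable dense
  set add up to less than a. So distances to fixed points suffice, and no \<sigma>-algebra on pairs
  of points is involved.\<close>

lemma borel_measurable_mdist_pair:
  assumes S: "separable_in m S" and SM: "S \<subseteq> mspace m"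
    and f: "\<And>\<omega>. \<omega> \<in> space Q \<Longrightarrow> f \<omega> \<in> S" and g: "\<And>\<omega>. \<omega> \<in> space Q \<Longrightarrow> g \<omega> \<in> mspace m"
    and fm: "\<And>c. c \<in> S \<Longrightarrow> (\<lambda>\<omega>. mdist m (f \<omega>) c) \<in> borel_measurable Q"
    and gm: "\<And>c. c \<in> S \<Longrightarrow> (\<lambda>\<omega>. mdist m (g \<omega>) c) \<in> borel_measurable Q"
  shows "(\<lambda>\<omega>. mdist m (f \<omega>) (g \<omega>)) \<in> borel_measurable Q"
proof -
  obtain C where C: "countable C" "C \<subseteq> S" "\<And>x e. x \<in> S \<Longrightarrow> 0 < e \<Longrightarrow> \<exists>c\<in>C. mdist m x c < e"
    using separable_inE[OF S] by blast
  have "{\<omega> \<in> space Q. mdist m (f \<omega>) (g \<omega>) < a}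
     = (\<Union>c\<in>C. {\<omega> \<in> space Q. mdist m (f \<omega>) c + mdist m (g \<omega>) c < a})" for a
  proof (intro equalityI subsetI)
    fix \<omega> assume \<omega>: "\<omega> \<in> {\<omega> \<in> space Q. mdist m (f \<omega>) (g \<omega>) < a}"
    let ?e = "(a - mdist m (f \<omega>) (g \<omega>)) / 2"
    obtain c where c: "c \<in> C" "mdist m (f \<omega>) c < ?e" using C(3)[of "f \<omega>" ?e] f \<omega> by auto
    have "mdist m (g \<omega>) c \<le> mdist m (g \<omega>) (f \<omega>) + mdist m (f \<omega>) c"
      using f[of \<omega>] g[of \<omega>] \<omega> c(1) C(2) SM by (intro mdist_triangle) auto
    then have "mdist m (f \<omega>) c + mdist m (g \<omega>) c < a"
      using c(2) mdist_commute[of m "g \<omega>" "f \<omega>"] by simp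
    then show "\<omega> \<in> (\<Union>c\<in>C. {\<omega> \<in> space Q. mdist m (f \<omega>) c + mdist m (g \<omega>) c < a})"
      using c(1) \<omega> by auto
  next
    fix \<omega> assume "\<omega> \<in> (\<Union>c\<in>C. {\<omega> \<in> space Q. mdist m (f \<omega>) c + mdist m (g \<omega>) c < a})"
    then obtain c where c: "c \<in> C" "\<omega> \<in> space Q" "mdist m (f \<omega>) c + mdist m (g \<omega>) c < a" by auto
    have "mdist m (f \<omega>) (g \<omega>) \<le> mdist m (f \<omega>) c + mdist m c (g \<omega>)"
      using f[of \<omega>] g[of \<omega>] c C(2) SM by (intro mdist_triangle) auto
    then show "\<omega> \<in> {\<omega> \<in> space Q. mdist m (f \<omega>) (g \<omega>) < a}"
      using c mdist_commute[of m c] by auto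
  qed
  moreover have "(\<Union>c\<in>C. {\<omega> \<in> space Q. mdist m (f \<omega>) c + mdist m (g \<omega>) c < a}) \<in> sets Q" for a
  proof (rule sets.countable_UN''[OF C(1)])
    fix c assume "c \<in> C"
    then have [measurable]: "(\<lambda>\<omega>. mdist m (f \<omega>) c) \<in> borel_measurable Q" "(\<lambda>\<omega>. mdist m (g \<omega>) c) \<in> borel_measurable Q"
      using fm gm C(2) by auto
    show "{\<omega> \<in> space Q. mdist m (f \<omega>) c + mdist m (g \<omega>) c < a} \<in> sets Q" by measurable
  qed
  ultimately show ?thesis by (intro borel_measurableI_less) simp
qed

lemma msupp_sub: "msupp m \<mu> \<subseteq> mspace m"
  by (auto simp: msupp_def)

lemma closedin_msupp:
  assumes "sets \<mu> = sets (borel_of (mtopology_of m))"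
  shows "closedin (mtopology_of m) (msupp m \<mu>)"
  unfolding closedin_def openin_mtopology_of
proof (intro conjI ballI)
  fix x assume "x \<in> topspace (mtopology_of m) - msupp m \<mu>"
  then obtain e where x: "x \<in> mspace m" and e: "e > 0" "emeasure \<mu> (mball_of m x e) = 0"
    by (auto simp: msupp_def)
  show "\<exists>e>0. \<forall>y\<in>mspace m. mdist m x y < e \<longrightarrow> y \<in> topspace (mtopology_of m) - msupp m \<mu>"
  proof (intro exI[of _ e] conjI ballI impI)
    fix y assume y: "y \<in> mspace m" "mdist m x y < e"
    have "mball_of m y (e - mdist m x y) \<subseteq> mball_of m x e"
      using mdist_triangle[of x m y] x y by fastforce
    then have "emeasure \<mu> (mball_of m y (e - mdist m x y)) \<le> emeasure \<mu> (mball_of m x e)"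
      using borel_of_open[OF openin_mball_of] by (intro emeasure_mono) (auto simp: assms)
    then have "\<not> emeasure \<mu> (mball_of m y (e - mdist m x y)) > 0" using e(2) by simp
    moreover have "e - mdist m x y > 0" using y(2) by simp
    ultimately show "y \<in> topspace (mtopology_of m) - msupp m \<mu>" using y(1) unfolding msupp_def topspace_mtopology_of by blast
  qed (rule e)
qed (use msupp_sub[of m \<mu>] in auto)

lemma msupp_sets: "sets \<mu> = sets (borel_of (mtopology_of m)) \<Longrightarrow> msupp m \<mu> \<in> sets \<mu>"
  using borel_of_closed[OF closedin_msupp] by blast

text \<open>The points of S outside the support are covered by countably many null balls, with
  centres in a dense subset of S and rational radii.\<close>

lemma separable_carried:
  assumes sets: "sets \<mu> = sets (borel_of (mtopology_of m))" and S: "separable_in m S" "S \<in> sets \<mu>"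
  shows "emeasure \<mu> (S - msupp m \<mu>) = 0"
proof -
  have SM: "S \<subseteq> mspace m" using sets.sets_into_space[OF S(2)] sets_eq_imp_space_eq[OF sets] by simp
  obtain C where C: "countable C" "C \<subseteq> S" "\<And>x e. x \<in> S \<Longrightarrow> 0 < e \<Longrightarrow> \<exists>c\<in>C. mdist m x c < e"
    using separable_inE[OF S(1)] by blast
  define I where "I = {(c, q::rat). c \<in> C \<and> emeasure \<mu> (mball_of m c (of_rat q)) = 0}"
  have "I \<subseteq> C \<times> UNIV" by (auto simp: I_def)
  then have I: "countable I" using C(1) by (meson countable_SIGMA countable_subset countableI_type)
  have "(\<Union>(c, q)\<in>I. mball_of m c (of_rat q)) \<in> null_sets \<mu>"
    using I borel_of_open[OF openin_mball_of] by (intro null_sets_UN') (auto simp: I_def sets null_sets_def)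
  moreover have "S - msupp m \<mu> \<subseteq> (\<Union>(c, q)\<in>I. mball_of m c (of_rat q))"
  proof
    fix x assume x: "x \<in> S - msupp m \<mu>"
    then obtain e where e: "e > 0" "emeasure \<mu> (mball_of m x e) = 0"
      using SM by (auto simp: msupp_def)
    obtain q where q: "e / 4 < of_rat q" "of_rat q < e / 2" using of_rat_dense[of "e/4" "e/2"] e by auto
    obtain c where c: "c \<in> C" "mdist m x c < e / 4" using C(3)[of x "e/4"] x e by auto
    have "mball_of m c (of_rat q) \<subseteq> mball_of m x e"
    proof
      fix y assume "y \<in> mball_of m c (of_rat q)"
      then have y: "y \<in> mspace m" "mdist m c y < of_rat q" "c \<in> mspace m" by auto
      have "mdist m x y \<le> mdist m x c + mdist m c y" using x SM y by (intro mdist_triangle) auto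
      then show "y \<in> mball_of m x e" using y c q x SM e by auto
    qed
    then have "emeasure \<mu> (mball_of m c (of_rat q)) \<le> emeasure \<mu> (mball_of m x e)"
      using borel_of_open[OF openin_mball_of] by (intro emeasure_mono) (auto simp: sets)
    then have "(c, q) \<in> I" using e c by (simp add: I_def)
    moreover have "x \<in> mball_of m c (of_rat q)" using x SM c C(2) q mdist_commute[of m x c] by auto
    ultimately show "x \<in> (\<Union>(c, q)\<in>I. mball_of m c (of_rat q))" by blast
  qed
  moreover have "S - msupp m \<mu> \<in> sets \<mu>" using S(2) msupp_sets[OF sets] by blast
  ultimately show ?thesis by (metis null_setsD1 null_sets_subset)
qed

section \<open>Sampling from pointed metric measure spaces\<close>

text \<open>\<open>fin_meas_css\<close> without completeness, which a pruned tree may lack.\<close>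

definition carried :: "'a metric \<Rightarrow> 'a measure \<Rightarrow> bool" where
  "carried m \<mu> \<longleftrightarrow> sets \<mu> = sets (borel_of (mtopology_of m)) \<and> finite_measure \<mu> \<and>
     separable_in m (msupp m \<mu>) \<and> emeasure \<mu> (mspace m - msupp m \<mu>) = 0"

lemma fin_meas_css_iff:
  "fin_meas_css m \<mu> \<longleftrightarrow> carried m \<mu> \<and> mcomplete_of (submetric m (msupp m \<mu>))"
  using separable_space_iff[OF msupp_sub, of m \<mu>] by (auto simp: fin_meas_css_def carried_def)

lemma carriedD:
  assumes "carried m \<mu>"
  shows "sets \<mu> = sets (borel_of (mtopology_of m))" "finite_measure \<mu>" "separable_in m (msupp m \<mu>)"
    "space \<mu> = mspace m" "msupp m \<mu> \<in> sets \<mu>" "emeasure \<mu> (mspace m - msupp m \<mu>) = 0"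
proof -
  show s: "sets \<mu> = sets (borel_of (mtopology_of m))" and "finite_measure \<mu>"
    and "emeasure \<mu> (mspace m - msupp m \<mu>) = 0"
    and "separable_in m (msupp m \<mu>)"
    using assms by (auto simp: carried_def)
  show "space \<mu> = mspace m" using sets_eq_imp_space_eq[OF s] by simp
  show "msupp m \<mu> \<in> sets \<mu>" using msupp_sets[OF s] .
qed

lemma space_on_supp:
  assumes "sets \<mu> = sets (borel_of (mtopology_of m))"
  shows "space (on_supp m \<mu>) = msupp m \<mu>"
  using sets_eq_imp_space_eq[OF assms] msupp_sub[of m \<mu>] by (auto simp: on_supp_def space_restrict_space)

lemma on_supp_measurable_D:
  assumes "sets \<mu> = sets (borel_of (mtopology_of m))" "f \<in> measurable Q (on_supp m \<mu>)"
  shows "f \<in> measurable Q \<mu>" "\<And>\<omega>. \<omega> \<in> space Q \<Longrightarrow> f \<omega> \<in> msupp m \<mu>"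
  using assms(2) measurable_space[OF assms(2)] space_on_supp[OF assms(1)]
  by (auto simp: on_supp_def measurable_restrict_space2_iff)

lemma emeasure_on_supp:
  assumes "sets \<mu> = sets (borel_of (mtopology_of m))" "emeasure \<mu> (mspace m - msupp m \<mu>) = 0" "A \<in> sets \<mu>"
  shows "emeasure (on_supp m \<mu>) (A \<inter> msupp m \<mu>) = emeasure \<mu> A"
proof -
  have S: "msupp m \<mu> \<in> sets \<mu>" using msupp_sets[OF assms(1)] .
  have sp: "space \<mu> = mspace m" using sets_eq_imp_space_eq[OF assms(1)] by simp
  have "emeasure (on_supp m \<mu>) (A \<inter> msupp m \<mu>) = emeasure \<mu> (A \<inter> msupp m \<mu>)"
    unfolding on_supp_def using S by (intro emeasure_restrict_space) auto
  also have "\<dots> = emeasure \<mu> A"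
  proof (rule emeasure_eq_AE)
    have "mspace m - msupp m \<mu> \<in> null_sets \<mu>" using assms(2) S sp sets.compl_sets[OF S] by (auto simp: null_sets_def)
    then show "AE x in \<mu>. (x \<in> A \<inter> msupp m \<mu>) = (x \<in> A)"
      by (rule AE_I') (use sp in auto)
  qed (use S assms(3) in auto)
  finally show ?thesis .
qed

lemma on_supp_finite:
  assumes "carried m \<mu>"
  shows "finite_measure (on_supp m \<mu>)" "emeasure (on_supp m \<mu>) (space (on_supp m \<mu>)) = emeasure \<mu> (space \<mu>)"
    "measure (on_supp m \<mu>) (space (on_supp m \<mu>)) = total_mass \<mu>"
proof -
  note f = carriedD[OF assms]
  interpret finite_measure \<mu> by (rule f(2))
  have "emeasure (on_supp m \<mu>) (space \<mu> \<inter> msupp m \<mu>) = emeasure \<mu> (space \<mu>)"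
    using emeasure_on_supp[OF f(1,6) sets.top] .
  moreover have "space \<mu> \<inter> msupp m \<mu> = space (on_supp m \<mu>)"
    using space_on_supp[OF f(1)] f(4) msupp_sub[of m \<mu>] by auto
  ultimately show *: "emeasure (on_supp m \<mu>) (space (on_supp m \<mu>)) = emeasure \<mu> (space \<mu>)" by simp
  then show "finite_measure (on_supp m \<mu>)" by (intro finite_measureI) simp
  show "measure (on_supp m \<mu>) (space (on_supp m \<mu>)) = total_mass \<mu>"
    using * by (simp add: measure_def total_mass_def)
qed

lemma on_supp_normalized_alt:
  assumes "carried m \<mu>"
  shows "on_supp_normalized m \<mu> = scale_measure (inverse (emeasure (on_supp m \<mu>) (space (on_supp m \<mu>)))) (on_supp m \<mu>)"
  by (simp add: on_supp_normalized_def on_supp_finite(2)[OF assms])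

lemma mdist_measurable_borel:
  assumes "sets \<mu> = sets (borel_of (mtopology_of m))" "c \<in> mspace m"
  shows "(\<lambda>x. mdist m x c) \<in> borel_measurable \<mu>"
  using borel_of_continuous_map[OF continuous_map_mdist_right[OF assms(2)]]
  by (simp add: measurable_cong_sets[OF assms(1) refl])

lemma mdist_measurable_on_supp:
  assumes \<mu>: "sets \<mu> = sets (borel_of (mtopology_of m))" and f: "f \<in> measurable Q (on_supp m \<mu>)" and c: "c \<in> mspace m"
  shows "(\<lambda>\<omega>. mdist m (f \<omega>) c) \<in> borel_measurable Q"
  using measurable_compose[OF on_supp_measurable_D(1)[OF \<mu> f] mdist_measurable_borel[OF \<mu> c]] .

text \<open>A point of the configuration is either a fixed one or a sampled one.\<close>

lemma mdist_measurable_points: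
  assumes \<mu>: "sets \<mu> = sets (borel_of (mtopology_of m))" "separable_in m (msupp m \<mu>)"
    and f: "(\<exists>c\<in>mspace m. \<forall>\<omega>\<in>space Q. f \<omega> = c) \<or> f \<in> measurable Q (on_supp m \<mu>)"
    and g: "(\<exists>c\<in>mspace m. \<forall>\<omega>\<in>space Q. g \<omega> = c) \<or> g \<in> measurable Q (on_supp m \<mu>)"
  shows "(\<lambda>\<omega>. mdist m (f \<omega>) (g \<omega>)) \<in> borel_measurable Q"
proof -
  have c: "(\<lambda>\<omega>. mdist m (h \<omega>) c) \<in> borel_measurable Q"
    if "c \<in> mspace m" and h: "(\<exists>c\<in>mspace m. \<forall>\<omega>\<in>space Q. h \<omega> = c) \<or> h \<in> measurable Q (on_supp m \<mu>)" for h c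
    using h
  proof
    assume "\<exists>c\<in>mspace m. \<forall>\<omega>\<in>space Q. h \<omega> = c"
    then obtain b where "\<And>\<omega>. \<omega> \<in> space Q \<Longrightarrow> h \<omega> = b" by blast
    then have "(\<lambda>\<omega>. mdist m (h \<omega>) c) \<in> borel_measurable Q \<longleftrightarrow> (\<lambda>\<omega>. mdist m b c) \<in> borel_measurable Q"
      by (intro measurable_cong) simp
    then show ?thesis by simp
  qed (rule mdist_measurable_on_supp[OF \<mu>(1) _ that(1)])
  show ?thesis using f
  proof
    assume "\<exists>c\<in>mspace m. \<forall>\<omega>\<in>space Q. f \<omega> = c"
    then obtain b where b: "b \<in> mspace m" "\<And>\<omega>. \<omega> \<in> space Q \<Longrightarrow> f \<omega> = b" by blast
    then have "(\<lambda>\<omega>. mdist m (f \<omega>) (g \<omega>)) \<in> borel_measurable Q \<longleftrightarrow> (\<lambda>\<omega>. mdist m (g \<omega>) b) \<in> borel_measurable Q"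
      by (intro measurable_cong) (simp add: mdist_commute)
    then show ?thesis using c[OF b(1) g] by simp
  next
    assume f': "f \<in> measurable Q (on_supp m \<mu>)"
    have gs: "g \<omega> \<in> mspace m" if "\<omega> \<in> space Q" for \<omega>
      using g
    proof
      assume "\<exists>c\<in>mspace m. \<forall>\<omega>\<in>space Q. g \<omega> = c"
      then show ?thesis using that by auto
    next
      assume "g \<in> measurable Q (on_supp m \<mu>)"
      then show ?thesis using on_supp_measurable_D(2)[OF \<mu>(1) _ that] msupp_sub[of m \<mu>] by blast
    qed
    show ?thesis
    proof (rule borel_measurable_mdist_pair[OF \<mu>(2) msupp_sub on_supp_measurable_D(2)[OF \<mu>(1) f'] gs])
      fix b assume "b \<in> msupp m \<mu>"
      then have "b \<in> mspace m" using msupp_sub[of m \<mu>] by blast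
      then show "(\<lambda>\<omega>. mdist m (f \<omega>) b) \<in> borel_measurable Q" "(\<lambda>\<omega>. mdist m (g \<omega>) b) \<in> borel_measurable Q"
        using c[OF _ f] c[OF _ g] by blast+
    qed
  qed
qed

section \<open>Distance matrices of sampled points\<close>

lemma topspace_matrix_top: "topspace (matrix_top I) = Pi\<^sub>E I (\<lambda>_. {0..})"
  by (simp add: matrix_top_def)

lemma dist_matrix_topspace: "dist_matrix I Y v \<in> topspace (matrix_top I)"
  by (auto simp: topspace_matrix_top dist_matrix_def split: prod.splits)

lemma dist_matrix_apply: "(i, j) \<in> I \<Longrightarrow> dist_matrix I Y v (i, j) = mdist (p_metric Y) (points_then Y v i) (points_then Y v j)"
  by (simp add: dist_matrix_def)

lemma measurable_into_matrix_top:
  assumes "\<And>\<omega>. \<omega> \<in> space Q \<Longrightarrow> R \<omega> \<in> topspace (matrix_top I)"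
    and "\<And>p. p \<in> I \<Longrightarrow> (\<lambda>\<omega>. R \<omega> p) \<in> borel_measurable Q"
  shows "R \<in> measurable Q (borel_of (matrix_top I))"
proof (rule measurable_into_generated[OF generated_by_matrix_top assms(1)])
  fix i :: "(nat \<times> nat) \<times> unit"
  obtain p where i: "i = (p, ())" by (cases i) auto
  show "(\<lambda>\<omega>. (case i of (l, _) \<Rightarrow> \<lambda>c. if l \<in> I then c l else 0) (R \<omega>)) \<in> borel_measurable Q"
    using assms(2)[of p] by (cases "p \<in> I") (auto simp: i)
qed

lemma matrix_entry_measurable: "p \<in> I \<Longrightarrow> (\<lambda>R. R p) \<in> borel_measurable (borel_of (matrix_top I))"
  using borel_of_continuous_map[OF generated_by_continuous[OF generated_by_matrix_top[of I], of "(p, ())"]]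
  by simp

lemma pmm_spacesD:
  assumes "Y \<in> pmm_spaces n"
  shows "length (p_points Y) = n" "p_root Y \<in> mspace (p_metric Y)" "set (p_points Y) \<subseteq> mspace (p_metric Y)"
    "carried (p_metric Y) (p_measure Y)"
  using assms by (auto simp: pmm_spaces_def fin_meas_css_iff)

abbreviation p_sample :: "'a pmm \<Rightarrow> 'a measure" where
  "p_sample Y \<equiv> on_supp (p_metric Y) (p_measure Y)"

abbreviation p_mass :: "'a pmm \<Rightarrow> real" where
  "p_mass Y \<equiv> total_mass (p_measure Y)"

text \<open>Position 0 is the root and positions 1 to n are the marked points, so
  \<open>n + 1 + k\<close> is the k-th sampled point. Only positions that occur in I have to be
  measurable.\<close>

lemma dist_matrix_measurable:
  assumes Y: "Y \<in> pmm_spaces n"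
    and v: "\<And>i j k. (i, j) \<in> I \<Longrightarrow> i = n + 1 + k \<or> j = n + 1 + k \<Longrightarrow> (\<lambda>\<omega>. v \<omega> k) \<in> measurable Q (p_sample Y)"
  shows "(\<lambda>\<omega>. dist_matrix I Y (v \<omega>)) \<in> measurable Q (borel_of (matrix_top I))"
proof (rule measurable_into_matrix_top[OF dist_matrix_topspace])
  note y = pmm_spacesD[OF Y]
  fix p assume p: "p \<in> I"
  obtain i j where ij: "p = (i, j)" by (cases p)
  have pt: "(\<exists>c\<in>mspace (p_metric Y). \<forall>\<omega>\<in>space Q. points_then Y (v \<omega>) l = c) \<or>
     (\<lambda>\<omega>. points_then Y (v \<omega>) l) \<in> measurable Q (p_sample Y)" if l: "l = i \<or> l = j" for l
  proof (cases "l = 0 \<or> l \<le> n")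
    case True
    define c where "c = (if l = 0 then p_root Y else p_points Y ! (l - 1))"
    have "c \<in> mspace (p_metric Y)"
      using True y(1,2,3) nth_mem[of "l - 1" "p_points Y"] by (auto simp: c_def)
    moreover have "points_then Y (v \<omega>) l = c" for \<omega> using True y(1) by (auto simp: c_def points_then_def)
    ultimately show ?thesis by blast
  next
    case False
    then obtain k where k: "l = n + 1 + k" by (metis Suc_eq_plus1 add_Suc_right less_imp_Suc_add not_le add.commute)
    then have "(\<lambda>\<omega>. v \<omega> k) \<in> measurable Q (p_sample Y)" using v[of i j k] p l ij by blast
    moreover have "(\<lambda>\<omega>. points_then Y (v \<omega>) l) = (\<lambda>\<omega>. v \<omega> k)"
      using False k y(1) by (auto simp: points_then_def)
    ultimately show ?thesis by simp
  qed
  have "(\<lambda>\<omega>. mdist (p_metric Y) (points_then Y (v \<omega>) i) (points_then Y (v \<omega>) j)) \<in> borel_measurable Q"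
    by (rule mdist_measurable_points[OF carriedD(1,3)[OF y(4)] pt pt]) auto
  then show "(\<lambda>\<omega>. dist_matrix I Y (v \<omega>) p) \<in> borel_measurable Q"
    using p ij by (simp add: dist_matrix_apply)
qed

lemma pairs_upto_iff: "(i, j) \<in> pairs_upto k \<longleftrightarrow> i < j \<and> j \<le> k"
  by (simp add: pairs_upto_def)

text \<open>The integral in \<open>Phi_fun\<close> without the factor \<gamma>. It is also applied
  to integrands other than \<phi>: tents and cut-off versions of \<phi>.\<close>

definition samp :: "'a pmm \<Rightarrow> nat \<Rightarrow> ((nat \<times> nat \<Rightarrow> real) \<Rightarrow> real) \<Rightarrow> real" where
  "samp Y k \<psi> = (\<integral>v. \<psi> (dist_matrix (pairs_upto (length (p_points Y) + k)) Y v) \<partial>Pi\<^sub>M {..<k} (\<lambda>_. p_sample Y))"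

lemma Phi_fun_samp: "Phi_fun \<gamma> k \<phi> Y = \<gamma> (p_mass Y) * samp Y k \<phi>"
  by (simp add: Phi_fun_def samp_def)

abbreviation "matrix_measurable k \<psi> \<equiv> \<psi> \<in> borel_measurable (borel_of (matrix_top (pairs_upto k)))"

lemma Cb_matrix_measurable: "\<psi> \<in> Cb (matrix_top (pairs_upto k)) \<Longrightarrow> matrix_measurable k \<psi>"
  by (simp add: Cb_def borel_of_continuous_map)

lemma samp_measurable:
  assumes Y: "Y \<in> pmm_spaces n" and \<psi>: "matrix_measurable (n + k) \<psi>"
  shows "(\<lambda>v. \<psi> (dist_matrix (pairs_upto (n + k)) Y v)) \<in> borel_measurable (Pi\<^sub>M {..<k} (\<lambda>_. p_sample Y))"
  by (rule measurable_compose[OF dist_matrix_measurable[OF Y] \<psi>])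
     (auto simp: pairs_upto_iff)

lemma samp_bound:
  assumes Y: "Y \<in> pmm_spaces n" and \<psi>: "matrix_measurable (n + k) \<psi>"
    and B: "\<And>R. R \<in> topspace (matrix_top (pairs_upto (n + k))) \<Longrightarrow> \<bar>\<psi> R\<bar> \<le> B"
  shows "\<bar>samp Y k \<psi>\<bar> \<le> B * p_mass Y ^ k"
    "integrable (Pi\<^sub>M {..<k} (\<lambda>_. p_sample Y)) (\<lambda>v. \<psi> (dist_matrix (pairs_upto (n + k)) Y v))"
proof -
  note y = pmm_spacesD[OF Y]
  note os = on_supp_finite[OF y(4)]
  let ?P = "Pi\<^sub>M {..<k} (\<lambda>_. p_sample Y)"
  have fin: "finite_measure ?P" "measure ?P (space ?P) = p_mass Y ^ k"
    using finite_measure_PiM[OF os(1), of "{..<k}"] os(3) by auto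
  interpret P: finite_measure ?P by (rule fin(1))
  show int: "integrable ?P (\<lambda>v. \<psi> (dist_matrix (pairs_upto (n + k)) Y v))"
    using B[OF dist_matrix_topspace] by (intro P.integrable_const_bound[of _ B] samp_measurable[OF Y \<psi>]) auto
  have "\<bar>samp Y k \<psi>\<bar> \<le> (\<integral>v. B \<partial>?P)"
    unfolding samp_def y(1) using B[OF dist_matrix_topspace] int
    by (intro order_trans[OF integral_abs_bound] integral_mono) auto
  then show "\<bar>samp Y k \<psi>\<bar> \<le> B * p_mass Y ^ k" using fin(2) by (simp add: mult.commute)
qed

section \<open>Sampling integrals and the law \<open>upsilon\<close>\<close>

lemma upsilon_sets: "sets (upsilon Y) = sets (borel_of (matrix_top all_pairs))"
  by (simp add: upsilon_def)

lemma restrict_matrix_measurable: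
  assumes "J \<subseteq> I" shows "(\<lambda>R. restrict R J) \<in> measurable (borel_of (matrix_top I)) (borel_of (matrix_top J))"
proof (rule measurable_into_matrix_top)
  fix p assume "p \<in> J"
  then show "(\<lambda>R. restrict R J p) \<in> borel_measurable (borel_of (matrix_top I))"
    using matrix_entry_measurable[of p I] assms by auto
qed (use assms in \<open>auto simp: topspace_matrix_top PiE_iff\<close>)

lemma restrict_matrix_continuous:
  assumes "J \<subseteq> I" shows "continuous_map (matrix_top I) (matrix_top J) (\<lambda>R. restrict R J)"
  unfolding matrix_top_def continuous_map_componentwise
  using assms by (auto intro!: continuous_map_product_projection)

lemma pairs_upto_sub: "pairs_upto k \<subseteq> all_pairs"
  by (auto simp: pairs_upto_def all_pairs_def)

lemma sample_matrix_measurable: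
  assumes Y: "Y \<in> pmm_spaces n"
  shows "dist_matrix all_pairs Y \<in> measurable
    (Pi\<^sub>M UNIV (\<lambda>_. on_supp_normalized (p_metric Y) (p_measure Y))) (borel_of (matrix_top all_pairs))"
proof (rule dist_matrix_measurable[OF Y])
  let ?N = "on_supp_normalized (p_metric Y) (p_measure Y)"
  fix k :: nat
  have "sets ?N = sets (p_sample Y)" by (simp add: on_supp_normalized_def)
  moreover have "(\<lambda>\<omega>. \<omega> k) \<in> measurable (Pi\<^sub>M UNIV (\<lambda>_. ?N)) ?N" by measurable
  ultimately show "(\<lambda>\<omega>. \<omega> k) \<in> measurable (Pi\<^sub>M UNIV (\<lambda>_. ?N)) (p_sample Y)"
    using measurable_cong_sets[OF refl] by blast
qed

text \<open>\<open>upsilon\<close> carries one factor of the mass and normalised samples,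
  \<open>samp\<close> carries k factors. Both sides are multiplied out so that mass 0 is no
  exception.\<close>

lemma upsilon_samp:
  assumes Y: "Y \<in> pmm_spaces n" and \<psi>: "matrix_measurable (n + k) \<psi>"
  shows "p_mass Y ^ k * (\<integral>R. \<psi> (restrict R (pairs_upto (n + k))) \<partial>upsilon Y) = p_mass Y * samp Y k \<psi>"
proof (cases "p_mass Y = 0")
  case True
  then have "(\<integral>R. \<psi> (restrict R (pairs_upto (n + k))) \<partial>upsilon Y) = 0"
    by (simp add: upsilon_def)
  then show ?thesis using True by simp
next
  case False
  note y = pmm_spacesD[OF Y]
  note os = on_supp_finite[OF y(4)]
  have M0: "0 \<le> p_mass Y" by (simp add: total_mass_def)
  let ?N = "on_supp_normalized (p_metric Y) (p_measure Y)"
  note dm = sample_matrix_measurable[OF Y]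
  have meas: "(\<lambda>R. \<psi> (restrict R (pairs_upto (n + k)))) \<in> borel_measurable (borel_of (matrix_top all_pairs))"
    using restrict_matrix_measurable[OF pairs_upto_sub] \<psi> by (rule measurable_compose)
  have "(\<integral>R. \<psi> (restrict R (pairs_upto (n + k))) \<partial>upsilon Y) =
    p_mass Y * (\<integral>v. \<psi> (restrict (dist_matrix all_pairs Y v) (pairs_upto (n + k))) \<partial>Pi\<^sub>M UNIV (\<lambda>_. ?N))"
    using False M0 meas dm by (simp add: upsilon_def integral_scale_measure' integral_distr)
  also have "(\<lambda>v. \<psi> (restrict (dist_matrix all_pairs Y v) (pairs_upto (n + k))))
    = (\<lambda>v. \<psi> (dist_matrix (pairs_upto (n + k)) Y (\<lambda>i\<in>{..<k}. v i)))"
  proof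
    fix v
    have "restrict (dist_matrix all_pairs Y v) (pairs_upto (n + k)) = dist_matrix (pairs_upto (n + k)) Y (\<lambda>i\<in>{..<k}. v i)"
      using y(1) by (auto simp: fun_eq_iff dist_matrix_def pairs_upto_def all_pairs_def points_then_def)
    then show "\<psi> (restrict (dist_matrix all_pairs Y v) (pairs_upto (n + k))) = \<psi> (dist_matrix (pairs_upto (n + k)) Y (\<lambda>i\<in>{..<k}. v i))"
      by simp
  qed
  finally have *: "(\<integral>R. \<psi> (restrict R (pairs_upto (n + k))) \<partial>upsilon Y) = p_mass Y *
    (\<integral>v. \<psi> (dist_matrix (pairs_upto (n + k)) Y (\<lambda>i\<in>{..<k}. v i)) \<partial>Pi\<^sub>M UNIV (\<lambda>_. ?N))" .
  have "p_mass Y ^ card {..<k} * (\<integral>v. \<psi> (dist_matrix (pairs_upto (n + k)) Y (\<lambda>i\<in>{..<k}. v i)) \<partial>Pi\<^sub>M UNIV (\<lambda>_. ?N))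
    = (\<integral>v. \<psi> (dist_matrix (pairs_upto (n + k)) Y v) \<partial>Pi\<^sub>M {..<k} (\<lambda>_. p_sample Y))"
    unfolding on_supp_normalized_alt[OF y(4)]
    by (rule integral_PiM_normalize[OF os(1) os(3) False _ samp_measurable[OF Y \<psi>]]) simp
  then show ?thesis unfolding * samp_def y(1) by (simp add: algebra_simps)
qed

lemma upsilon_finite: "finite_measure (upsilon Y)" if "Y \<in> pmm_spaces n"
proof (cases "p_mass Y = 0")
  case True then show ?thesis by (auto simp: upsilon_def intro!: finite_measureI)
next
  case False
  let ?N = "on_supp_normalized (p_metric Y) (p_measure Y)"
  have "prob_space ?N" unfolding on_supp_normalized_alt[OF pmm_spacesD(4)[OF that]]
    using on_supp_finite[OF pmm_spacesD(4)[OF that]] False by (intro prob_space_normalize) auto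
  then have "prob_space (Pi\<^sub>M (UNIV :: nat set) (\<lambda>_. ?N))" by (intro prob_space_PiM)
  then have "prob_space (distr (Pi\<^sub>M UNIV (\<lambda>_. ?N)) (borel_of (matrix_top all_pairs)) (dist_matrix all_pairs Y))"
    by (rule prob_space.prob_space_distr[OF _ sample_matrix_measurable[OF that]])
  from prob_space.emeasure_space_1[OF this] show ?thesis
    using False by (intro finite_measureI) (simp add: upsilon_def space_scale_measure)
qed

section \<open>Transport of samples along isometries\<close>

text \<open>An open set pulls back to the trace on D of a union of balls, since balls around points
  of D correspond under an isometry.\<close>

lemma isometry_measurable:
  assumes \<mu>: "sets \<mu> = sets (borel_of (mtopology_of m))" and D: "D \<subseteq> mspace m"
    and \<phi>: "\<phi> ` D \<subseteq> mspace m'" "\<And>x y. x \<in> D \<Longrightarrow> y \<in> D \<Longrightarrow> mdist m' (\<phi> x) (\<phi> y) = mdist m x y"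
  shows "\<phi> \<in> measurable (restrict_space \<mu> D) (borel_of (mtopology_of m'))"
proof -
  have sp: "space (restrict_space \<mu> D) = D" using D sets_eq_imp_space_eq[OF \<mu>] by (auto simp: space_restrict_space)
  show ?thesis
    unfolding borel_of_def
  proof (rule measurable_measure_of)
    show "\<phi> \<in> space (restrict_space \<mu> D) \<rightarrow> topspace (mtopology_of m')" using \<phi>(1) sp by auto
    fix U assume "U \<in> {U. openin (mtopology_of m') U}"
    then have U: "openin (mtopology_of m') U" by simp
    let ?V = "\<Union>{mball_of m x e | x e. x \<in> D \<and> mball_of m x e \<inter> D \<subseteq> \<phi> -` U}"
    have "\<phi> -` U \<inter> D = ?V \<inter> D"
    proof (intro equalityI subsetI)
      fix x assume x: "x \<in> \<phi> -` U \<inter> D"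
      then obtain e where e: "e > 0" "\<And>y. y \<in> mspace m' \<Longrightarrow> mdist m' (\<phi> x) y < e \<Longrightarrow> y \<in> U"
        using U unfolding openin_mtopology_of by blast
      have "mball_of m x e \<inter> D \<subseteq> \<phi> -` U"
        using e(2) \<phi> x by auto
      moreover have "x \<in> mball_of m x e" using x D e by auto
      ultimately show "x \<in> ?V \<inter> D" using x by blast
    qed blast
    moreover have "openin (mtopology_of m) ?V" by (intro openin_Union) (auto simp: openin_mball_of)
    ultimately have "\<phi> -` U \<inter> D = D \<inter> ?V" "?V \<in> sets \<mu>" using \<mu> borel_of_open by auto
    then show "\<phi> -` U \<inter> space (restrict_space \<mu> D) \<in> sets (restrict_space \<mu> D)"
      by (auto simp: sp sets_restrict_space)
  qed (use openin_subset[of "mtopology_of m'"] in auto)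
qed

text \<open>A ball around an image point pulls back to a set containing the original ball up to a
  null set, so supports go to supports and the sampling measures correspond. D is where the isometry
  is given: \<open>psupp\<close> for pointed spaces, the span of the support for bi-measure
  trees.\<close>

lemma transport_on_supp:
  assumes \<mu>: "sets \<mu> = sets (borel_of (mtopology_of m))" "emeasure \<mu> (mspace m - msupp m \<mu>) = 0"
    and \<mu>': "sets \<mu>' = sets (borel_of (mtopology_of m'))"
    and D: "D \<in> sets \<mu>" "msupp m \<mu> \<subseteq> D"
    and \<phi>: "\<phi> ` D \<subseteq> mspace m'" "\<And>x y. x \<in> D \<Longrightarrow> y \<in> D \<Longrightarrow> mdist m' (\<phi> x) (\<phi> y) = mdist m x y"
    and eq: "\<And>B. B \<in> sets \<mu>' \<Longrightarrow> emeasure \<mu> {x \<in> D. \<phi> x \<in> B} = emeasure \<mu>' B"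
  shows "\<phi> \<in> measurable (on_supp m \<mu>) (on_supp m' \<mu>')"
    "distr (on_supp m \<mu>) (on_supp m' \<mu>') \<phi> = on_supp m' \<mu>'"
    "emeasure \<mu> (space \<mu>) = emeasure \<mu>' (space \<mu>')"
proof -
  have sp: "space \<mu> = mspace m" "space \<mu>' = mspace m'"
    using sets_eq_imp_space_eq[OF \<mu>(1)] sets_eq_imp_space_eq[OF \<mu>'] by auto
  have DM: "D \<subseteq> mspace m" using sets.sets_into_space[OF D(1)] sp by simp
  have S: "msupp m \<mu> \<in> sets \<mu>" "msupp m' \<mu>' \<in> sets \<mu>'" using msupp_sets \<mu>(1) \<mu>' by auto
  have m0: "\<phi> \<in> measurable (restrict_space \<mu> D) \<mu>'"
    using isometry_measurable[OF \<mu>(1) DM \<phi>] measurable_cong_sets[OF refl \<mu>'] by blast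
  have mD: "{x \<in> D. \<phi> x \<in> B} \<in> sets \<mu>" if "B \<in> sets \<mu>'" for B
  proof -
    have "{x \<in> D. \<phi> x \<in> B} = \<phi> -` B \<inter> space (restrict_space \<mu> D)"
      using DM sp by (auto simp: space_restrict_space)
    then show ?thesis using measurable_sets[OF m0 that] D(1) by (auto simp: sets_restrict_space_iff)
  qed
  have nul: "AE x in \<mu>. x \<in> msupp m \<mu>"
    by (rule AE_I'[of "mspace m - msupp m \<mu>"]) (use \<mu>(2) S(1) sp sets.compl_sets[OF S(1)] in \<open>auto simp: null_sets_def\<close>)
  have supp: "\<phi> x \<in> msupp m' \<mu>'" if x: "x \<in> msupp m \<mu>" for x
    unfolding msupp_def
  proof (intro CollectI conjI allI impI)
    show "\<phi> x \<in> mspace m'" using x D(2) \<phi>(1) by auto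
    fix e :: real assume e: "e > 0"
    have B: "mball_of m' (\<phi> x) e \<in> sets \<mu>'" by (simp add: \<mu>' borel_of_open openin_mball_of)
    have "0 < emeasure \<mu> (mball_of m x e)" using x e by (simp add: msupp_def)
    also have "\<dots> \<le> emeasure \<mu> {y \<in> D. \<phi> y \<in> mball_of m' (\<phi> x) e}"
    proof (rule emeasure_mono_AE)
      show "AE y in \<mu>. y \<in> mball_of m x e \<longrightarrow> y \<in> {y \<in> D. \<phi> y \<in> mball_of m' (\<phi> x) e}"
        using nul
      proof eventually_elim
        case (elim y)
        then have "x \<in> D" "y \<in> D" "\<phi> x \<in> mspace m'" "\<phi> y \<in> mspace m'" using x D(2) \<phi>(1) by auto
        then show ?case using \<phi>(2)[of x y] by simp
      qed
    qed (rule mD[OF B])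
    also have "\<dots> = emeasure \<mu>' (mball_of m' (\<phi> x) e)" by (rule eq[OF B])
    finally show "0 < emeasure \<mu>' (mball_of m' (\<phi> x) e)" .
  qed
  show m1: "\<phi> \<in> measurable (on_supp m \<mu>) (on_supp m' \<mu>')"
    unfolding on_supp_def
  proof (rule measurable_restrict_space2)
    have "restrict_space (restrict_space \<mu> D) (msupp m \<mu>) = restrict_space \<mu> (msupp m \<mu>)"
      using D by (subst restrict_restrict_space) (auto simp: Int_absorb1 sets.sets_into_space S(1) intro!: sets.Int)
    then show "\<phi> \<in> measurable (restrict_space \<mu> (msupp m \<mu>)) \<mu>'"
      using measurable_restrict_space1[OF m0, of "msupp m \<mu>"] by simp
    show "\<phi> \<in> space (restrict_space \<mu> (msupp m \<mu>)) \<rightarrow> msupp m' \<mu>'"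
      using supp by (auto simp: space_restrict_space)
  qed
  show "distr (on_supp m \<mu>) (on_supp m' \<mu>') \<phi> = on_supp m' \<mu>'"
  proof (rule measure_eqI)
    fix B assume "B \<in> sets (distr (on_supp m \<mu>) (on_supp m' \<mu>') \<phi>)"
    then have B: "B \<in> sets (on_supp m' \<mu>')" by simp
    then have B': "B \<in> sets \<mu>'" "B \<subseteq> msupp m' \<mu>'"
      using S(2) unfolding on_supp_def by (auto simp: sets_restrict_space_iff)
    have "emeasure (distr (on_supp m \<mu>) (on_supp m' \<mu>') \<phi>) B = emeasure (on_supp m \<mu>) ({x \<in> D. \<phi> x \<in> B} \<inter> msupp m \<mu>)"
      using D(2) by (subst emeasure_distr[OF m1 B]) (auto simp: space_on_supp[OF \<mu>(1)] intro!: arg_cong[where f="emeasure _"])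
    also have "\<dots> = emeasure \<mu> {x \<in> D. \<phi> x \<in> B}" by (rule emeasure_on_supp[OF \<mu> mD[OF B'(1)]])
    also have "\<dots> = emeasure \<mu>' B" by (rule eq[OF B'(1)])
    also have "\<dots> = emeasure (on_supp m' \<mu>') B"
      unfolding on_supp_def using S(2) B' by (subst emeasure_restrict_space) auto
    finally show "emeasure (distr (on_supp m \<mu>) (on_supp m' \<mu>') \<phi>) B = emeasure (on_supp m' \<mu>') B" .
  qed simp
  have "emeasure \<mu> (space \<mu>) = emeasure \<mu> {x \<in> D. \<phi> x \<in> space \<mu>'}"
  proof (rule emeasure_eq_AE)
    show "AE x in \<mu>. (x \<in> space \<mu>) = (x \<in> {x \<in> D. \<phi> x \<in> space \<mu>'})"
      using nul AE_space by eventually_elim (use D \<phi> sp in auto)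
  qed (use mD in auto)
  also have "\<dots> = emeasure \<mu>' (space \<mu>')" by (intro eq) auto
  finally show "emeasure \<mu> (space \<mu>) = emeasure \<mu>' (space \<mu>')" .
qed

lemma psupp_sets:
  assumes Y: "Y \<in> pmm_spaces n" shows "psupp Y \<in> sets (p_measure Y)"
proof -
  note y = pmm_spacesD[OF Y]
  note f = carriedD[OF y(4)]
  have "closedin (mtopology_of (p_metric Y)) ({p_root Y} \<union> set (p_points Y))"
    using y(2,3) by (intro closedin_Hausdorff_finite)
      (auto simp: mtopology_of_def Metric_space.Hausdorff_space_mtopology Metric_space.topspace_mtopology)
  then have "{p_root Y} \<union> set (p_points Y) \<in> sets (p_measure Y)" unfolding f(1) by (rule borel_of_closed)
  then show ?thesis unfolding psupp_def Un_assoc by (rule sets.Un[OF f(5)])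
qed

text \<open>Makes the choice of \<open>class_rep\<close> harmless: mass, sampling integrals and
  marked distances are all that is ever read off a class of pointed spaces.\<close>

lemma pmm_iso_invariant:
  assumes iso: "pmm_iso Y Y'" and Y: "Y \<in> pmm_spaces n" and Y': "Y' \<in> pmm_spaces n"
  shows "p_mass Y' = p_mass Y" "\<And>k \<psi>. matrix_measurable (n + k) \<psi> \<Longrightarrow> samp Y' k \<psi> = samp Y k \<psi>"
    "point_matrix Y' = point_matrix Y"
proof -
  note y = pmm_spacesD[OF Y] and y' = pmm_spacesD[OF Y']
  note f = carriedD[OF y(4)] and f' = carriedD[OF y'(4)]
  obtain \<phi> where \<phi>: "bij_betw \<phi> (psupp Y) (psupp Y')"
    "\<And>x z. x \<in> psupp Y \<Longrightarrow> z \<in> psupp Y \<Longrightarrow> mdist (p_metric Y') (\<phi> x) (\<phi> z) = mdist (p_metric Y) x z"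
    "\<phi> (p_root Y) = p_root Y'" "map \<phi> (p_points Y) = p_points Y'"
    "\<And>B. B \<in> sets (p_measure Y') \<Longrightarrow> emeasure (p_measure Y) {x \<in> psupp Y. \<phi> x \<in> B} = emeasure (p_measure Y') B"
    using iso unfolding pmm_iso_def by blast
  note D = psupp_sets[OF Y]
  have im: "\<phi> ` psupp Y \<subseteq> mspace (p_metric Y')"
    using \<phi>(1) y'(2,3) msupp_sub[of "p_metric Y'" "p_measure Y'"] by (auto simp: bij_betw_def psupp_def)
  note tr = transport_on_supp[OF f(1,6) f'(1) D _ im \<phi>(2,5)]
  have sub: "msupp (p_metric Y) (p_measure Y) \<subseteq> psupp Y" by (auto simp: psupp_def)
  show "p_mass Y' = p_mass Y" using tr(3)[OF sub] by (simp add: total_mass_def measure_def)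
  have pt: "points_then Y' (\<lambda>i\<in>{..<k}. \<phi> (v i)) l = \<phi> (points_then Y v l) \<and> points_then Y v l \<in> psupp Y"
    if v: "\<And>i. i < k \<Longrightarrow> v i \<in> psupp Y" and l: "l \<le> n + k" for v k l
    using that y(1) y'(1) \<phi>(3) nth_map[of "l - 1" "p_points Y" \<phi>] unfolding \<phi>(4)
    by (auto simp: points_then_def psupp_def)
  show "samp Y' k \<psi> = samp Y k \<psi>" if \<psi>: "matrix_measurable (n + k) \<psi>" for k \<psi>
  proof -
    note os = on_supp_finite(1)[OF y(4)] and os' = on_supp_finite(1)[OF y'(4)]
    interpret F: finite_measure "p_sample Y" by (rule os)
    interpret F': finite_measure "p_sample Y'" by (rule os')
    have "samp Y' k \<psi> = (\<integral>v. \<psi> (dist_matrix (pairs_upto (n + k)) Y' (\<lambda>i\<in>{..<k}. \<phi> (v i))) \<partial>Pi\<^sub>M {..<k} (\<lambda>_. p_sample Y))"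
      unfolding samp_def y'(1)
      by (rule integral_PiM_map[OF tr(1)[OF sub] F.sigma_finite_measure_axioms F'.sigma_finite_measure_axioms
            tr(2)[OF sub] finite_lessThan samp_measurable[OF Y' \<psi>]])
    also have "\<dots> = samp Y k \<psi>"
      unfolding samp_def y(1)
    proof (rule Bochner_Integration.integral_cong[OF refl])
      fix v assume "v \<in> space (Pi\<^sub>M {..<k} (\<lambda>_. p_sample Y))"
      then have v: "\<And>i. i < k \<Longrightarrow> v i \<in> psupp Y"
        using sub by (auto simp: space_PiM PiE_iff space_on_supp[OF f(1)])
      have "dist_matrix (pairs_upto (n + k)) Y' (\<lambda>i\<in>{..<k}. \<phi> (v i)) = dist_matrix (pairs_upto (n + k)) Y v"
        using pt[OF v] \<phi>(2) by (auto simp: dist_matrix_def pairs_upto_def fun_eq_iff)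
      then show "\<psi> (dist_matrix (pairs_upto (n + k)) Y' (\<lambda>i\<in>{..<k}. \<phi> (v i))) = \<psi> (dist_matrix (pairs_upto (n + k)) Y v)"
        by simp
    qed
    finally show ?thesis .
  qed
  have "points_then Y' (\<lambda>_. p_root Y') l = \<phi> (points_then Y (\<lambda>_. p_root Y) l) \<and> points_then Y (\<lambda>_. p_root Y) l \<in> psupp Y"
    if "l \<le> n" for l
    using that y(1) y'(1) \<phi>(3) nth_map[of "l - 1" "p_points Y" \<phi>] unfolding \<phi>(4)
    by (auto simp: points_then_def psupp_def)
  then show "point_matrix Y' = point_matrix Y"
    using \<phi>(2) unfolding point_matrix_def y(1) y'(1)
    by (auto simp: dist_matrix_def pairs_upto_def fun_eq_iff)
qed

lemma pmm_iso_refl: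
  assumes Y: "Y \<in> pmm_spaces n" shows "pmm_iso Y Y"
proof -
  note y = pmm_spacesD[OF Y]
  note f = carriedD[OF y(4)]
  have "emeasure (p_measure Y) {x \<in> psupp Y. x \<in> B} = emeasure (p_measure Y) B" if B: "B \<in> sets (p_measure Y)" for B
  proof (rule emeasure_eq_AE)
    have "psupp Y \<in> sets (p_measure Y)" by (rule psupp_sets[OF Y])
    then show "{x \<in> psupp Y. x \<in> B} \<in> sets (p_measure Y)" using B by (simp add: Collect_conj_eq sets.Int)
    have "mspace (p_metric Y) - msupp (p_metric Y) (p_measure Y) \<in> null_sets (p_measure Y)"
      using f sets.compl_sets[OF f(5)] by (auto simp: null_sets_def)
    then show "AE x in p_measure Y. (x \<in> {x \<in> psupp Y. x \<in> B}) = (x \<in> B)"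
      by (rule AE_I') (use f(4) in \<open>auto simp: psupp_def\<close>)
  qed (rule B)
  then show ?thesis unfolding pmm_iso_def by (intro exI[of _ "\<lambda>x. x"]) (auto simp: bij_betw_def)
qed

lemma pmm_class_rep:
  assumes Y: "Y \<in> pmm_spaces n"
  shows "class_rep (pmm_class n Y) \<in> pmm_spaces n" "pmm_iso Y (class_rep (pmm_class n Y))" "pmm_class n Y \<in> MM n"
proof -
  have "Y \<in> pmm_class n Y" using Y pmm_iso_refl[OF Y] by (simp add: pmm_class_def)
  then have "class_rep (pmm_class n Y) \<in> pmm_class n Y" unfolding class_rep_def by (rule someI)
  then show "class_rep (pmm_class n Y) \<in> pmm_spaces n" "pmm_iso Y (class_rep (pmm_class n Y))"
    by (auto simp: pmm_class_def)
  have "{(X, Z). X \<in> pmm_spaces n \<and> Z \<in> pmm_spaces n \<and> pmm_iso X Z} `` {Y} \<in> MM n"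
    unfolding MM_def by (rule quotientI[OF Y])
  moreover have "{(X, Z). X \<in> pmm_spaces n \<and> Z \<in> pmm_spaces n \<and> pmm_iso X Z} `` {Y} = pmm_class n Y"
    using Y by (auto simp: pmm_class_def)
  ultimately show "pmm_class n Y \<in> MM n" by simp
qed

lemma MM_rep:
  assumes "c \<in> MM n" shows "class_rep c \<in> pmm_spaces n"
proof -
  obtain Y where Y: "Y \<in> pmm_spaces n" "c = {(X, Z). X \<in> pmm_spaces n \<and> Z \<in> pmm_spaces n \<and> pmm_iso X Z} `` {Y}"
    using assms unfolding MM_def by (auto elim: quotientE)
  then have "c = pmm_class n Y" by (auto simp: pmm_class_def)
  then show ?thesis using pmm_class_rep(1)[OF Y(1)] by simp
qed

section \<open>Continuity and measurability for the pointed Gromov-weak topology\<close>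

lemma generated_by_tendsto:
  assumes gen: "generated_by X F" and f: "continuous_map X euclideanreal f"
    and x: "x \<in> topspace X" "\<And>N. y N \<in> topspace X" and lim: "\<And>i. (\<lambda>N. F i (y N)) \<longlonglongrightarrow> F i x"
  shows "(\<lambda>N. f (y N)) \<longlonglongrightarrow> f x"
proof (rule topological_tendstoI)
  fix S assume S: "open S" "f x \<in> S"
  have op: "openin X {z \<in> topspace X. f z \<in> S}"
    using openin_continuous_map_preimage[OF f, of S] S(1) by simp
  have xin: "x \<in> {z \<in> topspace X. f z \<in> S}" using x S by simp
  obtain J e where J: "finite J" "0 < e"
    "\<And>z. z \<in> topspace X \<Longrightarrow> (\<And>j. j \<in> J \<Longrightarrow> \<bar>F j z - F j x\<bar> < e) \<Longrightarrow> z \<in> {z \<in> topspace X. f z \<in> S}"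
    by (rule generated_byD[OF gen op xin]) blast
  have "\<forall>\<^sub>F N in sequentially. \<forall>j\<in>J. \<bar>F j (y N) - F j x\<bar> < e"
    using J(1) tendstoD[OF lim J(2)] by (intro eventually_ball_finite) (auto simp: dist_real_def)
  then show "\<forall>\<^sub>F N in sequentially. f (y N) \<in> S"
    by eventually_elim (use J(3) x(2) in blast)
qed

abbreviation coord :: "(nat \<times> nat) set \<Rightarrow> (nat \<times> nat) \<times> unit \<Rightarrow> (nat \<times> nat \<Rightarrow> real) \<Rightarrow> real" where
  "coord I \<equiv> (\<lambda>(l, _) c. if l \<in> I then c l else 0)"

text \<open>Countably many functions that decide pGw-convergence: the distances of the marked
  points, and tents integrated against \<open>upsilon\<close>. The countable index type is what
  \<open>measurable_into_generated\<close> asks for.\<close>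

definition pGw_gen :: "nat \<Rightarrow> (nat \<times> nat) + ((((nat \<times> nat) \<times> unit) \<times> rat) list \<times> nat \<times> rat) list \<Rightarrow> 'a pmm set \<Rightarrow> real" where
  "pGw_gen n i c = (case i of
     Inl p \<Rightarrow> if p \<in> pairs_upto n then point_matrix (class_rep c) p else 0
   | Inr cs \<Rightarrow> \<integral>R. tents (coord all_pairs) cs R \<partial>upsilon (class_rep c))"

lemma pGw_converges_iff:
  assumes "range c \<subseteq> MM n" "d \<in> MM n"
  shows "pGw_converges n c d \<longleftrightarrow> (\<forall>i. (\<lambda>N. pGw_gen n i (c N)) \<longlonglongrightarrow> pGw_gen n i d)"
proof -
  have "c N \<in> MM n" for N using assms(1) by blast
  note rep = MM_rep[OF this] MM_rep[OF assms(2)]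
  have 1: "weakly_converges (matrix_top all_pairs) (\<lambda>N. upsilon (class_rep (c N))) (upsilon (class_rep d)) \<longleftrightarrow>
    (\<forall>cs. (\<lambda>N. pGw_gen n (Inr cs) (c N)) \<longlonglongrightarrow> pGw_gen n (Inr cs) d)"
    using weakly_converges_tents[OF generated_by_matrix_top upsilon_finite[OF rep(1)] upsilon_finite[OF rep(2)]
        upsilon_sets upsilon_sets]
    by (simp add: pGw_gen_def)
  have 2: "(\<forall>p\<in>pairs_upto n. (\<lambda>N. point_matrix (class_rep (c N)) p) \<longlonglongrightarrow> point_matrix (class_rep d) p) \<longleftrightarrow>
    (\<forall>p. (\<lambda>N. pGw_gen n (Inl p) (c N)) \<longlonglongrightarrow> pGw_gen n (Inl p) d)"
    by (auto simp: pGw_gen_def)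
  have "(\<forall>i. (\<lambda>N. pGw_gen n i (c N)) \<longlonglongrightarrow> pGw_gen n i d) \<longleftrightarrow>
     (\<forall>p. (\<lambda>N. pGw_gen n (Inl p) (c N)) \<longlonglongrightarrow> pGw_gen n (Inl p) d) \<and>
     (\<forall>cs. (\<lambda>N. pGw_gen n (Inr cs) (c N)) \<longlonglongrightarrow> pGw_gen n (Inr cs) d)"
    by (metis sum.exhaust)
  then show ?thesis unfolding pGw_converges_def 1 2 by blast
qed

lemma generated_by_pGw: "generated_by (pGw n) (pGw_gen n)"
  unfolding pGw_def by (rule generated_by_topology_of_convergence) (rule pGw_converges_iff)

lemma generated_by_HH_seq_top:
  "generated_by HH_seq_top (\<lambda>(l, i) c. if l \<in> {1..} then pGw_gen l i (c l) else 0)"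
  unfolding HH_seq_top_def
  by (rule generated_by_product) (rule generated_by_subtopology[OF generated_by_pGw])

lemma topspace_pGw: "topspace (pGw n) = MM n"
  by (simp add: pGw_def)

lemma HH_MM: "HH n \<subseteq> MM n"
  by (auto simp: HH_def)

lemma topspace_HH_seq_top: "topspace HH_seq_top = Pi\<^sub>E {1..} HH"
  using HH_MM by (auto simp: HH_seq_top_def topspace_pGw PiE_iff subset_iff)

lemma samp_mass_zero:
  assumes Y: "Y \<in> pmm_spaces n" and "p_mass Y = 0" "1 \<le> k"
  shows "samp Y k \<psi> = 0"
proof -
  note y = pmm_spacesD[OF Y]
  note os = on_supp_finite[OF y(4)]
  let ?P = "Pi\<^sub>M {..<k} (\<lambda>_. p_sample Y)"
  have fin: "finite_measure ?P" "measure ?P (space ?P) = 0"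
    using finite_measure_PiM[OF os(1), of "{..<k}"] os(3) assms(2,3) by auto
  interpret P: finite_measure ?P by (rule fin(1))
  have "emeasure ?P (space ?P) = 0" using fin(2) by (simp add: P.emeasure_eq_measure)
  then have "AE v in ?P. \<psi> (dist_matrix (pairs_upto (n + k)) Y v) = 0"
    by (intro AE_I[of _ _ "space ?P"]) auto
  then show ?thesis unfolding samp_def y(1) by (rule integral_eq_zero_AE)
qed

text \<open>One sampled point already accounts for the factor of mass in \<open>upsilon\<close>, so
  with k + 1 samples no division is left; at mass 0 both sides vanish.\<close>

lemma samp_upsilon:
  assumes Y: "Y \<in> pmm_spaces n" and \<psi>: "matrix_measurable (n + Suc k) \<psi>"
  shows "samp Y (Suc k) \<psi> = p_mass Y ^ k * (\<integral>R. \<psi> (restrict R (pairs_upto (n + Suc k))) \<partial>upsilon Y)"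
proof (cases "p_mass Y = 0")
  case True
  then show ?thesis using samp_mass_zero[OF Y] by (simp add: upsilon_def)
next
  case False
  then show ?thesis using upsilon_samp[OF Y \<psi>] by (simp add: mult.assoc)
qed

lemma upsilon_total:
  assumes Y: "Y \<in> pmm_spaces n" shows "p_mass Y = (\<integral>R. 1 \<partial>upsilon Y)"
proof (cases "p_mass Y = 0")
  case False
  then show ?thesis using upsilon_samp[OF Y, where k=0 and \<psi>="\<lambda>_. 1"]
    by (simp add: samp_def PiM_empty lebesgue_integral_count_space_finite)
qed (simp add: upsilon_def)

lemma dist_matrix_point_matrix:
  assumes "Y \<in> pmm_spaces n" shows "dist_matrix (pairs_upto n) Y v = point_matrix Y"
  using pmm_spacesD(1)[OF assms]
  by (auto simp: point_matrix_def dist_matrix_def fun_eq_iff pairs_upto_def points_then_def)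

lemma samp_0:
  assumes Y: "Y \<in> pmm_spaces n" shows "samp Y 0 \<psi> = \<psi> (point_matrix Y)"
  using pmm_spacesD(1)[OF Y] dist_matrix_point_matrix[OF Y]
  by (simp add: samp_def PiM_empty lebesgue_integral_count_space_finite)

lemma pGw_mass_tendsto:
  assumes "range c \<subseteq> MM n" "d \<in> MM n" "pGw_converges n c d"
  shows "(\<lambda>N. p_mass (class_rep (c N))) \<longlonglongrightarrow> p_mass (class_rep d)"
proof -
  have "c N \<in> MM n" for N using assms(1) by blast
  note rep = MM_rep[OF this] MM_rep[OF assms(2)]
  have "(\<lambda>_. 1) \<in> Cb (matrix_top all_pairs)" by (auto simp: Cb_def bounded_iff)
  then have "(\<lambda>N. \<integral>R. (1::real) \<partial>upsilon (class_rep (c N))) \<longlonglongrightarrow> (\<integral>R. 1 \<partial>upsilon (class_rep d))"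
    using assms(3) unfolding pGw_converges_def weakly_converges_def by blast
  then show ?thesis using upsilon_total[OF rep(1)] upsilon_total[OF rep(2)] by simp
qed

text \<open>With at least one sampled point the integral is a power of the mass times an
  \<open>upsilon\<close>-integral. Without any it is \<psi> at the marked distances, which
  \<open>upsilon\<close> forgets at mass 0; this is where their separate convergence enters.\<close>

lemma pGw_samp_tendsto:
  assumes c: "range c \<subseteq> MM n" "d \<in> MM n" "pGw_converges n c d" and \<psi>: "\<psi> \<in> Cb (matrix_top (pairs_upto (n + k)))"
  shows "(\<lambda>N. samp (class_rep (c N)) k \<psi>) \<longlonglongrightarrow> samp (class_rep d) k \<psi>"
proof -
  have "c N \<in> MM n" for N using c(1) by blast
  note rep = MM_rep[OF this] MM_rep[OF c(2)]
  have meas: "matrix_measurable (n + k) \<psi>" using Cb_matrix_measurable[OF \<psi>] .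
  have cont: "continuous_map (matrix_top (pairs_upto (n + k))) euclideanreal \<psi>" using \<psi> by (simp add: Cb_def)
  show ?thesis
  proof (cases k)
    case 0
    have "(\<lambda>N. \<psi> (point_matrix (class_rep (c N)))) \<longlonglongrightarrow> \<psi> (point_matrix (class_rep d))"
    proof (rule generated_by_tendsto[OF generated_by_matrix_top[of "pairs_upto n"], where f=\<psi>])
      show "continuous_map (matrix_top (pairs_upto n)) euclideanreal \<psi>" using cont 0 by simp
      show "point_matrix (class_rep d) \<in> topspace (matrix_top (pairs_upto n))"
        using dist_matrix_topspace[of "pairs_upto n" "class_rep d" undefined] dist_matrix_point_matrix[OF rep(2)] by simp
      show "point_matrix (class_rep (c N)) \<in> topspace (matrix_top (pairs_upto n))" for N
        using dist_matrix_topspace[of "pairs_upto n" "class_rep (c N)" undefined] dist_matrix_point_matrix[OF rep(1)] by simp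
      fix i :: "(nat \<times> nat) \<times> unit"
      show "(\<lambda>N. coord (pairs_upto n) i (point_matrix (class_rep (c N)))) \<longlonglongrightarrow> coord (pairs_upto n) i (point_matrix (class_rep d))"
        using c(3) unfolding pGw_converges_def by (cases i) auto
    qed
    then show ?thesis using 0 samp_0[OF rep(1)] samp_0[OF rep(2)] by simp
  next
    case (Suc j)
    have "(\<lambda>R. \<psi> (restrict R (pairs_upto (n + k)))) \<in> Cb (matrix_top all_pairs)"
    proof -
      have r: "continuous_map (matrix_top all_pairs) (matrix_top (pairs_upto (n + k))) (\<lambda>R. restrict R (pairs_upto (n + k)))"
        by (rule restrict_matrix_continuous[OF pairs_upto_sub])
      have "continuous_map (matrix_top all_pairs) euclideanreal (\<psi> \<circ> (\<lambda>R. restrict R (pairs_upto (n + k))))"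
        by (rule continuous_map_compose[OF r cont])
      moreover have "bounded ((\<lambda>R. \<psi> (restrict R (pairs_upto (n + k)))) ` topspace (matrix_top all_pairs))"
        using \<psi> continuous_map_image_subset_topspace[OF r] unfolding Cb_def
        by (auto intro: bounded_subset[of "\<psi> ` topspace (matrix_top (pairs_upto (n + k)))"])
      ultimately show ?thesis by (simp add: Cb_def comp_def)
    qed
    then have "(\<lambda>N. \<integral>R. \<psi> (restrict R (pairs_upto (n + k))) \<partial>upsilon (class_rep (c N))) \<longlonglongrightarrow>
        (\<integral>R. \<psi> (restrict R (pairs_upto (n + k))) \<partial>upsilon (class_rep d))"
      using c(3) unfolding pGw_converges_def weakly_converges_def by blast
    from tendsto_mult[OF tendsto_power[OF pGw_mass_tendsto[OF c], of j] this]
    show ?thesis using samp_upsilon[OF rep(1)] samp_upsilon[OF rep(2)] meas Suc by simp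
  qed
qed

section \<open>Continuous functions on classes of pointed spaces\<close>

definition pGw_cont :: "nat \<Rightarrow> ('a pmm \<Rightarrow> real) \<Rightarrow> bool" where
  "pGw_cont n H \<longleftrightarrow> continuous_map (pGw n) euclideanreal (\<lambda>c. H (class_rep c))"

lemma pGw_contI:
  assumes "\<And>c d. range c \<subseteq> MM n \<Longrightarrow> d \<in> MM n \<Longrightarrow> pGw_converges n c d \<Longrightarrow>
    (\<lambda>N. H (class_rep (c N))) \<longlonglongrightarrow> H (class_rep d)"
  shows "pGw_cont n H"
  unfolding pGw_cont_def pGw_def by (rule continuous_map_topology_of_convergence) (rule assms)

lemma pGw_cont_samp: "\<psi> \<in> Cb (matrix_top (pairs_upto (n + k))) \<Longrightarrow> pGw_cont n (\<lambda>Y. samp Y k \<psi>)"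
  by (rule pGw_contI) (rule pGw_samp_tendsto)

lemma pGw_cont_mass: "pGw_cont n p_mass"
  by (rule pGw_contI) (rule pGw_mass_tendsto)

lemma pGw_cont_compose_nonneg:
  assumes H: "pGw_cont n H" "\<And>Y. 0 \<le> H Y" and \<gamma>: "\<gamma> \<in> Cb (top_of_set {0..})"
  shows "pGw_cont n (\<lambda>Y. \<gamma> (H Y))"
proof -
  have "continuous_map (pGw n) (top_of_set {0..}) (\<lambda>c. H (class_rep c))"
    using H by (simp add: pGw_cont_def continuous_map_in_subtopology image_subset_iff Pi_iff)
  moreover have "continuous_map (top_of_set {0..}) euclideanreal \<gamma>"
    using \<gamma> unfolding Cb_def by blast
  ultimately have "continuous_map (pGw n) euclideanreal (\<gamma> \<circ> (\<lambda>c. H (class_rep c)))"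
    by (rule continuous_map_compose)
  then show ?thesis by (simp add: pGw_cont_def comp_def)
qed

lemma pGw_cont_mult: "pGw_cont n H \<Longrightarrow> pGw_cont n G \<Longrightarrow> pGw_cont n (\<lambda>Y. H Y * G Y)"
  by (simp add: pGw_cont_def continuous_map_real_mult)

lemma HH_seq_cont:
  assumes H: "pGw_cont n H" and n: "1 \<le> n"
  shows "continuous_map HH_seq_top euclideanreal (\<lambda>s. H (class_rep (s n)))"
proof -
  have "continuous_map HH_seq_top (subtopology (pGw n) (HH n)) (\<lambda>s. s n)"
    unfolding HH_seq_top_def using n by (intro continuous_map_product_projection) auto
  moreover have "continuous_map (subtopology (pGw n) (HH n)) euclideanreal (\<lambda>c. H (class_rep c))"
    using H by (simp add: pGw_cont_def continuous_map_from_subtopology)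
  ultimately have "continuous_map HH_seq_top euclideanreal ((\<lambda>c. H (class_rep c)) \<circ> (\<lambda>s. s n))"
    by (rule continuous_map_compose)
  then show ?thesis by (simp add: comp_def)
qed

section \<open>Measurability of random sequences of classes\<close>

lemma tent_cong:
  assumes "\<And>p. p \<in> set (fst c) \<Longrightarrow> F (fst p) x = G (fst p) y" shows "tent F c x = tent G c y"
proof -
  have "map (\<lambda>p. \<bar>F (fst p) x - of_rat (snd p)\<bar>) (fst c) = map (\<lambda>p. \<bar>G (fst p) y - of_rat (snd p)\<bar>) (fst c)"
    by (rule map_cong) (use assms in auto)
  from arg_cong[where f=sum_list, OF this] show ?thesis unfolding tent_def by (cases c) simp
qed

lemma tents_cong:
  "(\<And>c p. c \<in> set cs \<Longrightarrow> p \<in> set (fst c) \<Longrightarrow> F (fst p) x = G (fst p) y) \<Longrightarrow> tents F cs x = tents G cs y"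
proof (induction cs)
  case (Cons c cs)
  have "tent F c x = tent G c y" by (rule tent_cong) (rule Cons.prems, simp_all)
  moreover have "tents F cs x = tents G cs y" by (rule Cons.IH) (rule Cons.prems, simp_all)
  ultimately show ?case by simp
qed simp

lemma tents_finite_coords:
  "\<exists>k\<ge>1. \<forall>R. tents (coord all_pairs) cs R = tents (coord (pairs_upto (n + k))) cs (restrict R (pairs_upto (n + k)))"
proof -
  \<comment> \<open>Bounding the larger index j of each pair (i, j) is enough: a pair that is not of
    the form i < j reads as 0 on both sides.\<close>
  let ?L = "\<Union>c\<in>set cs. (\<lambda>p. snd (fst (fst p))) ` set (fst c)"
  have fin: "finite ?L" by simp
  define k where "k = Suc (Max (insert 0 ?L))"
  have "tents (coord all_pairs) cs R = tents (coord (pairs_upto (n + k))) cs (restrict R (pairs_upto (n + k)))" for R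
  proof (rule tents_cong)
    fix c p assume h: "c \<in> set cs" "p \<in> set (fst c)"
    obtain i j q where p: "p = (((i, j), ()), q)" by (metis old.unit.exhaust prod.exhaust)
    have "j \<in> ?L" using h p by force
    then have "j \<le> k" unfolding k_def by (intro le_SucI Max_ge) (use fin in simp_all)
    then show "coord all_pairs (fst p) R = coord (pairs_upto (n + k)) (fst p) (restrict R (pairs_upto (n + k)))"
      by (auto simp: p all_pairs_def pairs_upto_def)
  qed
  then show ?thesis by (intro exI[of _ k]) (auto simp: k_def)
qed

lemma HH_class:
  assumes Y: "Y \<in> pmm_spaces n" and h: "zero_hyperbolic_on (p_metric Y) (psupp Y)"
  shows "pmm_class n Y \<in> HH n"
  unfolding HH_def
proof (intro CollectI conjI ballI)
  show "pmm_class n Y \<in> MM n" by (rule pmm_class_rep(3)[OF Y])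
  fix X assume "X \<in> pmm_class n Y"
  then obtain \<phi> where \<phi>: "bij_betw \<phi> (psupp Y) (psupp X)"
    "\<And>x z. x \<in> psupp Y \<Longrightarrow> z \<in> psupp Y \<Longrightarrow> mdist (p_metric X) (\<phi> x) (\<phi> z) = mdist (p_metric Y) x z"
    unfolding pmm_class_def pmm_iso_def by blast
  have "psupp X = \<phi> ` psupp Y" using \<phi>(1) by (simp add: bij_betw_def)
  then show "zero_hyperbolic_on (p_metric X) (psupp X)"
    using h \<phi>(2) by (auto simp: zero_hyperbolic_on_def)
qed

text \<open>By \<open>generated_by_HH_seq_top\<close> measurability is tested on countably many
  functions. Tents against \<open>upsilon\<close> reduce to \<open>samp\<close> because a tent
  involves only finitely many matrix entries.\<close>

lemma HH_seq_measurable: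
  assumes Y: "\<And>n \<omega>. 1 \<le> n \<Longrightarrow> \<omega> \<in> space Q \<Longrightarrow> Y n \<omega> \<in> pmm_spaces n"
    and h: "\<And>n \<omega>. 1 \<le> n \<Longrightarrow> \<omega> \<in> space Q \<Longrightarrow> zero_hyperbolic_on (p_metric (Y n \<omega>)) (psupp (Y n \<omega>))"
    and pm: "\<And>n p. 1 \<le> n \<Longrightarrow> p \<in> pairs_upto n \<Longrightarrow> (\<lambda>\<omega>. point_matrix (Y n \<omega>) p) \<in> borel_measurable Q"
    and ms: "\<And>n. 1 \<le> n \<Longrightarrow> (\<lambda>\<omega>. p_mass (Y n \<omega>)) \<in> borel_measurable Q"
    and sm: "\<And>n k \<psi>. 1 \<le> n \<Longrightarrow> \<psi> \<in> Cb (matrix_top (pairs_upto (n + k))) \<Longrightarrow> (\<lambda>\<omega>. samp (Y n \<omega>) k \<psi>) \<in> borel_measurable Q"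
  shows "(\<lambda>\<omega>. \<lambda>n\<in>{1..}. pmm_class n (Y n \<omega>)) \<in> measurable Q (borel_of HH_seq_top)"
proof (rule measurable_into_generated[OF generated_by_HH_seq_top])
  fix \<omega> assume "\<omega> \<in> space Q"
  then show "(\<lambda>n\<in>{1..}. pmm_class n (Y n \<omega>)) \<in> topspace HH_seq_top"
    using HH_class[OF Y h] by (auto simp: topspace_HH_seq_top)
next
  fix i :: "nat \<times> ((nat \<times> nat) + ((((nat \<times> nat) \<times> unit) \<times> rat) list \<times> nat \<times> rat) list)"
  obtain n j where i: "i = (n, j)" by (cases i)
  show "(\<lambda>\<omega>. (case i of (l, i) \<Rightarrow> \<lambda>c. if l \<in> {1..} then pGw_gen l i (c l) else 0)
      (\<lambda>n\<in>{1..}. pmm_class n (Y n \<omega>))) \<in> borel_measurable Q"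
  proof (cases "1 \<le> n")
    case True
    have inv: "p_mass (class_rep (pmm_class n (Y n \<omega>))) = p_mass (Y n \<omega>)"
      "\<And>k \<psi>. matrix_measurable (n + k) \<psi> \<Longrightarrow> samp (class_rep (pmm_class n (Y n \<omega>))) k \<psi> = samp (Y n \<omega>) k \<psi>"
      "point_matrix (class_rep (pmm_class n (Y n \<omega>))) = point_matrix (Y n \<omega>)"
      "class_rep (pmm_class n (Y n \<omega>)) \<in> pmm_spaces n" if "\<omega> \<in> space Q" for \<omega>
      using pmm_iso_invariant[OF pmm_class_rep(2)[OF Y[OF True that]] Y[OF True that] pmm_class_rep(1)[OF Y[OF True that]]]
        pmm_class_rep(1)[OF Y[OF True that]]
      by blast+
    have "(\<lambda>\<omega>. pGw_gen n j (pmm_class n (Y n \<omega>))) \<in> borel_measurable Q"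
    proof (cases j)
      case (Inl p)
      then have "(\<lambda>\<omega>. pGw_gen n j (pmm_class n (Y n \<omega>))) \<in> borel_measurable Q \<longleftrightarrow>
        (\<lambda>\<omega>. if p \<in> pairs_upto n then point_matrix (Y n \<omega>) p else 0) \<in> borel_measurable Q"
        by (intro measurable_cong) (simp add: pGw_gen_def inv)
      moreover have "(\<lambda>\<omega>. if p \<in> pairs_upto n then point_matrix (Y n \<omega>) p else 0) \<in> borel_measurable Q"
        using pm[OF True, of p] by (cases "p \<in> pairs_upto n") simp_all
      ultimately show ?thesis by simp
    next
      case (Inr cs)
      obtain k where k: "1 \<le> k" "\<And>R. tents (coord all_pairs) cs R = tents (coord (pairs_upto (n + k))) cs (restrict R (pairs_upto (n + k)))"
        using tents_finite_coords by blast
      let ?\<psi> = "tents (coord (pairs_upto (n + k))) cs"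
      have \<psi>: "?\<psi> \<in> Cb (matrix_top (pairs_upto (n + k)))" by (rule tents_Cb[OF generated_by_matrix_top])
      have "(\<lambda>\<omega>. pGw_gen n j (pmm_class n (Y n \<omega>))) \<in> borel_measurable Q \<longleftrightarrow>
        (\<lambda>\<omega>. if p_mass (Y n \<omega>) = 0 then 0 else p_mass (Y n \<omega>) * samp (Y n \<omega>) k ?\<psi> / p_mass (Y n \<omega>) ^ k) \<in> borel_measurable Q"
      proof (rule measurable_cong)
        fix \<omega> assume \<omega>: "\<omega> \<in> space Q"
        let ?Z = "class_rep (pmm_class n (Y n \<omega>))"
        have *: "pGw_gen n j (pmm_class n (Y n \<omega>)) = (\<integral>R. ?\<psi> (restrict R (pairs_upto (n + k))) \<partial>upsilon ?Z)"
          unfolding pGw_gen_def Inr sum.case by (rule arg_cong[where f="integral\<^sup>L _"]) (rule ext, rule k(2))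
        show "pGw_gen n j (pmm_class n (Y n \<omega>)) =
          (if p_mass (Y n \<omega>) = 0 then 0 else p_mass (Y n \<omega>) * samp (Y n \<omega>) k ?\<psi> / p_mass (Y n \<omega>) ^ k)"
        proof (cases "p_mass (Y n \<omega>) = 0")
          case True
          then show ?thesis unfolding * using inv(1)[OF \<omega>] by (simp add: upsilon_def)
        next
          case False
          then show ?thesis unfolding *
            using upsilon_samp[OF inv(4)[OF \<omega>] Cb_matrix_measurable[OF \<psi>]] inv(1)[OF \<omega>] inv(2)[OF \<omega> Cb_matrix_measurable[OF \<psi>]]
            by (simp add: field_simps)
        qed
      qed
      moreover note [measurable] = ms[OF True] sm[OF True \<psi>]
      ultimately show ?thesis by simp
    qed
    then show ?thesis using True by (simp add: i)
  qed (simp add: i)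
qed

section \<open>Bi-measure trees\<close>

lemma sets_borel_of_subtopology:
  assumes "A \<in> sets (borel_of T)"
  shows "sets (borel_of (subtopology T A)) = sets (restrict_space (borel_of T) A)"
proof -
  have A: "A \<subseteq> topspace T" using sets.sets_into_space[OF assms] by simp
  have "sets (restrict_space (borel_of T) A) = (\<inter>) A ` sigma_sets (topspace T) {U. openin T U}"
    by (simp add: sets_restrict_space sets_borel_of)
  also have "\<dots> = sigma_sets A ((\<inter>) A ` {U. openin T U})"
    using assms A by (intro sigma_sets_Int) (auto simp: sets_borel_of)
  also have "(\<inter>) A ` {U. openin T U} = {U. openin (subtopology T A) U}"
    by (auto simp: openin_subtopology)
  finally show ?thesis using A by (simp add: sets_borel_of Int_absorb1)
qed

text \<open>Bi-measure trees without completeness of the support and without the condition on leaves: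
  pruned trees are only of this kind.\<close>

definition pre_bmt :: "'a bmt \<Rightarrow> bool" where
  "pre_bmt X \<longleftrightarrow> real_tree (b_metric X) \<and> b_root X \<in> mspace (b_metric X) \<and>
     carried (b_metric X) (b_mu X) \<and>
     sets (b_nu X) = sets (borel_of (mtopology_of (b_metric X))) \<and> sigma_finite_measure (b_nu X) \<and>
     (AE u in b_mu X. emeasure (b_nu X) (seg (b_metric X) (b_root X) u) < \<infinity>)"

lemma bm_trees_iff:
  "X \<in> bm_trees \<longleftrightarrow> pre_bmt X \<and> mcomplete_of (submetric (b_metric X) (b_supp X)) \<and>
     emeasure (b_nu X) (leaves X) = 0"
  by (auto simp: bm_trees_def pre_bmt_def fin_meas_css_iff b_supp_def)

abbreviation (input) b_sample :: "'a bmt \<Rightarrow> 'a measure" where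
  "b_sample X \<equiv> on_supp (b_metric X) (b_mu X)"

abbreviation (input) b_samples :: "nat \<Rightarrow> 'a bmt \<Rightarrow> (nat \<Rightarrow> 'a) measure" where
  "b_samples n X \<equiv> Pi\<^sub>M {..<n} (\<lambda>_. b_sample X)"

locale pbt =
  fixes X :: "'a bmt"
  assumes pre: "pre_bmt X"
begin

sublocale rtree "b_metric X" "b_root X"
  using pre by unfold_locales (auto simp: pre_bmt_def)

abbreviation "\<mu> \<equiv> b_mu X"
abbreviation "\<nu> \<equiv> b_nu X"
abbreviation "S \<equiv> b_supp X"
abbreviation "W \<equiv> b_span X S"
abbreviation "r \<equiv> b_root X"
abbreviation "br \<equiv> seg (b_metric X) r"

lemma car: "carried (b_metric X) \<mu>" using pre by (simp add: pre_bmt_def)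
lemma sets_mu: "sets \<mu> = sets (borel_of T)" using carriedD(1)[OF car] .
lemma sets_nu: "sets \<nu> = sets (borel_of T)" using pre by (simp add: pre_bmt_def)
lemma space_mu: "space \<mu> = M" using sets_eq_imp_space_eq[OF sets_mu] by simp
lemma space_nu: "space \<nu> = M" using sets_eq_imp_space_eq[OF sets_nu] by simp
lemma fin_mu: "finite_measure \<mu>" using carriedD(2)[OF car] .
lemma sf_nu: "sigma_finite_measure \<nu>" using pre by (simp add: pre_bmt_def)
lemma AE_fin: "AE u in \<mu>. emeasure \<nu> (br u) < \<infinity>" using pre by (simp add: pre_bmt_def)
lemma S_M: "S \<subseteq> M" using msupp_sub by (simp add: b_supp_def)
lemma S_sep: "separable_in (b_metric X) S" using carriedD(3)[OF car] by (simp add: b_supp_def)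
lemma S_sets: "S \<in> sets \<mu>" using carriedD(5)[OF car] by (simp add: b_supp_def)
lemma AE_S: "AE u in \<mu>. u \<in> S"
proof (rule AE_I')
  show "M - S \<in> null_sets \<mu>"
    using carriedD(6)[OF car] sets.compl_sets[OF S_sets] space_mu by (auto simp: null_sets_def b_supp_def)
qed (use space_mu in auto)

lemma span_eq: "b_span X A = span_tree (b_metric X) r A" by (simp add: b_span_def)
lemma W_M: "W \<subseteq> M" using span_sub[OF S_M] by (simp add: span_eq)
lemma S_W: "S \<subseteq> W" using span_end[OF S_M] by (simp add: span_eq)
lemma r_W: "r \<in> W" using span_root by (simp add: span_eq)
lemma span_W: "A \<subseteq> S \<Longrightarrow> b_span X A \<subseteq> W"
  by (auto simp: b_span_def span_tree_def)

lemma closed_sets: "closedin T C \<Longrightarrow> C \<in> sets \<nu>" "closedin T C \<Longrightarrow> C \<in> sets \<mu>"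
  using borel_of_closed by (auto simp: sets_nu sets_mu)

lemma seg_sets: "v \<in> M \<Longrightarrow> br v \<in> sets \<nu>"
  using closed_sets closedin_seg by auto

lemma sing_sets: "v \<in> M \<Longrightarrow> {v} \<in> sets \<nu>" "v \<in> M \<Longrightarrow> {v} \<in> sets \<mu>"
  using closed_sets closedin_Hausdorff_singleton[OF hausdorff] by auto

lemma seg_dense:
  assumes C: "\<And>x e. x \<in> S \<Longrightarrow> 0 < e \<Longrightarrow> \<exists>c\<in>C. d x c < e" "C \<subseteq> M" and v: "v \<in> S" and w: "w \<in> br v" "w \<noteq> v"
  shows "\<exists>c\<in>C. w \<in> br c - {c}"
proof -
  have M: "v \<in> M" "w \<in> M" using v w S_M seg_sub by blast+
  have "d w v > 0" using M w mdist_nonneg[of "b_metric X" w v] mdist_zero[of w "b_metric X" v] by linarith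
  then obtain c where "c \<in> C" "d v c < d w v" using C(1) v by blast
  then show ?thesis using seg_stable[of v c w] M w C(2) by blast
qed

text \<open>A point strictly below a support point lies below some point of the dense set C by
  \<open>seg_stable\<close>; only the root and the support itself have to be added. With C countable
  this makes the span Borel and separable.\<close>

lemma W_decomp:
  assumes C: "\<And>x e. x \<in> S \<Longrightarrow> 0 < e \<Longrightarrow> \<exists>c\<in>C. d x c < e" "C \<subseteq> S"
  shows "W = insert r S \<union> (\<Union>c\<in>C. br c)"
proof (intro equalityI subsetI)
  fix w assume "w \<in> W"
  then consider "w = r" | v where "v \<in> S" "w \<in> br v" by (auto simp: b_span_def span_tree_def)
  then show "w \<in> insert r S \<union> (\<Union>c\<in>C. br c)"
    using seg_dense[OF C(1) subset_trans[OF C(2) S_M]] by cases blast+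
next
  fix w assume "w \<in> insert r S \<union> (\<Union>c\<in>C. br c)"
  then show "w \<in> W" using r_W S_W C(2) by (auto simp: b_span_def span_tree_def)
qed

lemma W_sets: "W \<in> sets \<nu>" "W \<in> sets \<mu>"
  and W_sep: "separable_in (b_metric X) W"
proof -
  obtain C where C: "countable C" "C \<subseteq> S" "\<And>x e. x \<in> S \<Longrightarrow> 0 < e \<Longrightarrow> \<exists>c\<in>C. d x c < e"
    using separable_inE[OF S_sep] by blast
  have CM: "\<And>c. c \<in> C \<Longrightarrow> c \<in> M" using C(2) S_M by blast
  have Weq: "W = insert r S \<union> (\<Union>c\<in>C. br c)"
    by (rule W_decomp) (rule C(3), assumption+, rule C(2))
  have "insert r S \<in> sets \<nu>"
    using S_sets sing_sets(1)[OF root] sets_mu sets_nu sets.Un[of "{r}" \<nu> S] by simp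
  moreover have "(\<Union>c\<in>C. br c) \<in> sets \<nu>"
    using C(1) CM seg_sets by (intro sets.countable_UN'') auto
  ultimately show "W \<in> sets \<nu>" unfolding Weq by (intro sets.Un)
  then show "W \<in> sets \<mu>" using sets_mu sets_nu by simp
  have "separable_in (b_metric X) ({r} \<union> S \<union> (\<Union>c\<in>C. br c))"
  proof (intro separable_in_Un S_sep)
    show "separable_in (b_metric X) {r}"
      using root by (intro separable_in_compactin) (simp add: finite_imp_compactin)
    show "separable_in (b_metric X) (\<Union>c\<in>C. br c)"
      using C(1) CM by (intro separable_in_UN separable_in_compactin compactin_seg) auto
  qed
  then show "separable_in (b_metric X) W" unfolding Weq by simp
qed

lemma skeleton_decomp:
  assumes C: "\<And>x e. x \<in> S \<Longrightarrow> 0 < e \<Longrightarrow> \<exists>c\<in>C. d x c < e" "C \<subseteq> S"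
  shows "skeleton X = (\<Union>c\<in>C. br c - {c}) \<union> {v \<in> M. emeasure \<mu> {v} > 0}"
  using seg_dense[OF C(1) subset_trans[OF C(2) S_M]] C(2) unfolding skeleton_def by blast

lemma countable_atoms: "countable {v \<in> M. emeasure \<mu> {v} > 0}"
proof -
  interpret finite_measure \<mu> by (rule fin_mu)
  have "{v \<in> M. emeasure \<mu> {v} > 0} \<subseteq> {x. measure \<mu> {x} \<noteq> 0}"
    by (auto simp: emeasure_eq_measure)
  then show ?thesis using countable_support countable_subset by blast
qed

lemma skeleton_sets: "skeleton X \<in> sets \<nu>"
proof -
  obtain C where C: "countable C" "C \<subseteq> S" "\<And>x e. x \<in> S \<Longrightarrow> 0 < e \<Longrightarrow> \<exists>c\<in>C. d x c < e"
    using separable_inE[OF S_sep] by blast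
  have CM: "\<And>c. c \<in> C \<Longrightarrow> c \<in> M" using C(2) S_M by blast
  have "(\<Union>c\<in>C. br c - {c}) \<in> sets \<nu>"
    using C(1) CM seg_sets sing_sets by (intro sets.countable_UN'') auto
  moreover have "{v \<in> M. emeasure \<mu> {v} > 0} \<in> sets \<nu>"
    by (rule sets.countable[OF _ countable_atoms]) (use sing_sets(1) in blast)
  moreover have "skeleton X = (\<Union>c\<in>C. br c - {c}) \<union> {v \<in> M. emeasure \<mu> {v} > 0}"
    by (rule skeleton_decomp) (rule C(3), assumption+, rule C(2))
  ultimately show ?thesis by (simp only: sets.Un)
qed

lemma atom_supp: "v \<in> M \<Longrightarrow> emeasure \<mu> {v} > 0 \<Longrightarrow> v \<in> S"
  unfolding b_supp_def msupp_def
proof (intro CollectI conjI allI impI)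
  fix e :: real assume v: "v \<in> M" "emeasure \<mu> {v} > 0" and "e > 0"
  then have "emeasure \<mu> {v} \<le> emeasure \<mu> (mball_of (b_metric X) v e)"
    by (intro emeasure_mono) (auto simp: sets_mu borel_of_open openin_mball_of)
  then show "emeasure \<mu> (mball_of (b_metric X) v e) > 0" using v(2) by order
qed

lemma skeleton_W: "skeleton X \<subseteq> W"
  using S_W atom_supp unfolding skeleton_def b_span_def span_tree_def by blast

text \<open>\<mu>-almost every root segment has finite \<nu>-mass, so the endpoints of such segments
  are dense in the support and include every atom of \<mu>. Countably many of them cover the
  skeleton, and on each the Poisson measure will almost surely be finite.\<close>

lemma skeleton_cover:
  obtains D where "countable D" "D \<subseteq> S" "\<And>v. v \<in> D \<Longrightarrow> emeasure \<nu> (br v) < \<infinity>"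
    "skeleton X \<subseteq> (\<Union>v\<in>D. br v)"
proof -
  let ?G = "{u \<in> S. emeasure \<nu> (br u) < \<infinity>}"
  have ae: "AE u in \<mu>. u \<in> ?G" using AE_fin AE_S by eventually_elim simp
  have sepG: "separable_in (b_metric X) ?G" by (rule separable_in_subset[OF S_sep _ S_M]) blast
  obtain C where C: "countable C" "C \<subseteq> ?G" "\<And>x e. x \<in> ?G \<Longrightarrow> 0 < e \<Longrightarrow> \<exists>c\<in>C. d x c < e"
    by (rule separable_inE[OF sepG]) blast
  have dense: "\<exists>c\<in>C. d x c < e" if x: "x \<in> S" and e: "0 < e" for x e
  proof -
    have pos: "emeasure \<mu> (mball_of (b_metric X) x (e/2)) > 0" using x e by (auto simp: b_supp_def msupp_def)
    have "\<exists>y\<in>?G. y \<in> mball_of (b_metric X) x (e/2)"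
    proof (rule ccontr)
      assume neg: "\<not> ?thesis"
      have B: "mball_of (b_metric X) x (e/2) \<in> sets \<mu>" by (simp add: sets_mu borel_of_open openin_mball_of)
      have "AE u in \<mu>. u \<notin> mball_of (b_metric X) x (e/2)" using ae by eventually_elim (use neg in blast)
      then have "mball_of (b_metric X) x (e/2) \<in> null_sets \<mu>" using AE_iff_null_sets[OF B] by blast
      then show False using pos by auto
    qed
    then obtain y where y: "y \<in> ?G" "y \<in> M" "d x y < e/2" by auto
    obtain c where c: "c \<in> C" "d y c < e/2" using C(3)[OF y(1), of "e/2"] e by auto
    have "d x c \<le> d x y + d y c" using x y c C(2) S_M by (intro mdist_triangle) auto
    then show ?thesis using c y by (intro bexI[of _ c]) auto
  qed
  \<comment> \<open>Atoms of \<mu> belong to the skeleton even if no support point lies beyond them,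
    so they join the cover as endpoints.\<close>
  let ?A = "{v \<in> M. emeasure \<mu> {v} > 0}"
  have A: "?A \<subseteq> ?G"
  proof
    fix v assume v: "v \<in> ?A"
    have "v \<in> ?G"
    proof (rule ccontr)
      assume neg: "v \<notin> ?G"
      have "AE u in \<mu>. u \<notin> {v}" using ae by eventually_elim (use neg in blast)
      then have "{v} \<in> null_sets \<mu>" using v AE_iff_null_sets[OF sing_sets(2)[of v]] by blast
      then have "emeasure \<mu> {v} = 0" by auto
      then show False using v by simp
    qed
    then show "v \<in> ?G" .
  qed
  show thesis
  proof (rule that[of "C \<union> ?A"])
    show "countable (C \<union> ?A)" using C(1) countable_atoms by simp
    show "C \<union> ?A \<subseteq> S" using C(2) A by blast
    show "\<And>v. v \<in> C \<union> ?A \<Longrightarrow> emeasure \<nu> (br v) < \<infinity>" using C(2) A by blast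
    show "skeleton X \<subseteq> (\<Union>v\<in>C \<union> ?A. br v)"
    proof
      fix x assume "x \<in> skeleton X"
      moreover have "skeleton X = (\<Union>c\<in>C. br c - {c}) \<union> ?A"
        by (rule skeleton_decomp[OF dense]) (use C(2) in auto)
      ultimately show "x \<in> (\<Union>v\<in>C \<union> ?A. br v)" using seg_end by blast
    qed
  qed
qed

lemma leaves_sets: "leaves X \<in> sets \<nu>"
  using W_sets skeleton_sets by (auto simp: leaves_def)

lemma countable_nu_atoms: "countable {v \<in> M. emeasure \<nu> {v} > 0}"
proof -
  interpret sigma_finite_measure \<nu> by (rule sf_nu)
  obtain A :: "nat \<Rightarrow> 'a set" where A: "range A \<subseteq> sets \<nu>" "(\<Union>i. A i) = space \<nu>" "\<And>i. emeasure \<nu> (A i) \<noteq> \<infinity>"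
    using sigma_finite by blast
  have "{v \<in> M. emeasure \<nu> {v} > 0} \<subseteq> (\<Union>i. {v. measure (restrict_space \<nu> (A i)) {v} \<noteq> 0})"
  proof
    fix v assume v: "v \<in> {v \<in> M. emeasure \<nu> {v} > 0}"
    then obtain i where i: "v \<in> A i" using A(2) space_nu by auto
    have "emeasure \<nu> {v} \<le> emeasure \<nu> (A i)" using i A(1) by (intro emeasure_mono) auto
    then have "measure \<nu> {v} \<noteq> 0" using v A(3)[of i] by (auto simp: measure_def enn2real_eq_0_iff top_unique)
    then have "measure (restrict_space \<nu> (A i)) {v} \<noteq> 0" using i A(1) by (subst measure_restrict_space) auto
    then show "v \<in> (\<Union>i. {v. measure (restrict_space \<nu> (A i)) {v} \<noteq> 0})" by blast
  qed
  moreover have "countable {v. measure (restrict_space \<nu> (A i)) {v} \<noteq> 0}" for i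
  proof -
    have "finite_measure (restrict_space \<nu> (A i))"
      using A(1,3) by (intro finite_measureI) (auto simp: space_restrict_space emeasure_restrict_space)
    then show ?thesis by (rule finite_measure.countable_support)
  qed
  then have "countable (\<Union>i. {v. measure (restrict_space \<nu> (A i)) {v} \<noteq> 0})" by (intro countable_UN) auto
  ultimately show ?thesis by (rule countable_subset)
qed

text \<open>\<nu> has countably many atoms, and those off the skeleton are not atoms of \<mu>, so a
  sampled point avoids them. An equivalence transports \<nu> only on the skeleton, while a spanned
  subtree contains its leaves; this closes the gap.\<close>

lemma AE_no_leaf_atom: "AE u in \<mu>. u \<in> skeleton X \<or> emeasure \<nu> {u} = 0"
proof (rule AE_I')
  let ?B = "{v \<in> M. emeasure \<nu> {v} > 0} - skeleton X"
  have "countable ?B" using countable_nu_atoms by blast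
  moreover have "{v} \<in> null_sets \<mu>" if "v \<in> ?B" for v
    using that sing_sets(2)[of v] by (auto simp: null_sets_def skeleton_def)
  ultimately have "(\<Union>v\<in>?B. {v}) \<in> null_sets \<mu>" by (intro null_sets_UN')
  then show "?B \<in> null_sets \<mu>" by simp
qed (auto simp: space_mu zero_less_iff_neq_zero)

subsection \<open>Spanned subtrees\<close>

lemma span_closed: "set us \<subseteq> S \<Longrightarrow> closedin T (b_span X (set us))"
  using closedin_span[of "set us"] S_M by (simp add: span_eq)

lemma span_compact: "set us \<subseteq> S \<Longrightarrow> compactin T (b_span X (set us))"
  using compactin_span[of "set us"] S_M by (simp add: span_eq)

lemma span_sets: "set us \<subseteq> S \<Longrightarrow> b_span X (set us) \<in> sets \<nu>"
  using closed_sets span_closed by blast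

lemma tau_simps:
  "p_metric (tau_rep X us) = submetric (b_metric X) (b_span X (set us))"
  "p_root (tau_rep X us) = r" "p_points (tau_rep X us) = us"
  "emeasure \<nu> (b_span X (set us)) < \<infinity> \<Longrightarrow> p_measure (tau_rep X us) = restrict_space \<nu> (b_span X (set us))"
  "\<not> emeasure \<nu> (b_span X (set us)) < \<infinity> \<Longrightarrow> p_measure (tau_rep X us) = null_measure (restrict_space \<nu> (b_span X (set us)))"
  by (simp_all add: tau_rep_def Let_def)

text \<open>A finitely spanned subtree is compact, which gives completeness and separability of the
  support at once.\<close>

lemma tau_carried:
  assumes us: "set us \<subseteq> S"
  shows "fin_meas_css (p_metric (tau_rep X us)) (p_measure (tau_rep X us))"
proof -
  let ?A = "b_span X (set us)" and ?m = "p_metric (tau_rep X us)" and ?\<kappa> = "p_measure (tau_rep X us)"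
  note A = span_sets[OF us] span_compact[OF us]
  have AM: "?A \<subseteq> M" using sets.sets_into_space[OF A(1)] space_nu by simp
  have m: "mspace ?m = ?A" "mtopology_of ?m = subtopology T ?A" using AM by (auto simp: tau_simps mtopology_of_submetric)
  have "sets ?\<kappa> = sets (restrict_space \<nu> ?A)"
    by (cases "emeasure \<nu> ?A < \<infinity>") (simp_all add: tau_simps)
  also have "\<dots> = sets (restrict_space (borel_of T) ?A)" using sets_nu by (simp add: sets_restrict_space)
  also have "\<dots> = sets (borel_of (mtopology_of ?m))" using sets_borel_of_subtopology[of ?A T] A(1) sets_nu m(2) by simp
  finally have sets: "sets ?\<kappa> = sets (borel_of (mtopology_of ?m))" .
  have "finite_measure ?\<kappa>"
  proof (cases "emeasure \<nu> ?A < \<infinity>")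
    case True
    then show ?thesis using A(1) AM space_nu
      by (intro finite_measureI) (auto simp: tau_simps space_restrict_space emeasure_restrict_space Int_absorb2)
  next
    case False
    then show ?thesis by (intro finite_measureI) (simp add: tau_simps)
  qed
  moreover have sepA: "separable_in ?m ?A"
    using separable_in_compactin[OF A(2)] by (simp add: separable_in_def tau_simps)
  have sub: "msupp ?m ?\<kappa> \<subseteq> ?A" using msupp_sub[of ?m ?\<kappa>] m(1) by simp
  moreover have "separable_in ?m (msupp ?m ?\<kappa>)" by (rule separable_in_subset[OF sepA sub]) (simp add: m(1))
  moreover have "emeasure ?\<kappa> (mspace ?m - msupp ?m ?\<kappa>) = 0"
  proof -
    have "?A \<in> sets ?\<kappa>" using sets_eq_imp_space_eq[OF sets] sets.top[of ?\<kappa>] m by (metis topspace_mtopology_of space_borel_of)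
    then show ?thesis using separable_carried[OF sets sepA] m(1) by simp
  qed
  moreover have "mcomplete_of (submetric ?m (msupp ?m ?\<kappa>))"
  proof -
    have "compactin (mtopology_of ?m) (msupp ?m ?\<kappa>)"
    proof (rule closed_compactin)
      show "compactin (mtopology_of ?m) ?A" using A(2) m(2) by (simp add: compactin_subtopology)
      show "closedin (mtopology_of ?m) (msupp ?m ?\<kappa>)" by (rule closedin_msupp[OF sets])
    qed (rule sub)
    then have "compact_space (mtopology_of (submetric ?m (msupp ?m ?\<kappa>)))"
      by (simp add: compactin_subspace mtopology_of_submetric)
    then show ?thesis
      unfolding mcomplete_of_def mtopology_of_def
      by (rule Metric_space.compact_space_imp_mcomplete[OF Metric_space_mspace_mdist])
  qed
  ultimately show ?thesis using sets by (simp add: fin_meas_css_iff carried_def)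
qed

lemma tau_pmm:
  assumes us: "set us \<subseteq> S" shows "tau_rep X us \<in> pmm_spaces (length us)"
proof -
  have "r \<in> b_span X (set us)" "set us \<subseteq> b_span X (set us)"
    using span_root span_end[of "set us"] us S_M by (auto simp: span_eq)
  then show ?thesis
    using tau_carried[OF us] root us S_M by (auto simp: pmm_spaces_def tau_simps)
qed

lemma tau_hyp:
  assumes us: "set us \<subseteq> S" shows "zero_hyperbolic_on (p_metric (tau_rep X us)) (psupp (tau_rep X us))"
proof -
  have "psupp (tau_rep X us) \<subseteq> M"
    using us S_M root msupp_sub[of "p_metric (tau_rep X us)" "p_measure (tau_rep X us)"]
    by (auto simp: psupp_def tau_simps)
  then show ?thesis using hyp unfolding zero_hyperbolic_on_def tau_simps mdist_submetric by blast
qed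

lemma tau_mass:
  assumes us: "set us \<subseteq> S"
  shows "p_mass (tau_rep X us) = measure \<nu> (b_span X (set us))"
proof (cases "emeasure \<nu> (b_span X (set us)) < \<infinity>")
  case True
  have "b_span X (set us) \<subseteq> M" using sets.sets_into_space[OF span_sets[OF us]] space_nu by simp
  then show ?thesis using True span_sets[OF us] space_nu
    by (simp add: total_mass_def tau_simps space_restrict_space measure_restrict_space Int_absorb2)
next
  \<comment> \<open>\<open>measure\<close> reads an infinite value as 0, in agreement with the null
    measure that \<open>tau_rep\<close> uses in this case.\<close>
  case False
  then show ?thesis by (simp add: total_mass_def tau_simps measure_def not_less top_unique)
qed

end

section \<open>Measurable dependence of spanned subtrees on the leaves\<close>

context pbt
begin

text \<open>Measurability tested on distances to fixed points only. It covers sampled leaves, points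
  drawn from \<open>nuW\<close> and the root alike, and as W is separable, mutual distances become
  measurable (\<open>distm_pair\<close>).\<close>

definition distm :: "'q measure \<Rightarrow> ('q \<Rightarrow> 'a) \<Rightarrow> bool" where
  "distm Q h \<longleftrightarrow> (\<forall>\<omega>\<in>space Q. h \<omega> \<in> W) \<and> (\<forall>c\<in>M. (\<lambda>\<omega>. d (h \<omega>) c) \<in> borel_measurable Q)"

abbreviation "nuW \<equiv> restrict_space \<nu> W"

lemma distm_pair:
  assumes "distm Q f" "distm Q g" shows "(\<lambda>\<omega>. d (f \<omega>) (g \<omega>)) \<in> borel_measurable Q"
proof (rule borel_measurable_mdist_pair[OF W_sep W_M])
  fix c assume "c \<in> W"
  then have "c \<in> M" using W_M by blast
  then show "(\<lambda>\<omega>. d (f \<omega>) c) \<in> borel_measurable Q" "(\<lambda>\<omega>. d (g \<omega>) c) \<in> borel_measurable Q"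
    using assms by (auto simp: distm_def)
qed (use assms W_M in \<open>auto simp: distm_def\<close>)

lemma distm_root: "distm Q (\<lambda>_. r)"
  using r_W by (simp add: distm_def)

lemma distm_sample:
  assumes "f \<in> measurable Q (b_sample X)" shows "distm Q f"
  using on_supp_measurable_D(2)[OF sets_mu assms] S_W mdist_measurable_on_supp[OF sets_mu assms]
  by (auto simp: distm_def b_supp_def)

lemma distm_nuW:
  assumes f: "f \<in> measurable Q nuW" shows "distm Q f"
  unfolding distm_def
proof (intro conjI ballI)
  fix \<omega> assume "\<omega> \<in> space Q"
  then show "f \<omega> \<in> W" using measurable_space[OF f] by (auto simp: space_restrict_space)
next
  fix c assume "c \<in> M"
  moreover have "f \<in> measurable Q \<nu>" using f by (simp add: measurable_restrict_space2_iff)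
  ultimately show "(\<lambda>\<omega>. d (f \<omega>) c) \<in> borel_measurable Q"
    using measurable_compose[OF _ mdist_measurable_borel[OF sets_nu]] by blast
qed

lemma distm_compose: "distm Q h \<Longrightarrow> f \<in> measurable Q' Q \<Longrightarrow> distm Q' (\<lambda>\<omega>. h (f \<omega>))"
  unfolding distm_def using measurable_space measurable_compose by fast

definition distm_list :: "'q measure \<Rightarrow> nat \<Rightarrow> ('q \<Rightarrow> 'a list) \<Rightarrow> bool" where
  "distm_list Q n us \<longleftrightarrow> (\<forall>\<omega>\<in>space Q. length (us \<omega>) = n \<and> set (us \<omega>) \<subseteq> S) \<and> (\<forall>i<n. distm Q (\<lambda>\<omega>. us \<omega> ! i))"

lemma distm_list_compose: "distm_list Q n us \<Longrightarrow> f \<in> measurable Q' Q \<Longrightarrow> distm_list Q' n (\<lambda>\<omega>. us (f \<omega>))"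
  using measurable_space distm_compose unfolding distm_list_def by fast

lemma points_then_tau:
  "points_then (tau_rep X us) v l = (if l = 0 then r else if l \<le> length us then us ! (l - 1) else v (l - 1 - length us))"
  by (simp add: points_then_def tau_simps)

lemma tau_matrix_measurable:
  assumes us: "distm_list Q n us"
    and v: "\<And>i j k. (i, j) \<in> I \<Longrightarrow> i = n + 1 + k \<or> j = n + 1 + k \<Longrightarrow> distm Q (\<lambda>\<omega>. v \<omega> k)"
  shows "(\<lambda>\<omega>. dist_matrix I (tau_rep X (us \<omega>)) (v \<omega>)) \<in> measurable Q (borel_of (matrix_top I))"
proof (rule measurable_into_matrix_top[OF dist_matrix_topspace])
  fix p assume p: "p \<in> I"
  obtain i j where ij: "p = (i, j)" by (cases p)
  have len: "\<And>\<omega>. \<omega> \<in> space Q \<Longrightarrow> length (us \<omega>) = n" using us by (simp add: distm_list_def)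
  define h where "h l \<omega> = (if l = 0 then r else if l \<le> n then us \<omega> ! (l - 1) else v \<omega> (l - 1 - n))" for l \<omega>
  have h: "distm Q (h l)" if l: "l = i \<or> l = j" for l
  proof -
    consider "l = 0" | "l \<noteq> 0" "l \<le> n" | k where "l = n + 1 + k"
      by (metis Suc_eq_plus1 add_Suc_right add.commute less_imp_Suc_add not_le)
    then show ?thesis
    proof cases
      case 1 then show ?thesis using distm_root by (simp add: h_def[abs_def])
    next
      case 2
      then have "distm Q (\<lambda>\<omega>. us \<omega> ! (l - 1))" using us by (simp add: distm_list_def)
      then show ?thesis using 2 by (simp add: h_def[abs_def])
    next
      case 3
      then have "distm Q (\<lambda>\<omega>. v \<omega> k)" using v[of i j k] p ij l by blast
      then show ?thesis using 3 by (simp add: h_def[abs_def])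
    qed
  qed
  have "(\<lambda>\<omega>. d (h i \<omega>) (h j \<omega>)) \<in> borel_measurable Q" by (rule distm_pair[OF h h]) auto
  moreover have "dist_matrix I (tau_rep X (us \<omega>)) (v \<omega>) p = d (h i \<omega>) (h j \<omega>)" if "\<omega> \<in> space Q" for \<omega>
    using len[OF that] p ij by (simp add: dist_matrix_apply tau_simps(1) points_then_tau h_def)
  ultimately show "(\<lambda>\<omega>. dist_matrix I (tau_rep X (us \<omega>)) (v \<omega>) p) \<in> borel_measurable Q"
    by (subst measurable_cong) auto
qed

lemma span_in_iff:
  assumes "set us \<subseteq> S" "w \<in> M"
  shows "w \<in> b_span X (set us) \<longleftrightarrow> d w r = 0 \<or> (\<exists>i<length us. d r w + d w (us ! i) = d r (us ! i))"
proof -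
  have "set us \<subseteq> M" using assms S_M by blast
  then have "w \<in> b_span X (set us) \<longleftrightarrow> w = r \<or> (\<exists>v\<in>set us. w \<in> br v)" using span_iff span_eq by metis
  also have "\<dots> \<longleftrightarrow> d w r = 0 \<or> (\<exists>v\<in>set us. d r w + d w v = d r v)"
    using \<open>set us \<subseteq> M\<close> assms(2) root seg_iff by (metis mdist_zero subsetD)
  finally show ?thesis by (metis in_set_conv_nth)
qed

text \<open>Incidence of a random point with a random subtree is a finite disjunction of equations
  between distances (\<open>span_in_iff\<close>).\<close>

lemma span_in_measurable:
  assumes us: "distm_list Q n us" and w: "distm Q w"
  shows "{\<omega> \<in> space Q. w \<omega> \<in> b_span X (set (us \<omega>))} \<in> sets Q"
proof -
  have [measurable]: "(\<lambda>\<omega>. d (w \<omega>) r) \<in> borel_measurable Q" "(\<lambda>\<omega>. d r (w \<omega>)) \<in> borel_measurable Q"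
    using distm_pair[OF w distm_root] distm_pair[OF distm_root w] by auto
  have u: "distm Q (\<lambda>\<omega>. us \<omega> ! i)" if "i < n" for i using us that by (simp add: distm_list_def)
  have "{\<omega> \<in> space Q. w \<omega> \<in> b_span X (set (us \<omega>))} =
    {\<omega> \<in> space Q. d (w \<omega>) r = 0} \<union> (\<Union>i\<in>{..<n}. {\<omega> \<in> space Q. d r (w \<omega>) + d (w \<omega>) (us \<omega> ! i) = d r (us \<omega> ! i)})"
  proof -
    have "w \<omega> \<in> b_span X (set (us \<omega>)) \<longleftrightarrow> d (w \<omega>) r = 0 \<or> (\<exists>i<n. d r (w \<omega>) + d (w \<omega>) (us \<omega> ! i) = d r (us \<omega> ! i))"
      if "\<omega> \<in> space Q" for \<omega>
    proof -
      have "w \<omega> \<in> M" "set (us \<omega>) \<subseteq> S" "length (us \<omega>) = n"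
        using us w that W_M unfolding distm_list_def distm_def by auto
      then show ?thesis using span_in_iff by simp
    qed
    then show ?thesis by auto
  qed
  also have "\<dots> \<in> sets Q"
  proof (intro sets.Un sets.finite_UN)
    fix i assume "i \<in> {..<n}"
    then have [measurable]: "(\<lambda>\<omega>. d (w \<omega>) (us \<omega> ! i)) \<in> borel_measurable Q" "(\<lambda>\<omega>. d r (us \<omega> ! i)) \<in> borel_measurable Q"
      using distm_pair[OF w u] distm_pair[OF distm_root u] by auto
    show "{\<omega> \<in> space Q. d r (w \<omega>) + d (w \<omega>) (us \<omega> ! i) = d r (us \<omega> ! i)} \<in> sets Q" by measurable
  qed auto
  finally show ?thesis .
qed

lemma sf_nuW: "sigma_finite_measure nuW"
  using sigma_finite_restrict[OF sf_nu W_sets(1)] .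

lemma space_nuW: "space nuW = W"
  using W_M space_nu by (auto simp: space_restrict_space)

lemma emeasure_nuW: "A \<in> sets \<nu> \<Longrightarrow> A \<subseteq> W \<Longrightarrow> emeasure nuW A = emeasure \<nu> A"
  using W_sets by (intro emeasure_restrict_space) auto

lemma span_W': "set us \<subseteq> S \<Longrightarrow> b_span X (set us) \<in> sets nuW"
  using span_sets span_W W_sets(1) by (auto simp: sets_restrict_space_iff)

text \<open>The incidence set is measurable in the leaves and the point together, and its sections
  are the subtrees; \<sigma>-finiteness of \<open>nuW\<close> makes their masses measurable.\<close>

lemma span_emeasure_measurable:
  assumes us: "distm_list Q n us"
  shows "(\<lambda>\<omega>. emeasure \<nu> (b_span X (set (us \<omega>)))) \<in> borel_measurable Q"
proof -
  interpret nuW: sigma_finite_measure nuW by (rule sf_nuW)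
  let ?E = "{x \<in> space (Q \<Otimes>\<^sub>M nuW). snd x \<in> b_span X (set (us (fst x)))}"
  have E: "?E \<in> sets (Q \<Otimes>\<^sub>M nuW)"
    by (rule span_in_measurable[OF distm_list_compose[OF us measurable_fst] distm_nuW[OF measurable_snd]])
  have "(\<lambda>\<omega>. emeasure nuW (Pair \<omega> -` ?E)) \<in> borel_measurable Q"
    by (rule nuW.measurable_emeasure_Pair[OF E])
  moreover have "emeasure nuW (Pair \<omega> -` ?E) = emeasure \<nu> (b_span X (set (us \<omega>)))" if "\<omega> \<in> space Q" for \<omega>
  proof -
    have s: "set (us \<omega>) \<subseteq> S" using us that by (simp add: distm_list_def)
    have "Pair \<omega> -` ?E = b_span X (set (us \<omega>))"
      using span_W[OF s] that space_nuW by (auto simp: space_pair_measure)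
    then show ?thesis using emeasure_nuW[OF span_sets[OF s] span_W[OF s]] by simp
  qed
  ultimately show ?thesis by (subst (asm) measurable_cong) auto
qed

lemma tau_mass_measurable:
  assumes us: "distm_list Q n us"
  shows "(\<lambda>\<omega>. p_mass (tau_rep X (us \<omega>))) \<in> borel_measurable Q"
proof -
  have "(\<lambda>\<omega>. measure \<nu> (b_span X (set (us \<omega>)))) \<in> borel_measurable Q"
    using span_emeasure_measurable[OF us] unfolding measure_def by measurable
  moreover have "p_mass (tau_rep X (us \<omega>)) = measure \<nu> (b_span X (set (us \<omega>)))" if "\<omega> \<in> space Q" for \<omega>
    using us that by (intro tau_mass) (simp add: distm_list_def)
  ultimately show ?thesis by (subst measurable_cong) auto
qed

text \<open>\<open>p_sample\<close> is drawn on the support of the restricted measure, which may be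
  smaller than the subtree, but only by a null set.\<close>

lemma tau_sample:
  assumes us: "set us \<subseteq> S" and fin: "emeasure \<nu> (b_span X (set us)) < \<infinity>"
  obtains A where "A \<in> sets nuW" "A \<subseteq> b_span X (set us)" "emeasure \<nu> (b_span X (set us) - A) = 0"
    "p_sample (tau_rep X us) = restrict_space nuW A"
proof -
  let ?B = "b_span X (set us)" and ?m = "p_metric (tau_rep X us)" and ?\<kappa> = "p_measure (tau_rep X us)"
  let ?A = "msupp ?m ?\<kappa>"
  note car = carriedD[OF pmm_spacesD(4)[OF tau_pmm[OF us]]]
  have \<kappa>: "?\<kappa> = restrict_space \<nu> ?B" using fin by (simp add: tau_simps)
  have B: "?B \<in> sets \<nu>" using span_sets[OF us] .
  have BM: "?B \<subseteq> M" using sets.sets_into_space[OF B] space_nu by simp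
  have AB: "?A \<subseteq> ?B" using msupp_sub[of ?m ?\<kappa>] by (auto simp: tau_simps)
  have A: "?A \<in> sets \<nu>" using car(5) B unfolding \<kappa> by (simp add: sets_restrict_space_iff)
  have mB: "mspace ?m = ?B" using BM by (auto simp: tau_simps)
  have "emeasure ?\<kappa> (?B - ?A) = 0" using car(6) unfolding mB .
  then have 0: "emeasure \<nu> (?B - ?A) = 0" using B unfolding \<kappa> by (subst (asm) emeasure_restrict_space) auto
  have "p_sample (tau_rep X us) = restrict_space (restrict_space \<nu> ?B) ?A" by (simp add: on_supp_def \<kappa>)
  also have "\<dots> = restrict_space \<nu> (?B \<inter> ?A)" using A B by (intro restrict_restrict_space) auto
  also have "?B \<inter> ?A = W \<inter> ?A" using AB span_W[OF us] by blast
  also have "restrict_space \<nu> (W \<inter> ?A) = restrict_space nuW ?A" using A W_sets by (intro restrict_restrict_space[symmetric]) auto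
  finally have "p_sample (tau_rep X us) = restrict_space nuW ?A" .
  moreover have "?A \<in> sets nuW" using A W_sets AB span_W[OF us] by (auto simp: sets_restrict_space_iff)
  ultimately show thesis using that AB 0 by blast
qed

lemma distm_list_const:
  assumes "set us \<subseteq> S" shows "distm_list Q (length us) (\<lambda>_. us)"
  using assms S_W nth_mem[of _ us] unfolding distm_list_def distm_def by (auto simp: subset_iff)

text \<open>The measure on the right does not depend on \<open>us\<close>, so measurability in the
  leaves becomes that of an integral with a parameter.\<close>

lemma samp_tau:
  assumes us: "set us \<subseteq> S" and fin: "emeasure \<nu> (b_span X (set us)) < \<infinity>"
    and \<psi>: "matrix_measurable (length us + k) \<psi>"
  shows "samp (tau_rep X us) k \<psi> = (\<integral>v. (\<Prod>i<k. indicator (b_span X (set us)) (v i)) *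
     \<psi> (dist_matrix (pairs_upto (length us + k)) (tau_rep X us) v) \<partial>Pi\<^sub>M {..<k} (\<lambda>_. nuW))"
proof -
  let ?B = "b_span X (set us)"
  obtain A where A: "A \<in> sets nuW" "A \<subseteq> ?B" "emeasure \<nu> (?B - A) = 0" "p_sample (tau_rep X us) = restrict_space nuW A"
    using tau_sample[OF us fin] by blast
  let ?f = "\<lambda>v. \<psi> (dist_matrix (pairs_upto (length us + k)) (tau_rep X us) v)"
  have fm: "?f \<in> borel_measurable (Pi\<^sub>M {..<k} (\<lambda>_. nuW))"
    by (rule measurable_compose[OF tau_matrix_measurable[OF distm_list_const[OF us]] \<psi>])
       (auto intro!: distm_nuW simp: pairs_upto_iff)
  have "samp (tau_rep X us) k \<psi> = (\<integral>v. ?f v \<partial>Pi\<^sub>M {..<k} (\<lambda>_. restrict_space nuW A))"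
    by (simp add: samp_def tau_simps(3) A(4))
  also have "\<dots> = (\<integral>v. (\<Prod>i<k. indicator A (v i)) * ?f v \<partial>Pi\<^sub>M {..<k} (\<lambda>_. nuW))"
    by (rule integral_PiM_restrict[OF sf_nuW A(1) finite_lessThan fm])
  also have "\<dots> = (\<integral>v. (\<Prod>i<k. indicator ?B (v i)) * ?f v \<partial>Pi\<^sub>M {..<k} (\<lambda>_. nuW))"
  proof (rule integral_cong_AE)
    have BA: "?B - A \<in> sets nuW" using A(1) span_W'[OF us] by blast
    then have "?B - A \<in> sets \<nu>" using W_sets by (auto simp: sets_restrict_space_iff)
    then have "?B - A \<in> null_sets nuW" using A(3) BA span_W[OF us] emeasure_nuW[of "?B - A"] by (auto simp: null_sets_def)
    then have "AE x in nuW. indicator A x = (indicator ?B x :: real)"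
      by (rule AE_I') (use A(2) in \<open>auto simp: indicator_def\<close>)
    from AE_PiM_components[OF sf_nuW finite_lessThan this, of k]
    show "AE v in Pi\<^sub>M {..<k} (\<lambda>_. nuW). (\<Prod>i<k. indicator A (v i)) * ?f v = (\<Prod>i<k. indicator ?B (v i)) * ?f v"
      by eventually_elim simp
    show "(\<lambda>v. (\<Prod>i<k. indicator A (v i)) * ?f v) \<in> borel_measurable (Pi\<^sub>M {..<k} (\<lambda>_. nuW))"
      using A(1) fm by measurable
    show "(\<lambda>v. (\<Prod>i<k. indicator ?B (v i)) * ?f v) \<in> borel_measurable (Pi\<^sub>M {..<k} (\<lambda>_. nuW))"
      using span_W'[OF us] fm by measurable
  qed
  finally show ?thesis .
qed

lemma tau_samp_measurable:
  assumes us: "distm_list Q n us" and \<psi>: "matrix_measurable (n + k) \<psi>"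
  shows "(\<lambda>\<omega>. samp (tau_rep X (us \<omega>)) k \<psi>) \<in> borel_measurable Q"
proof -
  have len: "length (us \<omega>) = n" "set (us \<omega>) \<subseteq> S" if "\<omega> \<in> space Q" for \<omega> using us that by (auto simp: distm_list_def)
  let ?P = "Pi\<^sub>M {..<k} (\<lambda>_. nuW)"
  interpret nuW: sigma_finite_measure nuW by (rule sf_nuW)
  interpret product_sigma_finite "\<lambda>_::nat. nuW" by unfold_locales
  interpret P: sigma_finite_measure ?P by (rule sigma_finite) simp
  define g where "g \<omega> v = (\<Prod>i<k. indicator (b_span X (set (us \<omega>))) (v i)) *
     \<psi> (dist_matrix (pairs_upto (n + k)) (tau_rep X (us \<omega>)) v)" for \<omega> v
  have us': "distm_list (Q \<Otimes>\<^sub>M ?P) n (\<lambda>x. us (fst x))" by (rule distm_list_compose[OF us measurable_fst])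
  have v': "distm (Q \<Otimes>\<^sub>M ?P) (\<lambda>x. snd x i)" if "i < k" for i
    using that by (intro distm_nuW) measurable
  have "(\<lambda>x. indicator (b_span X (set (us (fst x)))) (snd x i) :: real) \<in> borel_measurable (Q \<Otimes>\<^sub>M ?P)" if "i < k" for i
  proof -
    have "(\<lambda>x. indicator {x \<in> space (Q \<Otimes>\<^sub>M ?P). snd x i \<in> b_span X (set (us (fst x)))} x :: real) \<in> borel_measurable (Q \<Otimes>\<^sub>M ?P)"
      using span_in_measurable[OF us' v'[OF that]] by (rule borel_measurable_indicator)
    then show ?thesis by (subst measurable_cong) (auto simp: indicator_def)
  qed
  then have i: "(\<lambda>x. \<Prod>i<k. indicator (b_span X (set (us (fst x)))) (snd x i) :: real) \<in> borel_measurable (Q \<Otimes>\<^sub>M ?P)"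
    by (intro borel_measurable_prod) auto
  have "(\<lambda>x. dist_matrix (pairs_upto (n + k)) (tau_rep X (us (fst x))) (snd x)) \<in> measurable (Q \<Otimes>\<^sub>M ?P) (borel_of (matrix_top (pairs_upto (n + k))))"
    by (rule tau_matrix_measurable[OF us']) (auto intro!: v' simp: pairs_upto_iff)
  then have "(\<lambda>x. \<psi> (dist_matrix (pairs_upto (n + k)) (tau_rep X (us (fst x))) (snd x))) \<in> borel_measurable (Q \<Otimes>\<^sub>M ?P)"
    by (rule measurable_compose[OF _ \<psi>])
  then have "(\<lambda>(\<omega>, v). g \<omega> v) \<in> borel_measurable (Q \<Otimes>\<^sub>M ?P)"
    using i unfolding g_def case_prod_beta by measurable
  then have 1: "(\<lambda>\<omega>. \<integral>v. g \<omega> v \<partial>?P) \<in> borel_measurable Q" by (rule P.borel_measurable_lebesgue_integral)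
  have 2: "(\<lambda>\<omega>. if k = 0 then \<psi> (dist_matrix (pairs_upto n) (tau_rep X (us \<omega>)) (\<lambda>_. r)) else 0) \<in> borel_measurable Q"
  proof (cases "k = 0")
    case True
    have "(\<lambda>\<omega>. dist_matrix (pairs_upto n) (tau_rep X (us \<omega>)) (\<lambda>_. r)) \<in> measurable Q (borel_of (matrix_top (pairs_upto n)))"
      by (rule tau_matrix_measurable[OF us]) (rule distm_root)
    then show ?thesis using True \<psi> measurable_compose[of _ Q _ \<psi> borel] by simp
  qed simp
  \<comment> \<open>On an infinite span \<open>tau_rep\<close> carries the null measure: the
    integral is 0 if a point is sampled, and \<psi> of the marked distances otherwise.\<close>
  have "samp (tau_rep X (us \<omega>)) k \<psi> = (if emeasure \<nu> (b_span X (set (us \<omega>))) < \<infinity> then (\<integral>v. g \<omega> v \<partial>?P)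
      else if k = 0 then \<psi> (dist_matrix (pairs_upto n) (tau_rep X (us \<omega>)) (\<lambda>_. r)) else 0)" if w: "\<omega> \<in> space Q" for \<omega>
  proof (cases "emeasure \<nu> (b_span X (set (us \<omega>))) < \<infinity>")
    case True
    then show ?thesis using samp_tau[OF len(2)[OF w] True, of \<psi> k] \<psi> len(1)[OF w] by (simp add: g_def[abs_def])
  next
    case False
    have Y: "tau_rep X (us \<omega>) \<in> pmm_spaces n" using tau_pmm[OF len(2)[OF w]] len(1)[OF w] by simp
    have "p_mass (tau_rep X (us \<omega>)) = 0" using False by (simp add: total_mass_def tau_simps)
    then show ?thesis using False samp_mass_zero[OF Y, of k] samp_0[OF Y] dist_matrix_point_matrix[OF Y] by auto
  qed
  moreover have "{\<omega> \<in> space Q. emeasure \<nu> (b_span X (set (us \<omega>))) < \<infinity>} \<in> sets Q"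
    using span_emeasure_measurable[OF us] by measurable
  ultimately show ?thesis
    using measurable_If[OF 1 2] by (subst measurable_cong) auto
qed

lemma tau_point_matrix_measurable:
  assumes us: "distm_list Q n us" and p: "p \<in> pairs_upto n"
  shows "(\<lambda>\<omega>. point_matrix (tau_rep X (us \<omega>)) p) \<in> borel_measurable Q"
proof -
  have "(\<lambda>\<omega>. dist_matrix (pairs_upto n) (tau_rep X (us \<omega>)) (\<lambda>_. r)) \<in> measurable Q (borel_of (matrix_top (pairs_upto n)))"
    by (rule tau_matrix_measurable[OF us]) (rule distm_root)
  from measurable_compose[OF this matrix_entry_measurable[OF p]]
  have "(\<lambda>\<omega>. dist_matrix (pairs_upto n) (tau_rep X (us \<omega>)) (\<lambda>_. r) p) \<in> borel_measurable Q" .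
  moreover have "point_matrix (tau_rep X (us \<omega>)) = dist_matrix (pairs_upto n) (tau_rep X (us \<omega>)) (\<lambda>_. r)"
    if "\<omega> \<in> space Q" for \<omega>
    using us that dist_matrix_point_matrix[OF tau_pmm[of "us \<omega>"]] by (auto simp: distm_list_def)
  ultimately show ?thesis by (subst measurable_cong) auto
qed

end

section \<open>Invariance under equivalence of bi-measure trees\<close>

text \<open>A measure-preserving isometry of the whole carriers may be given instead of one between
  supports: it matches balls and their measures, hence supports.\<close>

lemma pmm_isoI:
  assumes Y: "Y \<in> pmm_spaces n" and Y': "Y' \<in> pmm_spaces n"
    and \<phi>: "bij_betw \<phi> (mspace (p_metric Y)) (mspace (p_metric Y'))"
    and iso: "\<And>x y. x \<in> mspace (p_metric Y) \<Longrightarrow> y \<in> mspace (p_metric Y) \<Longrightarrow> mdist (p_metric Y') (\<phi> x) (\<phi> y) = mdist (p_metric Y) x y"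
    and pts: "\<phi> (p_root Y) = p_root Y'" "map \<phi> (p_points Y) = p_points Y'"
    and meas: "\<And>B. B \<in> sets (p_measure Y') \<Longrightarrow>
      emeasure (p_measure Y) {x \<in> mspace (p_metric Y). \<phi> x \<in> B} = emeasure (p_measure Y') B"
  shows "pmm_iso Y Y'"
proof -
  let ?m = "p_metric Y" and ?m' = "p_metric Y'" and ?k = "p_measure Y" and ?k' = "p_measure Y'"
  note y = pmm_spacesD[OF Y] and y' = pmm_spacesD[OF Y']
  note f = carriedD[OF y(4)] and f' = carriedD[OF y'(4)]
  have im: "\<And>x. x \<in> mspace ?m \<Longrightarrow> \<phi> x \<in> mspace ?m'" using \<phi> by (auto simp: bij_betw_def)
  have msets: "{x \<in> mspace ?m. \<phi> x \<in> B} \<in> sets ?k" if "B \<in> sets ?k'" for B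
  proof -
    have top: "mspace ?m \<in> sets ?k" using f(4) sets.top[of ?k] by simp
    have "\<phi> \<in> measurable (restrict_space ?k (mspace ?m)) (borel_of (mtopology_of ?m'))"
      using im iso by (intro isometry_measurable[OF f(1)]) auto
    then have "\<phi> -` B \<inter> space (restrict_space ?k (mspace ?m)) \<in> sets (restrict_space ?k (mspace ?m))"
      using that f'(1) by (intro measurable_sets) auto
    moreover have "\<phi> -` B \<inter> space (restrict_space ?k (mspace ?m)) = {x \<in> mspace ?m. \<phi> x \<in> B}"
      using f(4) by (auto simp: space_restrict_space)
    ultimately show ?thesis using top by (auto simp: sets_restrict_space_iff)
  qed
  have ball: "emeasure ?k' (mball_of ?m' (\<phi> x) e) = emeasure ?k (mball_of ?m x e)" if x: "x \<in> mspace ?m" for x e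
  proof -
    have "{z \<in> mspace ?m. \<phi> z \<in> mball_of ?m' (\<phi> x) e} = mball_of ?m x e"
      using x im iso by auto
    then show ?thesis using meas[of "mball_of ?m' (\<phi> x) e"] f'(1) by (simp add: borel_of_open openin_mball_of)
  qed
  have supp: "\<phi> ` msupp ?m ?k = msupp ?m' ?k'"
  proof (intro equalityI subsetI)
    fix z assume "z \<in> \<phi> ` msupp ?m ?k"
    then show "z \<in> msupp ?m' ?k'" using ball im by (auto simp: msupp_def)
  next
    fix z assume z: "z \<in> msupp ?m' ?k'"
    then have "z \<in> mspace ?m'" by (simp add: msupp_def)
    then obtain x where "x \<in> mspace ?m" "z = \<phi> x" using \<phi> by (auto simp: bij_betw_def)
    then show "z \<in> \<phi> ` msupp ?m ?k" using z ball by (auto simp: msupp_def)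
  qed
  have sub: "psupp Y \<subseteq> mspace ?m" using y msupp_sub[of ?m ?k] by (auto simp: psupp_def)
  have "\<phi> ` psupp Y = psupp Y'"
    using supp pts by (simp add: psupp_def image_Un flip: set_map)
  then have b: "bij_betw \<phi> (psupp Y) (psupp Y')"
    using \<phi> sub unfolding bij_betw_def by (meson inj_on_subset)
  have "emeasure ?k {x \<in> psupp Y. \<phi> x \<in> B} = emeasure ?k' B" if B: "B \<in> sets ?k'" for B
  proof -
    have null: "mspace ?m - msupp ?m ?k \<in> null_sets ?k"
      using f(6) sets.compl_sets[OF f(5)] f(4) by (auto simp: null_sets_def)
    have "emeasure ?k {x \<in> psupp Y. \<phi> x \<in> B} = emeasure ?k {x \<in> mspace ?m. \<phi> x \<in> B}"
    proof (rule emeasure_eq_AE)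
      have "{x \<in> psupp Y. \<phi> x \<in> B} = psupp Y \<inter> {x \<in> mspace ?m. \<phi> x \<in> B}" using sub by auto
      then show "{x \<in> psupp Y. \<phi> x \<in> B} \<in> sets ?k" using msets[OF B] psupp_sets[OF Y] by simp
      show "AE x in ?k. (x \<in> {x \<in> psupp Y. \<phi> x \<in> B}) = (x \<in> {x \<in> mspace ?m. \<phi> x \<in> B})"
        by (rule AE_I'[OF null]) (use f(4) sub in \<open>auto simp: psupp_def\<close>)
    qed (rule msets[OF B])
    then show ?thesis using meas[OF B] by simp
  qed
  then show ?thesis unfolding pmm_iso_def using b iso pts sub by (intro exI[of _ \<phi>]) blast
qed

text \<open>A spanned subtree lies in the skeleton except possibly for the points of
  \<open>us\<close>, and those off the skeleton are \<nu>-null by \<open>noatom\<close>. On the side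
  of Z the leaves are null. So all the mass sits on the skeleton, the only place where an
  equivalence controls \<nu>.\<close>

lemma bm_iso_tau:
  fixes X Z :: "'a bmt"
  assumes X: "pre_bmt X" and Z: "pre_bmt Z" and lz: "emeasure (b_nu Z) (leaves Z) = 0"
    and im: "\<phi> ` b_span X (b_supp X) \<subseteq> mspace (b_metric Z)"
    and iso: "\<And>x y. x \<in> b_span X (b_supp X) \<Longrightarrow> y \<in> b_span X (b_supp X) \<Longrightarrow> mdist (b_metric Z) (\<phi> x) (\<phi> y) = mdist (b_metric X) x y"
    and root: "\<phi> (b_root X) = b_root Z"
    and nu: "\<And>B. B \<in> sets (b_nu Z) \<Longrightarrow> emeasure (b_nu X) {x \<in> skeleton X. \<phi> x \<in> B} = emeasure (b_nu Z) (B \<inter> skeleton Z)"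
    and us: "set us \<subseteq> b_supp X" "us \<noteq> []" and us': "\<phi> ` set us \<subseteq> b_supp Z"
    and noatom: "\<And>u. u \<in> set us \<Longrightarrow> u \<in> skeleton X \<or> emeasure (b_nu X) {u} = 0"
  shows "pmm_iso (tau_rep X us) (tau_rep Z (map \<phi> us))"
proof -
  interpret A: pbt X using X by unfold_locales
  interpret B: pbt Z using Z by unfold_locales
  let ?A = "b_span X (set us)" and ?B = "b_span Z (set (map \<phi> us))"
  have us2: "set (map \<phi> us) \<subseteq> B.S" using us' by auto
  have AW: "?A \<subseteq> A.W" and BW: "?B \<subseteq> B.W" using A.span_W[OF us(1)] B.span_W[OF us2] by auto
  have \<phi>M: "\<And>x. x \<in> A.W \<Longrightarrow> \<phi> x \<in> B.M" using im by auto
  have usM: "\<And>u. u \<in> set us \<Longrightarrow> u \<in> A.M \<and> u \<in> A.W \<and> \<phi> u \<in> B.M"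
    using us(1) A.S_M A.S_W \<phi>M by blast
  have seg1: "w \<in> seg (b_metric X) A.r u \<longleftrightarrow> \<phi> w \<in> seg (b_metric Z) B.r (\<phi> u)" if "u \<in> set us" "w \<in> A.W" for u w
    using usM[OF that(1)] \<phi>M[OF that(2)] A.W_M that(2) A.r_W
      A.seg_iff[of u w] B.seg_iff[of "\<phi> u" "\<phi> w"] iso[of A.r w] iso[of w u] iso[of A.r u] root by auto
  have A_iff: "w \<in> ?A \<longleftrightarrow> \<phi> w \<in> ?B" if w: "w \<in> A.W" for w
  proof -
    have "w = A.r \<longleftrightarrow> \<phi> w = B.r"
    proof
      assume "\<phi> w = B.r"
      then have "A.d A.r w = 0" using iso[OF A.r_W w] B.root root by simp
      then show "w = A.r" using w A.W_M A.root by (auto simp: subset_iff)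
    qed (use root in simp)
    then show ?thesis using seg1[OF _ w] by (simp add: b_span_def span_tree_def)
  qed
  \<comment> \<open>The image of a root segment is the whole root segment of the image: the first
    tree has a point at each height, and the second has only one.\<close>
  have surj: "\<exists>w\<in>?A. z = \<phi> w" if z: "z \<in> ?B" for z
  proof (cases "z = B.r")
    case True
    then show ?thesis using root by (intro bexI[of _ A.r]) (auto simp: b_span_def span_tree_def)
  next
    case False
    then obtain u where u: "u \<in> set us" "z \<in> seg (b_metric Z) B.r (\<phi> u)"
      using z by (auto simp: b_span_def span_tree_def)
    note uM = usM[OF u(1)]
    have "B.d B.r z + B.d z (\<phi> u) = B.d B.r (\<phi> u)" using B.seg_iff[of "\<phi> u" z] u(2) uM by simp
    then have "B.d B.r z \<le> B.d B.r (\<phi> u)" using mdist_nonneg[of "b_metric Z" z "\<phi> u"] by linarith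
    also have "\<dots> = A.d A.r u" using iso[OF A.r_W, of u] uM root by simp
    finally obtain p where p: "p \<in> geod (b_metric X) A.r u" "A.d A.r p = B.d B.r z"
      using real_tree_point[OF A.tree A.root, of u] uM by (metis mdist_nonneg)
    then have p': "p \<in> seg (b_metric X) A.r u" using A.seg_geod uM by simp
    then have pA: "p \<in> ?A" using u(1) by (auto simp: b_span_def span_tree_def)
    have "\<phi> p \<in> seg (b_metric Z) B.r (\<phi> u)" using seg1[OF u(1)] p' pA AW by blast
    moreover have "B.d B.r (\<phi> p) = B.d B.r z" using iso[OF A.r_W, of p] pA AW p(2) root by auto
    ultimately have "\<phi> p = z" using B.seg_unique[of "\<phi> u" "\<phi> p" z] u(2) uM by simp
    then show ?thesis using pA by blast
  qed
  have inj: "inj_on \<phi> A.W"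
  proof (rule inj_onI)
    fix x y assume h: "x \<in> A.W" "y \<in> A.W" "\<phi> x = \<phi> y"
    have "A.d x y = 0" using iso[OF h(1,2)] h(3) \<phi>M[OF h(2)] by simp
    then show "x = y" using h A.W_M by (auto simp: subset_iff)
  qed
  have img: "\<phi> ` ?A = ?B" using surj A_iff AW by blast
  have key: "emeasure A.\<nu> {x \<in> ?A. \<phi> x \<in> C} = emeasure B.\<nu> C" if C: "C \<in> sets B.\<nu>" "C \<subseteq> ?B" for C
  proof -
    have msets: "{x \<in> A.W. \<phi> x \<in> C} \<in> sets A.\<nu>"
    proof -
      have "\<phi> \<in> measurable (restrict_space A.\<nu> A.W) (borel_of B.T)"
        by (rule isometry_measurable[OF A.sets_nu A.W_M im iso])
      then have "\<phi> -` C \<inter> space (restrict_space A.\<nu> A.W) \<in> sets (restrict_space A.\<nu> A.W)"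
        using C(1) B.sets_nu by (intro measurable_sets) auto
      moreover have "\<phi> -` C \<inter> space (restrict_space A.\<nu> A.W) = {x \<in> A.W. \<phi> x \<in> C}" using A.space_nuW by auto
      ultimately show ?thesis using A.W_sets by (auto simp: sets_restrict_space_iff)
    qed
    have null: "(\<Union>u\<in>{u \<in> set us. u \<notin> skeleton X}. {u}) \<in> null_sets A.\<nu>"
      using noatom A.sing_sets usM by (intro null_sets_UN') (auto simp: null_sets_def countable_finite)
    have "emeasure A.\<nu> {x \<in> ?A. \<phi> x \<in> C} = emeasure A.\<nu> {x \<in> skeleton X. \<phi> x \<in> C}"
    proof (rule emeasure_eq_AE)
      have "{x \<in> ?A. \<phi> x \<in> C} = {x \<in> A.W. \<phi> x \<in> C} \<inter> ?A" using AW by blast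
      then show "{x \<in> ?A. \<phi> x \<in> C} \<in> sets A.\<nu>" using msets A.span_sets[OF us(1)] by simp
      have "{x \<in> skeleton X. \<phi> x \<in> C} = {x \<in> A.W. \<phi> x \<in> C} \<inter> skeleton X" using A.skeleton_W by blast
      then show "{x \<in> skeleton X. \<phi> x \<in> C} \<in> sets A.\<nu>" using msets A.skeleton_sets by simp
      show "AE x in A.\<nu>. (x \<in> {x \<in> ?A. \<phi> x \<in> C}) = (x \<in> {x \<in> skeleton X. \<phi> x \<in> C})"
      proof (rule AE_I'[OF null], rule subsetI)
        fix x assume "x \<in> {x \<in> space A.\<nu>. (x \<in> {x \<in> ?A. \<phi> x \<in> C}) \<noteq> (x \<in> {x \<in> skeleton X. \<phi> x \<in> C})}"
        then have x: "x \<in> ?A" "x \<notin> skeleton X" using A_iff C(2) A.skeleton_W by auto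
        obtain u where u: "u \<in> set us" "x \<in> seg (b_metric X) A.r u"
        proof (cases "x = A.r")
          case True
          obtain u where "u \<in> set us" using us(2) by (meson list.set_sel(1))
          then show ?thesis using that True A.seg_root usM by blast
        next
          case False then show ?thesis using that x(1) by (auto simp: b_span_def span_tree_def)
        qed
        then have "x = u" using x(2) us(1) unfolding skeleton_def by blast
        then show "x \<in> (\<Union>u\<in>{u \<in> set us. u \<notin> skeleton X}. {u})" using u(1) x(2) by simp
      qed
    qed
    also have "\<dots> = emeasure B.\<nu> (C \<inter> skeleton Z)" by (rule nu[OF C(1)])
    also have "\<dots> = emeasure B.\<nu> C"
    proof (rule emeasure_eq_AE)
      have "leaves Z \<in> null_sets B.\<nu>" using lz B.leaves_sets by (auto simp: null_sets_def)
      then show "AE x in B.\<nu>. (x \<in> C \<inter> skeleton Z) = (x \<in> C)"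
        by (rule AE_I') (use C(2) BW in \<open>auto simp: leaves_def\<close>)
    qed (use C(1) B.skeleton_sets in auto)
    finally show ?thesis .
  qed
  have mA: "mspace (p_metric (tau_rep X us)) = ?A" and mB: "mspace (p_metric (tau_rep Z (map \<phi> us))) = ?B"
    using AW BW A.W_M B.W_M by (auto simp: A.tau_simps B.tau_simps)
  show ?thesis
  proof (rule pmm_isoI[OF A.tau_pmm[OF us(1)]])
    show "tau_rep Z (map \<phi> us) \<in> pmm_spaces (length us)" using B.tau_pmm[OF us2] by simp
    show "bij_betw \<phi> (mspace (p_metric (tau_rep X us))) (mspace (p_metric (tau_rep Z (map \<phi> us))))"
      unfolding mA mB bij_betw_def using inj_on_subset[OF inj AW] img by blast
    show "\<And>x y. x \<in> mspace (p_metric (tau_rep X us)) \<Longrightarrow> y \<in> mspace (p_metric (tau_rep X us)) \<Longrightarrow>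
      mdist (p_metric (tau_rep Z (map \<phi> us))) (\<phi> x) (\<phi> y) = mdist (p_metric (tau_rep X us)) x y"
      unfolding mA using iso AW by (auto simp: A.tau_simps B.tau_simps)
    show "\<phi> (p_root (tau_rep X us)) = p_root (tau_rep Z (map \<phi> us))" by (simp add: A.tau_simps B.tau_simps root)
    show "map \<phi> (p_points (tau_rep X us)) = p_points (tau_rep Z (map \<phi> us))" by (simp add: A.tau_simps B.tau_simps)
    fix C assume C: "C \<in> sets (p_measure (tau_rep Z (map \<phi> us)))"
    have tot: "emeasure A.\<nu> ?A = emeasure B.\<nu> ?B"
    proof -
      have "{x \<in> ?A. \<phi> x \<in> ?B} = ?A" using A_iff AW by auto
      then show ?thesis using key[OF B.span_sets[OF us2]] by simp
    qed
    show "emeasure (p_measure (tau_rep X us)) {x \<in> mspace (p_metric (tau_rep X us)). \<phi> x \<in> C} =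
         emeasure (p_measure (tau_rep Z (map \<phi> us))) C"
    proof (cases "emeasure A.\<nu> ?A < \<infinity>")
      case True
      then have pm: "p_measure (tau_rep X us) = restrict_space A.\<nu> ?A"
        "p_measure (tau_rep Z (map \<phi> us)) = restrict_space B.\<nu> ?B"
        using tot by (auto simp: A.tau_simps B.tau_simps)
      then have C': "C \<in> sets B.\<nu>" "C \<subseteq> ?B"
        using C B.span_sets[OF us2] by (auto simp: sets_restrict_space_iff)
      show ?thesis unfolding mA pm
        using key[OF C'] A.span_sets[OF us(1)] B.span_sets[OF us2] C'
        by (simp add: emeasure_restrict_space Collect_conj_eq Int_assoc subset_eq)
    next
      case False
      then show ?thesis using tot by (auto simp: A.tau_simps B.tau_simps)
    qed
  qed
qed

section \<open>Pruned trees\<close>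

lemma closedin_mcomplete_submetric:
  assumes "mcomplete_of (submetric m S)" "closedin (mtopology_of m) C" "C \<subseteq> S"
  shows "mcomplete_of (submetric m C)"
proof -
  let ?m = "submetric m S"
  have CM: "C \<subseteq> mspace m" using closedin_subset[OF assms(2)] by simp
  have cl: "closedin (mtopology_of ?m) C"
    using assms(2,3) by (auto simp: mtopology_of_submetric closedin_subtopology intro!: exI[of _ C])
  interpret Submetric "mspace ?m" "mdist ?m" C
    by (rule Submetric.intro[OF Metric_space_mspace_mdist], rule Submetric_axioms.intro) (use CM assms(3) in auto)
  have "sub.mcomplete"
    using cl assms(1) unfolding mtopology_of_def mcomplete_of_def by (rule closedin_mcomplete_imp_mcomplete)
  moreover have "C \<inter> mspace m = C" using CM by auto
  ultimately show ?thesis by (simp add: mcomplete_of_def)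
qed

locale pruned = pbt X for X :: "'a bmt" +
  fixes A :: "'a set"
  assumes A: "countable A" "A \<subseteq> M" and complete: "mcomplete_of (submetric (b_metric X) S)"
    and ne: "remaining X A \<noteq> {}"
begin

abbreviation "R \<equiv> remaining X A"
abbreviation "P \<equiv> prune X A"
abbreviation "mR \<equiv> submetric (b_metric X) R"

lemma R_M: "R \<subseteq> M" by (auto simp: remaining_def)

lemma R_down: "w \<in> R \<Longrightarrow> br w \<subseteq> R"
  using seg_trans seg_sub by (fastforce simp: remaining_def)

lemma r_R: "r \<in> R"
proof -
  obtain w where w: "w \<in> R" using ne by blast
  then have "r \<in> br w" using R_M seg_root by blast
  then show ?thesis using R_down[OF w] by blast
qed

lemma seg_R: "w \<in> R \<Longrightarrow> seg mR r w = br w"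
  by (rule subtree(2)[OF R_M r_R]) (use R_down in auto)

lemma R_sets: "R \<in> sets \<nu>" "R \<in> sets \<mu>"
proof -
  have "{w \<in> M. v \<in> br w} \<in> sets \<nu>" if "v \<in> A" for v
    using closed_sets(1)[OF closedin_above] that A(2) by blast
  then have "(\<Union>v\<in>A. {w \<in> M. v \<in> br w}) \<in> sets \<nu>"
    using A(1) by (intro sets.countable_UN') auto
  then have "space \<nu> - (\<Union>v\<in>A. {w \<in> M. v \<in> br w}) \<in> sets \<nu>" by (rule sets.compl_sets)
  moreover have "space \<nu> - (\<Union>v\<in>A. {w \<in> M. v \<in> br w}) = R"
    using space_nu by (auto simp: remaining_def)
  ultimately show "R \<in> sets \<nu>" by simp
  then show "R \<in> sets \<mu>" using sets_nu sets_mu by simp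
qed

lemma P_simps: "b_metric P = mR" "b_root P = r" "b_mu P = restrict_space \<mu> R" "b_nu P = restrict_space \<nu> R"
  using ne by (simp_all add: prune_def Let_def)

lemma mspace_R: "mspace mR = R" using R_M by auto

lemma sets_P: "sets (restrict_space \<mu> R) = sets (borel_of (mtopology_of mR))"
  "sets (restrict_space \<nu> R) = sets (borel_of (mtopology_of mR))"
  using R_sets sets_borel_of_subtopology[of R T]
  by (simp_all add: sets_mu sets_nu mtopology_of_submetric sets_restrict_space)

lemma supp_P: "b_supp P = {x \<in> R. \<forall>e>0. emeasure \<mu> (mball_of (b_metric X) x e \<inter> R) > 0}"
proof -
  have "emeasure (restrict_space \<mu> R) (mball_of mR x e) = emeasure \<mu> (mball_of (b_metric X) x e \<inter> R)"
    if "x \<in> R" for x e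
  proof -
    have "mball_of mR x e = mball_of (b_metric X) x e \<inter> R" using that R_M by auto
    then show ?thesis using R_sets by (subst emeasure_restrict_space) auto
  qed
  then show ?thesis using mspace_R by (auto simp: b_supp_def msupp_def P_simps)
qed

lemma supp_P_sub: "b_supp P \<subseteq> S \<inter> R"
proof
  fix x assume x: "x \<in> b_supp P"
  have "emeasure \<mu> (mball_of (b_metric X) x e) > 0" if "e > 0" for e
  proof -
    have "0 < emeasure \<mu> (mball_of (b_metric X) x e \<inter> R)" using x that by (simp add: supp_P)
    also have "\<dots> \<le> emeasure \<mu> (mball_of (b_metric X) x e)"
      by (intro emeasure_mono) (simp_all add: sets_mu borel_of_open openin_mball_of)
    finally show ?thesis .
  qed
  moreover have "x \<in> R" using x unfolding supp_P by blast
  ultimately show "x \<in> S \<inter> R" using R_M unfolding b_supp_def msupp_def by blast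
qed

text \<open>Pruning may separate points of S from the mass around them, so the new support can be
  smaller than S \<inter> R, but only by a null set.\<close>

lemma SR_null: "emeasure \<mu> (S \<inter> R - b_supp P) = 0" "b_supp P \<in> sets \<mu>"
proof -
  have "separable_in (b_metric X) (S \<inter> R)" by (rule separable_in_subset[OF S_sep _ S_M]) blast
  then have sep: "separable_in mR (S \<inter> R)" by (simp add: separable_in_def)
  have SR: "S \<inter> R \<in> sets (restrict_space \<mu> R)" using S_sets R_sets by (auto simp: sets_restrict_space_iff)
  have "emeasure (restrict_space \<mu> R) (S \<inter> R - b_supp P) = 0"
    using separable_carried[OF sets_P(1) sep SR] by (simp add: b_supp_def P_simps)
  then show "emeasure \<mu> (S \<inter> R - b_supp P) = 0" using R_sets by (subst (asm) emeasure_restrict_space) auto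
  have "b_supp P \<in> sets (restrict_space \<mu> R)" using msupp_sets[OF sets_P(1)] by (simp add: b_supp_def P_simps)
  then show "b_supp P \<in> sets \<mu>" using R_sets by (auto simp: sets_restrict_space_iff)
qed

lemma R_supp_null: "emeasure \<mu> (R - b_supp P) = 0"
proof -
  have "M - S \<in> null_sets \<mu>"
    using carriedD(6)[OF car] sets.compl_sets[OF S_sets] space_mu by (auto simp: null_sets_def b_supp_def)
  moreover have "S \<inter> R - b_supp P \<in> null_sets \<mu>" using SR_null S_sets R_sets by (auto simp: null_sets_def)
  ultimately have "(M - S) \<union> (S \<inter> R - b_supp P) \<in> null_sets \<mu>" by (rule null_sets.Un)
  moreover have "R - b_supp P \<subseteq> (M - S) \<union> (S \<inter> R - b_supp P)" using R_M by blast
  moreover have "R - b_supp P \<in> sets \<mu>" using R_sets SR_null by blast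
  ultimately show ?thesis by (metis null_setsD1 null_sets_subset)
qed

lemma pre_P: "pre_bmt P"
proof -
  interpret F: finite_measure \<mu> by (rule fin_mu)
  have rt: "real_tree mR" using subtree(1)[OF R_M r_R R_down] by (simp add: rtree_def)
  have "carried mR (restrict_space \<mu> R)"
    unfolding carried_def
  proof (intro conjI)
    show "sets (restrict_space \<mu> R) = sets (borel_of (mtopology_of mR))" by (rule sets_P)
    show "finite_measure (restrict_space \<mu> R)"
      using R_sets R_M space_mu by (intro finite_measureI) (auto simp: space_restrict_space emeasure_restrict_space)
    have "separable_in (b_metric X) (b_supp P)" by (rule separable_in_subset[OF S_sep _ S_M]) (use supp_P_sub in blast)
    then show "separable_in mR (msupp mR (restrict_space \<mu> R))"
      by (simp add: separable_in_def b_supp_def P_simps)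
    show "emeasure (restrict_space \<mu> R) (mspace mR - msupp mR (restrict_space \<mu> R)) = 0"
      using R_supp_null R_sets unfolding mspace_R
      by (subst emeasure_restrict_space) (auto simp: b_supp_def P_simps)
  qed
  moreover have "sigma_finite_measure (restrict_space \<nu> R)" by (rule sigma_finite_restrict[OF sf_nu R_sets(1)])
  moreover have "AE u in restrict_space \<mu> R. emeasure (restrict_space \<nu> R) (seg mR r u) < \<infinity>"
  proof -
    have "AE u in \<mu>. u \<in> R \<longrightarrow> emeasure (restrict_space \<nu> R) (seg mR r u) < \<infinity>"
      using AE_fin
    proof eventually_elim
      case (elim u)
      show ?case
      proof
        assume u: "u \<in> R"
        have "emeasure (restrict_space \<nu> R) (seg mR r u) = emeasure \<nu> (br u)"
          using seg_R[OF u] R_down[OF u] R_sets by (simp add: emeasure_restrict_space)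
        then show "emeasure (restrict_space \<nu> R) (seg mR r u) < \<infinity>" using elim by simp
      qed
    qed
    then show ?thesis using R_sets by (subst AE_restrict_space_iff) auto
  qed
  ultimately show ?thesis using rt r_R sets_P(2) mspace_R unfolding pre_bmt_def P_simps by blast
qed

text \<open>The completion of the pruned tree is carried by the original tree: only its measures change, and the part of \<open>\<nu>\<close>
  that has become invisible on the leaves is removed.\<close>

definition comp :: "'a bmt" where
  "comp = \<lparr>b_metric = b_metric X, b_root = r, b_mu = density \<mu> (indicator R), b_nu = density \<nu> (indicator (skeleton P))\<rparr>"

lemma comp_simps: "b_metric comp = b_metric X" "b_root comp = r" "b_mu comp = density \<mu> (indicator R)"
  "b_nu comp = density \<nu> (indicator (skeleton P))"
  by (simp_all add: comp_def)

lemma emeasure_comp_mu: "B \<in> sets \<mu> \<Longrightarrow> emeasure (b_mu comp) B = emeasure \<mu> (B \<inter> R)"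
  using R_sets by (simp add: comp_simps emeasure_restricted Int_commute)

lemma supp_comp: "b_supp comp = {x \<in> M. \<forall>e>0. emeasure \<mu> (mball_of (b_metric X) x e \<inter> R) > 0}"
  using emeasure_comp_mu[of "mball_of (b_metric X) _ _"]
  by (simp add: b_supp_def msupp_def comp_simps(1) sets_mu borel_of_open openin_mball_of)

lemma supp_P_comp: "b_supp P = b_supp comp \<inter> R"
  using R_M by (auto simp: supp_P supp_comp)

lemma supp_comp_sub: "b_supp comp \<subseteq> S"
proof
  fix x assume x: "x \<in> b_supp comp"
  have "emeasure \<mu> (mball_of (b_metric X) x e) > 0" if "e > 0" for e
  proof -
    have "0 < emeasure \<mu> (mball_of (b_metric X) x e \<inter> R)" using x that by (simp add: supp_comp)
    also have "\<dots> \<le> emeasure \<mu> (mball_of (b_metric X) x e)"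
      by (intro emeasure_mono) (simp_all add: sets_mu borel_of_open openin_mball_of)
    finally show ?thesis .
  qed
  moreover have "x \<in> M" using x unfolding supp_comp by blast
  ultimately show "x \<in> S" unfolding b_supp_def msupp_def by blast
qed

lemma supp_dense: "x \<in> b_supp comp \<Longrightarrow> 0 < e \<Longrightarrow> \<exists>y\<in>b_supp P. d x y < e"
proof (rule ccontr)
  assume x: "x \<in> b_supp comp" "0 < e" and neg: "\<not> (\<exists>y\<in>b_supp P. d x y < e)"
  have "mball_of (b_metric X) x e \<inter> R \<subseteq> R - b_supp P" using neg by auto
  then have "emeasure \<mu> (mball_of (b_metric X) x e \<inter> R) \<le> emeasure \<mu> (R - b_supp P)"
    using R_sets SR_null by (intro emeasure_mono) auto
  then show False using x R_supp_null by (auto simp: supp_comp)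
qed

text \<open>New support points are limits of points of \<open>b_supp P\<close>, and by
  \<open>seg_stable\<close> a point strictly below a limit is strictly below some nearby point of
  \<open>b_supp P\<close>. So completion does not enlarge the skeleton.\<close>

lemma skeleton_comp: "skeleton comp = skeleton P"
proof -
  have "(\<Union>v\<in>b_supp comp. br v - {v}) = (\<Union>v\<in>b_supp P. br v - {v})"
  proof (intro equalityI subsetI)
    fix w assume "w \<in> (\<Union>v\<in>b_supp comp. br v - {v})"
    then obtain v where v: "v \<in> b_supp comp" "w \<in> br v" "w \<noteq> v" by blast
    have M: "v \<in> M" using v by (simp add: supp_comp)
    then have wM: "w \<in> M" using v seg_sub by blast
    have "d w v > 0" using M wM v(3) mdist_nonneg[of "b_metric X" w v] mdist_zero[of w "b_metric X" v] by linarith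
    then obtain c where "c \<in> b_supp P" "d v c < d w v" using supp_dense[OF v(1)] by blast
    then show "w \<in> (\<Union>v\<in>b_supp P. br v - {v})"
      using seg_stable[of v c w] M v(2) supp_P_sub R_M by blast
  qed (use supp_P_comp in blast)
  moreover have "seg mR r v = br v" if "v \<in> b_supp P" for v
    using seg_R that supp_P_sub by blast
  moreover have "{v \<in> M. emeasure (b_mu comp) {v} > 0} = {v \<in> R. emeasure (restrict_space \<mu> R) {v} > 0}"
  proof -
    have "emeasure (b_mu comp) {v} = (if v \<in> R then emeasure (restrict_space \<mu> R) {v} else 0)" if "v \<in> M" for v
      using emeasure_comp_mu[OF sing_sets(2)[OF that]] R_sets by (simp add: emeasure_restrict_space)
    then show ?thesis using R_M by (auto split: if_splits)
  qed
  ultimately show ?thesis using mspace_R unfolding skeleton_def comp_simps(1,2) P_simps by simp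
qed

lemma skeleton_P_sub: "skeleton P \<subseteq> R" "skeleton P \<in> sets \<nu>"
proof -
  interpret Q: pbt P using pre_P by unfold_locales
  have "skeleton P \<in> sets (restrict_space \<nu> R)" using Q.skeleton_sets by (simp add: P_simps)
  then show "skeleton P \<subseteq> R" "skeleton P \<in> sets \<nu>" using R_sets by (auto simp: sets_restrict_space_iff)
qed

text \<open>\<nu> was cut down to the skeleton, so its leaves are null by construction. The support
  is a closed subset of the complete support of X.\<close>

lemma comp_bm_trees: "comp \<in> bm_trees"
  unfolding bm_trees_iff
proof (intro conjI)
  interpret F: finite_measure \<mu> by (rule fin_mu)
  have sets: "sets (b_mu comp) = sets (borel_of T)" "sets (b_nu comp) = sets (borel_of T)"
    by (simp_all add: comp_simps sets_mu sets_nu)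
  have sep: "separable_in (b_metric X) (b_supp comp)" by (rule separable_in_subset[OF S_sep supp_comp_sub S_M])
  have "carried (b_metric X) (b_mu comp)"
    unfolding carried_def
  proof (intro conjI sets(1))
    show "finite_measure (b_mu comp)"
      using emeasure_comp_mu[of "space \<mu>"] by (intro finite_measureI) (simp add: comp_simps)
    show "separable_in (b_metric X) (msupp (b_metric X) (b_mu comp))" using sep by (simp add: b_supp_def comp_simps)
    have "msupp (b_metric X) (b_mu comp) \<in> sets \<mu>" using msupp_sets[OF sets(1)] sets(1) sets_mu by simp
    then have *: "M - msupp (b_metric X) (b_mu comp) \<in> sets \<mu>" using space_mu sets.compl_sets by metis
    have "emeasure \<mu> ((M - msupp (b_metric X) (b_mu comp)) \<inter> R) \<le> emeasure \<mu> (R - b_supp P)"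
      using supp_P_comp R_sets SR_null by (intro emeasure_mono) (auto simp: b_supp_def comp_simps(1))
    then show "emeasure (b_mu comp) (M - msupp (b_metric X) (b_mu comp)) = 0"
      using emeasure_comp_mu[OF *] R_supp_null by simp
  qed
  moreover have "sigma_finite_measure (b_nu comp)"
    using sigma_finite_density_indicator[OF sf_nu skeleton_P_sub(2)] by (simp add: comp_simps)
  moreover have "AE u in b_mu comp. emeasure (b_nu comp) (br u) < \<infinity>"
  proof -
    have "AE u in \<mu>. 0 < (indicator R u :: ennreal) \<longrightarrow> emeasure (b_nu comp) (br u) < \<infinity>"
      using AE_fin AE_space
    proof eventually_elim
      case (elim u)
      then have s: "br u \<in> sets \<nu>" using seg_sets space_mu by simp
      have "emeasure (b_nu comp) (br u) \<le> emeasure \<nu> (br u)"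
        using s skeleton_P_sub by (simp add: comp_simps emeasure_restricted emeasure_mono)
      then show ?case using elim by (simp add: order_le_less_trans)
    qed
    then show ?thesis unfolding comp_simps(3) using R_sets by (subst AE_density) auto
  qed
  ultimately show "pre_bmt comp" using tree root sets by (simp add: pre_bmt_def comp_simps(1,2))
  have "closedin T (b_supp comp)" using closedin_msupp[OF sets(1)] by (simp add: b_supp_def comp_simps)
  then show "mcomplete_of (submetric (b_metric comp) (b_supp comp))"
    using closedin_mcomplete_submetric[OF complete _ supp_comp_sub] by (simp add: comp_simps)
  interpret C: pbt comp by unfold_locales fact
  have "leaves comp \<in> sets \<nu>" using C.leaves_sets by (simp add: comp_simps)
  then have "emeasure (b_nu comp) (leaves comp) = emeasure \<nu> (skeleton P \<inter> leaves comp)"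
    using skeleton_P_sub by (simp add: comp_simps emeasure_restricted)
  also have "skeleton P \<inter> leaves comp = {}" using skeleton_comp by (auto simp: leaves_def)
  finally show "emeasure (b_nu comp) (leaves comp) = 0" by simp
qed

lemma bm_iso_comp: "bm_iso P comp"
  unfolding bm_iso_def
proof (intro exI[of _ "\<lambda>x. x"] conjI ballI)
  interpret Q: pbt P using pre_P by unfold_locales
  have WR: "b_span P (b_supp P) \<subseteq> R" using Q.W_M mspace_R by (simp add: P_simps)
  show "(\<lambda>x. x) ` b_span P (b_supp P) \<subseteq> mspace (b_metric comp)" using WR R_M by (auto simp: comp_simps)
  show "(b_root P) = b_root comp" by (simp add: P_simps comp_simps)
  fix B
  { assume "B \<in> sets (b_mu comp)"
    then have B: "B \<in> sets \<mu>" by (simp add: comp_simps)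
    have W: "b_span P (b_supp P) \<in> sets \<mu>" using Q.W_sets(2) R_sets by (auto simp: P_simps sets_restrict_space_iff)
    have eq: "{x \<in> b_span P (b_supp P). x \<in> B} = b_span P (b_supp P) \<inter> B" by auto
    have "emeasure (b_mu P) {x \<in> b_span P (b_supp P). x \<in> B} = emeasure \<mu> (b_span P (b_supp P) \<inter> B)"
      unfolding eq P_simps using WR R_sets by (subst emeasure_restrict_space) auto
    also have "\<dots> = emeasure \<mu> (B \<inter> R)"
    proof (rule emeasure_eq_AE)
      have "R - b_supp P \<in> null_sets \<mu>" using R_supp_null R_sets SR_null by (auto simp: null_sets_def)
      then show "AE x in \<mu>. (x \<in> b_span P (b_supp P) \<inter> B) = (x \<in> B \<inter> R)"
        by (rule AE_I') (use WR Q.S_W in auto)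
    qed (use W B R_sets in auto)
    finally show "emeasure (b_mu P) {x \<in> b_span P (b_supp P). x \<in> B} = emeasure (b_mu comp) B"
      using emeasure_comp_mu[OF B] by simp }
  { assume "B \<in> sets (b_nu comp)"
    then have B: "B \<in> sets \<nu>" by (simp add: comp_simps)
    have eq: "{x \<in> skeleton P. x \<in> B} = skeleton P \<inter> B" by auto
    have "emeasure (b_nu P) {x \<in> skeleton P. x \<in> B} = emeasure \<nu> (skeleton P \<inter> B)"
      unfolding eq P_simps using skeleton_P_sub R_sets by (subst emeasure_restrict_space) auto
    also have "\<dots> = emeasure (b_nu comp) (B \<inter> skeleton comp)"
      using B skeleton_P_sub unfolding comp_simps skeleton_comp
      by (subst emeasure_restricted) (auto intro!: arg_cong[where f="emeasure \<nu>"])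
    finally show "emeasure (b_nu P) {x \<in> skeleton P. x \<in> B} = emeasure (b_nu comp) (B \<inter> skeleton comp)" . }
qed (simp_all add: P_simps comp_simps)

text \<open>For surviving leaves the records are equal, not just isometric: R is closed towards the
  root and restrictions compose.\<close>

lemma tau_P:
  assumes us: "set us \<subseteq> b_supp P" shows "tau_rep P us = tau_rep X us"
proof -
  have sR: "set us \<subseteq> R" "set us \<subseteq> S" using us supp_P_sub by auto
  have sp: "b_span P (set us) = b_span X (set us)"
    unfolding b_span_def P_simps by (rule span_submetric[OF R_M r_R]) (use R_down sR in auto)
  have spR: "b_span X (set us) \<subseteq> R"
    using R_down sR(1) r_R by (auto simp: b_span_def span_tree_def)
  have sets: "b_span X (set us) \<in> sets \<nu>" by (rule span_sets[OF sR(2)])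
  have 1: "restrict_space (restrict_space \<nu> R) (b_span X (set us)) = restrict_space \<nu> (b_span X (set us))"
    using restrict_restrict_space[of R \<nu> "b_span X (set us)"] R_sets sets spR by (simp add: Int_absorb1)
  have 2: "emeasure (restrict_space \<nu> R) (b_span X (set us)) = emeasure \<nu> (b_span X (set us))"
    using spR R_sets by (intro emeasure_restrict_space) auto
  have 3: "submetric (submetric (b_metric X) R) (b_span X (set us)) = submetric (b_metric X) (b_span X (set us))"
    using spR by (simp add: Int_absorb1)
  show ?thesis unfolding tau_rep_def sp Let_def P_simps 1 2 3 ..
qed

lemma sample_P: "b_sample P = restrict_space (b_sample X) (b_supp P)" "b_supp P \<in> sets (b_sample X)"
  "emeasure (b_sample X) (S \<inter> R - b_supp P) = 0" "S \<inter> R \<in> sets (b_sample X)"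
proof -
  have s: "b_sample X = restrict_space \<mu> S" by (simp add: on_supp_def b_supp_def)
  have sub: "b_supp P \<subseteq> S" "b_supp P \<subseteq> R" using supp_P_sub by auto
  show 1: "b_supp P \<in> sets (b_sample X)" "S \<inter> R \<in> sets (b_sample X)"
    unfolding s using sub SR_null(2) S_sets R_sets by (auto simp: sets_restrict_space_iff)
  have "b_sample P = restrict_space (restrict_space \<mu> R) (b_supp P)" by (simp add: on_supp_def b_supp_def P_simps)
  also have "\<dots> = restrict_space \<mu> (R \<inter> b_supp P)"
    using restrict_restrict_space[of R \<mu> "b_supp P"] R_sets SR_null by simp
  also have "R \<inter> b_supp P = S \<inter> b_supp P" using sub by blast
  also have "restrict_space \<mu> (S \<inter> b_supp P) = restrict_space (restrict_space \<mu> S) (b_supp P)"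
    using restrict_restrict_space[of S \<mu> "b_supp P"] S_sets SR_null by simp
  finally show "b_sample P = restrict_space (b_sample X) (b_supp P)" unfolding s .
  show "emeasure (b_sample X) (S \<inter> R - b_supp P) = 0"
    unfolding s using SR_null S_sets by (subst emeasure_restrict_space) auto
qed

end

section \<open>Test functions along the sampled subtrees\<close>

lemma length_nths_upto: "length us = n \<Longrightarrow> I \<subseteq> {..<n} \<Longrightarrow> length (nths us I) = card I"
  unfolding length_nths by (rule arg_cong[where f=card]) auto

lemma nths_map_nth: "length us = n \<Longrightarrow> nths us I = map (\<lambda>i. us ! i) (nths [0..<n] I)"
  using map_nth[of us] nths_map[of "\<lambda>i. us ! i" "[0..<n]" I] by simp

lemma set_nths_upto: "set (nths [0..<n] I) \<subseteq> {..<n}"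
  by (auto dest: in_set_nthsD)

lemma prefix_list_simps [simp]: "length (prefix_list n u) = n" "i < n \<Longrightarrow> prefix_list n u ! i = u i"
  "set (prefix_list n u) = u ` {..<n}"
  by (auto simp: prefix_list_def lessThan_atLeast0)

context pbt
begin

lemma distm_list_nths:
  assumes us: "distm_list Q n us" and I: "I \<subseteq> {..<n}"
  shows "distm_list Q (card I) (\<lambda>\<omega>. nths (us \<omega>) I)"
  unfolding distm_list_def
proof (intro conjI ballI allI impI)
  fix \<omega> assume \<omega>: "\<omega> \<in> space Q"
  then show "length (nths (us \<omega>) I) = card I" using us I length_nths_upto[of "us \<omega>" n I] by (auto simp: distm_list_def)
  show "set (nths (us \<omega>) I) \<subseteq> S" using us \<omega> set_nths_subset[of "us \<omega>" I] by (auto simp: distm_list_def)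
next
  fix j assume j: "j < card I"
  then have lt: "j < length (nths [0..<n] I)" using length_nths_upto[of "[0..<n]" n I] I by simp
  then have "nths [0..<n] I ! j < n" using set_nths_upto[of n I] nth_mem by blast
  then have "distm Q (\<lambda>\<omega>. us \<omega> ! (nths [0..<n] I ! j))" using us by (simp add: distm_list_def)
  moreover have "nths (us \<omega>) I ! j = us \<omega> ! (nths [0..<n] I ! j)" if "\<omega> \<in> space Q" for \<omega>
    using us that lt nths_map_nth[of "us \<omega>" n I] by (simp add: distm_list_def)
  ultimately show "distm Q (\<lambda>\<omega>. nths (us \<omega>) I ! j)"
    unfolding distm_def by (simp cong: measurable_cong)
qed

lemma distm_list_prefix:
  assumes "\<And>i. i < n \<Longrightarrow> (\<lambda>\<omega>. u \<omega> i) \<in> measurable Q (b_sample X)"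
  shows "distm_list Q n (\<lambda>\<omega>. prefix_list n (u \<omega>))"
  using on_supp_measurable_D(2)[OF sets_mu assms] distm_sample[OF assms]
  by (auto simp: distm_list_def b_supp_def)

lemma distm_list_PiM: "distm_list (b_samples n X) n (prefix_list n)"
  by (rule distm_list_prefix) measurable

lemma fin_sample: "finite_measure (b_sample X)" "space (b_sample X) = S" "measure (b_sample X) S = b_mass X"
  using on_supp_finite[OF car] space_on_supp[OF sets_mu] by (simp_all add: b_supp_def b_mass_def)

lemma sf_sample: "sigma_finite_measure (b_sample X)"
proof -
  interpret finite_measure "b_sample X" by (rule fin_sample)
  show ?thesis by unfold_locales
qed

lemma prefix_S: "u \<in> space (b_samples n X) \<Longrightarrow> set (prefix_list n u) \<subseteq> S"
  using fin_sample(2) by (auto simp: space_PiM PiE_iff)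

lemma AE_sample: assumes "AE u in \<mu>. Q u" shows "AE u in b_sample X. Q u"
proof -
  have "AE u in \<mu>. u \<in> S \<longrightarrow> Q u" using assms by eventually_elim simp
  then show ?thesis
    unfolding on_supp_def using S_sets by (subst AE_restrict_space_iff) (auto simp: b_supp_def)
qed

lemma AE_samples: assumes "AE u in \<mu>. Q u" shows "AE u in Pi\<^sub>M {..<n::nat} (\<lambda>_. b_sample X). \<forall>i<n. Q (u i)"
  using AE_PiM_components[OF sf_sample _ AE_sample[OF assms], of "{..<n}"] by (simp add: Ball_def)

lemma span_seg: "us \<noteq> [] \<Longrightarrow> set us \<subseteq> S \<Longrightarrow> b_span X (set us) = (\<Union>u\<in>set us. br u)"
  using seg_root S_M hd_in_set[of us] unfolding b_span_def span_tree_def by blast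

lemma emeasure_span_le:
  assumes "us \<noteq> []" "set us \<subseteq> S"
  shows "emeasure \<nu> (b_span X (set us)) \<le> (\<Sum>u\<in>set us. emeasure \<nu> (br u))"
  unfolding span_seg[OF assms] using seg_sets assms(2) S_M by (intro emeasure_subadditive_finite) auto

lemma AE_span_finite:
  assumes n: "1 \<le> n"
  shows "AE u in b_samples n X. emeasure \<nu> (b_span X (set (prefix_list n u))) < \<infinity>"
  using AE_samples[OF AE_fin, of n] AE_space
proof eventually_elim
  case (elim u)
  have "emeasure \<nu> (b_span X (set (prefix_list n u))) \<le> (\<Sum>v\<in>set (prefix_list n u). emeasure \<nu> (br v))"
    using n prefix_S[OF elim(2)] by (intro emeasure_span_le) (auto simp: prefix_list_def)
  also have "\<dots> < \<infinity>" using elim(1) by (auto simp: less_top)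
  finally show ?case .
qed

lemma span_mono: "A \<subseteq> B \<Longrightarrow> b_span X A \<subseteq> b_span X B"
  by (auto simp: b_span_def span_tree_def)

text \<open>Finiteness matters: on an infinite span \<open>tau_rep\<close> carries the null measure,
  while the span of fewer points may have positive mass.\<close>

lemma project_tau:
  assumes us: "set us \<subseteq> S" and fin: "emeasure \<nu> (b_span X (set us)) < \<infinity>"
  shows "project_points I (tau_rep X us) = tau_rep X (nths us I)"
proof -
  let ?S = "b_span X (set us)" and ?vs = "nths us I"
  have vs: "set ?vs \<subseteq> set us" by (rule set_nths_subset)
  have usM: "set us \<subseteq> M" using us S_M by blast
  have SM: "?S \<subseteq> M" using span_sub[OF usM] by (simp add: span_eq)
  have down: "\<And>w. w \<in> ?S \<Longrightarrow> br w \<subseteq> ?S" using span_down[OF usM] by (simp add: span_eq)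
  have vsS: "set ?vs \<subseteq> ?S" using vs span_end[OF usM] by (auto simp: span_eq)
  have sp: "span_tree (submetric (b_metric X) ?S) r (set ?vs) = b_span X (set ?vs)"
    unfolding span_eq[of "set ?vs"] by (rule span_submetric[OF SM _ down vsS]) (auto simp: b_span_def span_tree_def)
  have sub: "b_span X (set ?vs) \<subseteq> ?S" by (rule span_mono[OF vs])
  have sets: "b_span X (set ?vs) \<in> sets \<nu>" "?S \<in> sets \<nu>" using span_sets us vs by auto
  have fin': "emeasure \<nu> (b_span X (set ?vs)) < \<infinity>"
    using emeasure_mono[OF sub sets(2)] fin by (rule order_le_less_trans)
  have 1: "restrict_space (restrict_space \<nu> ?S) (b_span X (set ?vs)) = restrict_space \<nu> (b_span X (set ?vs))"
    using restrict_restrict_space[of ?S \<nu> "b_span X (set ?vs)"] sets sub by (simp add: Int_absorb1)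
  have 2: "submetric (submetric (b_metric X) ?S) (b_span X (set ?vs)) = submetric (b_metric X) (b_span X (set ?vs))"
    using sub by (simp add: Int_absorb1)
  have t: "tau_rep X us = \<lparr>p_metric = submetric (b_metric X) ?S, p_root = r, p_points = us, p_measure = restrict_space \<nu> ?S\<rparr>"
    "tau_rep X ?vs = \<lparr>p_metric = submetric (b_metric X) (b_span X (set ?vs)), p_root = r, p_points = ?vs,
       p_measure = restrict_space \<nu> (b_span X (set ?vs))\<rparr>"
    using fin fin' by (simp_all add: tau_rep_def Let_def)
  show ?thesis unfolding t project_points_def Let_def pmm.simps sp 1 2 ..
qed

lemma tau_mass_subadditive:
  assumes us: "set us \<subseteq> S" "us \<noteq> []"
  shows "p_mass (tau_rep X us) \<le> (\<Sum>i<length us. p_mass (tau_rep X [us ! i]))"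
proof (cases "emeasure \<nu> (b_span X (set us)) < \<infinity>")
  case True
  have usi: "us ! i \<in> S" if "i < length us" for i using us(1) that nth_mem by blast
  have seg: "b_span X {us ! i} = br (us ! i)" if "i < length us" for i
    using span_seg[of "[us ! i]"] usi[OF that] by simp
  have f: "emeasure \<nu> (b_span X {us ! i}) < \<infinity>" if "i < length us" for i
    using emeasure_mono[OF span_mono span_sets[OF us(1)], of "{us ! i}"] True that by (auto intro: order_le_less_trans)
  have "ennreal (measure \<nu> (b_span X (set us))) = emeasure \<nu> (b_span X (set us))"
    using True by (simp add: emeasure_eq_ennreal_measure less_top)
  also have un: "b_span X (set us) = (\<Union>i\<in>{..<length us}. b_span X {us ! i})"
    using span_seg[OF us(2,1)] seg by (auto simp: set_conv_nth)
  also have "emeasure \<nu> \<dots> \<le> (\<Sum>i<length us. emeasure \<nu> (b_span X {us ! i}))"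
    using span_sets[of "[us ! _]"] usi by (intro emeasure_subadditive_finite) auto
  also have "\<dots> = (\<Sum>i<length us. ennreal (measure \<nu> (b_span X {us ! i})))"
    using f by (intro sum.cong) (auto simp: emeasure_eq_ennreal_measure less_top)
  finally have "measure \<nu> (b_span X (set us)) \<le> (\<Sum>i<length us. measure \<nu> (b_span X {us ! i}))"
    unfolding un by (simp add: sum_nonneg)
  then show ?thesis using tau_mass[OF us(1)] tau_mass[of "[us ! _]"] usi by simp
next
  case False
  then have "p_mass (tau_rep X us) = 0" by (simp add: total_mass_def tau_simps)
  then show ?thesis by (simp add: sum_nonneg total_mass_def)
qed

end

section \<open>Decay of test functions in the mass of the spanned subtree\<close>

lemma Cb_half_line_measurable:
  fixes \<gamma> :: "real \<Rightarrow> real"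
  assumes \<gamma>: "\<gamma> \<in> Cb (top_of_set {0..})" and f: "f \<in> borel_measurable Q" and nn: "\<And>\<omega>. 0 \<le> f \<omega>"
  shows "(\<lambda>\<omega>. \<gamma> (f \<omega>)) \<in> borel_measurable Q"
proof -
  have 1: "continuous_on {0..} \<gamma>" using \<gamma> by (simp add: Cb_def)
  \<comment> \<open>\<gamma> is continuous on the half-line only; composing it with max 0 extends it
    without changing its values at masses.\<close>
  have 2: "continuous_on UNIV (\<lambda>x::real. max 0 x)" by (intro continuous_on_max continuous_on_const continuous_on_id)
  have "continuous_on UNIV (\<lambda>x. \<gamma> (max 0 x))" by (rule continuous_on_compose2[OF 1 2]) auto
  then have "(\<lambda>x. \<gamma> (max 0 x)) \<in> borel_measurable borel" by (rule borel_measurable_continuous_onI)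
  from measurable_compose[OF f this] show ?thesis using nn by (simp add: max_absorb2)
qed

lemma decay_bound:
  fixes \<gamma> :: "real \<Rightarrow> real"
  assumes \<gamma>: "\<gamma> \<in> Cb (top_of_set {0..})" and dec: "((\<lambda>x. x ^ k * \<gamma> x) \<longlongrightarrow> 0) at_top"
  shows "\<exists>B. \<forall>x\<ge>0. x ^ k * \<bar>\<gamma> x\<bar> \<le> B"
proof -
  have "\<forall>\<^sub>F x in at_top. dist (x ^ k * \<gamma> x) 0 < 1" using tendstoD[OF dec, of 1] by simp
  then obtain a where a: "\<And>x. a \<le> x \<Longrightarrow> \<bar>x ^ k * \<gamma> x\<bar> < 1" by (auto simp: eventually_at_top_linorder)
  obtain C where C: "\<And>x. 0 \<le> x \<Longrightarrow> \<bar>\<gamma> x\<bar> \<le> C" using \<gamma> by (auto simp: Cb_def bounded_iff)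
  show ?thesis
  proof (intro exI allI impI)
    fix x :: real assume x: "0 \<le> x"
    show "x ^ k * \<bar>\<gamma> x\<bar> \<le> max 1 (\<bar>a\<bar> ^ k * C)"
    proof (cases "a \<le> x")
      case True
      then show ?thesis using a[OF True] x by (simp add: abs_mult le_max_iff_disj)
    next
      case False
      then have "x ^ k * \<bar>\<gamma> x\<bar> \<le> \<bar>a\<bar> ^ k * C" using x C[OF x] by (intro mult_mono power_mono) auto
      then show ?thesis by (simp add: le_max_iff_disj)
    qed
  qed
qed

locale test_function =
  fixes n :: nat and \<gamma> :: "nat set \<Rightarrow> real \<Rightarrow> real" and m :: "nat set \<Rightarrow> nat"
    and \<phi> :: "nat set \<Rightarrow> (nat \<times> nat \<Rightarrow> real) \<Rightarrow> real"
  assumes n: "1 \<le> n"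
    and \<phi>: "\<And>I. I \<in> Pow {..<n} - {{}} \<Longrightarrow> \<phi> I \<in> Cb (matrix_top (pairs_upto (card I + m I)))"
    and \<gamma>: "\<And>I. I \<in> Pow {..<n} - {{}} \<Longrightarrow> \<gamma> I \<in> Cb (top_of_set {0..})"
    and decay: "\<And>I k. I \<in> Pow {..<n} - {{}} \<Longrightarrow> ((\<lambda>x. x ^ k * \<gamma> I x) \<longlongrightarrow> 0) at_top"
begin

abbreviation "IX \<equiv> Pow {..<n} - {{}}"
abbreviation "Phi I \<equiv> Phi_fun (\<gamma> I) (m I) (\<phi> I)"

text \<open>The weight \<open>\<theta>\<close> is there for the semigroup, which multiplies it by \<open>exp (- t * x)\<close>.\<close>

definition EE :: "(real \<Rightarrow> real) \<Rightarrow> 'a bmt \<Rightarrow> 'a list \<Rightarrow> real" where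
  "EE \<theta> X us = \<theta> (p_mass (tau_rep X us)) * (\<Prod>I\<in>IX. Phi I (tau_rep X (nths us I)))"

text \<open>\<theta> = 1 gives \<open>Psi1\<close> (see \<open>Psi1_JJ\<close>), \<theta>(x) = exp
  (- t x) its image under the semigroup, and \<theta>(x) = x minus its generator.\<close>

definition JJ :: "(real \<Rightarrow> real) \<Rightarrow> 'a bmt \<Rightarrow> real" where
  "JJ \<theta> X = (\<integral>u. EE \<theta> X (prefix_list n u) \<partial>b_samples n X)"

lemma finite_IX: "finite IX" by simp

lemma mass_nonneg: "0 \<le> p_mass Y" by (simp add: total_mass_def)

lemma Phi_mass_bound:
  assumes I: "I \<in> IX"
  shows "\<exists>C\<ge>0. \<forall>Y::'a pmm\<in>pmm_spaces (card I). p_mass Y ^ k * \<bar>Phi I Y\<bar> \<le> C"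
proof -
  \<comment> \<open>Exponent k + m I: the m I sampled points contribute that many factors of the
    mass, and k more are to be absorbed.\<close>
  obtain B where B: "\<And>x. x \<ge> 0 \<Longrightarrow> x ^ (k + m I) * \<bar>\<gamma> I x\<bar> \<le> B"
    using decay_bound[OF \<gamma>[OF I] decay[OF I]] by blast
  obtain C where C: "\<And>R. R \<in> topspace (matrix_top (pairs_upto (card I + m I))) \<Longrightarrow> \<bar>\<phi> I R\<bar> \<le> C" "0 < C"
    using \<phi>[OF I] unfolding Cb_def bounded_pos by auto
  have B0: "0 \<le> B" using B[of 0] by (smt (verit) abs_ge_zero mult_nonneg_nonneg zero_le_power)
  show ?thesis
  proof (intro exI[of _ "B * C"] conjI ballI)
    show "0 \<le> B * C" using B0 C(2) by simp
    fix Y :: "'a pmm" assume Y: "Y \<in> pmm_spaces (card I)"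
    have "\<bar>Phi I Y\<bar> \<le> \<bar>\<gamma> I (p_mass Y)\<bar> * (C * p_mass Y ^ m I)"
      unfolding Phi_fun_samp abs_mult
      using samp_bound(1)[OF Y Cb_matrix_measurable[OF \<phi>[OF I]] C(1)] by (intro mult_left_mono) auto
    then have "p_mass Y ^ k * \<bar>Phi I Y\<bar> \<le> p_mass Y ^ k * (\<bar>\<gamma> I (p_mass Y)\<bar> * (C * p_mass Y ^ m I))"
      by (intro mult_left_mono zero_le_power mass_nonneg)
    also have "\<dots> = (p_mass Y ^ (k + m I) * \<bar>\<gamma> I (p_mass Y)\<bar>) * C" by (simp add: power_add)
    also have "\<dots> \<le> B * C" using B[OF mass_nonneg] C(2) by (intro mult_right_mono) auto
    finally show "p_mass Y ^ k * \<bar>Phi I Y\<bar> \<le> B * C" .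
  qed
qed

lemma Phi_bounds:
  obtains C :: "nat \<Rightarrow> nat set \<Rightarrow> real"
  where "\<And>k I. I \<in> IX \<Longrightarrow> 0 \<le> C k I"
    "\<And>k I (Y::'a pmm). I \<in> IX \<Longrightarrow> Y \<in> pmm_spaces (card I) \<Longrightarrow> p_mass Y ^ k * \<bar>Phi I Y\<bar> \<le> C k I"
proof -
  define C where "C k I = (SOME C. 0 \<le> C \<and> (\<forall>Y::'a pmm\<in>pmm_spaces (card I). p_mass Y ^ k * \<bar>Phi I Y\<bar> \<le> C))" for k I
  have C: "0 \<le> C k I \<and> (\<forall>Y::'a pmm\<in>pmm_spaces (card I). p_mass Y ^ k * \<bar>Phi I Y\<bar> \<le> C k I)" if "I \<in> IX" for k I
    unfolding C_def by (rule someI_ex) (rule Phi_mass_bound[OF that])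
  show thesis
  proof (rule that[of C])
    fix k I assume I: "I \<in> IX"
    show "0 \<le> C k I" using C[OF I] by blast
    fix Y :: "'a pmm" assume "Y \<in> pmm_spaces (card I)"
    then show "p_mass Y ^ k * \<bar>Phi I Y\<bar> \<le> C k I" using C[OF I] by blast
  qed
qed

lemma nths_tau_pmm:
  assumes X: "pbt X" and us: "set us \<subseteq> b_supp X" "length us = n" and I: "I \<in> IX"
  shows "tau_rep X (nths us I) \<in> pmm_spaces (card I)"
proof -
  have "set (nths us I) \<subseteq> b_supp X" using us(1) set_nths_subset[of us I] by blast
  moreover have "length (nths us I) = card I" using us(2) I length_nths_upto by auto
  ultimately show ?thesis using pbt.tau_pmm[OF X] by metis
qed

text \<open>The singletons \<open>I = {i}\<close> dominate the total mass, since \<open>\<nu>\<close> is subadditive over the segments.\<close>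

lemma EE_bound:
  "\<exists>B\<ge>0. \<forall>(X::'a bmt) us \<theta>. pbt X \<longrightarrow> set us \<subseteq> b_supp X \<longrightarrow> length us = n \<longrightarrow>
     (\<forall>x\<ge>0. \<bar>\<theta> x\<bar> \<le> x ^ k) \<longrightarrow> \<bar>EE \<theta> X us\<bar> \<le> B"
proof -
  obtain C where C: "\<And>k I. I \<in> IX \<Longrightarrow> 0 \<le> C k I"
    "\<And>k I (Y::'a pmm). I \<in> IX \<Longrightarrow> Y \<in> pmm_spaces (card I) \<Longrightarrow> p_mass Y ^ k * \<bar>Phi I Y\<bar> \<le> C k I"
    by (rule Phi_bounds) blast
  \<comment> \<open>The k-th power of the sum of the masses x i is at most n^k times that of the
    largest one. The factor with index set {i} absorbs \<open>x i ^ k\<close>, and the others are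
    bounded with exponent 0.\<close>
  define B where "B = (\<Sum>i<n. real n ^ k * (C k {i} * (\<Prod>I\<in>IX - {{i}}. C 0 I)))"
  have B0: "0 \<le> B" unfolding B_def using C(1) by (intro sum_nonneg mult_nonneg_nonneg prod_nonneg) auto
  have "\<bar>EE \<theta> X us\<bar> \<le> B"
    if X: "pbt X" and us: "set us \<subseteq> b_supp X" "length us = n" and \<theta>: "\<forall>x\<ge>0. \<bar>\<theta> x\<bar> \<le> x ^ k"
    for X :: "'a bmt" and us \<theta>
  proof -
    note tp = nths_tau_pmm[OF X us]
    let ?p = "\<Prod>I\<in>IX. \<bar>Phi I (tau_rep X (nths us I))\<bar>"
    have p0: "0 \<le> ?p" by (intro prod_nonneg) auto
    define x where "x i = p_mass (tau_rep X [us ! i])" for i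
    have x0: "0 \<le> x i" for i by (simp add: x_def mass_nonneg)
    have nth: "nths us {i} = [us ! i]" if "i < n" for i
    proof -
      have "nths us {i} = map (\<lambda>i. us ! i) (nths [0..<n] {i})" by (rule nths_map_nth[OF us(2)])
      moreover have "nths [0..<n] {i} = [i]"
      proof -
        have l: "length (nths [0..<n] {i}) = 1" using that length_nths_upto[of "[0..<n]" n "{i}"] by simp
        then obtain j where j: "nths [0..<n] {i} = [j]" by (auto simp: length_Suc_conv)
        have "j \<in> set (nths [0..<n] {i})" by (simp add: j)
        then have "j = i" by (auto simp: set_nths)
        then show ?thesis by (simp add: j)
      qed
      ultimately show ?thesis by simp
    qed
    have "us \<noteq> []" using us(2) n by (metis list.size(3) not_one_le_zero)
    then have "p_mass (tau_rep X us) \<le> (\<Sum>i<n. x i)"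
      using pbt.tau_mass_subadditive[OF X us(1)] us(2) by (simp add: x_def)
    then have 1: "p_mass (tau_rep X us) ^ k \<le> (\<Sum>i<n. x i) ^ k" using mass_nonneg by (intro power_mono) auto
    have "(\<Sum>i<n. x i) ^ k \<le> (\<Sum>i<n. real n ^ k * x i ^ k)"
    proof -
      obtain i where i: "i < n" "\<And>j. j < n \<Longrightarrow> x j \<le> x i"
      proof -
        have "0 \<in> {..<n}" using n by simp
        then have ne: "finite (x ` {..<n})" "x ` {..<n} \<noteq> {}" by blast+
        from Max_in[OF ne] obtain i where i: "Max (x ` {..<n}) = x i" "i \<in> {..<n}" by (rule imageE)
        show ?thesis
        proof (rule that[of i])
          fix j assume "j < n"
          then show "x j \<le> x i" using Max_ge[OF ne(1), of "x j"] i(1) by simp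
        qed (use i(2) in simp)
      qed
      have "(\<Sum>i<n. x i) \<le> (\<Sum>j<n. x i)" using i by (intro sum_mono) auto
      then have "(\<Sum>i<n. x i) ^ k \<le> (real n * x i) ^ k" using x0 by (intro power_mono) (auto intro: sum_nonneg)
      also have "\<dots> = real n ^ k * x i ^ k" by (simp add: power_mult_distrib)
      also have "\<dots> \<le> (\<Sum>i<n. real n ^ k * x i ^ k)" using i(1) x0 by (intro member_le_sum) auto
      finally show ?thesis .
    qed
    with 1 have "p_mass (tau_rep X us) ^ k \<le> (\<Sum>i<n. real n ^ k * x i ^ k)" by simp
    then have "\<bar>EE \<theta> X us\<bar> \<le> (\<Sum>i<n. real n ^ k * x i ^ k) * ?p"
      unfolding EE_def abs_mult abs_prod using \<theta> mass_nonneg p0 by (intro mult_right_mono) (auto intro: order_trans)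
    also have "\<dots> = (\<Sum>i<n. real n ^ k * (x i ^ k * ?p))" by (simp add: sum_distrib_right mult.assoc)
    also have "\<dots> \<le> B"
      unfolding B_def
    proof (intro sum_mono mult_left_mono)
      fix i assume "i \<in> {..<n}"
      then have i: "{i} \<in> IX" "i < n" by auto
      have "?p = \<bar>Phi {i} (tau_rep X (nths us {i}))\<bar> * (\<Prod>I\<in>IX - {{i}}. \<bar>Phi I (tau_rep X (nths us I))\<bar>)"
        using i(1) by (intro prod.remove) auto
      then have "x i ^ k * ?p = (x i ^ k * \<bar>Phi {i} (tau_rep X (nths us {i}))\<bar>) * (\<Prod>I\<in>IX - {{i}}. \<bar>Phi I (tau_rep X (nths us I))\<bar>)"
        by simp
      also have "\<dots> \<le> C k {i} * (\<Prod>I\<in>IX - {{i}}. C 0 I)"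
      proof (intro mult_mono prod_mono conjI)
        show "x i ^ k * \<bar>Phi {i} (tau_rep X (nths us {i}))\<bar> \<le> C k {i}"
          using C(2)[OF i(1) tp[OF i(1)], of k] nth[OF i(2)] by (simp add: x_def)
        fix I assume "I \<in> IX - {{i}}"
        then have I: "I \<in> IX" by simp
        show "\<bar>Phi I (tau_rep X (nths us I))\<bar> \<le> C 0 I" using C(2)[OF I tp[OF I], of 0] by simp
      qed (use C(1) i in \<open>auto intro!: prod_nonneg\<close>)
      finally show "x i ^ k * ?p \<le> C k {i} * (\<Prod>I\<in>IX - {{i}}. C 0 I)" .
    qed auto
    finally show ?thesis .
  qed
  then show ?thesis using B0 by blast
qed

lemma Phi_tau_measurable:
  assumes X: "pbt X" and us: "pbt.distm_list X Q (card I) us" and I: "I \<in> IX"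
  shows "(\<lambda>\<omega>. Phi I (tau_rep X (us \<omega>))) \<in> borel_measurable Q"
proof -
  interpret pbt X by (rule X)
  have "(\<lambda>\<omega>. samp (tau_rep X (us \<omega>)) (m I) (\<phi> I)) \<in> borel_measurable Q"
    by (rule tau_samp_measurable[OF us Cb_matrix_measurable[OF \<phi>[OF I]]])
  moreover have "(\<lambda>\<omega>. \<gamma> I (p_mass (tau_rep X (us \<omega>)))) \<in> borel_measurable Q"
    by (rule Cb_half_line_measurable[OF \<gamma>[OF I] tau_mass_measurable[OF us] mass_nonneg])
  ultimately show ?thesis unfolding Phi_fun_samp by measurable
qed

lemma EE_measurable:
  assumes X: "pbt X" and us: "pbt.distm_list X Q n us" and \<theta>: "\<theta> \<in> borel_measurable borel"
  shows "(\<lambda>\<omega>. EE \<theta> X (us \<omega>)) \<in> borel_measurable Q"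
proof -
  interpret pbt X by (rule X)
  have "(\<lambda>\<omega>. \<Prod>I\<in>IX. Phi I (tau_rep X (nths (us \<omega>) I))) \<in> borel_measurable Q"
    by (intro borel_measurable_prod Phi_tau_measurable[OF X distm_list_nths[OF us]]) auto
  moreover have "(\<lambda>\<omega>. \<theta> (p_mass (tau_rep X (us \<omega>)))) \<in> borel_measurable Q"
    by (rule measurable_compose[OF tau_mass_measurable[OF us] \<theta>])
  ultimately show ?thesis unfolding EE_def by measurable
qed

lemma Pi_tilde_EE:
  assumes X: "pbt X" and us: "set us \<subseteq> b_supp X" and fin: "emeasure (b_nu X) (b_span X (set us)) < \<infinity>"
  shows "(\<Prod>I\<in>IX. Phi I (project_points I (tau_rep X us))) = EE (\<lambda>_. 1) X us"
  using pbt.project_tau[OF X us fin] by (simp add: EE_def)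

end

lemma Pi_tilde_cases:
  assumes "\<Phi> \<in> Pi_tilde n" "1 \<le> n"
  obtains \<gamma> m \<phi> where "test_function n \<gamma> m \<phi>"
    "\<Phi> = (\<lambda>X. \<Prod>I\<in>Pow {..<n} - {{}}. Phi_fun (\<gamma> I) (m I) (\<phi> I) (project_points I X))"
proof -
  obtain F where F: "\<Phi> = (\<lambda>X. \<Prod>I\<in>Pow {..<n} - {{}}. F I (project_points I X))"
    "\<And>I. I \<in> Pow {..<n} - {{}} \<Longrightarrow> F I \<in> Pi_test (card I)"
    using assms(1) unfolding Pi_tilde_def by blast
  have "\<forall>I\<in>Pow {..<n} - {{}}. \<exists>g k p. F I = Phi_fun g k p \<and> p \<in> Cb (matrix_top (pairs_upto (card I + k))) \<and>
     g \<in> Cb (top_of_set {0..}) \<and> (\<forall>k::nat. ((\<lambda>x. x ^ k * g x) \<longlongrightarrow> 0) at_top)"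
    using F(2) unfolding Pi_test_def by blast
  from bchoice[OF this] obtain \<gamma> where
    "\<forall>I\<in>Pow {..<n} - {{}}. \<exists>k p. F I = Phi_fun (\<gamma> I) k p \<and> p \<in> Cb (matrix_top (pairs_upto (card I + k))) \<and>
     \<gamma> I \<in> Cb (top_of_set {0..}) \<and> (\<forall>k::nat. ((\<lambda>x. x ^ k * \<gamma> I x) \<longlongrightarrow> 0) at_top)" ..
  from bchoice[OF this] obtain m where
    "\<forall>I\<in>Pow {..<n} - {{}}. \<exists>p. F I = Phi_fun (\<gamma> I) (m I) p \<and> p \<in> Cb (matrix_top (pairs_upto (card I + m I))) \<and>
     \<gamma> I \<in> Cb (top_of_set {0..}) \<and> (\<forall>k::nat. ((\<lambda>x. x ^ k * \<gamma> I x) \<longlongrightarrow> 0) at_top)" ..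
  from bchoice[OF this] obtain \<phi> where
    c: "\<forall>I\<in>Pow {..<n} - {{}}. F I = Phi_fun (\<gamma> I) (m I) (\<phi> I) \<and> \<phi> I \<in> Cb (matrix_top (pairs_upto (card I + m I))) \<and>
     \<gamma> I \<in> Cb (top_of_set {0..}) \<and> (\<forall>k::nat. ((\<lambda>x. x ^ k * \<gamma> I x) \<longlongrightarrow> 0) at_top)" ..
  have "test_function n \<gamma> m \<phi>" using c assms(2) by unfold_locales auto
  moreover have "\<Phi> = (\<lambda>X. \<Prod>I\<in>Pow {..<n} - {{}}. Phi_fun (\<gamma> I) (m I) (\<phi> I) (project_points I X))"
    unfolding F(1) using c by (intro ext prod.cong) auto
  ultimately show thesis by (rule that)
qed

section \<open>Invariance and pruning of the sampling functionals\<close>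

lemma bm_treesD: "X \<in> bm_trees \<Longrightarrow> pbt X"
  by (simp add: bm_trees_iff pbt_def)

lemma bm_iso_refl:
  assumes "X \<in> bm_trees" shows "bm_iso X X"
  unfolding bm_iso_def
proof (intro exI[of _ "\<lambda>x. x"] conjI ballI)
  interpret pbt X using bm_treesD[OF assms] .
  show "(\<lambda>x. x) ` W \<subseteq> M" using W_M by simp
  fix B
  { assume B: "B \<in> sets \<mu>"
    show "emeasure \<mu> {x \<in> W. x \<in> B} = emeasure \<mu> B"
    proof (rule emeasure_eq_AE)
      show "AE x in \<mu>. (x \<in> {x \<in> W. x \<in> B}) = (x \<in> B)"
        using AE_S by eventually_elim (use S_W in auto)
      have "{x \<in> W. x \<in> B} = W \<inter> B" by auto
      then show "{x \<in> W. x \<in> B} \<in> sets \<mu>" using B W_sets by simp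
    qed (rule B) }
  show "emeasure \<nu> {x \<in> skeleton X. x \<in> B} = emeasure \<nu> (B \<inter> skeleton X)"
    by (rule arg_cong[where f="emeasure \<nu>"]) auto
qed simp_all

lemma bm_class_rep:
  assumes "bm_iso X Z" "Z \<in> bm_trees"
  shows "class_rep (bm_class X) \<in> bm_trees" "bm_iso X (class_rep (bm_class X))"
proof -
  have "Z \<in> bm_class X" using assms by (simp add: bm_class_def)
  then have "class_rep (bm_class X) \<in> bm_class X" unfolding class_rep_def by (rule someI)
  then show "class_rep (bm_class X) \<in> bm_trees" "bm_iso X (class_rep (bm_class X))" by (auto simp: bm_class_def)
qed

lemma bm_class_eq: "X \<in> bm_trees \<Longrightarrow>
    {(X, Y). X \<in> bm_trees \<and> Y \<in> bm_trees \<and> bm_iso X Y} `` {X} = bm_class X"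
  by (auto simp: bm_class_def)

lemma bm_class_Hfs:
  assumes "X \<in> bm_trees" shows "bm_class X \<in> Hfs"
  unfolding Hfs_def bm_class_eq[OF assms, symmetric] by (rule quotientI[OF assms])

lemma Hfs_rep:
  assumes "c \<in> Hfs" shows "class_rep c \<in> bm_trees" "class_rep c \<in> c"
proof -
  obtain X where X: "X \<in> bm_trees" "c = bm_class X"
    using assms bm_class_eq unfolding Hfs_def by (auto elim!: quotientE)
  then have "X \<in> c" using bm_iso_refl[OF X(1)] by (simp add: bm_class_def)
  then show "class_rep c \<in> c" unfolding class_rep_def by (rule someI)
  then show "class_rep c \<in> bm_trees" using X by (simp add: bm_class_def)
qed

lemma bm_iso_transport:
  assumes X: "pre_bmt X" and Z: "pre_bmt Z" and iso: "bm_iso X Z"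
  obtains \<phi> where "\<phi> ` b_span X (b_supp X) \<subseteq> mspace (b_metric Z)"
    "\<And>x y. x \<in> b_span X (b_supp X) \<Longrightarrow> y \<in> b_span X (b_supp X) \<Longrightarrow> mdist (b_metric Z) (\<phi> x) (\<phi> y) = mdist (b_metric X) x y"
    "\<phi> (b_root X) = b_root Z"
    "\<And>B. B \<in> sets (b_nu Z) \<Longrightarrow> emeasure (b_nu X) {x \<in> skeleton X. \<phi> x \<in> B} = emeasure (b_nu Z) (B \<inter> skeleton Z)"
    "\<phi> \<in> measurable (b_sample X) (b_sample Z)" "distr (b_sample X) (b_sample Z) \<phi> = b_sample Z"
    "b_mass Z = b_mass X"
proof -
  interpret A: pbt X using X by unfold_locales
  interpret B: pbt Z using Z by unfold_locales
  obtain \<phi> where \<phi>: "\<phi> ` A.W \<subseteq> B.M"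
    "\<And>x y. x \<in> A.W \<Longrightarrow> y \<in> A.W \<Longrightarrow> B.d (\<phi> x) (\<phi> y) = A.d x y"
    "\<phi> A.r = B.r"
    "\<And>B. B \<in> sets B.\<mu> \<Longrightarrow> emeasure A.\<mu> {x \<in> A.W. \<phi> x \<in> B} = emeasure B.\<mu> B"
    "\<And>B. B \<in> sets B.\<nu> \<Longrightarrow> emeasure A.\<nu> {x \<in> skeleton X. \<phi> x \<in> B} = emeasure B.\<nu> (B \<inter> skeleton Z)"
    using iso unfolding bm_iso_def by blast
  have sub: "msupp (b_metric X) A.\<mu> \<subseteq> A.W" using A.S_W by (simp add: b_supp_def)
  note tr = transport_on_supp[OF A.sets_mu carriedD(6)[OF A.car] B.sets_mu A.W_sets(2) sub \<phi>(1,2,4)]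
  have "b_mass Z = b_mass X" using tr(3) by (simp add: b_mass_def total_mass_def measure_def)
  then show thesis using that[OF \<phi>(1,2,3,5) tr(1,2)] by blast
qed

lemma HKs_class:
  assumes X: "X \<in> bm_trees" "b_mass X \<le> K" shows "bm_class X \<in> HKs K"
proof -
  have "b_mass Y \<le> K" if "Y \<in> bm_class X" for Y
    using that X by (auto simp: bm_class_def bm_trees_iff elim!: bm_iso_transport[of X Y])
  then show ?thesis using bm_class_Hfs[OF X(1)] by (simp add: HKs_def)
qed

lemma HKs_rep:
  assumes "c \<in> HKs K" shows "class_rep c \<in> bm_trees" "b_mass (class_rep c) \<le> K" "c \<in> Hfs"
  using assms Hfs_rep[of c] by (auto simp: HKs_def)

lemma msupp_null: "emeasure \<mu> (space \<mu>) = 0 \<Longrightarrow> msupp m \<mu> = {}"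
proof (rule equals0I)
  fix x assume 0: "emeasure \<mu> (space \<mu>) = 0" and x: "x \<in> msupp m \<mu>"
  have "emeasure \<mu> (mball_of m x 1) \<le> emeasure \<mu> (space \<mu>)" by (rule emeasure_space)
  moreover have "0 < emeasure \<mu> (mball_of m x 1)" using x unfolding msupp_def by simp
  ultimately show False using 0 by simp
qed

section \<open>Test functions on equivalent and on pruned trees\<close>

context test_function
begin

lemma full_IX: "{..<n} \<in> IX"
proof -
  have "0 \<in> {..<n}" using n by simp
  then show ?thesis by blast
qed

lemma EE_iso:
  assumes iso: "\<And>I. I \<in> IX \<Longrightarrow> pmm_iso (tau_rep X (nths us I)) (tau_rep Z (nths us' I))"
    and X: "pbt X" "set us \<subseteq> b_supp X" "length us = n" and Z: "pbt Z" "set us' \<subseteq> b_supp Z" "length us' = n"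
  shows "EE \<theta> Z us' = EE \<theta> X us"
proof -
  have "p_mass (tau_rep Z (nths us' I)) = p_mass (tau_rep X (nths us I)) \<and>
      samp (tau_rep Z (nths us' I)) (m I) (\<phi> I) = samp (tau_rep X (nths us I)) (m I) (\<phi> I)" if I: "I \<in> IX" for I
    using pmm_iso_invariant[OF iso[OF I] nths_tau_pmm[OF X I] nths_tau_pmm[OF Z I]] Cb_matrix_measurable[OF \<phi>[OF I]]
    by blast
  moreover have "nths us {..<n} = us" "nths us' {..<n} = us'" using X(3) Z(3) by (auto simp: nths_all)
  ultimately have "p_mass (tau_rep Z us') = p_mass (tau_rep X us)"
    "(\<Prod>I\<in>IX. Phi I (tau_rep Z (nths us' I))) = (\<Prod>I\<in>IX. Phi I (tau_rep X (nths us I)))"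
    using full_IX unfolding Phi_fun_samp by (metis, intro prod.cong) auto
  then show ?thesis by (simp add: EE_def)
qed

text \<open>The sample of Z is the image of the sample of X, and almost surely no leaf is a
  \<nu>-atom off the skeleton, so all spanned subtrees correspond. X need not be complete: it will
  be a pruned tree.\<close>

lemma JJ_iso:
  assumes X: "pre_bmt X" and Z: "Z \<in> bm_trees" and iso: "bm_iso X Z" and \<theta>: "\<theta> \<in> borel_measurable borel"
  shows "JJ \<theta> Z = JJ \<theta> X"
proof -
  have Z': "pre_bmt Z" "emeasure (b_nu Z) (leaves Z) = 0" using Z by (auto simp: bm_trees_iff)
  interpret A: pbt X using X by unfold_locales
  interpret B: pbt Z using Z' by unfold_locales
  obtain \<phi>' where \<phi>: "\<phi>' ` A.W \<subseteq> B.M"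
    "\<And>x y. x \<in> A.W \<Longrightarrow> y \<in> A.W \<Longrightarrow> B.d (\<phi>' x) (\<phi>' y) = A.d x y"
    "\<phi>' A.r = B.r"
    "\<And>B. B \<in> sets B.\<nu> \<Longrightarrow> emeasure A.\<nu> {x \<in> skeleton X. \<phi>' x \<in> B} = emeasure B.\<nu> (B \<inter> skeleton Z)"
    "\<phi>' \<in> measurable (b_sample X) (b_sample Z)" "distr (b_sample X) (b_sample Z) \<phi>' = b_sample Z"
    by (rule bm_iso_transport[OF X Z'(1) iso]) blast
  have m1: "(\<lambda>u. EE \<theta> Z (prefix_list n u)) \<in> borel_measurable (b_samples n Z)"
    by (rule EE_measurable[OF B.pbt_axioms B.distm_list_PiM \<theta>])
  have m2: "(\<lambda>u. EE \<theta> X (prefix_list n u)) \<in> borel_measurable (b_samples n X)"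
    by (rule EE_measurable[OF A.pbt_axioms A.distm_list_PiM \<theta>])
  have "JJ \<theta> Z = (\<integral>u. EE \<theta> Z (prefix_list n (\<lambda>i\<in>{..<n}. \<phi>' (u i))) \<partial>b_samples n X)"
    unfolding JJ_def by (rule integral_PiM_map[OF \<phi>(5) A.sf_sample B.sf_sample \<phi>(6) finite_lessThan m1])
  also have "\<dots> = JJ \<theta> X"
    unfolding JJ_def
  proof (rule integral_cong_AE)
    have "(\<lambda>u. \<lambda>i\<in>{..<n}. \<phi>' (u i)) \<in> measurable (b_samples n X) (b_samples n Z)"
      using \<phi>(5) by measurable
    from measurable_compose[OF this m1]
    show "(\<lambda>u. EE \<theta> Z (prefix_list n (\<lambda>i\<in>{..<n}. \<phi>' (u i)))) \<in> borel_measurable (b_samples n X)" .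
    show "AE u in b_samples n X. EE \<theta> Z (prefix_list n (\<lambda>i\<in>{..<n}. \<phi>' (u i))) = EE \<theta> X (prefix_list n u)"
      using A.AE_samples[OF A.AE_no_leaf_atom, of n] AE_space
    proof eventually_elim
      case (elim u)
      let ?us = "prefix_list n u"
      have us: "set ?us \<subseteq> A.S" by (rule A.prefix_S[OF elim(2)])
      have im: "\<phi>' x \<in> B.S" if "x \<in> A.S" for x
        using measurable_space[OF \<phi>(5)] that A.fin_sample(2) B.fin_sample(2) by blast
      have us': "prefix_list n (\<lambda>i\<in>{..<n}. \<phi>' (u i)) = map \<phi>' ?us" by (simp add: prefix_list_def)
      have "pmm_iso (tau_rep X (nths ?us I)) (tau_rep Z (nths (map \<phi>' ?us) I))" if I: "I \<in> IX" for I
        unfolding nths_map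
      proof (rule bm_iso_tau[OF X Z' \<phi>(1,2,3,4)])
        show "set (nths ?us I) \<subseteq> A.S" using us set_nths_subset[of ?us I] by blast
        then show "\<phi>' ` set (nths ?us I) \<subseteq> B.S" using im by blast
        have "length (nths ?us I) = card I" using I by (intro length_nths_upto[of _ n]) auto
        moreover have "card I \<noteq> 0" using I finite_subset[of I "{..<n}"] by auto
        ultimately show "nths ?us I \<noteq> []" by auto
        fix v assume "v \<in> set (nths ?us I)"
        then have "v \<in> u ` {..<n}" using set_nths_subset[of ?us I] by auto
        then show "v \<in> skeleton X \<or> emeasure A.\<nu> {v} = 0" using elim(1) by blast
      qed
      then show ?case unfolding us'
        by (rule EE_iso[OF _ A.pbt_axioms us _ B.pbt_axioms]) (use us im in auto)
    qed
  qed (rule m2)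
  finally show ?thesis .
qed

lemma JJ_null:
  assumes X: "pbt X" and "b_mass X = 0" shows "JJ \<theta> X = 0"
proof -
  interpret pbt X by (rule X)
  let ?P = "b_samples n X"
  have fin: "finite_measure ?P" "measure ?P (space ?P) = 0"
    using finite_measure_PiM[OF fin_sample(1), of "{..<n}"] fin_sample(2,3) assms(2) n by auto
  interpret P: finite_measure ?P by (rule fin(1))
  have "emeasure ?P (space ?P) = 0" using fin(2) by (simp add: P.emeasure_eq_measure)
  then have "AE v in ?P. EE \<theta> X (prefix_list n v) = 0" by (intro AE_I[of _ _ "space ?P"]) auto
  then show ?thesis unfolding JJ_def by (rule integral_eq_zero_AE)
qed

text \<open>The sample of the pruned tree is the original one restricted to the remaining points, up
  to a null set, and surviving points span the same subtrees as before. Passing to a representative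
  of the class does not change \<open>JJ\<close> by \<open>JJ_iso\<close>.\<close>

lemma JJ_prune:
  assumes X: "X \<in> bm_trees" and A: "countable A" "A \<subseteq> mspace (b_metric X)" and \<theta>: "\<theta> \<in> borel_measurable borel"
  shows "class_rep (bm_class (prune X A)) \<in> bm_trees \<and> JJ \<theta> (class_rep (bm_class (prune X A))) =
    (\<integral>u. (\<Prod>i<n. indicator (remaining X A) (u i)) * EE \<theta> X (prefix_list n u) \<partial>b_samples n X)"
proof -
  interpret pbt X using bm_treesD[OF X] .
  have complete: "mcomplete_of (submetric (b_metric X) S)" using X by (simp add: bm_trees_iff)
  show ?thesis
  proof (cases "remaining X A = {}")
    case True
    let ?O = "prune X A"
    \<comment> \<open>X with both measures set to 0 witnesses that the class of the one-point tree
      is inhabited; the chosen representative then has mass 0.\<close>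
    let ?Z = "\<lparr>b_metric = b_metric X, b_root = r, b_mu = null_measure \<mu>, b_nu = null_measure \<nu>\<rparr>"
    have O: "?O = \<lparr>b_metric = submetric (b_metric X) {r}, b_root = r, b_mu = null_measure (count_space {r}),
          b_nu = null_measure (count_space {r})\<rparr>" using True by (simp add: prune_def Let_def)
    have s0: "msupp (b_metric X) (null_measure \<mu>) = {}" by (rule msupp_null) simp
    have s1: "msupp (submetric (b_metric X) {r}) (null_measure (count_space {r})) = {}" by (rule msupp_null) simp
    have f0: "finite_measure (null_measure N)" for N :: "'a measure" by (intro finite_measureI) simp
    have "sigma_finite_measure (null_measure \<nu>)" using f0 by (rule finite_measure.axioms(1))
    moreover have "separable_in (b_metric X) {}" by (auto simp: separable_in_def)
    moreover have "AE u in null_measure \<mu>. emeasure (null_measure \<nu>) (br u) < \<infinity>" by simp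
    ultimately have "pre_bmt ?Z"
      unfolding pre_bmt_def bmt.simps carried_def s0
      using tree root f0 by (simp add: sets_mu sets_nu)
    moreover have "mcomplete_of (submetric (b_metric X) {})"
      by (rule closedin_mcomplete_submetric[OF complete]) auto
    ultimately have Z: "?Z \<in> bm_trees" unfolding bm_trees_iff by (simp add: b_supp_def s0)
    have iso: "bm_iso ?O ?Z"
      unfolding bm_iso_def O by (intro exI[of _ "\<lambda>x. x"]) (use root in \<open>simp add: b_supp_def s1 b_span_def span_tree_def\<close>)
    let ?R = "class_rep (bm_class ?O)"
    note R = bm_class_rep[OF iso Z]
    have "emeasure (b_mu ?R) B = 0" if "B \<in> sets (b_mu ?R)" for B
    proof -
      obtain \<psi> where "\<And>B. B \<in> sets (b_mu ?R) \<Longrightarrow>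
        emeasure (b_mu ?O) {x \<in> b_span ?O (b_supp ?O). \<psi> x \<in> B} = emeasure (b_mu ?R) B"
        using R(2) unfolding bm_iso_def by blast
      then show ?thesis using that by (simp add: O)
    qed
    then have "b_mass ?R = 0" by (simp add: b_mass_def total_mass_def measure_def)
    then have "JJ \<theta> ?R = 0" by (rule JJ_null[OF bm_treesD[OF R(1)]])
    moreover have z: "(\<Prod>i<n. indicator (remaining X A) (u i)) = (0::real)" for u :: "nat \<Rightarrow> 'a"
    proof (rule prod_zero)
      have "0 \<in> {..<n}" using n by simp
      then show "\<exists>i\<in>{..<n}. indicator (remaining X A) (u i) = (0::real)" by (intro bexI[of _ 0]) (simp add: True)
    qed simp
    ultimately show ?thesis using R(1) by (simp only: z mult_zero_left Bochner_Integration.integral_zero simp_thms)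
  next
    case False
    interpret pruned X A using A complete False by unfold_locales
    interpret Q: pbt P using pre_P by unfold_locales
    let ?f = "\<lambda>u. EE \<theta> X (prefix_list n u)"
    have fm: "?f \<in> borel_measurable (b_samples n X)"
      by (rule EE_measurable[OF pbt_axioms distm_list_PiM \<theta>])
    note R = bm_class_rep[OF bm_iso_comp comp_bm_trees]
    have "JJ \<theta> (class_rep (bm_class P)) = JJ \<theta> P" by (rule JJ_iso[OF pre_P R \<theta>])
    also have "\<dots> = (\<integral>u. ?f u \<partial>b_samples n P)"
      unfolding JJ_def
    proof (rule Bochner_Integration.integral_cong[OF refl])
      fix u assume "u \<in> space (b_samples n P)"
      then have us: "set (prefix_list n u) \<subseteq> b_supp P" by (rule Q.prefix_S)
      have "tau_rep P (nths (prefix_list n u) I) = tau_rep X (nths (prefix_list n u) I)" for I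
        using us set_nths_subset[of "prefix_list n u" I] by (intro tau_P) blast
      then show "EE \<theta> P (prefix_list n u) = ?f u" using tau_P[OF us] by (simp add: EE_def)
    qed
    also have "\<dots> = (\<integral>u. (\<Prod>i<n. indicator (b_supp P) (u i)) * ?f u \<partial>b_samples n X)"
      unfolding sample_P(1) by (rule integral_PiM_restrict[OF sf_sample sample_P(2) finite_lessThan fm])
    \<comment> \<open>The support of the pruned tree is replaced by the set of surviving points, a
      condition that can be read off the cuts.\<close>
    also have "\<dots> = (\<integral>u. (\<Prod>i<n. indicator (S \<inter> R) (u i)) * ?f u \<partial>b_samples n X)"
    proof (rule integral_cong_AE)
      have "S \<inter> R - b_supp P \<in> null_sets (b_sample X)" using sample_P by (auto simp: null_sets_def)
      then have "AE x in b_sample X. indicator (b_supp P) x = (indicator (S \<inter> R) x :: real)"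
        by (rule AE_I') (use supp_P_sub in \<open>auto simp: indicator_def\<close>)
      from AE_PiM_components[OF sf_sample _ this, of "{..<n}", OF finite_lessThan]
      show "AE u in b_samples n X. (\<Prod>i<n. indicator (b_supp P) (u i)) * ?f u = (\<Prod>i<n. indicator (S \<inter> R) (u i)) * ?f u"
        by eventually_elim simp
      show "(\<lambda>u. (\<Prod>i<n. indicator (b_supp P) (u i)) * ?f u) \<in> borel_measurable (b_samples n X)"
        using sample_P(2) fm by measurable
      show "(\<lambda>u. (\<Prod>i<n. indicator (S \<inter> R) (u i)) * ?f u) \<in> borel_measurable (b_samples n X)"
        using sample_P(4) fm by measurable
    qed
    also have "\<dots> = (\<integral>u. (\<Prod>i<n. indicator R (u i)) * ?f u \<partial>b_samples n X)"
    proof (rule Bochner_Integration.integral_cong[OF refl])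
      fix u assume "u \<in> space (b_samples n X)"
      then have "u i \<in> S" if "i < n" for i using that fin_sample(2) by (auto simp: space_PiM PiE_iff)
      then have "(\<Prod>i<n. indicator (S \<inter> R) (u i)) = (\<Prod>i<n. indicator R (u i) :: real)"
        by (intro prod.cong) (auto simp: indicator_def)
      then show "(\<Prod>i<n. indicator (S \<inter> R) (u i)) * ?f u = (\<Prod>i<n. indicator R (u i)) * ?f u" by simp
    qed
    finally show ?thesis using R(1) by simp
  qed
qed

end

section \<open>Continuity of the sampling functionals\<close>

text \<open>The restriction of the measure to a subtree is not continuous for the Gromov-weak topology.  It is approximated by
  cut-off functions \<open>h\<close> of twice the distance \<open>r(\<rho>,v) + r(u,v) - r(\<rho>,u)\<close> of \<open>v\<close> to \<open>[\<rho>,u]\<close>.\<close>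

definition cutoff :: "nat \<Rightarrow> real \<Rightarrow> real" where
  "cutoff j x = max 0 (min 1 (1 - real (Suc j) * x))"

definition cutoff_lim :: "real \<Rightarrow> real" where
  "cutoff_lim x = (if x \<le> 0 then 1 else 0)"

lemma cutoff_tendsto: "(\<lambda>j. cutoff j x) \<longlonglongrightarrow> cutoff_lim x"
proof (cases "x \<le> 0")
  case True
  then have "cutoff j x = 1" for j by (simp add: cutoff_def mult_nonneg_nonpos)
  then show ?thesis using True by (simp add: cutoff_lim_def)
next
  case False
  then obtain j0 :: nat where j0: "1 / x < real j0" using reals_Archimedean2 by blast
  have "\<forall>\<^sub>F j in sequentially. cutoff j x = 0"
    using eventually_ge_at_top[of j0]
  proof eventually_elim
    case (elim j)
    then have "1 / x < real (Suc j)" using j0 by simp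
    then have "1 < real (Suc j) * x" using False by (simp add: field_simps)
    then show ?case by (simp add: cutoff_def)
  qed
  then show ?thesis using False by (simp add: cutoff_lim_def tendsto_eventually)
qed

lemma cutoff_range: "0 \<le> cutoff j x" "cutoff j x \<le> 1" "0 \<le> cutoff_lim x" "cutoff_lim x \<le> 1"
  by (auto simp: cutoff_def cutoff_lim_def)

lemma cutoff_measurable: "cutoff_lim \<in> borel_measurable borel"
proof -
  have "cutoff_lim = indicator {..0}" by (auto simp: cutoff_lim_def indicator_def)
  moreover have "(indicator {..0::real} :: real \<Rightarrow> real) \<in> borel_measurable borel"
    by (intro borel_measurable_indicator) simp
  ultimately show ?thesis by simp
qed

section \<open>Subtrees of some marked points seen from the full configuration\<close>

lemma nths_upto_less:
  assumes "J \<subseteq> {..<n}" "i < card J" shows "nths [0..<n] J ! i < n"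
proof -
  have "length (nths [0..<n] J) = card J" using length_nths_upto[of "[0..<n]" n J] assms by simp
  then have "nths [0..<n] J ! i \<in> set (nths [0..<n] J)" using assms(2) by simp
  then show ?thesis using set_nths_upto[of n J] by blast
qed

text \<open>A soft union over J: with h = \<open>cutoff_lim\<close> it is the indicator that the
  point at position s lies on the root segment of some p in J. \<open>Suc p\<close> is the position
  of the p-th marked point, 0 that of the root.\<close>

definition near :: "(real \<Rightarrow> real) \<Rightarrow> nat set \<Rightarrow> nat \<Rightarrow> (nat \<times> nat \<Rightarrow> real) \<Rightarrow> real" where
  "near h J s R = 1 - (\<Prod>p\<in>J. 1 - h (R (0, s) + R (Suc p, s) - R (0, Suc p)))"

lemma near_range:
  assumes "\<And>x. 0 \<le> h x" "\<And>x. h x \<le> 1"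
  shows "0 \<le> near h J s R" "near h J s R \<le> 1"
proof -
  have "(\<Prod>p\<in>J. 1 - h (R (0, s) + R (Suc p, s) - R (0, Suc p))) \<le> 1" by (rule prod_le_1) (use assms in auto)
  then show "0 \<le> near h J s R" by (simp add: near_def)
  have "0 \<le> (\<Prod>p\<in>J. 1 - h (R (0, s) + R (Suc p, s) - R (0, Suc p)))" by (rule prod_nonneg) (use assms in auto)
  then show "near h J s R \<le> 1" by (simp add: near_def)
qed

text \<open>Position of the \<open>a\<close>-th point of the configuration \<open>\<rho>, u\<^sub>J, v\<close> in \<open>\<rho>, u, v\<close>.\<close>

definition pos :: "nat \<Rightarrow> nat set \<Rightarrow> nat \<Rightarrow> nat" where
  "pos n J a = (if a = 0 then 0 else if a \<le> card J then Suc (nths [0..<n] J ! (a - 1)) else n + (a - card J))"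

text \<open>\<psi> on the subconfiguration J written as a function of the full matrix. The factors
  \<open>near\<close> do the work of restricting the measure to the subtree of J.\<close>

definition lift :: "(real \<Rightarrow> real) \<Rightarrow> nat \<Rightarrow> nat set \<Rightarrow> nat \<Rightarrow> ((nat \<times> nat \<Rightarrow> real) \<Rightarrow> real) \<Rightarrow> (nat \<times> nat \<Rightarrow> real) \<Rightarrow> real" where
  "lift h n J k \<psi> R = \<psi> (\<lambda>(a, b)\<in>pairs_upto (card J + k). R (pos n J a, pos n J b)) * (\<Prod>i<k. near h J (n + 1 + i) R)"

text \<open>Monotonicity keeps relabelled pairs in the form i < j by which the matrices are
  indexed.\<close>

lemma pos_less:
  assumes J: "J \<subseteq> {..<n}" and ab: "a < b" shows "pos n J a < pos n J b"
proof -
  let ?L = "nths [0..<n] J"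
  have len: "length ?L = card J" using length_nths_upto[of "[0..<n]" n J] J by simp
  have lt: "?L ! i < n" if "i < card J" for i using nths_upto_less[OF J that] .
  have "sorted_wrt (<) ?L" by (simp add: strict_sorted_iff sorted_nths distinct_nthsI)
  then have mono: "?L ! i < ?L ! j" if "i < j" "j < card J" for i j using that len by (simp add: sorted_wrt_nth_less)
  show ?thesis
  proof (cases "b \<le> card J")
    case True
    then show ?thesis using ab mono[of "a - 1" "b - 1"] by (auto simp: pos_def)
  next
    case False
    consider "a = 0" | "0 < a" "a \<le> card J" | "card J < a" by linarith
    then show ?thesis
    proof cases
      case 2
      then have "?L ! (a - 1) < n" using lt[of "a - 1"] by simp
      moreover have "n + (b - card J) > n" using False by simp
      ultimately show ?thesis using 2 False unfolding pos_def by simp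
    qed (use ab False in \<open>auto simp: pos_def\<close>)
  qed
qed

lemma pos_le:
  assumes J: "J \<subseteq> {..<n}" and a: "a \<le> card J + k" shows "pos n J a \<le> n + k"
proof (cases "a = 0 \<or> card J < a")
  case True then show ?thesis using a by (auto simp: pos_def)
next
  case False
  then have "a - 1 < card J" by linarith
  then show ?thesis using False nths_upto_less[OF J, of "a - 1"] by (auto simp: pos_def)
qed

lemma pos_pairs: "J \<subseteq> {..<n} \<Longrightarrow> (a, b) \<in> pairs_upto (card J + k) \<Longrightarrow> (pos n J a, pos n J b) \<in> pairs_upto (n + k)"
  using pos_less pos_le by (auto simp: pairs_upto_def)

lemma relabel_continuous:
  assumes "J \<subseteq> {..<n}"
  shows "continuous_map (matrix_top (pairs_upto (n + k))) (matrix_top (pairs_upto (card J + k)))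
    (\<lambda>R. \<lambda>(a, b)\<in>pairs_upto (card J + k). R (pos n J a, pos n J b))"
  unfolding matrix_top_def continuous_map_componentwise
proof (intro conjI ballI)
  fix p assume p: "p \<in> pairs_upto (card J + k)"
  obtain a b where ab: "p = (a, b)" by (cases p)
  have "continuous_map (product_topology (\<lambda>_. top_of_set {0..}) (pairs_upto (n + k))) (top_of_set {0..}) (\<lambda>R. R (pos n J a, pos n J b))"
    using pos_pairs[OF assms, of a b k] p ab by (intro continuous_map_product_projection) auto
  then show "continuous_map (product_topology (\<lambda>_. top_of_set {0..}) (pairs_upto (n + k))) (top_of_set {0..})
     (\<lambda>R. (\<lambda>(a, b)\<in>pairs_upto (card J + k). R (pos n J a, pos n J b)) p)" using p ab by simp
qed auto

lemma relabel_measurable: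
  assumes J: "J \<subseteq> {..<n}"
  shows "(\<lambda>R. \<lambda>(a, b)\<in>pairs_upto (card J + k). R (pos n J a, pos n J b))
    \<in> measurable (borel_of (matrix_top (pairs_upto (n + k)))) (borel_of (matrix_top (pairs_upto (card J + k))))"
proof (rule measurable_into_matrix_top)
  fix R assume "R \<in> space (borel_of (matrix_top (pairs_upto (n + k))))"
  then show "(\<lambda>(a, b)\<in>pairs_upto (card J + k). R (pos n J a, pos n J b)) \<in> topspace (matrix_top (pairs_upto (card J + k)))"
    using continuous_map_image_subset_topspace[OF relabel_continuous[OF J, of k]] by auto
next
  fix p assume p: "p \<in> pairs_upto (card J + k)"
  obtain a b where ab: "p = (a, b)" by (cases p)
  show "(\<lambda>R. (\<lambda>(a, b)\<in>pairs_upto (card J + k). R (pos n J a, pos n J b)) p) \<in> borel_measurable (borel_of (matrix_top (pairs_upto (n + k))))"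
    using matrix_entry_measurable[OF pos_pairs[OF J, of a b k]] p ab by simp
qed

lemma near_pairs:
  assumes "J \<subseteq> {..<n}" "i < k" "p \<in> J"
  shows "(0, n + 1 + i) \<in> pairs_upto (n + k)" "(Suc p, n + 1 + i) \<in> pairs_upto (n + k)" "(0, Suc p) \<in> pairs_upto (n + k)"
  using assms by (auto simp: pairs_upto_def)

lemma near_measurable:
  assumes J: "J \<subseteq> {..<n}" and i: "i < k" and h: "h \<in> borel_measurable borel"
  shows "matrix_measurable (n + k) (near h J (n + 1 + i))"
  unfolding near_def
proof (intro borel_measurable_diff borel_measurable_prod borel_measurable_const)
  fix p assume p: "p \<in> J"
  have "(\<lambda>R. R (0, n + 1 + i) + R (Suc p, n + 1 + i) - R (0, Suc p)) \<in> borel_measurable (borel_of (matrix_top (pairs_upto (n + k))))"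
    by (intro borel_measurable_diff borel_measurable_add matrix_entry_measurable near_pairs[OF J i p])
  from measurable_compose[OF this h]
  show "(\<lambda>R. h (R (0, n + 1 + i) + R (Suc p, n + 1 + i) - R (0, Suc p))) \<in> borel_measurable (borel_of (matrix_top (pairs_upto (n + k))))" .
qed

lemma lift_measurable:
  assumes J: "J \<subseteq> {..<n}" and \<psi>: "matrix_measurable (card J + k) \<psi>" and h: "h \<in> borel_measurable borel"
  shows "matrix_measurable (n + k) (lift h n J k \<psi>)"
  unfolding lift_def
  by (intro borel_measurable_times borel_measurable_prod near_measurable[OF J _ h] measurable_compose[OF relabel_measurable[OF J] \<psi>]) auto

lemma matrix_entry_continuous: "p \<in> I \<Longrightarrow> continuous_map (matrix_top I) euclideanreal (\<lambda>R. R p)"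
  using generated_by_continuous[OF generated_by_matrix_top[of I], of "(p, ())"] by simp

lemma lift_bound:
  assumes B: "\<And>R. R \<in> topspace (matrix_top (pairs_upto (card J + k))) \<Longrightarrow> \<bar>\<psi> R\<bar> \<le> B" and J: "J \<subseteq> {..<n}"
    and h: "\<And>x. 0 \<le> h x" "\<And>x. h x \<le> 1" and R: "R \<in> topspace (matrix_top (pairs_upto (n + k)))"
  shows "\<bar>lift h n J k \<psi> R\<bar> \<le> B"
proof -
  have 1: "\<bar>\<psi> (\<lambda>(a, b)\<in>pairs_upto (card J + k). R (pos n J a, pos n J b))\<bar> \<le> B"
    using continuous_map_image_subset_topspace[OF relabel_continuous[OF J, of k]] R by (intro B) blast
  have 2: "0 \<le> (\<Prod>i<k. near h J (n + 1 + i) R)" "(\<Prod>i<k. near h J (n + 1 + i) R) \<le> 1"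
    using near_range[OF h] by (auto intro!: prod_nonneg prod_le_1)
  have "\<bar>lift h n J k \<psi> R\<bar> \<le> B * 1"
    unfolding lift_def abs_mult using 1 2 by (intro mult_mono) auto
  then show ?thesis by simp
qed

lemma lift_Cb:
  assumes J: "J \<subseteq> {..<n}" and \<psi>: "\<psi> \<in> Cb (matrix_top (pairs_upto (card J + k)))"
  shows "lift (cutoff j) n J k \<psi> \<in> Cb (matrix_top (pairs_upto (n + k)))"
proof -
  obtain B where B: "\<And>R. R \<in> topspace (matrix_top (pairs_upto (card J + k))) \<Longrightarrow> \<bar>\<psi> R\<bar> \<le> B"
    using \<psi> by (auto simp: Cb_def bounded_iff)
  have \<psi>c: "continuous_map (matrix_top (pairs_upto (card J + k))) euclideanreal \<psi>" using \<psi> by (simp add: Cb_def)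
  have 1: "continuous_map (matrix_top (pairs_upto (n + k))) euclideanreal
      (\<lambda>R. \<psi> (\<lambda>(a, b)\<in>pairs_upto (card J + k). R (pos n J a, pos n J b)))"
    using continuous_map_compose[OF relabel_continuous[OF J, of k] \<psi>c] by (simp add: comp_def)
  have fin: "finite J" using J finite_subset by blast
  have 2: "continuous_map (matrix_top (pairs_upto (n + k))) euclideanreal (near (cutoff j) J (n + 1 + i))" if i: "i < k" for i
    unfolding near_def cutoff_def
    by (intro continuous_map_diff continuous_map_prod[OF fin] continuous_map_real_max continuous_map_real_min
        continuous_map_real_mult continuous_map_add continuous_map_canonical_const matrix_entry_continuous near_pairs[OF J i])
  have "continuous_map (matrix_top (pairs_upto (n + k))) euclideanreal (lift (cutoff j) n J k \<psi>)"
    unfolding lift_def[abs_def] by (intro continuous_map_real_mult 1 continuous_map_prod 2) auto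
  moreover have "bounded (lift (cutoff j) n J k \<psi> ` topspace (matrix_top (pairs_upto (n + k))))"
    unfolding bounded_iff real_norm_def
  proof (intro exI[of _ B] ballI)
    fix z assume "z \<in> lift (cutoff j) n J k \<psi> ` topspace (matrix_top (pairs_upto (n + k)))"
    then obtain R where R: "R \<in> topspace (matrix_top (pairs_upto (n + k)))" "z = lift (cutoff j) n J k \<psi> R" by blast
    show "\<bar>z\<bar> \<le> B" unfolding R(2) by (rule lift_bound[OF _ J cutoff_range(1,2) R(1)]) (rule B)
  qed
  ultimately show ?thesis by (simp add: Cb_def)
qed

lemma lift_tendsto: "(\<lambda>j. lift (cutoff j) n J k \<psi> R) \<longlonglongrightarrow> lift cutoff_lim n J k \<psi> R"
  unfolding lift_def near_def by (intro tendsto_intros cutoff_tendsto)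

lemma samp_lift_tendsto:
  assumes Y: "Y \<in> pmm_spaces n" and J: "J \<subseteq> {..<n}" and \<psi>: "\<psi> \<in> Cb (matrix_top (pairs_upto (card J + k)))"
  shows "(\<lambda>j. samp Y k (lift (cutoff j) n J k \<psi>)) \<longlonglongrightarrow> samp Y k (lift cutoff_lim n J k \<psi>)"
proof -
  obtain B where B: "\<And>R. R \<in> topspace (matrix_top (pairs_upto (card J + k))) \<Longrightarrow> \<bar>\<psi> R\<bar> \<le> B"
    using \<psi> by (auto simp: Cb_def bounded_iff)
  have m: "matrix_measurable (n + k) (lift (cutoff j) n J k \<psi>)" for j by (rule Cb_matrix_measurable[OF lift_Cb[OF J \<psi>]])
  have m': "matrix_measurable (n + k) (lift cutoff_lim n J k \<psi>)"
    by (rule lift_measurable[OF J Cb_matrix_measurable[OF \<psi>] cutoff_measurable])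
  show ?thesis
    unfolding samp_def pmm_spacesD(1)[OF Y]
  proof (rule integral_dominated_convergence[where w="\<lambda>_. B"])
    show "integrable (Pi\<^sub>M {..<k} (\<lambda>_. p_sample Y)) (\<lambda>_. B)"
      using finite_measure_PiM(1)[OF on_supp_finite(1)[OF pmm_spacesD(4)[OF Y]], of "{..<k}"]
      by (simp add: finite_measure.integrable_const)
    show "AE v in Pi\<^sub>M {..<k} (\<lambda>_. p_sample Y).
        norm (lift (cutoff j) n J k \<psi> (dist_matrix (pairs_upto (n + k)) Y v)) \<le> B" for j
    proof (rule AE_I2)
      fix v
      have "\<bar>lift (cutoff j) n J k \<psi> (dist_matrix (pairs_upto (n + k)) Y v)\<bar> \<le> B"
        by (rule lift_bound[OF _ J cutoff_range(1,2) dist_matrix_topspace]) (rule B)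
      then show "norm (lift (cutoff j) n J k \<psi> (dist_matrix (pairs_upto (n + k)) Y v)) \<le> B" by simp
    qed
  qed (auto intro!: samp_measurable[OF Y] m m' lift_tendsto)
qed

lemma tau_relabel:
  assumes len: "length us = n" and J: "J \<subseteq> {..<n}"
  shows "points_then (tau_rep X us) v (pos n J a) = points_then (tau_rep X (nths us J)) v a"
proof -
  let ?L = "nths [0..<n] J"
  have ll: "length ?L = card J" "length (nths us J) = card J"
    using length_nths_upto[of "[0..<n]" n J] length_nths_upto[OF len J] J by auto
  consider "a = 0" | "0 < a" "a \<le> card J" | "card J < a" by linarith
  then show ?thesis
  proof cases
    case 1 then show ?thesis by (simp add: pos_def points_then_def tau_rep_def Let_def)
  next
    case 2
    then have a: "a - 1 < card J" by linarith
    have "?L ! (a - 1) < n" by (rule nths_upto_less[OF J a])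
    moreover have "nths us J ! (a - 1) = us ! (?L ! (a - 1))" using a ll nths_map_nth[OF len, of J] by simp
    ultimately show ?thesis using 2 len ll by (simp add: pos_def points_then_def tau_rep_def Let_def)
  next
    case 3
    then have "\<not> n + (a - card J) \<le> n" "n + (a - card J) - 1 - n = a - 1 - card J" by auto
    then show ?thesis using 3 len ll unfolding pos_def points_then_def tau_rep_def Let_def by simp
  qed
qed

lemma tau_relabel_matrix:
  assumes len: "length us = n" and J: "J \<subseteq> {..<n}"
  shows "(\<lambda>(a, b)\<in>pairs_upto (card J + k). dist_matrix (pairs_upto (n + k)) (tau_rep X us) v (pos n J a, pos n J b))
    = dist_matrix (pairs_upto (card J + k)) (tau_rep X (nths us J)) v"
proof
  fix p :: "nat \<times> nat"
  obtain a b where p: "p = (a, b)" by (cases p)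
  show "(\<lambda>(a, b)\<in>pairs_upto (card J + k). dist_matrix (pairs_upto (n + k)) (tau_rep X us) v (pos n J a, pos n J b)) p
    = dist_matrix (pairs_upto (card J + k)) (tau_rep X (nths us J)) v p"
  proof (cases "p \<in> pairs_upto (card J + k)")
    case True
    then show ?thesis using pos_pairs[OF J, of a b k] p tau_relabel[OF len J, of X v]
      by (simp add: dist_matrix_apply) (simp add: tau_rep_def Let_def)
  next
    case False
    then show ?thesis by (simp add: p dist_matrix_def)
  qed
qed

lemma near_tau:
  assumes len: "length us = n" and J: "J \<subseteq> {..<n}" and i: "i < k"
  shows "near h J (n + 1 + i) (dist_matrix (pairs_upto (n + k)) (tau_rep X us) v) =
    1 - (\<Prod>p\<in>J. 1 - h (mdist (b_metric X) (b_root X) (v i) + mdist (b_metric X) (us ! p) (v i) - mdist (b_metric X) (b_root X) (us ! p)))"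
  unfolding near_def
proof (intro arg_cong2[where f="(-)"] prod.cong refl arg_cong[where f=h] arg_cong2[where f="(+)"])
  fix p assume p: "p \<in> J"
  have "p < n" using p J by auto
  then show "dist_matrix (pairs_upto (n + k)) (tau_rep X us) v (0, n + 1 + i) = mdist (b_metric X) (b_root X) (v i)"
    "dist_matrix (pairs_upto (n + k)) (tau_rep X us) v (Suc p, n + 1 + i) = mdist (b_metric X) (us ! p) (v i)"
    "dist_matrix (pairs_upto (n + k)) (tau_rep X us) v (0, Suc p) = mdist (b_metric X) (b_root X) (us ! p)"
    using near_pairs[OF J i p] len by (simp_all add: dist_matrix_apply) (simp_all add: points_then_def tau_rep_def Let_def)
qed

text \<open>With the sharp cut-off the factors \<open>near\<close> are exactly indicators of the
  smaller subtree, so weighting samples of the large subtree by them is sampling in the small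
  one.\<close>

lemma (in pbt) samp_tau_lift:
  assumes us: "set us \<subseteq> S" "length us = n" and fin: "emeasure \<nu> (b_span X (set us)) < \<infinity>"
    and J: "J \<subseteq> {..<n}" "J \<noteq> {}" and \<psi>: "matrix_measurable (card J + k) \<psi>"
  shows "samp (tau_rep X us) k (lift cutoff_lim n J k \<psi>) = samp (tau_rep X (nths us J)) k \<psi>"
proof -
  let ?vs = "nths us J"
  have vs: "set ?vs \<subseteq> set us" by (rule set_nths_subset)
  then have vsS: "set ?vs \<subseteq> S" using us by blast
  have lvs: "length ?vs = card J" by (rule length_nths_upto[OF us(2) J(1)])
  have fin': "emeasure \<nu> (b_span X (set ?vs)) < \<infinity>"
    using emeasure_mono[OF span_mono[OF vs] span_sets[OF us(1)]] fin by (rule order_le_less_trans)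
  have "finite J" using J(1) finite_subset by blast
  then have ne: "?vs \<noteq> []" using lvs J(2) by auto
  have svs: "set ?vs = (\<lambda>p. us ! p) ` J" using J(1) us(2) by (auto simp: set_nths)
  have near: "indicator (b_span X (set us)) (v i) * near cutoff_lim J (n + 1 + i) (dist_matrix (pairs_upto (n + k)) (tau_rep X us) v)
      = (indicator (b_span X (set ?vs)) (v i) :: real)" if i: "i < k" and v: "v i \<in> W" for v i
  proof -
    have vM: "v i \<in> M" using v W_M by blast
    have upM: "us ! p \<in> M" if "p \<in> J" for p
    proof -
      have "us ! p \<in> set us" using that J(1) us(2) by (intro nth_mem) auto
      then show ?thesis using us(1) S_M by blast
    qed
    \<comment> \<open>The argument of \<open>cutoff_lim\<close> is non-negative by the triangle
      inequality and 0 exactly on the segment.\<close>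
    have "1 - cutoff_lim (d r (v i) + d (us ! p) (v i) - d r (us ! p)) = (if v i \<in> br (us ! p) then 0 else 1)"
      if "p \<in> J" for p
      using seg_iff[OF upM[OF that], of "v i"] vM mdist_triangle[OF root vM upM[OF that]] mdist_commute[of "b_metric X" "us ! p" "v i"]
      by (auto simp: cutoff_lim_def)
    then have "(\<Prod>p\<in>J. 1 - cutoff_lim (d r (v i) + d (us ! p) (v i) - d r (us ! p)))
       = (\<Prod>p\<in>J. if v i \<in> br (us ! p) then 0 else 1)" by (intro prod.cong) auto
    also have "\<dots> = (if v i \<in> b_span X (set ?vs) then 0 else 1)"
      using span_seg[OF ne vsS] svs \<open>finite J\<close> by (auto intro!: prod.neutral prod_zero)
    finally have "near cutoff_lim J (n + 1 + i) (dist_matrix (pairs_upto (n + k)) (tau_rep X us) v) = indicator (b_span X (set ?vs)) (v i)"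
      using near_tau[OF us(2) J(1) i, of cutoff_lim X v] by simp
    then show ?thesis using span_mono[OF vs] by (auto simp: indicator_def)
  qed
  have "samp (tau_rep X us) k (lift cutoff_lim n J k \<psi>) =
    (\<integral>v. (\<Prod>i<k. indicator (b_span X (set us)) (v i)) *
       lift cutoff_lim n J k \<psi> (dist_matrix (pairs_upto (n + k)) (tau_rep X us) v) \<partial>Pi\<^sub>M {..<k} (\<lambda>_. nuW))"
    using samp_tau[OF us(1) fin, of "lift cutoff_lim n J k \<psi>" k] lift_measurable[OF J(1) \<psi> cutoff_measurable] us(2) by simp
  also have "\<dots> = (\<integral>v. (\<Prod>i<k. indicator (b_span X (set ?vs)) (v i)) *
       \<psi> (dist_matrix (pairs_upto (card J + k)) (tau_rep X ?vs) v) \<partial>Pi\<^sub>M {..<k} (\<lambda>_. nuW))"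
  proof (rule Bochner_Integration.integral_cong[OF refl])
    fix v assume "v \<in> space (Pi\<^sub>M {..<k} (\<lambda>_. nuW))"
    then have v: "\<And>i. i < k \<Longrightarrow> v i \<in> W" using space_nuW by (auto simp: space_PiM PiE_iff)
    have "(\<Prod>i<k. indicator (b_span X (set us)) (v i)) * (\<Prod>i<k. near cutoff_lim J (n + 1 + i) (dist_matrix (pairs_upto (n + k)) (tau_rep X us) v))
      = (\<Prod>i<k. indicator (b_span X (set ?vs)) (v i) :: real)"
      unfolding prod.distrib[symmetric] using near v by (intro prod.cong) auto
    then show "(\<Prod>i<k. indicator (b_span X (set us)) (v i)) * lift cutoff_lim n J k \<psi> (dist_matrix (pairs_upto (n + k)) (tau_rep X us) v)
      = (\<Prod>i<k. indicator (b_span X (set ?vs)) (v i)) * \<psi> (dist_matrix (pairs_upto (card J + k)) (tau_rep X ?vs) v)"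
      unfolding lift_def tau_relabel_matrix[OF us(2) J(1)] by (simp add: mult.commute mult.left_commute)
  qed
  also have "\<dots> = samp (tau_rep X ?vs) k \<psi>"
    using samp_tau[OF vsS fin', of \<psi> k] \<psi> lvs by simp
  finally show ?thesis .
qed

lemma tau_perm_simps:
  assumes "set us' = set us"
  shows "p_metric (tau_rep X us') = p_metric (tau_rep X us)" "p_measure (tau_rep X us') = p_measure (tau_rep X us)"
  using assms by (simp_all add: tau_rep_def Let_def)

text \<open>Metric and measure of \<open>tau_rep\<close> depend only on the set of leaves. The order
  enters through positions alone, and the product over J is reindexed by its increasing
  enumeration.\<close>

lemma samp_lift_perm:
  assumes len: "length us = n" "length us' = n" and set: "set us' = set us" and J: "J \<subseteq> {..<n}"
    and pre: "nths us' {..<card J} = nths us J"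
  shows "samp (tau_rep X us') k (lift h n {..<card J} k \<psi>) = samp (tau_rep X us) k (lift h n J k \<psi>)"
proof -
  let ?L = "nths [0..<n] J" and ?c = "card J"
  have cn: "?c \<le> n" using card_mono[OF _ J] by simp
  then have J': "{..<?c} \<subseteq> {..<n}" by auto
  have ll: "length ?L = ?c" using length_nths_upto[of "[0..<n]" n J] J by simp
  have bij: "bij_betw (\<lambda>q. ?L ! q) {..<?c} J"
  proof -
    have "distinct ?L" by (simp add: distinct_nthsI)
    then have "bij_betw (\<lambda>q. ?L ! q) {..<length ?L} (set ?L)" by (rule bij_betw_nth) auto
    moreover have "set ?L = J"
    proof -
      have "set ?L = {[0..<n] ! i | i. i < n \<and> i \<in> J}" by (simp add: set_nths)
      also have "\<dots> = {i. i < n \<and> i \<in> J}" by force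
      finally show ?thesis using J by auto
    qed
    ultimately show ?thesis using ll by simp
  qed
  have u: "us' ! q = us ! (?L ! q)" if "q < ?c" for q
  proof -
    have "nths us' {..<?c} = take ?c us'" by (simp add: nths_upt_eq_take)
    then have "us' ! q = nths us' {..<?c} ! q" using that by simp
    also have "\<dots> = us ! (?L ! q)" unfolding pre using that ll nths_map_nth[OF len(1), of J] by simp
    finally show ?thesis .
  qed
  have "lift h n {..<?c} k \<psi> (dist_matrix (pairs_upto (n + k)) (tau_rep X us') v)
     = lift h n J k \<psi> (dist_matrix (pairs_upto (n + k)) (tau_rep X us) v)" for v
  proof -
    have 1: "near h {..<?c} (n + 1 + i) (dist_matrix (pairs_upto (n + k)) (tau_rep X us') v)
      = near h J (n + 1 + i) (dist_matrix (pairs_upto (n + k)) (tau_rep X us) v)" if i: "i < k" for i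
      unfolding near_tau[OF len(2) J' i] near_tau[OF len(1) J i]
      by (subst prod.reindex_bij_betw[OF bij, symmetric]) (use u in simp)
    have 2: "(\<lambda>(a, b)\<in>pairs_upto (?c + k). dist_matrix (pairs_upto (n + k)) (tau_rep X us') v (pos n {..<?c} a, pos n {..<?c} b))
      = (\<lambda>(a, b)\<in>pairs_upto (?c + k). dist_matrix (pairs_upto (n + k)) (tau_rep X us) v (pos n J a, pos n J b))"
      using tau_relabel_matrix[OF len(2) J', of k X v] tau_relabel_matrix[OF len(1) J, of k X v] pre by simp
    show ?thesis unfolding lift_def card_lessThan 2 using 1 by simp
  qed
  moreover have "p_points (tau_rep X us') = us'" "p_points (tau_rep X us) = us" by (simp_all add: tau_rep_def Let_def)
  ultimately show ?thesis unfolding samp_def tau_perm_simps[OF set] by (simp add: len)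
qed

section \<open>Weak convergence of the sampled subtrees\<close>

text \<open>The integral against \<open>varpi\<close> written on the sampled leaves
  (\<open>varpi_integral\<close>), where a permutation of the sample can act.\<close>

definition sexp :: "'a bmt \<Rightarrow> ((nat \<Rightarrow> 'a) \<Rightarrow> real) \<Rightarrow> real" where
  "sexp X f = (if b_mass X = 0 then 0
     else b_mass X * (\<integral>u. f u \<partial>Pi\<^sub>M UNIV (\<lambda>_. on_supp_normalized (b_metric X) (b_mu X))))"

context pbt
begin

abbreviation "Nrm \<equiv> on_supp_normalized (b_metric X) \<mu>"
abbreviation "Pr \<equiv> Pi\<^sub>M (UNIV :: nat set) (\<lambda>_. Nrm)"

lemma sets_Nrm: "sets Nrm = sets (b_sample X)" by (simp add: on_supp_normalized_def)

lemma space_Nrm: "space Nrm = S" using sets_eq_imp_space_eq[OF sets_Nrm] fin_sample(2) by simp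

lemma Pr_component: "(\<lambda>u. u i) \<in> measurable Pr (b_sample X)"
proof -
  have "(\<lambda>u. u i) \<in> measurable Pr Nrm" by measurable
  then show ?thesis using measurable_cong_sets[OF refl sets_Nrm] by blast
qed

lemma Pr_S: "u \<in> space Pr \<Longrightarrow> u i \<in> S" using space_Nrm by (auto simp: space_PiM)

lemma prob_Nrm: "b_mass X \<noteq> 0 \<Longrightarrow> prob_space Nrm"
  unfolding on_supp_normalized_alt[OF car] using fin_sample by (intro prob_space_normalize) auto

lemma prob_Pr: "b_mass X \<noteq> 0 \<Longrightarrow> prob_space Pr"
  by (intro prob_space_PiM prob_Nrm)

lemma distm_list_Pr: "distm_list Pr n (prefix_list n)"
  by (rule distm_list_prefix) (rule Pr_component)

lemma prefix_Pr_S: "u \<in> space Pr \<Longrightarrow> set (prefix_list n u) \<subseteq> S" using Pr_S by auto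

lemma varsigma_measurable: "varsigma X \<in> measurable Pr (borel_of HH_seq_top)"
proof -
  have "(\<lambda>u. \<lambda>n\<in>{1..}. pmm_class n (tau_rep X (prefix_list n u))) \<in> measurable Pr (borel_of HH_seq_top)"
  proof (rule HH_seq_measurable)
    fix n u assume u: "u \<in> space Pr"
    show "tau_rep X (prefix_list n u) \<in> pmm_spaces n" using tau_pmm[OF prefix_Pr_S[OF u], of n] by simp
    show "zero_hyperbolic_on (p_metric (tau_rep X (prefix_list n u))) (psupp (tau_rep X (prefix_list n u)))"
      by (rule tau_hyp[OF prefix_Pr_S[OF u]])
  qed (auto intro!: tau_point_matrix_measurable tau_mass_measurable tau_samp_measurable distm_list_Pr Cb_matrix_measurable)
  then show ?thesis by (simp add: varsigma_def[abs_def])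
qed

lemma varpi_integral:
  assumes F: "F \<in> borel_measurable (borel_of HH_seq_top)"
  shows "(\<integral>s. F s \<partial>varpi X) = sexp X (\<lambda>u. F (varsigma X u))"
proof (cases "b_mass X = 0")
  case True then show ?thesis by (simp add: varpi_def sexp_def)
next
  case False
  have "0 \<le> b_mass X" by (simp add: b_mass_def total_mass_def)
  then show ?thesis using False F varsigma_measurable
    by (simp add: varpi_def sexp_def integral_scale_measure' integral_distr)
qed

lemma varsigma_rep:
  assumes u: "u \<in> space Pr" and k: "1 \<le> k"
  shows "class_rep (varsigma X u k) \<in> pmm_spaces k" "pmm_iso (tau_rep X (prefix_list k u)) (class_rep (varsigma X u k))"
proof -
  have "tau_rep X (prefix_list k u) \<in> pmm_spaces k" using tau_pmm[OF prefix_Pr_S[OF u], of k] by simp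
  moreover have "varsigma X u k = pmm_class k (tau_rep X (prefix_list k u))" using k by (simp add: varsigma_def)
  ultimately show "class_rep (varsigma X u k) \<in> pmm_spaces k" "pmm_iso (tau_rep X (prefix_list k u)) (class_rep (varsigma X u k))"
    using pmm_class_rep by auto
qed

lemma varsigma_inv:
  assumes u: "u \<in> space Pr" and k: "1 \<le> k"
  shows "p_mass (class_rep (varsigma X u k)) = p_mass (tau_rep X (prefix_list k u))"
    "matrix_measurable (k + l) \<psi> \<Longrightarrow> samp (class_rep (varsigma X u k)) l \<psi> = samp (tau_rep X (prefix_list k u)) l \<psi>"
proof -
  have "tau_rep X (prefix_list k u) \<in> pmm_spaces k" using tau_pmm[OF prefix_Pr_S[OF u], of k] by simp
  note inv = pmm_iso_invariant[OF varsigma_rep(2)[OF u k] this varsigma_rep(1)[OF u k]]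
  show "p_mass (class_rep (varsigma X u k)) = p_mass (tau_rep X (prefix_list k u))" by (rule inv(1))
  show "samp (class_rep (varsigma X u k)) l \<psi> = samp (tau_rep X (prefix_list k u)) l \<psi>" if "matrix_measurable (k + l) \<psi>"
    by (rule inv(2)[OF that])
qed

text \<open>Exchangeability: the sample is i.i.d., so every injective reindexing preserves its
  law.\<close>

lemma sexp_perm:
  assumes \<pi>: "inj \<pi>" and f: "f \<in> borel_measurable Pr"
  shows "sexp X (\<lambda>u. f (\<lambda>i. u (\<pi> i))) = sexp X f"
proof (cases "b_mass X = 0")
  case True then show ?thesis by (simp add: sexp_def)
next
  case False
  have "distr Pr Pr (\<lambda>u. \<lambda>i\<in>UNIV. u (\<pi> i)) = Pr"
    using distr_PiM_reindex[of UNIV "\<lambda>_. Nrm" \<pi> UNIV] prob_Nrm[OF False] \<pi> by simp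
  then have "(\<integral>u. f u \<partial>Pr) = (\<integral>u. f u \<partial>distr Pr Pr (\<lambda>u. \<lambda>i\<in>UNIV. u (\<pi> i)))" by simp
  also have "\<dots> = (\<integral>u. f (\<lambda>i\<in>UNIV. u (\<pi> i)) \<partial>Pr)"
    by (rule integral_distr) (use f in measurable)
  finally show ?thesis by (simp add: sexp_def restrict_UNIV)
qed

lemma sexp_cong: "(\<And>u. u \<in> space Pr \<Longrightarrow> f u = g u) \<Longrightarrow> sexp X f = sexp X g"
  unfolding sexp_def by (simp cong: Bochner_Integration.integral_cong)

lemma integrable_Pr:
  fixes f :: "(nat \<Rightarrow> 'a) \<Rightarrow> real"
  assumes "b_mass X \<noteq> 0" "f \<in> borel_measurable Pr" "\<And>u. u \<in> space Pr \<Longrightarrow> \<bar>f u\<bar> \<le> B"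
  shows "integrable Pr f"
proof -
  interpret prob_space Pr by (rule prob_Pr[OF assms(1)])
  show ?thesis using assms by (intro integrable_const_bound[of _ B]) auto
qed

lemma sexp_diff_le:
  assumes f: "f \<in> borel_measurable Pr" "\<And>u. u \<in> space Pr \<Longrightarrow> \<bar>f u\<bar> \<le> B"
    and g: "g \<in> borel_measurable Pr" "\<And>u. u \<in> space Pr \<Longrightarrow> \<bar>g u\<bar> \<le> B"
    and A: "finite A" and h: "\<And>i. i \<in> A \<Longrightarrow> h i \<in> borel_measurable Pr" "\<And>i u. i \<in> A \<Longrightarrow> u \<in> space Pr \<Longrightarrow> \<bar>h i u\<bar> \<le> B'"
    and le: "\<And>u. u \<in> space Pr \<Longrightarrow> \<bar>f u - g u\<bar> \<le> D * (\<Sum>i\<in>A. h i u)"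
  shows "\<bar>sexp X f - sexp X g\<bar> \<le> D * (\<Sum>i\<in>A. sexp X (h i))"
proof (cases "b_mass X = 0")
  case True then show ?thesis by (simp add: sexp_def)
next
  case False
  have b0: "0 \<le> b_mass X" by (simp add: b_mass_def total_mass_def)
  note int = integrable_Pr[OF False f] integrable_Pr[OF False g] integrable_Pr[OF False h]
  have "\<bar>(\<integral>u. f u \<partial>Pr) - (\<integral>u. g u \<partial>Pr)\<bar> = \<bar>\<integral>u. f u - g u \<partial>Pr\<bar>" using int by simp
  also have "\<dots> \<le> (\<integral>u. \<bar>f u - g u\<bar> \<partial>Pr)" by (rule integral_abs_bound)
  also have "\<dots> \<le> (\<integral>u. D * (\<Sum>i\<in>A. h i u) \<partial>Pr)"
    using int le by (intro integral_mono integrable_abs Bochner_Integration.integrable_diff integrable_mult_right Bochner_Integration.integrable_sum) auto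
  also have "\<dots> = D * (\<Sum>i\<in>A. \<integral>u. h i u \<partial>Pr)" using int by simp
  finally have "b_mass X * \<bar>(\<integral>u. f u \<partial>Pr) - (\<integral>u. g u \<partial>Pr)\<bar> \<le> b_mass X * (D * (\<Sum>i\<in>A. \<integral>u. h i u \<partial>Pr))"
    using b0 by (rule mult_left_mono)
  then show ?thesis using False b0
    by (simp add: sexp_def abs_mult sum_distrib_left mult.left_commute flip: right_diff_distrib)
qed

lemma sexp_tendsto_0:
  assumes "\<And>j. f j \<in> borel_measurable Pr" "\<And>j u. u \<in> space Pr \<Longrightarrow> \<bar>f j u\<bar> \<le> B"
    and "AE u in Pr. (\<lambda>j. f j u) \<longlonglongrightarrow> 0"
  shows "(\<lambda>j. sexp X (f j)) \<longlonglongrightarrow> 0"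
proof (cases "b_mass X = 0")
  case True then show ?thesis by (simp add: sexp_def)
next
  case False
  interpret prob_space Pr by (rule prob_Pr[OF False])
  have "(\<lambda>j. \<integral>u. f j u \<partial>Pr) \<longlonglongrightarrow> (\<integral>u. 0 \<partial>Pr)"
    by (rule integral_dominated_convergence[where w="\<lambda>_. B"]) (use assms in auto)
  from tendsto_mult_left[OF this, of "b_mass X"] show ?thesis using False by (simp add: sexp_def)
qed

lemma AE_Pr_finite:
  assumes n: "1 \<le> n" and "b_mass X \<noteq> 0"
  shows "AE u in Pr. emeasure \<nu> (b_span X (set (prefix_list n u))) < \<infinity>"
proof -
  have 1: "AE u in Nrm. emeasure \<nu> (br u) < \<infinity>"
  proof -
    obtain N where N: "N \<in> null_sets (b_sample X)" "{u \<in> space (b_sample X). \<not> emeasure \<nu> (br u) < \<infinity>} \<subseteq> N"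
      using AE_sample[OF AE_fin] by (auto elim!: AE_E)
    show ?thesis
    proof (rule AE_I')
      show "N \<in> null_sets Nrm" using N(1) by (auto simp: null_sets_def on_supp_normalized_def)
      show "{u \<in> space Nrm. \<not> emeasure \<nu> (br u) < \<infinity>} \<subseteq> N" using N(2) space_Nrm fin_sample(2) by simp
    qed
  qed
  interpret N: product_prob_space "\<lambda>_::nat. Nrm" UNIV
    using prob_Nrm[OF assms(2)] by (simp add: product_prob_space_def product_prob_space_axioms_def product_sigma_finite_def prob_space_imp_sigma_finite)
  have "AE u in Pr. emeasure \<nu> (br (u i)) < \<infinity>" for i
  proof -
    have "distr Pr Nrm (\<lambda>u. u i) = Nrm" by (rule N.PiM_component) simp
    then have "AE x in distr Pr Nrm (\<lambda>u. u i). emeasure \<nu> (br x) < \<infinity>"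
      using 1 by (simp only:)
    then show ?thesis by (rule AE_distrD[rotated]) measurable
  qed
  then have "AE u in Pr. \<forall>i. emeasure \<nu> (br (u i)) < \<infinity>" by (simp add: AE_all_countable)
  then show ?thesis using AE_space
  proof eventually_elim
    case (elim u)
    have "emeasure \<nu> (b_span X (set (prefix_list n u))) \<le> (\<Sum>v\<in>set (prefix_list n u). emeasure \<nu> (br v))"
      using n prefix_Pr_S[OF elim(2)] by (intro emeasure_span_le) (auto simp: prefix_list_def)
    also have "\<dots> < \<infinity>" using elim(1) by (auto simp: less_top)
    finally show ?case .
  qed
qed

end

text \<open>One factor is exchanged at a time; c i \<ge> 1 lets the full product bound every partial
  one.\<close>

lemma prod_diff_bound:
  fixes a b c :: "'i \<Rightarrow> real"
  assumes "finite A" "\<And>i. i \<in> A \<Longrightarrow> \<bar>a i\<bar> \<le> c i" "\<And>i. i \<in> A \<Longrightarrow> \<bar>b i\<bar> \<le> c i" "\<And>i. i \<in> A \<Longrightarrow> 1 \<le> c i"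
  shows "\<bar>(\<Prod>i\<in>A. a i) - (\<Prod>i\<in>A. b i)\<bar> \<le> (\<Prod>i\<in>A. c i) * (\<Sum>i\<in>A. \<bar>a i - b i\<bar>)"
  using assms
proof (induction A rule: finite_induct)
  case (insert x F)
  have IH: "\<bar>(\<Prod>i\<in>F. a i) - (\<Prod>i\<in>F. b i)\<bar> \<le> (\<Prod>i\<in>F. c i) * (\<Sum>i\<in>F. \<bar>a i - b i\<bar>)" using insert by auto
  have c1: "1 \<le> (\<Prod>i\<in>F. c i)" using insert.prems(3) by (intro prod_ge_1) auto
  have bF: "\<bar>\<Prod>i\<in>F. b i\<bar> \<le> (\<Prod>i\<in>F. c i)" unfolding abs_prod using insert.prems(2) by (intro prod_mono) auto
  have cx: "1 \<le> c x" "\<bar>a x\<bar> \<le> c x" using insert.prems by auto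
  have "a x * (\<Prod>i\<in>F. a i) - b x * (\<Prod>i\<in>F. b i) = a x * ((\<Prod>i\<in>F. a i) - (\<Prod>i\<in>F. b i)) + (a x - b x) * (\<Prod>i\<in>F. b i)"
    by (simp add: algebra_simps)
  then have "\<bar>a x * (\<Prod>i\<in>F. a i) - b x * (\<Prod>i\<in>F. b i)\<bar>
     \<le> \<bar>a x\<bar> * \<bar>(\<Prod>i\<in>F. a i) - (\<Prod>i\<in>F. b i)\<bar> + \<bar>a x - b x\<bar> * \<bar>\<Prod>i\<in>F. b i\<bar>"
    by (metis abs_mult abs_triangle_ineq)
  also have "\<dots> \<le> c x * ((\<Prod>i\<in>F. c i) * (\<Sum>i\<in>F. \<bar>a i - b i\<bar>)) + \<bar>a x - b x\<bar> * (c x * (\<Prod>i\<in>F. c i))"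
  proof (intro add_mono mult_mono IH cx)
    have "1 * (\<Prod>i\<in>F. c i) \<le> c x * (\<Prod>i\<in>F. c i)" using cx c1 by (intro mult_right_mono) auto
    then show "\<bar>\<Prod>i\<in>F. b i\<bar> \<le> c x * (\<Prod>i\<in>F. c i)" using bF by simp
  qed (use cx in auto)
  also have "\<dots> = (c x * (\<Prod>i\<in>F. c i)) * (\<bar>a x - b x\<bar> + (\<Sum>i\<in>F. \<bar>a i - b i\<bar>))" by (simp add: algebra_simps)
  finally show ?case using insert.hyps by simp
qed simp

text \<open>Presents the mass as a sampling integral, so that \<open>lift\<close> also applies to
  the argument of \<gamma>.\<close>

lemma p_mass_samp:
  assumes "Y \<in> pmm_spaces k" shows "samp Y (Suc 0) (\<lambda>_. 1) = p_mass Y"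
  using finite_measure_PiM(2)[OF on_supp_finite(1)[OF pmm_spacesD(4)[OF assms]], of "{..<Suc 0}"]
    on_supp_finite(3)[OF pmm_spacesD(4)[OF assms]]
  by (simp add: samp_def)

lemma const_Cb: "(\<lambda>_. c) \<in> Cb X"
  by (auto simp: Cb_def bounded_iff)

section \<open>Factors with a soft cut-off\<close>

context test_function
begin

text \<open>The factor with index set I, computed in the full n-point tree with cut-off h. J is kept
  apart from I because a permutation of the sample moves the points: J will be I or the initial
  piece of the same size.\<close>

definition AA :: "(real \<Rightarrow> real) \<Rightarrow> nat set \<Rightarrow> nat set \<Rightarrow> 'a pmm \<Rightarrow> real" where
  "AA h J I Y = \<gamma> I (samp Y (Suc 0) (lift h n J (Suc 0) (\<lambda>_. 1))) * samp Y (m I) (lift h n J (m I) (\<phi> I))"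

lemma samp_lift_nonneg:
  assumes "\<And>x. 0 \<le> h x" "\<And>x. h x \<le> 1"
  shows "0 \<le> samp Y k (lift h n J k (\<lambda>_. 1))"
proof -
  have "0 \<le> near h J s R" for s R by (rule near_range(1)) (rule assms)+
  then show ?thesis unfolding samp_def lift_def by (intro Bochner_Integration.integral_nonneg) (auto intro: prod_nonneg)
qed

lemma AA_cont:
  assumes I: "I \<in> IX" and J: "J \<subseteq> {..<n}" "card J = card I"
  shows "pGw_cont n (AA (cutoff j) J I)"
  unfolding AA_def[abs_def]
  by (intro pGw_cont_mult pGw_cont_compose_nonneg[OF _ _ \<gamma>[OF I]] pGw_cont_samp lift_Cb J(1) const_Cb
      samp_lift_nonneg cutoff_range) (use \<phi>[OF I] J(2) in simp)

lemma AA_tendsto: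
  assumes I: "I \<in> IX" and J: "J \<subseteq> {..<n}" "card J = card I" and Y: "Y \<in> pmm_spaces n"
  shows "(\<lambda>j. AA (cutoff j) J I Y) \<longlonglongrightarrow> AA cutoff_lim J I Y"
  unfolding AA_def
proof (rule tendsto_mult)
  have "continuous_on {0..} (\<gamma> I)" using \<gamma>[OF I] by (simp add: Cb_def)
  then show "(\<lambda>j. \<gamma> I (samp Y (Suc 0) (lift (cutoff j) n J (Suc 0) (\<lambda>_. 1)))) \<longlonglongrightarrow> \<gamma> I (samp Y (Suc 0) (lift cutoff_lim n J (Suc 0) (\<lambda>_. 1)))"
    by (rule continuous_on_tendsto_compose[OF _ samp_lift_tendsto[OF Y J(1) const_Cb]])
       (auto intro!: always_eventually samp_lift_nonneg cutoff_range)
  show "(\<lambda>j. samp Y (m I) (lift (cutoff j) n J (m I) (\<phi> I))) \<longlonglongrightarrow> samp Y (m I) (lift cutoff_lim n J (m I) (\<phi> I))"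
    by (rule samp_lift_tendsto[OF Y J(1)]) (use \<phi>[OF I] J(2) in simp)
qed

lemma AA_tau:
  assumes X: "pbt X" and us: "set us \<subseteq> b_supp X" "length us = n" and fin: "emeasure (b_nu X) (b_span X (set us)) < \<infinity>" and I: "I \<in> IX"
  shows "AA cutoff_lim I I (tau_rep X us) = Phi I (tau_rep X (nths us I))"
proof -
  have I': "I \<subseteq> {..<n}" "I \<noteq> {}" using I by auto
  note s = pbt.samp_tau_lift[OF X us fin I']
  have "samp (tau_rep X us) (Suc 0) (lift cutoff_lim n I (Suc 0) (\<lambda>_. 1)) = p_mass (tau_rep X (nths us I))"
    using s[of "\<lambda>_. 1" "Suc 0"] p_mass_samp[OF nths_tau_pmm[OF X us I]] by simp
  moreover have "samp (tau_rep X us) (m I) (lift cutoff_lim n I (m I) (\<phi> I)) = samp (tau_rep X (nths us I)) (m I) (\<phi> I)"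
    by (rule s) (rule Cb_matrix_measurable[OF \<phi>[OF I]])
  ultimately show ?thesis by (simp add: AA_def Phi_fun_samp)
qed

lemma AA_perm:
  assumes "length us = n" "length us' = n" "set us' = set us" and I: "I \<in> IX" and "nths us' {..<card I} = nths us I"
  shows "AA h {..<card I} I (tau_rep X us') = AA h I I (tau_rep X us)"
proof -
  have "I \<subseteq> {..<n}" using I by auto
  note p = samp_lift_perm[OF assms(1-3) this assms(5)]
  show ?thesis unfolding AA_def p ..
qed

lemma AA_tau_measurable:
  assumes X: "pbt X" and us: "pbt.distm_list X Q n us" and I: "I \<in> IX" and J: "J \<subseteq> {..<n}" "card J = card I"
  shows "(\<lambda>\<omega>. AA (cutoff j) J I (tau_rep X (us \<omega>))) \<in> borel_measurable Q"
proof -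
  interpret pbt X by (rule X)
  have "\<phi> I \<in> Cb (matrix_top (pairs_upto (card J + m I)))" using \<phi>[OF I] J(2) by simp
  then have "(\<lambda>\<omega>. samp (tau_rep X (us \<omega>)) (m I) (lift (cutoff j) n J (m I) (\<phi> I))) \<in> borel_measurable Q"
    by (intro tau_samp_measurable[OF us] Cb_matrix_measurable lift_Cb J(1))
  moreover have "(\<lambda>\<omega>. samp (tau_rep X (us \<omega>)) (Suc 0) (lift (cutoff j) n J (Suc 0) (\<lambda>_. 1))) \<in> borel_measurable Q"
    by (intro tau_samp_measurable[OF us] Cb_matrix_measurable lift_Cb J(1) const_Cb)
  then have "(\<lambda>\<omega>. \<gamma> I (samp (tau_rep X (us \<omega>)) (Suc 0) (lift (cutoff j) n J (Suc 0) (\<lambda>_. 1)))) \<in> borel_measurable Q"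
    by (rule Cb_half_line_measurable[OF \<gamma>[OF I]]) (intro samp_lift_nonneg cutoff_range)
  ultimately show ?thesis unfolding AA_def by measurable
qed

lemma AA_varsigma:
  assumes X: "pbt X" and u: "u \<in> space (pbt.Pr X)" and I: "I \<in> IX" and J: "J \<subseteq> {..<n}" "card J = card I"
  shows "AA (cutoff j) J I (class_rep (varsigma X u n)) = AA (cutoff j) J I (tau_rep X (prefix_list n u))"
proof -
  have "\<phi> I \<in> Cb (matrix_top (pairs_upto (card J + m I)))" using \<phi>[OF I] J(2) by simp
  then show ?thesis
    unfolding AA_def using pbt.varsigma_inv(2)[OF X u n] Cb_matrix_measurable[OF lift_Cb[OF J(1)]] const_Cb by metis
qed

text \<open>The n-fold sample carries n factors of the mass, of which \<open>sexp\<close> already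
  contains one.\<close>

lemma JJ_sexp:
  assumes X: "pbt X" and \<theta>: "\<theta> \<in> borel_measurable borel"
  shows "JJ \<theta> X = b_mass X ^ (n - 1) * sexp X (\<lambda>u. EE \<theta> X (prefix_list n u))"
proof (cases "b_mass X = 0")
  case True
  then show ?thesis using JJ_null[OF X True] by (simp add: sexp_def)
next
  case False
  interpret pbt X by (rule X)
  have fm: "(\<lambda>u. EE \<theta> X (prefix_list n u)) \<in> borel_measurable (b_samples n X)"
    by (rule EE_measurable[OF X distm_list_PiM \<theta>])
  have pr: "prefix_list n (\<lambda>i\<in>{..<n}. u i) = prefix_list n u" for u :: "nat \<Rightarrow> 'a"
    by (simp add: prefix_list_def)
  have "b_mass X ^ card {..<n} * (\<integral>u. EE \<theta> X (prefix_list n (\<lambda>i\<in>{..<n}. u i)) \<partial>Pr) = JJ \<theta> X"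
    unfolding JJ_def on_supp_normalized_alt[OF car]
    by (rule integral_PiM_normalize[OF fin_sample(1) _ False _ fm]) (use fin_sample in auto)
  then have "JJ \<theta> X = b_mass X ^ n * (\<integral>u. EE \<theta> X (prefix_list n u) \<partial>Pr)" unfolding pr by simp
  also have "b_mass X ^ n = b_mass X ^ (n - 1) * b_mass X" using n by (simp add: power_eq_if)
  finally show ?thesis using False by (simp add: sexp_def)
qed

end

section \<open>Passing to the limit in the LWV-topology\<close>

lemma LWV_tendsto_sexp:
  assumes c: "\<And>N. c N \<in> Hfs" "d \<in> Hfs"
    and conv: "weakly_converges HH_seq_top (\<lambda>N. varpi (class_rep (c N))) (varpi (class_rep d))"
    and F: "F \<in> Cb HH_seq_top"
  shows "(\<lambda>N. sexp (class_rep (c N)) (\<lambda>u. F (varsigma (class_rep (c N)) u))) \<longlonglongrightarrow>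
    sexp (class_rep d) (\<lambda>u. F (varsigma (class_rep d) u))"
proof -
  have "F \<in> borel_measurable (borel_of HH_seq_top)" using F by (simp add: Cb_def borel_of_continuous_map)
  note i = pbt.varpi_integral[OF bm_treesD[OF Hfs_rep(1)[OF c(1)]] this] pbt.varpi_integral[OF bm_treesD[OF Hfs_rep(1)[OF c(2)]] this]
  have "(\<lambda>N. \<integral>s. F s \<partial>varpi (class_rep (c N))) \<longlonglongrightarrow> (\<integral>s. F s \<partial>varpi (class_rep d))"
    using conv F unfolding weakly_converges_def by blast
  then show ?thesis unfolding i .
qed

lemma LWV_tendsto_mass:
  assumes c: "\<And>N. c N \<in> Hfs" "d \<in> Hfs"
    and conv: "weakly_converges HH_seq_top (\<lambda>N. varpi (class_rep (c N))) (varpi (class_rep d))"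
  shows "(\<lambda>N. b_mass (class_rep (c N))) \<longlonglongrightarrow> b_mass (class_rep d)"
proof -
  have "sexp X (\<lambda>u. 1) = b_mass X" if "pbt X" for X :: "'a bmt"
  proof (cases "b_mass X = 0")
    case False
    interpret pbt X by (rule that)
    interpret prob_space Pr by (rule prob_Pr[OF False])
    show ?thesis using prob_space by (simp add: sexp_def)
  qed (simp add: sexp_def)
  note s = this[OF bm_treesD[OF Hfs_rep(1)[OF c(1)]]] this[OF bm_treesD[OF Hfs_rep(1)[OF c(2)]]]
  show ?thesis using LWV_tendsto_sexp[OF c conv const_Cb[of 1]] unfolding s .
qed

text \<open>Puts the soft factors under the bound of the exact ones, as membership in
  \<open>Cb\<close> requires, and leaves the exact ones unchanged (\<open>clip_id\<close>).\<close>

definition clip :: "real \<Rightarrow> real \<Rightarrow> real" where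
  "clip D x = max (- D) (min D x)"

lemma clip_le: "0 \<le> D \<Longrightarrow> \<bar>clip D x\<bar> \<le> D"
  by (auto simp: clip_def)

lemma clip_id: "\<bar>x\<bar> \<le> D \<Longrightarrow> clip D x = x"
  by (auto simp: clip_def)

lemma continuous_map_clip:
  "continuous_map X euclideanreal f \<Longrightarrow> continuous_map X euclideanreal (\<lambda>x. clip D (f x))"
  unfolding clip_def by (intro continuous_map_real_max continuous_map_real_min) auto

lemma clip_tendsto: "(f \<longlongrightarrow> l) F \<Longrightarrow> ((\<lambda>x. clip D (f x)) \<longlongrightarrow> clip D l) F"
  unfolding clip_def by (intro tendsto_max tendsto_min tendsto_const)

lemma clip_measurable: "f \<in> borel_measurable Q \<Longrightarrow> (\<lambda>x. clip D (f x)) \<in> borel_measurable Q"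
  unfolding clip_def by (intro borel_measurable_max borel_measurable_min borel_measurable_const)

context test_function
begin

text \<open>With exactly the points of I marked, no restriction of the measure is involved, and the
  factor is continuous as it stands.\<close>

lemma Phi_cont: "I \<in> IX \<Longrightarrow> pGw_cont (card I) (Phi I)"
  unfolding Phi_fun_samp[abs_def]
  by (intro pGw_cont_mult pGw_cont_compose_nonneg[OF pGw_cont_mass mass_nonneg \<gamma>] pGw_cont_samp \<phi>)

text \<open>A permutation of the sample moves the points indexed by \<open>I\<close> to the front, where the
  joint law of the subtree spanned by them and of the whole tree is controlled by \<open>varpi\<close>.\<close>

definition front :: "nat set \<Rightarrow> nat \<Rightarrow> nat" where
  "front I i = (if i < n then (nths [0..<n] I @ nths [0..<n] (- I)) ! i else i)"

lemma front:
  assumes I: "I \<subseteq> {..<n}"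
  shows "inj (front I)" "set (prefix_list n (\<lambda>i. u (front I i))) = set (prefix_list n u)"
    "nths (prefix_list n (\<lambda>i. u (front I i))) {..<card I} = nths (prefix_list n u) I"
    "prefix_list (card I) (\<lambda>i. u (front I i)) = nths (prefix_list n u) I"
proof -
  let ?A = "nths [0..<n] I" and ?B = "nths [0..<n] (- I)"
  let ?L = "?A @ ?B"
  have memb: "set (nths [0..<n] J) = {i. i < n \<and> i \<in> J}" for J
  proof -
    have "set (nths [0..<n] J) = {[0..<n] ! i | i. i < n \<and> i \<in> J}" by (simp add: set_nths)
    also have "\<dots> = {i. i < n \<and> i \<in> J}" by force
    finally show ?thesis .
  qed
  have dist: "distinct ?L" using memb by (auto simp: distinct_nthsI)
  have setL: "set ?L = {..<n}" using memb by auto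
  have len: "length ?L = n" using distinct_card[OF dist] setL by simp
  have lenA: "length ?A = card I" using length_nths_upto[of "[0..<n]" n I] I by simp
  have bij: "bij_betw (\<lambda>i. ?L ! i) {..<n} {..<n}" using bij_betw_nth[OF dist _ setL[symmetric]] len by auto
  have frontL: "front I i = ?L ! i" if "i < n" for i using that by (simp add: front_def)
  have rng: "front I i < n" if "i < n" for i using bij that unfolding frontL[OF that] bij_betw_def by blast
  show "inj (front I)"
  proof (rule injI)
    fix i j assume h: "front I i = front I j"
    show "i = j"
    proof (cases "i < n \<and> j < n")
      case True
      then show ?thesis using h bij frontL by (auto simp: bij_betw_def inj_on_def)
    next
      case False
      then show ?thesis using h rng[of i] rng[of j] by (auto simp: front_def split: if_splits)
    qed
  qed
  have "front I ` {..<n} = {..<n}" using bij frontL by (auto simp: bij_betw_def image_def)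
  then show "set (prefix_list n (\<lambda>i. u (front I i))) = set (prefix_list n u)"
    by (simp only: prefix_list_simps image_image[symmetric, of u "front I"])
  have cn: "card I \<le> n" using card_mono[OF _ I] by simp
  show 4: "prefix_list (card I) (\<lambda>i. u (front I i)) = nths (prefix_list n u) I"
  proof (rule nth_equalityI)
    show "length (prefix_list (card I) (\<lambda>i. u (front I i))) = length (nths (prefix_list n u) I)"
      using length_nths_upto[of "prefix_list n u" n I] I by simp
    fix i assume "i < length (prefix_list (card I) (\<lambda>i. u (front I i)))"
    then have i: "i < card I" by simp
    then have "front I i = ?A ! i" using cn lenA frontL[of i] by (simp add: nth_append)
    moreover have "nths (prefix_list n u) I ! i = prefix_list n u ! (?A ! i)"
      using nths_map_nth[of "prefix_list n u" n I] i lenA by simp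
    ultimately show "prefix_list (card I) (\<lambda>i. u (front I i)) ! i = nths (prefix_list n u) I ! i"
      using i nths_upto_less[OF I i] by simp
  qed
  have "nths (prefix_list n (\<lambda>i. u (front I i))) {..<card I} = take (card I) (prefix_list n (\<lambda>i. u (front I i)))"
    by (simp add: nths_upt_eq_take)
  also have "\<dots> = prefix_list (card I) (\<lambda>i. u (front I i))"
    using cn by (simp add: prefix_list_def take_map)
  finally show "nths (prefix_list n (\<lambda>i. u (front I i))) {..<card I} = nths (prefix_list n u) I" using 4 by simp
qed

text \<open>Replacing every factor by its soft version \<open>aa j\<close> gives a continuous
  functional \<open>F j\<close> of the n-th subtree, for which convergence is immediate. The error
  is at most a constant times the sum of \<open>sexp X (g X j I)\<close>. After moving the points of
  I to the front, each summand is the integral of the continuous \<open>G j I\<close>, which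
  compares the subtrees of card I and of n points. Hence the error along the sequence converges to
  the error of the limit tree, and the latter vanishes as j grows.\<close>

lemma JJ_tendsto:
  fixes c :: "nat \<Rightarrow> 'a bmt set"
  assumes c: "\<And>N. c N \<in> Hfs" "d \<in> Hfs"
    and conv: "weakly_converges HH_seq_top (\<lambda>N. varpi (class_rep (c N))) (varpi (class_rep d))"
    and \<theta>: "continuous_on UNIV \<theta>" "\<And>x. \<bar>\<theta> x\<bar> \<le> B\<theta>"
  shows "(\<lambda>N. JJ \<theta> (class_rep (c N))) \<longlonglongrightarrow> JJ \<theta> (class_rep d)"
proof -
  let ?c = "\<lambda>N. class_rep (c N)" and ?d = "class_rep d"
  have \<theta>m: "\<theta> \<in> borel_measurable borel" using \<theta>(1) by (rule borel_measurable_continuous_onI)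
  have \<theta>Cb: "\<theta> \<in> Cb (top_of_set {0..})"
    using \<theta> continuous_on_subset[OF \<theta>(1)] by (auto simp: Cb_def bounded_iff)
  have B\<theta>: "0 \<le> B\<theta>" using \<theta>(2)[of 0] by (meson abs_ge_zero order_trans)
  obtain C :: "nat \<Rightarrow> nat set \<Rightarrow> real" where C: "\<And>k I. I \<in> IX \<Longrightarrow> 0 \<le> C k I"
    "\<And>k I (Y::'a pmm). I \<in> IX \<Longrightarrow> Y \<in> pmm_spaces (card I) \<Longrightarrow> p_mass Y ^ k * \<bar>Phi I Y\<bar> \<le> C k I"
    by (rule Phi_bounds) blast
  \<comment> \<open>At least 1, as \<open>prod_diff_bound\<close> requires.\<close>
  define D where "D I = max 1 (C 0 I)" for I
  have D: "1 \<le> D I" "0 \<le> D I" for I by (auto simp: D_def)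
  have PhiD: "\<bar>Phi I Y\<bar> \<le> D I" if "I \<in> IX" "Y \<in> pmm_spaces (card I)" for I and Y :: "'a pmm"
    using C(2)[OF that, of 0] by (simp add: D_def)
  define DD where "DD = (\<Prod>I\<in>IX. D I)"
  have DD: "0 \<le> DD" unfolding DD_def using D by (intro prod_nonneg) auto
  define aa where "aa j I Y = clip (D I) (AA (cutoff j) I I Y)" for j I and Y :: "'a pmm"
  define F where "F j s = \<theta> (p_mass (class_rep (s n))) * (\<Prod>I\<in>IX. aa j I (class_rep (s n)))" for j and s :: "nat \<Rightarrow> 'a pmm set"
  define G where "G j I s = \<bar>clip (D I) (Phi I (class_rep (s (card I)))) - clip (D I) (AA (cutoff j) {..<card I} I (class_rep (s n)))\<bar>"
    for j I and s :: "nat \<Rightarrow> 'a pmm set"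
  define g where "g X j I u = \<bar>Phi I (tau_rep X (nths (prefix_list n u) I)) - aa j I (tau_rep X (prefix_list n u))\<bar>"
    for X :: "'a bmt" and j I u
  have cI: "1 \<le> card I" if "I \<in> IX" for I using that finite_subset[of I "{..<n}"] by (auto simp: Suc_le_eq card_gt_0_iff)
  have cn: "card I \<le> n" if "I \<in> IX" for I using that card_mono[of "{..<n}" I] by auto
  have F_Cb: "F j \<in> Cb HH_seq_top" for j
  proof -
    have "continuous_map HH_seq_top euclideanreal (\<lambda>s. aa j I (class_rep (s n)))" if "I \<in> IX" for I
      unfolding aa_def by (intro continuous_map_clip HH_seq_cont[OF AA_cont[OF that] n]) (use that in auto)
    then have "continuous_map HH_seq_top euclideanreal (F j)"
      unfolding F_def[abs_def]
      by (intro continuous_map_real_mult continuous_map_prod finite_IX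
          HH_seq_cont[OF pGw_cont_compose_nonneg[OF pGw_cont_mass mass_nonneg \<theta>Cb] n])
    moreover have "\<bar>F j s\<bar> \<le> B\<theta> * DD" for s
      unfolding F_def abs_mult abs_prod DD_def aa_def using \<theta>(2) clip_le[OF D(2)] B\<theta>
      by (intro mult_mono prod_mono) (auto intro: prod_nonneg)
    ultimately show ?thesis by (auto simp: Cb_def bounded_iff)
  qed
  have G_Cb: "G j I \<in> Cb HH_seq_top" if I: "I \<in> IX" for j I
  proof -
    have "continuous_map HH_seq_top euclideanreal (G j I)"
      unfolding G_def[abs_def] using cn[OF I]
      by (intro continuous_map_real_abs continuous_map_diff continuous_map_clip HH_seq_cont[OF Phi_cont[OF I] cI[OF I]]
          HH_seq_cont[OF AA_cont[OF I] n]) auto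
    moreover have "\<bar>G j I s\<bar> \<le> 2 * D I" for s
      unfolding G_def using clip_le[OF D(2)[of I], of "Phi I (class_rep (s (card I)))"]
        clip_le[OF D(2)[of I], of "AA (cutoff j) {..<card I} I (class_rep (s n))"] by linarith
    ultimately show ?thesis by (auto simp: Cb_def bounded_iff)
  qed
  have gG: "sexp X (g X j I) = sexp X (\<lambda>u. G j I (varsigma X u))"
    and gm: "g X j I \<in> borel_measurable (pbt.Pr X)"
    and gb: "\<And>u. u \<in> space (pbt.Pr X) \<Longrightarrow> \<bar>g X j I u\<bar> \<le> 2 * D I"
    if X: "pbt X" and I: "I \<in> IX" for X :: "'a bmt" and j I
  proof -
    interpret pbt X by (rule X)
    have I': "I \<subseteq> {..<n}" using I by auto
    let ?f = "\<lambda>u. \<bar>Phi I (tau_rep X (prefix_list (card I) u)) - clip (D I) (AA (cutoff j) {..<card I} I (tau_rep X (prefix_list n u)))\<bar>"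
    have fm: "?f \<in> borel_measurable Pr"
      using cn[OF I] by (intro borel_measurable_abs borel_measurable_diff clip_measurable
        Phi_tau_measurable[OF X distm_list_Pr I] AA_tau_measurable[OF X distm_list_Pr I]) auto
    show "g X j I \<in> borel_measurable Pr"
      unfolding g_def[abs_def] aa_def using I'
      by (intro borel_measurable_abs borel_measurable_diff clip_measurable
        Phi_tau_measurable[OF X distm_list_nths[OF distm_list_Pr] I] AA_tau_measurable[OF X distm_list_Pr I]) auto
    \<comment> \<open>In \<open>g\<close> the small subtree is spanned by the sample points with
      indices in I, in ?f by an initial piece of the sample. Only the latter is a coordinate of
      \<open>varsigma\<close>.\<close>
    have "?f (\<lambda>i. u (front I i)) = g X j I u" for u
      unfolding g_def aa_def front(4)[OF I'] using AA_perm[OF _ _ front(2)[OF I', of u] I front(3)[OF I', of u]] by simp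
    then have "sexp X (g X j I) = sexp X ?f" using sexp_perm[OF front(1)[OF I'] fm] by simp
    also have "\<dots> = sexp X (\<lambda>u. G j I (varsigma X u))"
    proof (rule sexp_cong)
      fix u assume u: "u \<in> space Pr"
      have "Phi I (class_rep (varsigma X u (card I))) = Phi I (tau_rep X (prefix_list (card I) u))"
        unfolding Phi_fun_samp using varsigma_inv(1)[OF u cI[OF I]] varsigma_inv(2)[OF u cI[OF I] Cb_matrix_measurable[OF \<phi>[OF I]]] by simp
      moreover have "\<bar>Phi I (tau_rep X (prefix_list (card I) u))\<bar> \<le> D I"
        using PhiD[OF I, of "tau_rep X (prefix_list (card I) u)"] tau_pmm[OF prefix_Pr_S[OF u], of "card I"] by simp
      moreover have "AA (cutoff j) {..<card I} I (class_rep (varsigma X u n)) = AA (cutoff j) {..<card I} I (tau_rep X (prefix_list n u))"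
        using cn[OF I] by (intro AA_varsigma[OF X u I]) auto
      ultimately show "?f u = G j I (varsigma X u)" by (simp add: G_def clip_id)
    qed
    finally show "sexp X (g X j I) = sexp X (\<lambda>u. G j I (varsigma X u))" .
    fix u assume u: "u \<in> space Pr"
    have "\<bar>Phi I (tau_rep X (nths (prefix_list n u) I))\<bar> \<le> D I"
      by (rule PhiD[OF I nths_tau_pmm[OF X prefix_Pr_S[OF u] _ I]]) simp
    then show "\<bar>g X j I u\<bar> \<le> 2 * D I"
      using clip_le[OF D(2)[of I], of "AA (cutoff j) I I (tau_rep X (prefix_list n u))"] unfolding g_def aa_def by linarith
  qed
  have est: "\<bar>sexp X (\<lambda>u. EE \<theta> X (prefix_list n u)) - sexp X (\<lambda>u. F j (varsigma X u))\<bar> \<le> B\<theta> * DD * (\<Sum>I\<in>IX. sexp X (g X j I))"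
    if X: "pbt X" for X :: "'a bmt" and j
  proof -
    interpret pbt X by (rule X)
    define B' where "B' = (\<Sum>I\<in>IX. 2 * D I)"
    have B': "2 * D I \<le> B'" if "I \<in> IX" for I
      unfolding B'_def using that D by (intro member_le_sum) auto
    show ?thesis
    proof (rule sexp_diff_le)
      show "(\<lambda>u. EE \<theta> X (prefix_list n u)) \<in> borel_measurable Pr" by (rule EE_measurable[OF X distm_list_Pr \<theta>m])
      show "(\<lambda>u. F j (varsigma X u)) \<in> borel_measurable Pr"
        by (rule measurable_compose[OF varsigma_measurable]) (use F_Cb in \<open>auto simp: Cb_def intro: borel_of_continuous_map\<close>)
      show "g X j I \<in> borel_measurable Pr" if "I \<in> IX" for I by (rule gm[OF X that])
      show "\<bar>g X j I u\<bar> \<le> B'" if "I \<in> IX" "u \<in> space Pr" for I u using gb[OF X that] B'[OF that(1)] by (rule order_trans)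
      show "finite IX" by (rule finite_IX)
      fix u assume u: "u \<in> space Pr"
      have P: "\<bar>Phi I (tau_rep X (nths (prefix_list n u) I))\<bar> \<le> D I" if I: "I \<in> IX" for I
        by (rule PhiD[OF I nths_tau_pmm[OF X prefix_Pr_S[OF u] _ I]]) simp
      have a: "\<bar>aa j I Y\<bar> \<le> D I" for I Y unfolding aa_def by (rule clip_le[OF D(2)])
      have Fu: "F j (varsigma X u) = \<theta> (p_mass (tau_rep X (prefix_list n u))) * (\<Prod>I\<in>IX. aa j I (tau_rep X (prefix_list n u)))"
        unfolding F_def varsigma_inv(1)[OF u n] aa_def using AA_varsigma[OF X u]
        by (intro arg_cong2[where f="(*)"] prod.cong arg_cong[where f="clip _"] refl) auto
      show "\<bar>EE \<theta> X (prefix_list n u)\<bar> \<le> B\<theta> * DD"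
        unfolding EE_def abs_mult abs_prod DD_def using \<theta>(2) P B\<theta> by (intro mult_mono prod_mono) (auto intro: prod_nonneg)
      show "\<bar>F j (varsigma X u)\<bar> \<le> B\<theta> * DD"
        unfolding Fu abs_mult abs_prod DD_def using \<theta>(2) a B\<theta> by (intro mult_mono prod_mono) (auto intro: prod_nonneg)
      have "\<bar>EE \<theta> X (prefix_list n u) - F j (varsigma X u)\<bar> = \<bar>\<theta> (p_mass (tau_rep X (prefix_list n u)))\<bar> *
          \<bar>(\<Prod>I\<in>IX. Phi I (tau_rep X (nths (prefix_list n u) I))) - (\<Prod>I\<in>IX. aa j I (tau_rep X (prefix_list n u)))\<bar>"
        unfolding EE_def Fu by (simp flip: right_diff_distrib add: abs_mult)
      also have "\<dots> \<le> B\<theta> * (DD * (\<Sum>I\<in>IX. g X j I u))"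
        unfolding g_def DD_def using \<theta>(2) B\<theta> P a D by (intro mult_mono prod_diff_bound finite_IX) auto
      finally show "\<bar>EE \<theta> X (prefix_list n u) - F j (varsigma X u)\<bar> \<le> B\<theta> * DD * (\<Sum>I\<in>IX. g X j I u)" by (simp add: mult.assoc)
    qed
  qed
  note Xc = bm_treesD[OF Hfs_rep(1)[OF c(1)]] and Xd = bm_treesD[OF Hfs_rep(1)[OF c(2)]]
  have g0: "(\<lambda>j. sexp ?d (g ?d j I)) \<longlonglongrightarrow> 0" if I: "I \<in> IX" for I
  proof (cases "b_mass ?d = 0")
    case True then show ?thesis by (simp add: sexp_def)
  next
    case False
    interpret pbt "class_rep d" by (rule Xd)
    have I': "I \<subseteq> {..<n}" using I by auto
    show ?thesis
    proof (rule sexp_tendsto_0[OF gm[OF Xd I] gb[OF Xd I]])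
      show "AE u in Pr. (\<lambda>j. g ?d j I u) \<longlonglongrightarrow> 0"
        using AE_Pr_finite[OF n False] AE_space
      proof eventually_elim
        case (elim u)
        let ?us = "prefix_list n u"
        note us = prefix_Pr_S[OF elim(2), of n]
        have Y: "tau_rep ?d ?us \<in> pmm_spaces n" using tau_pmm[OF us] by simp
        have P: "\<bar>Phi I (tau_rep ?d (nths ?us I))\<bar> \<le> D I"
          by (rule PhiD[OF I nths_tau_pmm[OF Xd us _ I]]) simp
        have "(\<lambda>j. aa j I (tau_rep ?d ?us)) \<longlonglongrightarrow> clip (D I) (AA cutoff_lim I I (tau_rep ?d ?us))"
          unfolding aa_def by (intro clip_tendsto AA_tendsto[OF I I' refl Y])
        also have "clip (D I) (AA cutoff_lim I I (tau_rep ?d ?us)) = Phi I (tau_rep ?d (nths ?us I))"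
          using AA_tau[OF Xd us _ elim(1) I] clip_id[OF P] by simp
        finally have "(\<lambda>j. \<bar>Phi I (tau_rep ?d (nths ?us I)) - aa j I (tau_rep ?d ?us)\<bar>)
           \<longlonglongrightarrow> \<bar>Phi I (tau_rep ?d (nths ?us I)) - Phi I (tau_rep ?d (nths ?us I))\<bar>"
          by (intro tendsto_intros)
        then show ?case by (simp add: g_def)
      qed
    qed
  qed
  have "(\<lambda>N. sexp (?c N) (\<lambda>u. EE \<theta> (?c N) (prefix_list n u))) \<longlonglongrightarrow>
     sexp ?d (\<lambda>u. EE \<theta> ?d (prefix_list n u))"
  proof (rule tendstoI)
    fix e :: real assume e: "0 < e"
    have "(\<lambda>j. B\<theta> * DD * (\<Sum>I\<in>IX. sexp ?d (g ?d j I))) \<longlonglongrightarrow> B\<theta> * DD * (\<Sum>I\<in>IX. 0)"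
      by (intro tendsto_intros g0)
    then have "\<forall>\<^sub>F j in sequentially. B\<theta> * DD * (\<Sum>I\<in>IX. sexp ?d (g ?d j I)) < e / 3"
      using e by (intro order_tendstoD(2)) auto
    \<comment> \<open>The choice of j depends on the limit tree alone; convergence of the errors
      then carries the bound over to all large N.\<close>
    then obtain j where j: "B\<theta> * DD * (\<Sum>I\<in>IX. sexp ?d (g ?d j I)) < e / 3"
      by (meson eventually_happens sequentially_bot)
    have "(\<lambda>N. B\<theta> * DD * (\<Sum>I\<in>IX. sexp (?c N) (g (?c N) j I))) \<longlonglongrightarrow>
       B\<theta> * DD * (\<Sum>I\<in>IX. sexp ?d (g ?d j I))"
    proof (intro tendsto_mult_left tendsto_sum)
      fix I assume I: "I \<in> IX"
      show "(\<lambda>N. sexp (?c N) (g (?c N) j I)) \<longlonglongrightarrow> sexp ?d (g ?d j I)"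
        using LWV_tendsto_sexp[OF c conv G_Cb[OF I]] unfolding gG[OF Xc I] gG[OF Xd I] .
    qed
    then have 1: "\<forall>\<^sub>F N in sequentially. B\<theta> * DD * (\<Sum>I\<in>IX. sexp (?c N) (g (?c N) j I)) < e / 3"
      using j by (rule order_tendstoD(2))
    have 2: "\<forall>\<^sub>F N in sequentially. dist (sexp (?c N) (\<lambda>u. F j (varsigma (?c N) u)))
       (sexp ?d (\<lambda>u. F j (varsigma ?d u))) < e / 3"
      using tendstoD[OF LWV_tendsto_sexp[OF c conv F_Cb], of "e/3"] e by simp
    show "\<forall>\<^sub>F N in sequentially. dist (sexp (?c N) (\<lambda>u. EE \<theta> (?c N) (prefix_list n u)))
       (sexp ?d (\<lambda>u. EE \<theta> ?d (prefix_list n u))) < e"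
      using 1 2
    proof eventually_elim
      case (elim N)
      show ?case using elim est[OF Xc[of N], of j] est[OF Xd, of j] j unfolding dist_real_def by linarith
    qed
  qed
  from tendsto_mult[OF tendsto_power[OF LWV_tendsto_mass[OF c conv], of "n - 1"] this]
  show ?thesis unfolding JJ_sexp[OF Xc \<theta>m] JJ_sexp[OF Xd \<theta>m] .
qed

end

section \<open>The Poisson pruning semigroup\<close>

text \<open>Off a null set of outcomes the pruned tree is controlled, so the integrand equals a
  measurable function only almost everywhere; the completion makes it measurable.\<close>

lemma completion_measurable_AE:
  fixes f g :: "'a \<Rightarrow> real"
  assumes g: "g \<in> borel_measurable M" and ae: "AE x in M. f x = g x"
  shows "f \<in> borel_measurable (completion M)" "(\<integral>x. f x \<partial>completion M) = (\<integral>x. g x \<partial>M)"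
proof -
  obtain N where N: "N \<in> null_sets M" "{x \<in> space M. \<not> f x = g x} \<subseteq> N" using ae by (auto elim!: AE_E)
  show f: "f \<in> borel_measurable (completion M)"
  proof (rule measurableI)
    fix A :: "real set" assume A: "A \<in> sets borel"
    have "f x = g x" if "x \<in> space M" "x \<notin> N" for x using N(2) that by blast
    then have eq: "f -` A \<inter> space M = (g -` A \<inter> space M - N) \<union> (f -` A \<inter> space M \<inter> N)" by auto
    have "g -` A \<inter> space M - N \<in> sets M" using measurable_sets[OF g A] null_setsD2[OF N(1)] by (rule sets.Diff)
    then show "f -` A \<inter> space (completion M) \<in> sets (completion M)"
      unfolding space_completion by (intro sets_completionI[OF eq _ N(1)]) auto
  qed simp
  have "(\<integral>x. f x \<partial>completion M) = (\<integral>x. g x \<partial>completion M)"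
    by (rule integral_cong_AE[OF f measurable_completion[OF g] AE_completion[OF ae]])
  then show "(\<integral>x. f x \<partial>completion M) = (\<integral>x. g x \<partial>M)" using integral_completion[OF g] by simp
qed

lemma enat_valued_ge_1: "x \<in> range ennreal_of_enat \<Longrightarrow> x \<noteq> 0 \<Longrightarrow> 1 \<le> x"
proof -
  assume "x \<in> range ennreal_of_enat" "x \<noteq> 0"
  then obtain e where e: "x = ennreal_of_enat e" "e \<noteq> 0" by (metis ennreal_of_enat_0 imageE)
  then have "1 \<le> e" by (cases e) (auto simp: one_enat_def zero_enat_def)
  then show "1 \<le> x" using ennreal_of_enat_le_iff[of 1 e] e(1) by simp
qed

text \<open>The Poisson probabilities of the finite values add up to 1.\<close>

lemma poisson_AE_finite:
  assumes P: "poisson_point_measure P N M" and A: "A \<in> sets M" "emeasure M A < \<infinity>"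
  shows "AE \<omega> in P. emeasure (N \<omega>) A < \<infinity>"
proof -
  interpret prob_space P using P by (simp add: poisson_point_measure_def)
  have meas: "(\<lambda>\<omega>. emeasure (N \<omega>) A) \<in> borel_measurable P" using P A by (simp add: poisson_point_measure_def)
  let ?B = "\<lambda>k. {\<omega> \<in> space P. emeasure (N \<omega>) A = of_nat k}"
  have B: "range ?B \<subseteq> sets P" using meas by auto
  have "disjoint_family ?B" by (auto simp: disjoint_family_on_def)
  from finite_measure_UNION[OF B this]
  have s: "(\<lambda>k. prob (?B k)) sums prob (\<Union>k. ?B k)" .
  have "(\<lambda>k. exp (- measure M A) * (measure M A ^ k /\<^sub>R fact k)) sums (exp (- measure M A) * exp (measure M A))"
    by (intro sums_mult exp_converges)
  moreover have "prob (?B k) = exp (- measure M A) * (measure M A ^ k /\<^sub>R fact k)" for k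
    using P A by (simp add: poisson_point_measure_def divide_inverse mult.commute)
  ultimately have "prob (\<Union>k. ?B k) = exp (- measure M A) * exp (measure M A)" using s by (simp add: sums_iff)
  then have "prob (\<Union>k. ?B k) = 1" by (simp flip: exp_add)
  then have "AE \<omega> in P. \<omega> \<in> (\<Union>k. ?B k)" using B by (subst prob_eq_1[symmetric]) auto
  then show ?thesis by eventually_elim (auto simp: of_nat_less_top)
qed

lemma poisson_prob_0:
  assumes P: "poisson_point_measure P N M" and A: "A \<in> sets M" "emeasure M A < \<infinity>"
  shows "measure P {\<omega> \<in> space P. emeasure (N \<omega>) A = 0} = exp (- measure M A)"
proof -
  have "measure P {\<omega> \<in> space P. emeasure (N \<omega>) A = of_nat 0} = exp (- measure M A) * measure M A ^ 0 / fact 0"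
    using P A unfolding poisson_point_measure_def by blast
  then show ?thesis by simp
qed

lemma poisson_AE_0:
  assumes P: "poisson_point_measure P N M" and A: "A \<in> sets M" "emeasure M A = 0"
  shows "AE \<omega> in P. emeasure (N \<omega>) A = 0"
proof -
  interpret prob_space P using P by (simp add: poisson_point_measure_def)
  have meas: "(\<lambda>\<omega>. emeasure (N \<omega>) A) \<in> borel_measurable P" using P A by (simp add: poisson_point_measure_def)
  have "prob {\<omega> \<in> space P. emeasure (N \<omega>) A = 0} = 1" using poisson_prob_0[OF P A(1)] A(2) by (simp add: measure_def)
  then have "AE \<omega> in P. \<omega> \<in> {\<omega> \<in> space P. emeasure (N \<omega>) A = 0}" using meas by (subst prob_eq_1[symmetric]) auto
  then show ?thesis by eventually_elim simp
qed

context pbt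
begin

lemma intensity_sets: "0 \<le> t \<Longrightarrow> B \<in> sets \<nu> \<Longrightarrow> {0..t} \<times> B \<in> sets (pruning_intensity X)"
  unfolding pruning_intensity_def by (intro pair_measureI) (auto simp: sets_restrict_space_iff)

lemma intensity_emeasure:
  assumes "0 \<le> t" "B \<in> sets \<nu>"
  shows "emeasure (pruning_intensity X) ({0..t} \<times> B) = ennreal t * emeasure \<nu> B"
proof -
  interpret sigma_finite_measure \<nu> by (rule sf_nu)
  have "emeasure (pruning_intensity X) ({0..t} \<times> B) = emeasure (restrict_space lborel {0..}) {0..t} * emeasure \<nu> B"
    unfolding pruning_intensity_def using assms
    by (intro emeasure_pair_measure_Times) (auto simp: sets_restrict_space_iff)
  also have "emeasure (restrict_space lborel {0..}) {0..t} = ennreal t"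
    using assms by (subst emeasure_restrict_space) auto
  finally show ?thesis .
qed

lemma height_sets:
  assumes v: "v \<in> M" and Q: "{y. Q y} \<in> sets borel" shows "{x \<in> br v. Q (d r x)} \<in> sets \<nu>"
proof -
  have "{x \<in> space \<nu>. Q (d x r)} \<in> sets \<nu>"
    using measurable_sets[OF mdist_measurable_borel[OF sets_nu root] Q] by (simp add: vimage_def Int_def conj_commute)
  moreover have "{x \<in> br v. Q (d r x)} = br v \<inter> {x \<in> space \<nu>. Q (d x r)}"
    using seg_sub[OF v] space_nu mdist_commute[of "b_metric X" r] by auto
  ultimately show ?thesis using seg_sets[OF v] by simp
qed

lemma part_sets: "v \<in> M \<Longrightarrow> {x \<in> br v. 2 * d r x \<le> a} \<in> sets \<nu>"
  by (rule height_sets[where Q="\<lambda>y. 2 * y \<le> a"]) auto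

text \<open>A finite integer-valued measure on a segment has an atom at the smallest height below which it charges the segment.\<close>

lemma segment_atom:
  assumes sets: "\<And>B. B \<in> sets \<nu> \<Longrightarrow> {0..t} \<times> B \<in> sets \<pi>"
    and int: "\<And>A. A \<in> sets \<pi> \<Longrightarrow> emeasure \<pi> A \<in> range ennreal_of_enat"
    and v: "v \<in> M" and fin: "emeasure \<pi> ({0..t} \<times> br v) < \<infinity>"
  shows "emeasure \<pi> ({0..t} \<times> {x \<in> br v. 2 * d r x \<le> a}) \<noteq> 0 \<Longrightarrow>
      \<exists>w\<in>br v. 2 * d r w \<le> a \<and> emeasure \<pi> ({0..t} \<times> {w}) > 0"
    "emeasure \<pi> ({0..t} \<times> {x \<in> br v. 2 * d r x \<le> a}) = 0 \<Longrightarrow>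
      \<exists>q::rat. a < of_rat q \<and> emeasure \<pi> ({0..t} \<times> {x \<in> br v. 2 * d r x \<le> of_rat q}) = 0"
proof -
  \<comment> \<open>Heights are doubled to match the bound in \<open>seg_Int\<close>.\<close>
  define L where "L s = {x \<in> br v. 2 * d r x \<le> s}" for s
  define c where "c B = emeasure \<pi> ({0..t} \<times> B)" for B
  have segM: "br v \<in> sets \<nu>" by (rule seg_sets[OF v])
  have Ls: "L s \<in> sets \<nu>" for s unfolding L_def by (rule part_sets[OF v])
  have mono: "c A \<le> c B" if "A \<subseteq> B" "B \<in> sets \<nu>" for A B
    unfolding c_def using that sets by (intro emeasure_mono) auto
  have ge1: "1 \<le> c B" if "B \<in> sets \<nu>" "c B \<noteq> 0" for B
    using that enat_valued_ge_1[OF int[OF sets[OF that(1)]]] by (simp add: c_def)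
  have cfin: "c (L s) < \<infinity>" for s
    using mono[of "L s" "br v"] segM fin by (auto simp: L_def c_def intro: order_le_less_trans)
  \<comment> \<open>A non-zero integer count is at least 1, and this survives the limit from above.
    Finiteness on the segment is what allows continuity from above.\<close>
  have limit: "1 \<le> c (L s)" if pos: "\<And>s'. s < s' \<Longrightarrow> c (L s') \<noteq> 0" for s
  proof -
    let ?A = "\<lambda>k. {0..t} \<times> L (s + 1 / real (Suc k))"
    have "(\<lambda>k. emeasure \<pi> (?A k)) \<longlonglongrightarrow> emeasure \<pi> (\<Inter>k. ?A k)"
    proof (rule Lim_emeasure_decseq)
      show "range ?A \<subseteq> sets \<pi>" using sets[OF Ls] by auto
      show "decseq ?A"
      proof (rule decseq_SucI)
        fix k
        have "1 / real (Suc (Suc k)) \<le> 1 / real (Suc k)" by (intro divide_left_mono) auto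
        then show "?A (Suc k) \<subseteq> ?A k" unfolding L_def by auto
      qed
      show "emeasure \<pi> (?A k) \<noteq> \<infinity>" for k using cfin[of "s + 1 / real (Suc k)"] by (simp add: c_def less_top)
    qed
    moreover have "(\<Inter>k. ?A k) = {0..t} \<times> L s"
    proof -
      have "x \<le> s" if "\<And>k. x \<le> s + 1 / real (Suc k)" for x
      proof (rule field_le_epsilon)
        fix e :: real assume "0 < e"
        then obtain k where "1 / real (Suc k) < e" using nat_approx_posE by blast
        then show "x \<le> s + e" using that[of k] by linarith
      qed
      then have "(\<Inter>k. L (s + 1 / real (Suc k))) = L s"
        by (auto simp: L_def intro: add_increasing2)
      then show ?thesis by auto
    qed
    moreover have "1 \<le> emeasure \<pi> (?A k)" for k
      using ge1[OF Ls pos[of "s + 1 / real (Suc k)"]] by (simp add: c_def)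
    ultimately show ?thesis unfolding c_def by (intro LIMSEQ_le_const) auto
  qed
  { assume "emeasure \<pi> ({0..t} \<times> {x \<in> br v. 2 * d r x \<le> a}) = 0"
    then have 0: "c (L a) = 0" by (simp add: c_def L_def)
    then have "\<exists>s'>a. c (L s') = 0" using limit[of a] by force
    then obtain s' where s': "s' > a" "c (L s') = 0" by blast
    obtain q where q: "a < of_rat q" "of_rat q < s'" using of_rat_dense[OF s'(1)] by blast
    have "c (L (of_rat q)) \<le> c (L s')" by (rule mono[OF _ Ls]) (use q in \<open>auto simp: L_def\<close>)
    then have "c (L (of_rat q)) = 0" using s'(2) by simp
    then show "\<exists>q::rat. a < of_rat q \<and> emeasure \<pi> ({0..t} \<times> {x \<in> br v. 2 * d r x \<le> of_rat q}) = 0"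
      using q(1) by (auto simp: c_def L_def) }
  { assume "emeasure \<pi> ({0..t} \<times> {x \<in> br v. 2 * d r x \<le> a}) \<noteq> 0"
    then have a: "c (L a) \<noteq> 0" by (simp add: c_def L_def)
    let ?H = "{s. c (L s) \<noteq> 0}"
    have lb: "0 \<le> s" if "s \<in> ?H" for s
    proof (rule ccontr)
      assume s: "\<not> 0 \<le> s"
      have "\<not> 2 * d r x \<le> s" for x using s mdist_nonneg[of "b_metric X" r x] by linarith
      then have "L s = {}" unfolding L_def by blast
      then show False using that by (simp add: c_def)
    qed
    have bdd: "bdd_below ?H" using lb by (intro bdd_belowI)
    define s where "s = Inf ?H"
    have sa: "s \<le> a" unfolding s_def using a bdd by (intro cInf_lower) auto
    have up: "c (L s') \<noteq> 0" if "s < s'" for s'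
    proof -
      have "?H \<noteq> {}" using a by blast
      from cInf_lessD[OF this that[unfolded s_def]] obtain s'' where s'': "s'' \<in> ?H" "s'' < s'" by (rule bexE)
      have "L s'' \<subseteq> L s'" using s''(2) unfolding L_def by (auto intro: order_trans)
      from mono[OF this Ls] show ?thesis using s''(1) by (metis (mono_tags, lifting) le_zero_eq mem_Collect_eq)
    qed
    have s1: "1 \<le> c (L s)" by (rule limit[OF up])
    \<comment> \<open>Nothing is counted below height s, the infimum of the charged heights. So the
      count up to s sits on the points of that height, of which a segment has only one.\<close>
    let ?L' = "{x \<in> br v. 2 * d r x < s}" and ?E = "{x \<in> br v. 2 * d r x = s}"
    have "?L' \<in> sets \<nu>" by (rule height_sets[OF v, of "\<lambda>y. 2 * y < s"]) measurable
    moreover have "?E \<in> sets \<nu>" by (rule height_sets[OF v, of "\<lambda>y. 2 * y = s"]) measurable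
    ultimately have setsLE: "?L' \<in> sets \<nu>" "?E \<in> sets \<nu>" .
    have "{0..t} \<times> ?L' = (\<Union>k. {0..t} \<times> L (s - 1 / real (Suc k)))"
    proof -
      have "\<exists>k. x \<le> s - 1 / real (Suc k)" if "x < s" for x
      proof -
        have "0 < s - x" using that by simp
        then obtain k where "1 / real (Suc k) < s - x" by (rule nat_approx_posE)
        then show ?thesis by (intro exI[of _ k]) linarith
      qed
      moreover have "x < s" if "x \<le> s - 1 / real (Suc k)" for x k
        using that by (smt (verit) divide_pos_pos of_nat_0_less_iff zero_less_Suc zero_less_one)
      ultimately show ?thesis by (fastforce simp: L_def)
    qed
    moreover have "{0..t} \<times> L (s - 1 / real (Suc k)) \<in> null_sets \<pi>" for k
    proof -
      have "s - 1 / real (Suc k) \<notin> ?H"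
      proof
        assume "s - 1 / real (Suc k) \<in> ?H"
        then have "s \<le> s - 1 / real (Suc k)" unfolding s_def using bdd by (rule cInf_lower)
        moreover have "0 < 1 / real (Suc k)" by simp
        ultimately show False by linarith
      qed
      then show ?thesis using sets[OF Ls] by (auto simp: null_sets_def c_def)
    qed
    ultimately have "{0..t} \<times> ?L' \<in> null_sets \<pi>" by (metis (no_types, lifting) null_sets_UN)
    then have z: "c ?L' = 0" by (auto simp: c_def)
    have "c (L s) \<le> c ?L' + c ?E"
    proof -
      have "{0..t} \<times> L s = {0..t} \<times> ?L' \<union> {0..t} \<times> ?E" by (auto simp: L_def)
      then show ?thesis unfolding c_def using sets[OF setsLE(1)] sets[OF setsLE(2)] by (simp add: emeasure_subadditive)
    qed
    then have E: "1 \<le> c ?E" using s1 z by (simp add: order_trans)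
    have "c {} = 0" by (simp add: c_def)
    then have "?E \<noteq> {}" using E by (metis not_one_le_zero)
    then obtain w where w: "w \<in> br v" "2 * d r w = s" by blast
    have "?E \<subseteq> {w}" using w seg_unique[OF v _ w(1)] by force
    then have "c ?E \<le> c {w}" using w seg_sub[OF v] sing_sets(1) by (intro mono) auto
    then have "c {w} > 0" by (rule less_le_trans[OF zero_less_one order_trans[OF E]])
    then show "\<exists>w\<in>br v. 2 * d r w \<le> a \<and> emeasure \<pi> ({0..t} \<times> {w}) > 0"
      using w sa by (intro bexI[of _ w]) (auto simp: c_def) }
qed

end

section \<open>Survival of sampled points under the Poisson cuts\<close>

locale pruning = pbt X for X :: "'a bmt" +
  fixes P :: "'w measure" and N :: "'w \<Rightarrow> (real \<times> 'a) measure" and t :: real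
  assumes leaves_null: "emeasure \<nu> (leaves X) = 0" and poisson: "poisson_point_measure P N (pruning_intensity X)" and t: "0 \<le> t"
begin

definition cnt :: "'w \<Rightarrow> 'a set \<Rightarrow> ennreal" where "cnt \<omega> B = emeasure (N \<omega>) ({0..t} \<times> B)"

lemma prob: "prob_space P" using poisson by (simp add: poisson_point_measure_def)

lemma sets_N: "\<omega> \<in> space P \<Longrightarrow> B \<in> sets \<nu> \<Longrightarrow> {0..t} \<times> B \<in> sets (N \<omega>)"
  using poisson intensity_sets[OF t] by (simp add: poisson_point_measure_def)

lemma int_N: "\<omega> \<in> space P \<Longrightarrow> A \<in> sets (N \<omega>) \<Longrightarrow> emeasure (N \<omega>) A \<in> range ennreal_of_enat"
  using poisson by (simp add: poisson_point_measure_def)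

lemma cnt_measurable: "B \<in> sets \<nu> \<Longrightarrow> (\<lambda>\<omega>. cnt \<omega> B) \<in> borel_measurable P"
  using poisson intensity_sets[OF t] unfolding cnt_def by (simp add: poisson_point_measure_def)

lemma cnt_mono: "\<omega> \<in> space P \<Longrightarrow> A \<subseteq> B \<Longrightarrow> B \<in> sets \<nu> \<Longrightarrow> cnt \<omega> A \<le> cnt \<omega> B"
  unfolding cnt_def using sets_N by (intro emeasure_mono) auto

lemma AE_cnt_finite: "B \<in> sets \<nu> \<Longrightarrow> emeasure \<nu> B < \<infinity> \<Longrightarrow> AE \<omega> in P. cnt \<omega> B < \<infinity>"
  unfolding cnt_def using intensity_emeasure[OF t]
  by (intro poisson_AE_finite[OF poisson intensity_sets[OF t]]) (auto simp: ennreal_mult_less_top)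

lemma AE_cnt_0: "B \<in> sets \<nu> \<Longrightarrow> emeasure \<nu> B = 0 \<Longrightarrow> AE \<omega> in P. cnt \<omega> B = 0"
  unfolding cnt_def using intensity_emeasure[OF t]
  by (intro poisson_AE_0[OF poisson intensity_sets[OF t]]) auto

lemma prob_cnt_0:
  assumes "B \<in> sets \<nu>" "emeasure \<nu> B < \<infinity>"
  shows "measure P {\<omega> \<in> space P. cnt \<omega> B = 0} = exp (- t * measure \<nu> B)"
proof -
  have "emeasure (pruning_intensity X) ({0..t} \<times> B) < \<infinity>"
    using assms intensity_emeasure[OF t assms(1)] by (auto simp: ennreal_mult_less_top)
  note poisson_prob_0[OF poisson intensity_sets[OF t assms(1)] this]
  moreover have "measure (pruning_intensity X) ({0..t} \<times> B) = t * measure \<nu> B"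
    using intensity_emeasure[OF t assms(1)] t by (simp add: measure_def enn2real_mult)
  ultimately show ?thesis by (simp add: cnt_def)
qed

abbreviation "atoms \<omega> \<equiv> atoms_upto X t (N \<omega>)"

text \<open>On each of countably many pieces of finite \<nu>-mass the projected point measure is
  almost surely finite, and a finite measure has countably many atoms.\<close>

lemma AE_countable_atoms: "AE \<omega> in P. countable (atoms \<omega>)"
proof -
  interpret sigma_finite_measure \<nu> by (rule sf_nu)
  obtain A :: "nat \<Rightarrow> 'a set" where A: "range A \<subseteq> sets \<nu>" "(\<Union>i. A i) = space \<nu>" "\<And>i. emeasure \<nu> (A i) \<noteq> \<infinity>"
    using sigma_finite by blast
  have "AE \<omega> in P. \<forall>i. cnt \<omega> (A i) < \<infinity>"
    using A AE_cnt_finite by (auto simp: AE_all_countable less_top)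
  then show ?thesis using AE_space
  proof eventually_elim
    case (elim \<omega>)
    note w = elim(2)
    have "countable {v \<in> M. v \<in> A i \<and> cnt \<omega> {v} > 0}" for i
    proof -
      let ?L = "distr (restrict_space (N \<omega>) ({0..t} \<times> A i)) \<nu> snd"
      have As: "A i \<in> sets \<nu>" using A by auto
      have sn: "sets (N \<omega>) = sets (pruning_intensity X)" using poisson w by (simp add: poisson_point_measure_def)
      have "snd \<in> measurable (pruning_intensity X) \<nu>" unfolding pruning_intensity_def by measurable
      then have "snd \<in> measurable (N \<omega>) \<nu>" using measurable_cong_sets[OF sn refl] by blast
      then have m: "snd \<in> measurable (restrict_space (N \<omega>) ({0..t} \<times> A i)) \<nu>" by (rule measurable_restrict_space1)
      have R: "{0..t} \<times> A i \<in> sets (N \<omega>)" by (rule sets_N[OF w As])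
      have sub: "{0..t} \<times> A i \<subseteq> space (N \<omega>)" by (rule sets.sets_into_space[OF R])
      have "finite_measure (restrict_space (N \<omega>) ({0..t} \<times> A i))"
        using spec[OF elim(1), of i] R sub by (intro finite_measureI) (auto simp: space_restrict_space emeasure_restrict_space cnt_def Int_absorb2)
      then have f: "finite_measure ?L" by (rule finite_measure.finite_measure_distr[OF _ m])
      have "measure ?L {v} \<noteq> 0" if v: "v \<in> M" "v \<in> A i" "cnt \<omega> {v} > 0" for v
      proof -
        have "emeasure ?L {v} = emeasure (restrict_space (N \<omega>) ({0..t} \<times> A i)) (snd -` {v} \<inter> space (restrict_space (N \<omega>) ({0..t} \<times> A i)))"
          by (rule emeasure_distr[OF m sing_sets(1)[OF v(1)]])
        also have "snd -` {v} \<inter> space (restrict_space (N \<omega>) ({0..t} \<times> A i)) = {0..t} \<times> {v}"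
          using sub v(2) by (auto simp: space_restrict_space)
        also have "emeasure (restrict_space (N \<omega>) ({0..t} \<times> A i)) \<dots> = cnt \<omega> {v}"
          unfolding cnt_def using R v(2) by (subst emeasure_restrict_space) auto
        finally show ?thesis using v(3) finite_measure.emeasure_eq_measure[OF f, of "{v}"] by auto
      qed
      then have "{v \<in> M. v \<in> A i \<and> cnt \<omega> {v} > 0} \<subseteq> {v. measure ?L {v} \<noteq> 0}" by blast
      then show ?thesis using finite_measure.countable_support[OF f] by (rule countable_subset)
    qed
    then have "countable (\<Union>i. {v \<in> M. v \<in> A i \<and> cnt \<omega> {v} > 0})" by (intro countable_UN) auto
    moreover have "atoms \<omega> \<subseteq> (\<Union>i. {v \<in> M. v \<in> A i \<and> cnt \<omega> {v} > 0})"
      using A(2) space_nu by (auto simp: atoms_upto_def cnt_def)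
    ultimately show ?case by (rule countable_subset[rotated])
  qed
qed

text \<open>One choice of the set in \<open>skeleton_cover\<close>, fixed because both
  \<open>alive\<close> and \<open>good\<close> refer to it.\<close>

definition D :: "'a set" where
  "D = (SOME D. countable D \<and> D \<subseteq> S \<and> (\<forall>v\<in>D. emeasure \<nu> (br v) < \<infinity>) \<and>
    skeleton X \<subseteq> (\<Union>v\<in>D. br v))"

lemma D: "countable D" "D \<subseteq> S" "\<And>v. v \<in> D \<Longrightarrow> emeasure \<nu> (br v) < \<infinity>"
  "skeleton X \<subseteq> (\<Union>v\<in>D. br v)"
proof -
  have "countable D \<and> D \<subseteq> S \<and> (\<forall>v\<in>D. emeasure \<nu> (br v) < \<infinity>) \<and>
    skeleton X \<subseteq> (\<Union>v\<in>D. br v)"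
    unfolding D_def
  proof (rule someI_ex)
    obtain E where "countable E" "E \<subseteq> S" "\<And>v. v \<in> E \<Longrightarrow> emeasure \<nu> (br v) < \<infinity>"
      "skeleton X \<subseteq> (\<Union>v\<in>E. br v)" by (rule skeleton_cover) blast
    then show "\<exists>E. countable E \<and> E \<subseteq> S \<and> (\<forall>v\<in>E. emeasure \<nu> (br v) < \<infinity>) \<and>
      skeleton X \<subseteq> (\<Union>v\<in>E. br v)" by blast
  qed
  then show "countable D" "D \<subseteq> S" "\<And>v. v \<in> D \<Longrightarrow> emeasure \<nu> (br v) < \<infinity>"
    "skeleton X \<subseteq> (\<Union>v\<in>D. br v)" by auto
qed

text \<open>Survival of \<open>u\<close>, expressed by countably many counts so as to be jointly measurable in the sample and the point measure.\<close>

definition alive :: "'w \<Rightarrow> 'a \<Rightarrow> bool" where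
  "alive \<omega> u \<longleftrightarrow> (\<forall>v\<in>D. \<exists>q::rat. d r u + d r v - d u v < of_rat q \<and>
     cnt \<omega> {x \<in> br v. 2 * d r x \<le> of_rat q} = 0)"

definition good :: "'w \<Rightarrow> bool" where
  "good \<omega> \<longleftrightarrow> \<omega> \<in> space P \<and> (\<forall>v\<in>D. cnt \<omega> (br v) < \<infinity>) \<and> cnt \<omega> (leaves X) = 0 \<and> countable (atoms \<omega>)"

lemma goodD:
  assumes "good \<omega>"
  shows "\<omega> \<in> space P" "\<And>v. v \<in> D \<Longrightarrow> cnt \<omega> (br v) < \<infinity>" "cnt \<omega> (leaves X) = 0" "countable (atoms \<omega>)"
  using assms unfolding good_def by blast+

lemma cnt_0_subset: "\<omega> \<in> space P \<Longrightarrow> A \<subseteq> B \<Longrightarrow> B \<in> sets \<nu> \<Longrightarrow> cnt \<omega> B = 0 \<Longrightarrow> \<not> cnt \<omega> A > 0"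
  by (metis cnt_mono le_zero_eq less_irrefl)

lemma AE_good: "AE \<omega> in P. good \<omega>"
proof -
  have "AE \<omega> in P. \<forall>v\<in>D. cnt \<omega> (br v) < \<infinity>"
    unfolding AE_ball_countable[OF D(1)] using D(2) S_M by (intro ballI AE_cnt_finite seg_sets D(3)) auto
  then show ?thesis using AE_cnt_0[OF leaves_sets leaves_null] AE_countable_atoms AE_space
    by eventually_elim (simp add: good_def)
qed

text \<open>On a good outcome no cut is a leaf, so a cut below u lies on the segment to some v in D,
  and by \<open>seg_Int\<close> its height is bounded by the Gromov product of u and v. Conversely,
  \<open>segment_atom\<close> supplies the strict rational bound in \<open>alive\<close>: a count
  that vanishes up to a height vanishes slightly beyond it.\<close>

lemma alive_iff:
  assumes g: "good \<omega>" and u: "u \<in> S"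
  shows "alive \<omega> u \<longleftrightarrow> u \<in> remaining X (atoms \<omega>)"
proof
  note w = goodD(1)[OF g]
  have uM: "u \<in> M" using u S_M by blast
  assume al: "alive \<omega> u"
  have "a \<notin> br u" if a: "a \<in> atoms \<omega>" for a
  proof
    assume au: "a \<in> br u"
    have aM: "a \<in> M" and pos: "cnt \<omega> {a} > 0" using a by (auto simp: atoms_upto_def cnt_def)
    have "a \<in> W" using au u by (auto simp: b_span_def span_tree_def)
    moreover have "a \<notin> leaves X"
    proof
      assume "a \<in> leaves X"
      then have "{a} \<subseteq> leaves X" by simp
      then show False using cnt_0_subset[OF w _ leaves_sets goodD(3)[OF g]] pos by blast
    qed
    ultimately have "a \<in> skeleton X" by (simp add: leaves_def)
    then obtain v where v: "v \<in> D" "a \<in> br v" using D(4) by blast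
    then have vM: "v \<in> M" using D(2) S_M by blast
    obtain q where q: "d r u + d r v - d u v < of_rat q" "cnt \<omega> {x \<in> br v. 2 * d r x \<le> of_rat q} = 0"
      using al v(1) unfolding alive_def by blast
    have "2 * d r a \<le> d r u + d r v - d u v" using seg_Int[OF uM vM v(2)] au by simp
    then have "{a} \<subseteq> {x \<in> br v. 2 * d r x \<le> of_rat q}" using q(1) v(2) by simp
    then show False using cnt_0_subset[OF w _ part_sets[OF vM] q(2)] pos by blast
  qed
  then show "u \<in> remaining X (atoms \<omega>)" using uM by (auto simp: remaining_def)
next
  note w = goodD(1)[OF g]
  have uM: "u \<in> M" using u S_M by blast
  assume rem: "u \<in> remaining X (atoms \<omega>)"
  show "alive \<omega> u"
    unfolding alive_def
  proof
    fix v assume v: "v \<in> D"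
    then have vM: "v \<in> M" using D(2) S_M by blast
    have fin: "emeasure (N \<omega>) ({0..t} \<times> br v) < \<infinity>" using goodD(2)[OF g v] by (simp add: cnt_def)
    note sa = segment_atom[OF sets_N[OF w] int_N[OF w] vM fin, where a="d r u + d r v - d u v"]
    have "emeasure (N \<omega>) ({0..t} \<times> {x \<in> br v. 2 * d r x \<le> d r u + d r v - d u v}) = 0"
    proof (rule ccontr)
      assume "\<not> ?thesis"
      then obtain x where x: "x \<in> br v" "2 * d r x \<le> d r u + d r v - d u v" "emeasure (N \<omega>) ({0..t} \<times> {x}) > 0"
        using sa(1) by blast
      then have "x \<in> br u" using seg_Int[OF uM vM x(1)] by simp
      moreover have "x \<in> atoms \<omega>" using x seg_sub[OF vM] by (auto simp: atoms_upto_def)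
      ultimately show False using rem by (auto simp: remaining_def)
    qed
    then show "\<exists>q::rat. d r u + d r v - d u v < of_rat q \<and>
       cnt \<omega> {x \<in> br v. 2 * d r x \<le> of_rat q} = 0" using sa(2) by (simp add: cnt_def)
  qed
qed

lemma alive_measurable:
  assumes u: "f \<in> measurable Q (b_sample X)" and w: "h \<in> measurable Q P"
  shows "{x \<in> space Q. alive (h x) (f x)} \<in> sets Q"
proof -
  have fd: "distm Q f" by (rule distm_sample[OF u])
  have "{x \<in> space Q. alive (h x) (f x)} = {x \<in> space Q. \<forall>v\<in>D. \<exists>q::rat. d r (f x) + d r v - d (f x) v < of_rat q \<and>
     cnt (h x) {y \<in> br v. 2 * d r y \<le> of_rat q} = 0}" by (simp add: alive_def)
  also have "\<dots> \<in> sets Q"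
  proof (rule sets.sets_Collect_countable_All'[OF _ D(1)])
    fix v assume v: "v \<in> D"
    then have vM: "v \<in> M" using D(2) S_M by blast
    show "{x \<in> space Q. \<exists>q::rat. d r (f x) + d r v - d (f x) v < of_rat q \<and>
     cnt (h x) {y \<in> br v. 2 * d r y \<le> of_rat q} = 0} \<in> sets Q"
    proof (rule sets.sets_Collect_countable_Ex)
      fix q :: rat
      have [measurable]: "(\<lambda>x. d r (f x)) \<in> borel_measurable Q" "(\<lambda>x. d (f x) v) \<in> borel_measurable Q"
        using distm_pair[OF distm_root fd] fd vM by (auto simp: distm_def)
      have [measurable]: "(\<lambda>x. cnt (h x) {y \<in> br v. 2 * d r y \<le> of_rat q}) \<in> borel_measurable Q"
        by (rule measurable_compose[OF w cnt_measurable[OF part_sets[OF vM]]])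
      show "{x \<in> space Q. d r (f x) + d r v - d (f x) v < of_rat q \<and>
        cnt (h x) {y \<in> br v. 2 * d r y \<le> of_rat q} = 0} \<in> sets Q" by measurable
    qed
  qed
  finally show ?thesis .
qed

text \<open>Almost surely all points survive iff nothing is counted on the subtree they span, where
  the count is Poisson with mean t times the \<nu>-mass. That a segment without atoms has count 0 is
  again \<open>segment_atom\<close>.\<close>

lemma prob_alive:
  assumes us: "set us \<subseteq> S" "us \<noteq> []" and fin: "emeasure \<nu> (b_span X (set us)) < \<infinity>"
  shows "measure P {\<omega> \<in> space P. \<forall>u\<in>set us. alive \<omega> u} = exp (- t * measure \<nu> (b_span X (set us)))"
proof -
  interpret prob_space P by (rule prob)
  let ?B = "b_span X (set us)"
  have segs: "br u \<subseteq> ?B" if "u \<in> set us" for u using that by (auto simp: b_span_def span_tree_def)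
  have "prob {\<omega> \<in> space P. \<forall>u\<in>set us. alive \<omega> u} = prob {\<omega> \<in> space P. cnt \<omega> ?B = 0}"
  proof (rule measure_eq_AE)
    have "AE \<omega> in P. cnt \<omega> ?B < \<infinity>" by (rule AE_cnt_finite[OF span_sets[OF us(1)] fin])
    then show "AE \<omega> in P. (\<omega> \<in> {\<omega> \<in> space P. \<forall>u\<in>set us. alive \<omega> u}) = (\<omega> \<in> {\<omega> \<in> space P. cnt \<omega> ?B = 0})"
      using AE_good
    proof eventually_elim
      case (elim \<omega>)
      note w = goodD(1)[OF elim(2)]
      have "(\<forall>u\<in>set us. alive \<omega> u) \<longleftrightarrow> cnt \<omega> ?B = 0"
      proof
        assume 0: "cnt \<omega> ?B = 0"
        show "\<forall>u\<in>set us. alive \<omega> u"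
        proof
          fix u assume u: "u \<in> set us"
          have "a \<notin> br u" if a: "a \<in> atoms \<omega>" for a
          proof
            assume "a \<in> br u"
            then have "{a} \<subseteq> ?B" using segs[OF u] by blast
            moreover have "cnt \<omega> {a} > 0" using a by (simp add: atoms_upto_def cnt_def)
            ultimately show False using cnt_0_subset[OF w _ span_sets[OF us(1)] 0] by blast
          qed
          then have "u \<in> remaining X (atoms \<omega>)" using u us(1) S_M by (auto simp: remaining_def)
          then show "alive \<omega> u" using alive_iff[OF elim(2)] u us(1) by blast
        qed
      next
        assume al: "\<forall>u\<in>set us. alive \<omega> u"
        have "{0..t} \<times> br u \<in> null_sets (N \<omega>)" if u: "u \<in> set us" for u
        proof -
          have uS: "u \<in> S" "u \<in> M" using u us(1) S_M by auto
          have f: "emeasure (N \<omega>) ({0..t} \<times> br u) < \<infinity>"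
            using cnt_mono[OF w segs[OF u] span_sets[OF us(1)]] elim(1) unfolding cnt_def by (rule order_le_less_trans)
          have eq: "{x \<in> br u. 2 * d r x \<le> 2 * d r u} = br u"
          proof -
            have "d r x \<le> d r u" if "x \<in> br u" for x
              using that seg_iff[OF uS(2), of x] mdist_nonneg[of "b_metric X" x u] by linarith
            then show ?thesis by auto
          qed
          note sa = segment_atom(1)[OF sets_N[OF w] int_N[OF w] uS(2) f, where a="2 * d r u", unfolded eq]
          have "emeasure (N \<omega>) ({0..t} \<times> br u) = 0"
          proof (rule ccontr)
            assume "\<not> ?thesis"
            then obtain x where x: "x \<in> br u" "emeasure (N \<omega>) ({0..t} \<times> {x}) > 0" using sa by blast
            then have "x \<in> atoms \<omega>" using seg_sub[OF uS(2)] by (auto simp: atoms_upto_def)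
            moreover have "u \<in> remaining X (atoms \<omega>)" using alive_iff[OF elim(2) uS(1)] al u by blast
            ultimately show False using x(1) by (auto simp: remaining_def)
          qed
          then show ?thesis using sets_N[OF w seg_sets[OF uS(2)]] by (auto simp: null_sets_def)
        qed
        then have "(\<Union>u\<in>set us. {0..t} \<times> br u) \<in> null_sets (N \<omega>)"
          by (intro null_sets_UN') (auto simp: countable_finite)
        moreover have "(\<Union>u\<in>set us. {0..t} \<times> br u) = {0..t} \<times> ?B" using span_seg[OF us(2,1)] by auto
        ultimately show "cnt \<omega> ?B = 0" by (auto simp: cnt_def)
      qed
      then show ?case using w by simp
    qed
    have "{\<omega> \<in> space P. alive \<omega> u} \<in> sets P" if "u \<in> set us" for u
    proof -
      have "(\<lambda>_. u) \<in> measurable P (b_sample X)" using that us(1) fin_sample(2) by (intro measurable_const) auto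
      from alive_measurable[OF this measurable_ident] show ?thesis by simp
    qed
    then show "{\<omega> \<in> space P. \<forall>u\<in>set us. alive \<omega> u} \<in> sets P"
      by (intro sets.sets_Collect_finite_All') (use us in auto)
    show "{\<omega> \<in> space P. cnt \<omega> ?B = 0} \<in> sets P" using cnt_measurable[OF span_sets[OF us(1)]] by measurable
  qed
  then show ?thesis using prob_cnt_0[OF span_sets[OF us(1)] fin] by simp
qed

end

section \<open>The generator on the test functions\<close>

lemma (in pbt) sample_integral_bound:
  assumes f: "f \<in> borel_measurable (b_samples n X)"
    and B: "\<And>u. u \<in> space (b_samples n X) \<Longrightarrow> \<bar>f u\<bar> \<le> (B::real)"
  shows "integrable (b_samples n X) f" "\<bar>\<integral>u. f u \<partial>b_samples n X\<bar> \<le> B * b_mass X ^ n"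
proof -
  let ?Q = "b_samples n X"
  interpret finite_measure ?Q by (rule finite_measure_PiM[OF fin_sample(1) finite_lessThan])
  show i: "integrable ?Q f" using B by (intro integrable_const_bound[OF _ f]) auto
  have "\<bar>\<integral>u. f u \<partial>?Q\<bar> \<le> (\<integral>u. \<bar>f u\<bar> \<partial>?Q)" by (rule integral_abs_bound)
  also have "\<dots> \<le> (\<integral>u. B \<partial>?Q)" using i B by (intro integral_mono) auto
  also have "\<dots> = B * b_mass X ^ n"
    using finite_measure_PiM(2)[OF fin_sample(1), of "{..<n}"] fin_sample(2,3) by simp
  finally show "\<bar>\<integral>u. f u \<partial>?Q\<bar> \<le> B * b_mass X ^ n" .
qed

lemma uniform_limit_at_right_linear:
  fixes f :: "real \<Rightarrow> 'a \<Rightarrow> real"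
  assumes "\<And>t x. 0 < t \<Longrightarrow> x \<in> A \<Longrightarrow> \<bar>f t x - g x\<bar> \<le> t * C"
  shows "uniform_limit A f g (at_right 0)"
proof (rule uniform_limitI)
  fix e :: real assume e: "0 < e"
  have "dist (f t x) (g x) < e" if t: "0 < t" "t < e / (\<bar>C\<bar> + 1)" and x: "x \<in> A" for t x
  proof -
    have "t * C \<le> t * (\<bar>C\<bar> + 1)" using t(1) by (intro mult_left_mono) auto
    also have "\<dots> < e" using t(2) by (simp add: pos_less_divide_eq)
    finally show ?thesis using assms[OF t(1) x] by (simp add: dist_real_def)
  qed
  moreover have "0 < e / (\<bar>C\<bar> + 1)" using e by simp
  ultimately show "\<forall>\<^sub>F t in at_right 0. \<forall>x\<in>A. dist (f t x) (g x) < e"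
    unfolding eventually_at_right_field by blast
qed

text \<open>The first bound serves strong continuity at time 0, the second the derivative
  there.\<close>

lemma exp_minus_bounds:
  fixes y :: real assumes "0 \<le> y"
  shows "\<bar>exp (- y) - 1\<bar> \<le> y" "\<bar>exp (- y) - 1 + y\<bar> \<le> y\<^sup>2"
proof -
  have 1: "1 - y \<le> exp (- y)" using exp_ge_add_one_self[of "- y"] by simp
  then show "\<bar>exp (- y) - 1\<bar> \<le> y" using assms by simp
  have "exp (- y) \<le> 1 / (1 + y)"
    unfolding exp_minus inverse_eq_divide using assms exp_ge_add_one_self[of y] by (intro divide_left_mono) auto
  also have "\<dots> \<le> 1 - y + y\<^sup>2"
  proof -
    have "(1 - y + y\<^sup>2) * (1 + y) = 1 + y ^ 3" by (simp add: algebra_simps power2_eq_square power3_eq_cube)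
    then show ?thesis using assms by (simp add: pos_divide_le_eq)
  qed
  finally show "\<bar>exp (- y) - 1 + y\<bar> \<le> y\<^sup>2" using 1 by simp
qed

context test_function
begin

definition Phi_n :: "'a pmm \<Rightarrow> real" where
  "Phi_n Y = (\<Prod>I\<in>IX. Phi I (project_points I Y))"

lemma EE_diff: "EE \<theta>1 X us - EE \<theta>2 X us = EE (\<lambda>x. \<theta>1 x - \<theta>2 x) X us"
  by (simp add: EE_def left_diff_distrib)

text \<open>\<open>EE_bound\<close> with a constant c split off by scaling \<theta>. In the
  applications c carries the rate: t, its square, or 1 / L for a truncation at L.\<close>

lemma EE_dominated:
  "\<exists>B\<ge>0. \<forall>(X::'a bmt) \<theta> c. pbt X \<longrightarrow> \<theta> \<in> borel_measurable borel \<longrightarrow> 0 \<le> c \<longrightarrow> (\<forall>x\<ge>0. \<bar>\<theta> x\<bar> \<le> c * x ^ k) \<longrightarrow>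
     (\<forall>us. set us \<subseteq> b_supp X \<longrightarrow> length us = n \<longrightarrow> \<bar>EE \<theta> X us\<bar> \<le> c * B) \<and>
     integrable (b_samples n X) (\<lambda>u. EE \<theta> X (prefix_list n u)) \<and> \<bar>JJ \<theta> X\<bar> \<le> c * B * b_mass X ^ n"
proof -
  obtain B where B: "0 \<le> B" and bound: "\<And>(X::'a bmt) us \<theta>. pbt X \<Longrightarrow> set us \<subseteq> b_supp X \<Longrightarrow> length us = n \<Longrightarrow>
     (\<forall>x\<ge>0. \<bar>\<theta> x\<bar> \<le> x ^ k) \<Longrightarrow> \<bar>EE \<theta> X us\<bar> \<le> B" using EE_bound[of k, where ?'a='a] by blast
  show ?thesis
  proof (rule exI[of _ B], rule conjI[OF B], intro allI impI)
    fix X :: "'a bmt" and \<theta> :: "real \<Rightarrow> real" and c :: real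
    assume X: "pbt X" and \<theta>: "\<theta> \<in> borel_measurable borel" and c: "0 \<le> c" and b: "\<forall>x\<ge>0. \<bar>\<theta> x\<bar> \<le> c * x ^ k"
    interpret pbt X by (rule X)
    have 1: "\<bar>EE \<theta> X us\<bar> \<le> c * B" if us: "set us \<subseteq> b_supp X" "length us = n" for us
    proof (cases "c = 0")
      case True
      then have "\<theta> (p_mass (tau_rep X us)) = 0" using b mass_nonneg[of "tau_rep X us"] by fastforce
      then show ?thesis using True by (simp add: EE_def)
    next
      case False
      have "\<bar>EE (\<lambda>x. \<theta> x / c) X us\<bar> \<le> B"
        using b c False by (intro bound[OF X us]) (simp add: abs_divide pos_divide_le_eq mult.commute)
      moreover have "EE \<theta> X us = c * EE (\<lambda>x. \<theta> x / c) X us" using False by (simp add: EE_def)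
      ultimately show ?thesis using c by (simp add: abs_mult mult_left_mono)
    qed
    have 2: "\<bar>EE \<theta> X (prefix_list n u)\<bar> \<le> c * B" if "u \<in> space (b_samples n X)" for u
      using 1[OF prefix_S[OF that]] by simp
    note i = sample_integral_bound[OF EE_measurable[OF X distm_list_PiM \<theta>] 2]
    show "(\<forall>us. set us \<subseteq> b_supp X \<longrightarrow> length us = n \<longrightarrow> \<bar>EE \<theta> X us\<bar> \<le> c * B) \<and>
     integrable (b_samples n X) (\<lambda>u. EE \<theta> X (prefix_list n u)) \<and> \<bar>JJ \<theta> X\<bar> \<le> c * B * b_mass X ^ n"
      using 1 i unfolding JJ_def by blast
  qed
qed

lemma JJ_bound:
  obtains B where "0 \<le> B" "\<And>(X::'a bmt) \<theta> c. pbt X \<Longrightarrow> \<theta> \<in> borel_measurable borel \<Longrightarrow> 0 \<le> c \<Longrightarrow>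
    \<forall>x\<ge>0. \<bar>\<theta> x\<bar> \<le> c * x ^ k \<Longrightarrow> \<bar>JJ \<theta> X\<bar> \<le> c * B * b_mass X ^ n"
  using EE_dominated[of k, where ?'a='a] by blast

lemma EE_integrable:
  assumes "pbt X" "\<theta> \<in> borel_measurable borel" "\<And>x. 0 \<le> x \<Longrightarrow> \<bar>\<theta> x\<bar> \<le> x ^ k"
  shows "integrable (b_samples n X) (\<lambda>u. EE \<theta> X (prefix_list n u))"
  using EE_dominated[of k] assms by (metis mult_1 zero_le_one)

lemma JJ_diff:
  assumes X: "pbt X" and \<theta>: "\<theta> \<in> borel_measurable borel" "\<And>x. 0 \<le> x \<Longrightarrow> \<bar>\<theta> x\<bar> \<le> x ^ k"
    and \<theta>': "\<theta>' \<in> borel_measurable borel" "\<And>x. 0 \<le> x \<Longrightarrow> \<bar>\<theta>' x\<bar> \<le> x ^ k'"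
  shows "JJ \<theta> X - JJ \<theta>' X = JJ (\<lambda>x. \<theta> x - \<theta>' x) X"
  unfolding JJ_def EE_diff[symmetric]
  using EE_integrable[OF X \<theta>] EE_integrable[OF X \<theta>'] by (rule Bochner_Integration.integral_diff[symmetric])

text \<open>Where \<open>\<nu>\<close> is infinite on the spanned subtree, \<open>\<tau>\<close> is that of the tree with \<open>\<nu> = 0\<close>.\<close>

lemma Phi_n_tau:
  assumes X: "pbt X"
  shows "(\<lambda>u. Phi_n (tau_rep X (prefix_list n u))) \<in> borel_measurable (b_samples n X)"
    "AE u in b_samples n X. Phi_n (tau_rep X (prefix_list n u)) = EE (\<lambda>_. 1) X (prefix_list n u)"
proof -
  interpret pbt X by (rule X)
  let ?Q = "b_samples n X"
  let ?X = "X\<lparr>b_nu := null_measure \<nu>\<rparr>"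
  have "finite_measure (null_measure \<nu>)" by (intro finite_measureI) simp
  then have "sigma_finite_measure (null_measure \<nu>)" by (rule finite_measure.axioms(1))
  then have Y: "pbt ?X" using pre by (simp add: pbt_def pre_bmt_def)
  then interpret Y: pbt ?X .
  have sp: "b_span ?X = b_span X" "b_supp ?X = b_supp X" by (simp_all add: b_span_def[abs_def] b_supp_def)
  have inf: "Phi_n (tau_rep X us) = EE (\<lambda>_. 1) ?X us"
    if us: "set us \<subseteq> S" and i: "\<not> emeasure \<nu> (b_span X (set us)) < \<infinity>" for us
  proof -
    have "null_measure (restrict_space \<nu> (b_span X (set us))) = restrict_space (null_measure \<nu>) (b_span X (set us))"
    proof (rule measure_eqI)
      show "sets (null_measure (restrict_space \<nu> (b_span X (set us)))) = sets (restrict_space (null_measure \<nu>) (b_span X (set us)))"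
        by (simp add: sets_restrict_space)
      show "emeasure (null_measure (restrict_space \<nu> (b_span X (set us)))) A = emeasure (restrict_space (null_measure \<nu>) (b_span X (set us))) A"
        if "A \<in> sets (null_measure (restrict_space \<nu> (b_span X (set us))))" for A
        using that span_sets[OF us] by (subst emeasure_restrict_space) (auto simp: sets_restrict_space_iff)
    qed
    then have "tau_rep X us = tau_rep ?X us" using i by (simp add: tau_rep_def Let_def sp)
    moreover have "Phi_n (tau_rep ?X us) = EE (\<lambda>_. 1) ?X us"
      unfolding Phi_n_def using us by (intro Pi_tilde_EE[OF Y]) (simp_all add: sp)
    ultimately show ?thesis by simp
  qed
  have fin: "Phi_n (tau_rep X us) = EE (\<lambda>_. 1) X us"
    if us: "set us \<subseteq> S" and i: "emeasure \<nu> (b_span X (set us)) < \<infinity>" for us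
    unfolding Phi_n_def by (rule Pi_tilde_EE[OF X us i])
  have "distm_list ?Q n (prefix_list n)" by (rule distm_list_PiM)
  note m = span_emeasure_measurable[OF this] EE_measurable[OF X this, of "\<lambda>_. 1"]
  have m': "(\<lambda>u. EE (\<lambda>_. 1) ?X (prefix_list n u)) \<in> borel_measurable ?Q"
    using EE_measurable[OF Y Y.distm_list_PiM, of "\<lambda>_. 1"] by simp
  have "(\<lambda>u. if emeasure \<nu> (b_span X (set (prefix_list n u))) < \<infinity> then EE (\<lambda>_. 1) X (prefix_list n u)
    else EE (\<lambda>_. 1) ?X (prefix_list n u)) \<in> borel_measurable ?Q"
    using m m' by measurable
  also have "?this \<longleftrightarrow> (\<lambda>u. Phi_n (tau_rep X (prefix_list n u))) \<in> borel_measurable ?Q"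
    using fin inf prefix_S by (intro measurable_cong) metis
  finally show "(\<lambda>u. Phi_n (tau_rep X (prefix_list n u))) \<in> borel_measurable ?Q" .
  show "AE u in ?Q. Phi_n (tau_rep X (prefix_list n u)) = EE (\<lambda>_. 1) X (prefix_list n u)"
    using AE_span_finite[OF n] AE_space by eventually_elim (rule fin[OF prefix_S])
qed

lemma Psi1_JJ:
  assumes "class_rep c \<in> bm_trees" shows "Psi1 n Phi_n c = JJ (\<lambda>_. 1) (class_rep c)"
proof -
  note X = bm_treesD[OF assms]
  show ?thesis
    unfolding Psi1_def Let_def JJ_def
    using Phi_n_tau[OF X] EE_measurable[OF X pbt.distm_list_PiM[OF X]] by (intro integral_cong_AE) auto
qed

text \<open>Stated for s times \<open>JJ \<theta>\<close> because it is used for the test function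
  and for the candidate of its generator. Fubini exchanges cuts and samples; for given samples only
  the survival probability of the spanned subtree remains.\<close>

lemma expectation_JJ:
  fixes N :: "'w \<Rightarrow> (real \<times> 'a) measure"
  assumes X: "X \<in> bm_trees" and P: "poisson_point_measure P N (pruning_intensity X)" and t: "0 \<le> t"
    and \<theta>: "\<theta> \<in> borel_measurable borel" "\<And>x. 0 \<le> x \<Longrightarrow> \<bar>\<theta> x\<bar> \<le> x ^ k"
    and G: "\<And>c. class_rep c \<in> bm_trees \<Longrightarrow> G c = s * JJ \<theta> (class_rep c)"
  shows "(\<integral>\<omega>. G (bm_class (prune X (atoms_upto X t (N \<omega>)))) \<partial>completion P) = s * JJ (\<lambda>x. exp (- t * x) * \<theta> x) X"
proof -
  interpret pruning X P N t using X P t by unfold_locales (auto simp: bm_trees_iff)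
  let ?Q = "b_samples n X"
  let ?E = "\<lambda>u. EE \<theta> X (prefix_list n u)"
  \<comment> \<open>Survival is expressed by \<open>alive\<close>, which is jointly measurable in
    outcome and sample and agrees with \<open>remaining\<close> on good outcomes.\<close>
  let ?A = "{x \<in> space (P \<Otimes>\<^sub>M ?Q). \<forall>i\<in>{..<n}. alive (fst x) (snd x i)}"
  define F where "F \<omega> u = indicator ?A (\<omega>, u) * ?E u" for \<omega> u
  have fQ: "finite_measure ?Q" by (rule finite_measure_PiM[OF fin_sample(1) finite_lessThan])
  interpret Q: finite_measure ?Q by (rule fQ)
  interpret P: prob_space P by (rule prob)
  interpret PQ: pair_sigma_finite P ?Q ..
  obtain B where B: "0 \<le> B" "\<And>us. set us \<subseteq> S \<Longrightarrow> length us = n \<Longrightarrow> \<bar>EE \<theta> X us\<bar> \<le> B"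
    using EE_bound[of k, where ?'a='a] \<theta>(2) pbt_axioms by blast
  have Em: "?E \<in> borel_measurable ?Q" by (rule EE_measurable[OF pbt_axioms distm_list_PiM \<theta>(1)])
  have A: "?A \<in> sets (P \<Otimes>\<^sub>M ?Q)"
  proof -
    have "{x \<in> space (P \<Otimes>\<^sub>M ?Q). alive (fst x) (snd x i)} \<in> sets (P \<Otimes>\<^sub>M ?Q)" if "i \<in> {..<n}" for i
      using that by (intro alive_measurable) measurable
    from sets.sets_Collect_finite_All'[OF this finite_lessThan] show ?thesis using n by (simp add: lessThan_empty_iff)
  qed
  have Fm: "(\<lambda>(\<omega>, u). F \<omega> u) \<in> borel_measurable (P \<Otimes>\<^sub>M ?Q)"
    unfolding F_def split_beta' prod.collapse
    by (intro borel_measurable_times borel_measurable_indicator A measurable_compose[OF measurable_snd Em])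
  have int: "integrable (P \<Otimes>\<^sub>M ?Q) (\<lambda>(\<omega>, u). F \<omega> u)"
  proof -
    interpret R: finite_measure "P \<Otimes>\<^sub>M ?Q" by (rule finite_measure_pair_measure[OF fQ P.finite_measure_axioms])
    have "\<bar>F (fst x) (snd x)\<bar> \<le> B" if "x \<in> space (P \<Otimes>\<^sub>M ?Q)" for x
    proof -
      have "\<bar>?E (snd x)\<bar> \<le> B" using that by (intro B(2) prefix_S) (auto simp: space_pair_measure)
      then show ?thesis using B(1) by (simp add: F_def abs_mult indicator_def)
    qed
    then show ?thesis by (intro R.integrable_const_bound[OF _ Fm, of B] AE_I2) (simp add: split_beta')
  qed
  have ae: "AE \<omega> in P. G (bm_class (prune X (atoms \<omega>))) = s * (\<integral>u. F \<omega> u \<partial>?Q)"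
    using AE_good
  proof eventually_elim
    case (elim \<omega>)
    have "atoms \<omega> \<subseteq> M" by (auto simp: atoms_upto_def)
    note JP = JJ_prune[OF X goodD(4)[OF elim] this \<theta>(1)]
    have "G (bm_class (prune X (atoms \<omega>))) = s * (\<integral>u. (\<Prod>i<n. indicator (remaining X (atoms \<omega>)) (u i)) * ?E u \<partial>?Q)"
      using JP G by simp
    also have "(\<integral>u. (\<Prod>i<n. indicator (remaining X (atoms \<omega>)) (u i)) * ?E u \<partial>?Q) = (\<integral>u. F \<omega> u \<partial>?Q)"
    proof (rule Bochner_Integration.integral_cong[OF refl])
      fix u assume u: "u \<in> space ?Q"
      have "u i \<in> S" if "i < n" for i using prefix_S[OF u] that by auto
      then have "(\<Prod>i<n. indicator (remaining X (atoms \<omega>)) (u i)) = (\<Prod>i<n. if alive \<omega> (u i) then 1 else 0 :: real)"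
        using alive_iff[OF elim] by (intro prod.cong) (auto simp: indicator_def)
      also have "\<dots> = indicator ?A (\<omega>, u)"
        using u goodD(1)[OF elim] by (auto simp: indicator_def space_pair_measure intro!: prod_zero)
      finally show "(\<Prod>i<n. indicator (remaining X (atoms \<omega>)) (u i)) * ?E u = F \<omega> u" by (simp add: F_def)
    qed
    finally show ?case .
  qed
  have sm: "(\<lambda>\<omega>. s * (\<integral>u. F \<omega> u \<partial>?Q)) \<in> borel_measurable P"
    using Fm by (intro borel_measurable_times borel_measurable_const Q.borel_measurable_lebesgue_integral)
  have "(\<integral>\<omega>. G (bm_class (prune X (atoms \<omega>))) \<partial>completion P) = s * (\<integral>\<omega>. \<integral>u. F \<omega> u \<partial>?Q \<partial>P)"
    unfolding completion_measurable_AE(2)[OF sm ae] by (rule integral_mult_right_zero)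
  also have "(\<integral>\<omega>. \<integral>u. F \<omega> u \<partial>?Q \<partial>P) = (\<integral>u. \<integral>\<omega>. F \<omega> u \<partial>P \<partial>?Q)" by (rule PQ.Fubini_integral[OF int, symmetric])
  also have "(\<integral>u. \<integral>\<omega>. F \<omega> u \<partial>P \<partial>?Q) = JJ (\<lambda>x. exp (- t * x) * \<theta> x) X"
    unfolding JJ_def
  proof (rule integral_cong_AE)
    show "(\<lambda>u. \<integral>\<omega>. F \<omega> u \<partial>P) \<in> borel_measurable ?Q"
      using Fm by (intro P.borel_measurable_lebesgue_integral) (simp add: measurable_pair_swap_iff[of _ ?Q] split_beta')
    show "(\<lambda>u. EE (\<lambda>x. exp (- t * x) * \<theta> x) X (prefix_list n u)) \<in> borel_measurable ?Q"
      using \<theta>(1) by (intro EE_measurable[OF pbt_axioms distm_list_PiM]) measurable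
    show "AE u in ?Q. (\<integral>\<omega>. F \<omega> u \<partial>P) = EE (\<lambda>x. exp (- t * x) * \<theta> x) X (prefix_list n u)"
      using AE_span_finite[OF n] AE_space
    proof eventually_elim
      case (elim u)
      let ?us = "prefix_list n u"
      have ne: "?us \<noteq> []" using n prefix_list_simps(1)[of n u] by fastforce
      have "(\<integral>\<omega>. F \<omega> u \<partial>P) = (\<integral>\<omega>. indicator {\<omega> \<in> space P. \<forall>v\<in>set ?us. alive \<omega> v} \<omega> * ?E u \<partial>P)"
        using elim(2) by (intro Bochner_Integration.integral_cong[OF refl]) (auto simp: F_def space_pair_measure indicator_def)
      also have "\<dots> = P.prob {\<omega> \<in> space P. \<forall>v\<in>set ?us. alive \<omega> v} * ?E u"
        by (simp add: Int_def conj_commute)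
      also have "\<dots> = exp (- t * p_mass (tau_rep X ?us)) * ?E u"
        using prob_alive[OF prefix_S[OF elim(2)] ne elim(1)] tau_mass[OF prefix_S[OF elim(2)]] by simp
      finally show ?case by (simp add: EE_def)
    qed
  qed
  finally show ?thesis .
qed

text \<open>\<theta>(x) = x is unbounded, so \<open>JJ_tendsto\<close> does not apply directly.
  Truncation at L costs at most x^2 / L, which \<open>JJ_bound\<close> with k = 2 controls
  uniformly, the masses along the sequence being bounded.\<close>

lemma JJ_id_tendsto:
  fixes c :: "nat \<Rightarrow> 'a bmt set"
  assumes c: "\<And>N. c N \<in> Hfs" "d \<in> Hfs"
    and conv: "weakly_converges HH_seq_top (\<lambda>N. varpi (class_rep (c N))) (varpi (class_rep d))"
  shows "(\<lambda>N. JJ (\<lambda>x. x) (class_rep (c N))) \<longlonglongrightarrow> JJ (\<lambda>x. x) (class_rep d)"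
proof (rule LIMSEQ_I)
  let ?c = "\<lambda>N. class_rep (c N)" and ?d = "class_rep d"
  fix e :: real assume e: "0 < e"
  obtain B where B: "0 \<le> B" and bound: "\<And>(X::'a bmt) \<theta> c. pbt X \<Longrightarrow> \<theta> \<in> borel_measurable borel \<Longrightarrow> 0 \<le> c \<Longrightarrow>
    \<forall>x\<ge>0. \<bar>\<theta> x\<bar> \<le> c * x\<^sup>2 \<Longrightarrow> \<bar>JJ \<theta> X\<bar> \<le> c * B * b_mass X ^ n"
    by (rule JJ_bound[of 2, where ?'a='a]) blast
  have mass: "(\<lambda>N. b_mass (?c N)) \<longlonglongrightarrow> b_mass ?d" by (rule LWV_tendsto_mass[OF c conv])
  obtain C where C: "\<And>N. \<bar>b_mass (?c N)\<bar> \<le> C"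
    using convergent_imp_Bseq[OF convergentI[OF mass]] by (auto simp: Bseq_def)
  define D where "D = max C (b_mass ?d)"
  have D: "b_mass (?c N) \<le> D" "b_mass ?d \<le> D" for N
    using C[of N] by (auto simp: D_def)
  have m0: "0 \<le> b_mass X" for X :: "'a bmt" by (simp add: b_mass_def total_mass_def)
  \<comment> \<open>Chosen so that B D^n / L is below e / 3; the summand 1 keeps L positive.\<close>
  define L where "L = 1 + 3 * B * D ^ n / e"
  have D0: "0 \<le> D" using D(2) m0 order_trans by blast
  have L: "0 < L" using e B D0 by (simp add: L_def add_pos_nonneg)
  let ?\<theta> = "\<lambda>x. min \<bar>x\<bar> L"
  have close: "\<bar>JJ (\<lambda>x. x) X - JJ ?\<theta> X\<bar> < e / 3" if X: "X \<in> bm_trees" "b_mass X \<le> D" for X :: "'a bmt"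
  proof -
    have "JJ (\<lambda>x. x) X - JJ ?\<theta> X = JJ (\<lambda>x. x - ?\<theta> x) X"
      by (rule JJ_diff[OF bm_treesD[OF X(1)], where k=1 and k'=1]) (use L in auto)
    also have "\<bar>\<dots>\<bar> \<le> (1 / L) * B * b_mass X ^ n"
    proof (rule bound[OF bm_treesD[OF X(1)]])
      have "\<bar>x - ?\<theta> x\<bar> \<le> 1 / L * x\<^sup>2" if x: "0 \<le> x" for x
      proof (cases "x \<le> L")
        case False
        then have "x * L \<le> x * x" using x by (intro mult_left_mono) auto
        then have "x \<le> 1 / L * x\<^sup>2" using L by (simp add: pos_le_divide_eq power2_eq_square)
        then show ?thesis using False x L by simp
      qed (use x L in simp)
      then show "\<forall>x\<ge>0. \<bar>x - ?\<theta> x\<bar> \<le> 1 / L * x\<^sup>2" by blast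
    qed (use L in auto)
    also have "\<dots> \<le> (1 / L) * B * D ^ n" using X(2) m0 B L by (intro mult_left_mono power_mono) auto
    also have "\<dots> < e / 3" using L e by (simp add: pos_divide_less_eq) (simp add: L_def field_simps)
    finally show ?thesis .
  qed
  have "(\<lambda>N. JJ ?\<theta> (?c N)) \<longlonglongrightarrow> JJ ?\<theta> ?d"
    by (rule JJ_tendsto[OF c conv, where B\<theta>=L]) (use L in \<open>auto intro!: continuous_intros\<close>)
  from LIMSEQ_D[OF this, of "e / 3"] e obtain N0 where
    N0: "\<And>N. N0 \<le> N \<Longrightarrow> \<bar>JJ ?\<theta> (?c N) - JJ ?\<theta> ?d\<bar> < e / 3" by auto
  have "\<bar>JJ (\<lambda>x. x) (?c N) - JJ (\<lambda>x. x) ?d\<bar> < e" if "N0 \<le> N" for N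
    using N0[OF that] close[OF Hfs_rep(1)[OF c(1)] D(1)[of N]] close[OF Hfs_rep(1)[OF c(2)] D(2)] by linarith
  then show "\<exists>N0. \<forall>N\<ge>N0. norm (JJ (\<lambda>x. x) (?c N) - JJ (\<lambda>x. x) ?d) < e" by auto
qed

end

section \<open>The generator as an integral over single cuts\<close>

context test_function
begin

text \<open>A cut at v removes exactly the samples whose span contains v, so the jump at v is minus
  the integral of \<open>h u v\<close> over u. Integrating over v first turns the indicator into the
  \<nu>-mass of the span, the weight \<theta>(x) = x.\<close>

lemma jump_integral:
  assumes X: "X \<in> bm_trees"
  shows "integrable (b_nu X) (\<lambda>v. Psi1 n Phi_n (bm_class (prune X {v})) - JJ (\<lambda>_. 1) X)"
    "(\<integral>v. Psi1 n Phi_n (bm_class (prune X {v})) - JJ (\<lambda>_. 1) X \<partial>b_nu X) = - JJ (\<lambda>x. x) X"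
proof -
  interpret pbt X by (rule bm_treesD[OF X])
  let ?Q = "b_samples n X"
  let ?E = "\<lambda>u. EE (\<lambda>_. 1) X (prefix_list n u)"
  let ?A = "{x \<in> space (?Q \<Otimes>\<^sub>M nuW). snd x \<in> b_span X (set (prefix_list n (fst x)))}"
  define h where "h u v = indicator (b_span X (set (prefix_list n u))) v * ?E u" for u v
  have fQ: "finite_measure ?Q" by (rule finite_measure_PiM[OF fin_sample(1) finite_lessThan])
  interpret Q: finite_measure ?Q by (rule fQ)
  interpret nuW: sigma_finite_measure nuW by (rule sf_nuW)
  interpret QW: pair_sigma_finite ?Q nuW ..
  have Em: "?E \<in> borel_measurable ?Q" by (rule EE_measurable[OF pbt_axioms distm_list_PiM]) simp
  have A: "?A \<in> sets (?Q \<Otimes>\<^sub>M nuW)"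
    by (rule span_in_measurable[OF distm_list_compose[OF distm_list_PiM measurable_fst] distm_nuW[OF measurable_snd]])
  have hm: "(\<lambda>(u, v). h u v) \<in> borel_measurable (?Q \<Otimes>\<^sub>M nuW)"
  proof -
    have "(\<lambda>x. indicator ?A x * ?E (fst x)) \<in> borel_measurable (?Q \<Otimes>\<^sub>M nuW)"
      by (intro borel_measurable_times borel_measurable_indicator A measurable_compose[OF measurable_fst Em])
    then show ?thesis
      by (rule iffD1[OF measurable_cong, rotated]) (auto simp: h_def split_beta' indicator_def)
  qed
  have mW: "measure nuW (b_span X (set us) \<inter> space nuW) = p_mass (tau_rep X us)" if us: "set us \<subseteq> S" for us
    using emeasure_nuW[OF span_sets[OF us] span_W[OF us]] span_W[OF us] space_nuW tau_mass[OF us]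
    by (simp add: measure_def Int_absorb2)
  have inner: "(\<integral>v. h u v \<partial>nuW) = EE (\<lambda>x. x) X (prefix_list n u)"
    "(\<integral>v. norm (h u v) \<partial>nuW) = norm (EE (\<lambda>x. x) X (prefix_list n u))" if u: "u \<in> space ?Q" for u
    using mW[OF prefix_S[OF u]] by (simp_all add: h_def EE_def abs_mult mass_nonneg)
  have id: "integrable ?Q (\<lambda>u. EE (\<lambda>x. x) X (prefix_list n u))"
    by (rule EE_integrable[OF pbt_axioms, where k=1]) auto
  \<comment> \<open>The integral over v of the absolute value of the kernel is the absolute value of
    \<open>EE\<close> with weight x, which is integrable over the samples.\<close>
  have int: "integrable (?Q \<Otimes>\<^sub>M nuW) (\<lambda>(u, v). h u v)"
  proof (rule QW.Fubini_integrable[OF hm])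
    show "integrable ?Q (\<lambda>u. \<integral>v. norm (case (u, v) of (u, v) \<Rightarrow> h u v) \<partial>nuW)"
      using integrable_norm[OF id] inner(2) by (simp cong: Bochner_Integration.integrable_cong)
    show "AE u in ?Q. integrable nuW (\<lambda>v. case (u, v) of (u, v) \<Rightarrow> h u v)"
      using AE_span_finite[OF n] AE_space
    proof eventually_elim
      case (elim u)
      note us = prefix_S[OF elim(2)]
      have "integrable nuW (indicator (b_span X (set (prefix_list n u))) :: 'a \<Rightarrow> real)"
        using elim(1) unfolding emeasure_nuW[OF span_sets[OF us] span_W[OF us], symmetric]
        by (rule integrable_real_indicator[OF span_W'[OF us]])
      then show ?case by (simp add: h_def)
    qed
  qed
  have jump: "Psi1 n Phi_n (bm_class (prune X {v})) - JJ (\<lambda>_. 1) X = - (indicator W v *\<^sub>R (\<integral>u. h u v \<partial>?Q))"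
    if v: "v \<in> M" for v
  proof -
    let ?R = "\<lambda>u. (\<Prod>i<n. indicator (remaining X {v}) (u i)) :: real"
    have "countable {v}" "{v} \<subseteq> M" using v by auto
    note J = JJ_prune[OF X this, of "\<lambda>_. 1", OF borel_measurable_const]
    have "Psi1 n Phi_n (bm_class (prune X {v})) = (\<integral>u. ?R u * ?E u \<partial>?Q)"
      using Psi1_JJ[OF conjunct1[OF J]] conjunct2[OF J] by (rule trans)
    moreover have eq: "?R u * ?E u = ?E u - h u v" if u: "u \<in> space ?Q" for u
    proof -
      have us: "prefix_list n u \<noteq> []" using n prefix_list_simps(1)[of n u] by fastforce
      have "u i \<in> M" if "i < n" for i using prefix_S[OF u] S_M that by auto
      then have R: "u i \<in> remaining X {v} \<longleftrightarrow> v \<notin> br (u i)" if "i < n" for i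
        using that by (simp add: remaining_def)
      have sp: "v \<in> b_span X (set (prefix_list n u)) \<longleftrightarrow> (\<exists>i<n. v \<in> br (u i))"
        using span_seg[OF us prefix_S[OF u]] by auto
      have "?R u = 1 - indicator (b_span X (set (prefix_list n u))) v"
      proof (cases "v \<in> b_span X (set (prefix_list n u))")
        case True
        then obtain i where i: "i < n" "v \<in> br (u i)" using sp by blast
        then have "?R u = 0" using R[OF i(1)] by (intro prod_zero bexI[of _ i]) auto
        then show ?thesis using True by simp
      next
        case False
        then have "?R u = 1" using R sp by (intro prod.neutral) auto
        then show ?thesis using False by simp
      qed
      then show ?thesis by (simp add: h_def left_diff_distrib)
    qed
    ultimately have 1: "Psi1 n Phi_n (bm_class (prune X {v})) = (\<integral>u. ?E u - h u v \<partial>?Q)"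
      using Bochner_Integration.integral_cong[OF refl eq] by simp
    have Ei: "integrable ?Q ?E" by (rule EE_integrable[OF pbt_axioms, where k=0]) auto
    show ?thesis
    proof (cases "v \<in> W")
      case True
      then have "v \<in> space nuW" by (simp add: space_nuW)
      then have "(\<lambda>u. (u, v)) \<in> measurable ?Q (?Q \<Otimes>\<^sub>M nuW)" by measurable
      from measurable_compose[OF this hm] have "(\<lambda>u. h u v) \<in> borel_measurable ?Q" by simp
      then have "integrable ?Q (\<lambda>u. h u v)"
        by (rule Bochner_Integration.integrable_bound[OF Ei]) (auto simp: h_def indicator_def)
      from Bochner_Integration.integral_diff[OF Ei this] show ?thesis using 1 True by (simp add: JJ_def)
    next
      \<comment> \<open>A cut off the span of the support meets no sampled subtree, so there is no
        jump; this is why Fubini may be applied with \<nu> restricted to W.\<close>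
      case False
      have "h u v = 0" if "u \<in> space ?Q" for u
        using span_W[OF prefix_S[OF that]] False by (auto simp: h_def indicator_def)
      then have "(\<integral>u. ?E u - h u v \<partial>?Q) = JJ (\<lambda>_. 1) X"
        unfolding JJ_def by (intro Bochner_Integration.integral_cong) auto
      then show ?thesis using 1 False by simp
    qed
  qed
  have WM: "W \<inter> space \<nu> \<in> sets \<nu>" using W_sets(1) by simp
  have "integrable nuW (\<lambda>v. \<integral>u. h u v \<partial>?Q)" by (rule QW.integrable_snd[OF int])
  then have "integrable \<nu> (\<lambda>v. indicator W v *\<^sub>R (\<integral>u. h u v \<partial>?Q))"
    unfolding integrable_restrict_space[OF WM] .
  then have "integrable \<nu> (\<lambda>v. - (indicator W v *\<^sub>R (\<integral>u. h u v \<partial>?Q)))" by (rule Bochner_Integration.integrable_minus)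
  also have "?this \<longleftrightarrow> integrable \<nu> (\<lambda>v. Psi1 n Phi_n (bm_class (prune X {v})) - JJ (\<lambda>_. 1) X)"
    using jump space_nu by (intro Bochner_Integration.integrable_cong) auto
  finally show "integrable \<nu> (\<lambda>v. Psi1 n Phi_n (bm_class (prune X {v})) - JJ (\<lambda>_. 1) X)" .
  have "(\<integral>v. Psi1 n Phi_n (bm_class (prune X {v})) - JJ (\<lambda>_. 1) X \<partial>\<nu>) = (\<integral>v. - (indicator W v *\<^sub>R (\<integral>u. h u v \<partial>?Q)) \<partial>\<nu>)"
    using jump space_nu by (intro Bochner_Integration.integral_cong) auto
  also have "\<dots> = - (\<integral>v. indicator W v *\<^sub>R (\<integral>u. h u v \<partial>?Q) \<partial>\<nu>)" by (rule Bochner_Integration.integral_minus)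
  also have "(\<integral>v. indicator W v *\<^sub>R (\<integral>u. h u v \<partial>?Q) \<partial>\<nu>) = (\<integral>v. \<integral>u. h u v \<partial>?Q \<partial>nuW)"
    by (rule integral_restrict_space[OF WM, symmetric])
  also have "\<dots> = (\<integral>u. \<integral>v. h u v \<partial>nuW \<partial>?Q)" by (rule QW.Fubini_integral[OF int])
  also have "\<dots> = JJ (\<lambda>x. x) X"
    unfolding JJ_def using inner(1) by (intro Bochner_Integration.integral_cong) auto
  finally show "(\<integral>v. Psi1 n Phi_n (bm_class (prune X {v})) - JJ (\<lambda>_. 1) X \<partial>\<nu>) = - JJ (\<lambda>x. x) X" .
qed

lemma JJ_class:
  assumes "X \<in> bm_trees" "\<theta> \<in> borel_measurable borel" shows "JJ \<theta> (class_rep (bm_class X)) = JJ \<theta> X"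
  using JJ_iso[OF _ bm_class_rep[OF bm_iso_refl[OF assms(1)] assms(1)] assms(2)] assms(1) by (simp add: bm_trees_iff)

text \<open>Used twice, since \<open>is_generator_value\<close> asks both the function and its image
  to lie in the domain of strong continuity; s = -1 accounts for the sign of the image.\<close>

lemma JJ_strong_domain:
  fixes P :: "'a bmt \<Rightarrow> 'w measure" and N :: "'a bmt \<Rightarrow> 'w \<Rightarrow> (real \<times> 'a) measure"
  assumes P: "\<And>X. X \<in> bm_trees \<Longrightarrow> poisson_point_measure (P X) (N X) (pruning_intensity X)"
    and \<theta>: "\<theta> \<in> borel_measurable borel" "\<And>x. 0 \<le> x \<Longrightarrow> \<bar>\<theta> x\<bar> \<le> x ^ k"
    and G: "\<And>c. class_rep c \<in> bm_trees \<Longrightarrow> G c = s * JJ \<theta> (class_rep c)"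
    and lim: "\<And>c (d::'a bmt set). range c \<subseteq> Hfs \<Longrightarrow> d \<in> Hfs \<Longrightarrow>
      weakly_converges HH_seq_top (\<lambda>N. varpi (class_rep (c N))) (varpi (class_rep d)) \<Longrightarrow>
      (\<lambda>N. JJ \<theta> (class_rep (c N))) \<longlonglongrightarrow> JJ \<theta> (class_rep d)"
  shows "G \<in> strong_domain P N K"
proof -
  have mass: "0 \<le> b_mass (class_rep c)" "b_mass (class_rep c) \<le> K" if "c \<in> HKs K" for c :: "'a bmt set"
    using HKs_rep(2)[OF that] by (simp_all add: b_mass_def total_mass_def)
  obtain B where B: "0 \<le> B" "\<And>(X::'a bmt) \<theta> c. pbt X \<Longrightarrow> \<theta> \<in> borel_measurable borel \<Longrightarrow> 0 \<le> c \<Longrightarrow>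
    \<forall>x\<ge>0. \<bar>\<theta> x\<bar> \<le> c * x ^ k \<Longrightarrow> \<bar>JJ \<theta> X\<bar> \<le> c * B * b_mass X ^ n" by (rule JJ_bound[of k, where ?'a='a]) blast
  \<comment> \<open>One more power of the mass, from |exp (- t x) - 1| \<le> t x.\<close>
  obtain B' where B': "0 \<le> B'" "\<And>(X::'a bmt) \<theta> c. pbt X \<Longrightarrow> \<theta> \<in> borel_measurable borel \<Longrightarrow> 0 \<le> c \<Longrightarrow>
    \<forall>x\<ge>0. \<bar>\<theta> x\<bar> \<le> c * x ^ (k + 1) \<Longrightarrow> \<bar>JJ \<theta> X\<bar> \<le> c * B' * b_mass X ^ n"
    by (rule JJ_bound[of "k + 1", where ?'a='a]) blast
  have "continuous_map LWV euclideanreal G"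
    unfolding LWV_def
  proof (rule continuous_map_topology_of_convergence)
    fix c :: "nat \<Rightarrow> 'a bmt set" and d
    assume c: "range c \<subseteq> Hfs" "d \<in> Hfs"
      "weakly_converges HH_seq_top (\<lambda>N. varpi (class_rep (c N))) (varpi (class_rep d))"
    then have "G (c N) = s * JJ \<theta> (class_rep (c N))" "G d = s * JJ \<theta> (class_rep d)" for N
      using G Hfs_rep(1) by blast+
    then show "(\<lambda>N. G (c N)) \<longlonglongrightarrow> G d" using tendsto_mult_left[OF lim[OF c]] by simp
  qed
  moreover have "\<bar>G c\<bar> \<le> \<bar>s\<bar> * (B * K ^ n)" if c: "c \<in> HKs K" for c
  proof -
    have "\<bar>JJ \<theta> (class_rep c)\<bar> \<le> 1 * B * b_mass (class_rep c) ^ n"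
      by (rule B(2)[OF bm_treesD[OF HKs_rep(1)[OF c]] \<theta>(1)]) (use \<theta>(2) in auto)
    also have "\<dots> \<le> B * K ^ n" using mass[OF c] B(1) unfolding mult_1 by (intro mult_left_mono power_mono)
    finally show ?thesis unfolding G[OF HKs_rep(1)[OF c]] abs_mult by (intro mult_left_mono) auto
  qed
  ultimately have "G \<in> Cb (subtopology LWV (HKs K))"
    unfolding Cb_def by (auto simp: bounded_iff intro: continuous_map_from_subtopology)
  moreover have "uniform_limit (HKs K) (\<lambda>t. pruning_semigroup P N t G) G (at_right 0)"
  proof (rule uniform_limit_at_right_linear)
    fix t :: real and c :: "'a bmt set" assume t: "0 < t" and c: "c \<in> HKs K"
    let ?X = "class_rep c"
    note X = HKs_rep(1)[OF c]
    have e: "\<bar>exp (- t * x) * \<theta> x\<bar> \<le> x ^ k" if "0 \<le> x" for x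
    proof -
      have "exp (- t * x) \<le> 1" using t that by simp
      then have "\<bar>exp (- t * x) * \<theta> x\<bar> \<le> 1 * \<bar>\<theta> x\<bar>" unfolding abs_mult by (intro mult_right_mono) auto
      then show ?thesis using \<theta>(2)[OF that] by simp
    qed
    have "pruning_semigroup P N t G c = s * JJ (\<lambda>x. exp (- t * x) * \<theta> x) ?X"
      unfolding pruning_semigroup_def Let_def using expectation_JJ[OF X P[OF X] _ \<theta> G] t by simp
    then have "pruning_semigroup P N t G c - G c = s * JJ (\<lambda>x. exp (- t * x) * \<theta> x - \<theta> x) ?X"
      using JJ_diff[OF bm_treesD[OF X] _ e \<theta>] \<theta>(1) G[OF X] by (simp add: right_diff_distrib[symmetric])
    moreover have "\<bar>JJ (\<lambda>x. exp (- t * x) * \<theta> x - \<theta> x) ?X\<bar> \<le> t * B' * b_mass ?X ^ n"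
    proof (rule B'(2)[OF bm_treesD[OF X]])
      have "\<bar>exp (- t * x) * \<theta> x - \<theta> x\<bar> \<le> t * x ^ (k + 1)" if x: "0 \<le> x" for x
      proof -
        have "\<bar>exp (- t * x) * \<theta> x - \<theta> x\<bar> = \<bar>exp (- (t * x)) - 1\<bar> * \<bar>\<theta> x\<bar>"
          by (simp add: abs_mult[symmetric] left_diff_distrib)
        also have "\<dots> \<le> (t * x) * x ^ k" using exp_minus_bounds(1)[of "t * x"] \<theta>(2)[OF x] t x by (intro mult_mono) auto
        finally show ?thesis by (simp add: mult.assoc)
      qed
      then show "\<forall>x\<ge>0. \<bar>exp (- t * x) * \<theta> x - \<theta> x\<bar> \<le> t * x ^ (k + 1)" by blast
      show "(\<lambda>x. exp (- t * x) * \<theta> x - \<theta> x) \<in> borel_measurable borel" using \<theta>(1) by measurable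
    qed (use t in simp)
    moreover have "t * B' * b_mass ?X ^ n \<le> t * B' * K ^ n" using mass[OF c] B'(1) t by (intro mult_left_mono power_mono) auto
    ultimately have "pruning_semigroup P N t G c - G c = s * JJ (\<lambda>x. exp (- t * x) * \<theta> x - \<theta> x) ?X"
      "\<bar>JJ (\<lambda>x. exp (- t * x) * \<theta> x - \<theta> x) ?X\<bar> \<le> t * B' * K ^ n" by (blast, linarith)
    then have "\<bar>pruning_semigroup P N t G c - G c\<bar> \<le> \<bar>s\<bar> * (t * B' * K ^ n)"
      by (simp only: abs_mult mult_left_mono abs_ge_zero)
    then show "\<bar>pruning_semigroup P N t G c - G c\<bar> \<le> t * (\<bar>s\<bar> * B' * K ^ n)" by (simp add: mult_ac)
  qed
  ultimately show ?thesis by (simp add: strong_domain_def)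
qed

end

text \<open>\<open>generator\<close> picks some value by \<open>SOME\<close>; on
  \<open>HKs K\<close> all candidates agree because pointwise limits are unique.\<close>

lemma generator_unique:
  assumes "is_generator_value P N K f g" "c \<in> HKs K"
  shows "generator P N K f c = g c"
proof -
  have "is_generator_value P N K f (generator P N K f)"
    unfolding generator_def by (rule someI[where P="is_generator_value P N K f", OF assms(1)])
  then have "uniform_limit (HKs K) (\<lambda>t c. (pruning_semigroup P N t f c - f c) / t) (generator P N K f) (at_right 0)"
    "uniform_limit (HKs K) (\<lambda>t c. (pruning_semigroup P N t f c - f c) / t) g (at_right 0)"
    using assms(1) unfolding is_generator_value_def by blast+
  from tendsto_unique[OF trivial_limit_at_right_real this[THEN tendsto_uniform_limitI, OF assms(2)]] show ?thesis .
qed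

context test_function
begin

lemma generator_value:
  fixes P :: "'a bmt \<Rightarrow> 'w measure" and N :: "'a bmt \<Rightarrow> 'w \<Rightarrow> (real \<times> 'a) measure"
  assumes P: "\<And>X. X \<in> bm_trees \<Longrightarrow> poisson_point_measure (P X) (N X) (pruning_intensity X)"
  shows "is_generator_value P N K (Psi1 n Phi_n) (\<lambda>c. - JJ (\<lambda>x. x) (class_rep c))"
  unfolding is_generator_value_def
proof (intro conjI)
  show "Psi1 n Phi_n \<in> strong_domain P N K"
  proof (rule JJ_strong_domain[where \<theta>="\<lambda>_. 1" and k=0 and s=1, OF P])
    fix c :: "nat \<Rightarrow> 'a bmt set" and d
    assume c: "range c \<subseteq> Hfs" "d \<in> Hfs"
      "weakly_converges HH_seq_top (\<lambda>N. varpi (class_rep (c N))) (varpi (class_rep d))"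
    then have "c N \<in> Hfs" for N by blast
    from JJ_tendsto[OF this c(2,3), of "\<lambda>_. 1" 1]
    show "(\<lambda>N. JJ (\<lambda>_. 1) (class_rep (c N))) \<longlonglongrightarrow> JJ (\<lambda>_. 1) (class_rep d)" by simp
  qed (use Psi1_JJ in auto)
  show "(\<lambda>c. - JJ (\<lambda>x. x) (class_rep c)) \<in> strong_domain P N K"
  proof (rule JJ_strong_domain[where \<theta>="\<lambda>x. x" and k=1 and s="-1", OF P])
    fix c :: "nat \<Rightarrow> 'a bmt set" and d
    assume c: "range c \<subseteq> Hfs" "d \<in> Hfs"
      "weakly_converges HH_seq_top (\<lambda>N. varpi (class_rep (c N))) (varpi (class_rep d))"
    then have "c N \<in> Hfs" for N by blast
    from JJ_id_tendsto[OF this c(2,3)]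
    show "(\<lambda>N. JJ (\<lambda>x. x) (class_rep (c N))) \<longlonglongrightarrow> JJ (\<lambda>x. x) (class_rep d)" .
  qed auto
  \<comment> \<open>Exponent 2 is for the remainder exp (- t x) - 1 + t x, which is at most (t x)^2;
    after division by t the error is of order t.\<close>
  obtain B where B: "0 \<le> B" "\<And>(X::'a bmt) \<theta> c. pbt X \<Longrightarrow> \<theta> \<in> borel_measurable borel \<Longrightarrow> 0 \<le> c \<Longrightarrow>
    \<forall>x\<ge>0. \<bar>\<theta> x\<bar> \<le> c * x\<^sup>2 \<Longrightarrow> \<bar>JJ \<theta> X\<bar> \<le> c * B * b_mass X ^ n" by (rule JJ_bound[of 2, where ?'a='a]) blast
  show "uniform_limit (HKs K) (\<lambda>t c. (pruning_semigroup P N t (Psi1 n Phi_n) c - Psi1 n Phi_n c) / t)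
     (\<lambda>c. - JJ (\<lambda>x. x) (class_rep c)) (at_right 0)"
  proof (rule uniform_limit_at_right_linear)
    fix t :: real and c :: "'a bmt set" assume t: "0 < t" and c: "c \<in> HKs K"
    let ?X = "class_rep c"
    let ?\<theta> = "\<lambda>x. exp (- t * x) - 1 + t * x"
    note X = HKs_rep(1)[OF c]
    note Y = bm_treesD[OF X]
    let ?Q = "b_samples n ?X"
    have e: "\<bar>exp (- t * x)\<bar> \<le> x ^ 0" if "0 \<le> x" for x using t that by simp
    have "Psi1 n Phi_n c = 1 * JJ (\<lambda>_. 1) (class_rep c)" if "class_rep c \<in> bm_trees" for c :: "'a bmt set"
      using Psi1_JJ[OF that] by simp
    note ex = expectation_JJ[OF X P[OF X] _ _ _ this, of t 0]
    have "pruning_semigroup P N t (Psi1 n Phi_n) c = JJ (\<lambda>x. exp (- t * x)) ?X"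
      unfolding pruning_semigroup_def Let_def
      using ex t by simp
    moreover have "JJ ?\<theta> ?X = JJ (\<lambda>x. exp (- t * x)) ?X - JJ (\<lambda>_. 1) ?X + t * JJ (\<lambda>x. x) ?X"
    proof -
      have i: "integrable ?Q (\<lambda>u. EE (\<lambda>x. exp (- t * x)) ?X (prefix_list n u))"
        by (rule EE_integrable[OF Y _ e]) auto
      have j: "integrable ?Q (\<lambda>u. EE (\<lambda>_. 1) ?X (prefix_list n u))" by (rule EE_integrable[OF Y, where k=0]) auto
      have k: "integrable ?Q (\<lambda>u. EE (\<lambda>x. x) ?X (prefix_list n u))" by (rule EE_integrable[OF Y, where k=1]) auto
      have "JJ ?\<theta> ?X = (\<integral>u. EE (\<lambda>x. exp (- t * x)) ?X (prefix_list n u) - EE (\<lambda>_. 1) ?X (prefix_list n u)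
          + t * EE (\<lambda>x. x) ?X (prefix_list n u) \<partial>?Q)"
        by (simp add: JJ_def EE_def algebra_simps)
      then show ?thesis using i j k by (simp add: JJ_def)
    qed
    ultimately have "(pruning_semigroup P N t (Psi1 n Phi_n) c - Psi1 n Phi_n c) / t - - JJ (\<lambda>x. x) ?X = JJ ?\<theta> ?X / t"
      using t Psi1_JJ[OF X] by (simp add: field_simps)
    moreover have "\<bar>JJ ?\<theta> ?X\<bar> \<le> t\<^sup>2 * B * b_mass ?X ^ n"
    proof (rule B(2)[OF Y])
      show "\<forall>x\<ge>0. \<bar>?\<theta> x\<bar> \<le> t\<^sup>2 * x\<^sup>2"
        using exp_minus_bounds(2)[of "t * _"] t by (simp add: power_mult_distrib)
    qed auto
    moreover have "t\<^sup>2 * B * b_mass ?X ^ n \<le> t\<^sup>2 * B * K ^ n"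
      using HKs_rep(2)[OF c] B(1) by (intro mult_left_mono power_mono) (auto simp: b_mass_def total_mass_def)
    ultimately have "\<bar>(pruning_semigroup P N t (Psi1 n Phi_n) c - Psi1 n Phi_n c) / t - - JJ (\<lambda>x. x) ?X\<bar> = \<bar>JJ ?\<theta> ?X\<bar> / t"
      "\<bar>JJ ?\<theta> ?X\<bar> \<le> t\<^sup>2 * B * K ^ n" using t by (simp, linarith)
    then have "\<bar>(pruning_semigroup P N t (Psi1 n Phi_n) c - Psi1 n Phi_n c) / t - - JJ (\<lambda>x. x) ?X\<bar> \<le> t\<^sup>2 * B * K ^ n / t"
      using t by (simp only: divide_right_mono less_imp_le)
    also have "\<dots> = t * (B * K ^ n)" using t by (simp add: power2_eq_square)
    finally show "\<bar>(pruning_semigroup P N t (Psi1 n Phi_n) c - Psi1 n Phi_n c) / t - - JJ (\<lambda>x. x) ?X\<bar> \<le> t * (B * K ^ n)" .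
  qed
qed

text \<open>Almost every sample spans finite mass, where projection to fewer points commutes with
  \<open>tau_rep\<close>; the integrand is then \<open>EE\<close> with weight x.\<close>

lemma integral_mass_Phi_n:
  assumes X: "X \<in> bm_trees"
  shows "integrable (b_samples n X)
      (\<lambda>u. measure (b_nu X) (b_span X (u ` {..<n})) * Phi_n (tau_rep X (prefix_list n u)))"
    "(\<integral>u. measure (b_nu X) (b_span X (u ` {..<n})) * Phi_n (tau_rep X (prefix_list n u)) \<partial>b_samples n X) =
      JJ (\<lambda>x. x) X"
proof -
  interpret pbt X by (rule bm_treesD[OF X])
  let ?Q = "b_samples n X"
  let ?f = "\<lambda>u. measure \<nu> (b_span X (u ` {..<n})) * Phi_n (tau_rep X (prefix_list n u))"
  have mass: "measure \<nu> (b_span X (u ` {..<n})) = p_mass (tau_rep X (prefix_list n u))" if "u \<in> space ?Q" for u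
    using tau_mass[OF prefix_S[OF that]] by simp
  have "(\<lambda>u. p_mass (tau_rep X (prefix_list n u)) * Phi_n (tau_rep X (prefix_list n u))) \<in> borel_measurable ?Q"
    using tau_mass_measurable[OF distm_list_PiM] Phi_n_tau(1)[OF pbt_axioms] by (rule borel_measurable_times)
  then have m: "?f \<in> borel_measurable ?Q" using mass by (simp cong: measurable_cong)
  have ae: "AE u in ?Q. ?f u = EE (\<lambda>x. x) X (prefix_list n u)"
    using Phi_n_tau(2)[OF pbt_axioms] AE_space
  proof eventually_elim
    case (elim u)
    then show ?case using mass[OF elim(2)] by (simp add: EE_def)
  qed
  have i: "integrable ?Q (\<lambda>u. EE (\<lambda>x. x) X (prefix_list n u))"
    by (rule EE_integrable[OF pbt_axioms, where k=1]) auto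
  show "integrable ?Q ?f" using integrable_cong_AE[OF m borel_measurable_integrable[OF i] ae] i by blast
  show "(\<integral>u. ?f u \<partial>?Q) = JJ (\<lambda>x. x) X"
    unfolding JJ_def by (rule integral_cong_AE[OF m borel_measurable_integrable[OF i] ae])
qed

end

lemma generator_formula:
  fixes P :: "'a bmt \<Rightarrow> 'w measure" and N :: "'a bmt \<Rightarrow> 'w \<Rightarrow> (real \<times> 'a) measure"
  assumes P: "\<And>X. X \<in> bm_trees \<Longrightarrow> poisson_point_measure (P X) (N X) (pruning_intensity X)"
    and n: "1 \<le> n" and \<Phi>: "\<Phi> \<in> Pi_tilde n"
  shows "Psi1 n \<Phi> \<in> generator_domain P N K"
    "\<And>X. X \<in> bm_trees \<Longrightarrow> b_mass X \<le> K \<Longrightarrow>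
       integrable (b_nu X) (\<lambda>v. Psi1 n \<Phi> (bm_class (prune X {v})) - Psi1 n \<Phi> (bm_class X)) \<and>
       generator P N K (Psi1 n \<Phi>) (bm_class X) =
         (\<integral>v. Psi1 n \<Phi> (bm_class (prune X {v})) - Psi1 n \<Phi> (bm_class X) \<partial>b_nu X) \<and>
       integrable (b_samples n X) (\<lambda>u. measure (b_nu X) (b_span X (u ` {..<n})) * \<Phi> (tau_rep X (prefix_list n u))) \<and>
       (\<integral>v. Psi1 n \<Phi> (bm_class (prune X {v})) - Psi1 n \<Phi> (bm_class X) \<partial>b_nu X) =
         - (\<integral>u. measure (b_nu X) (b_span X (u ` {..<n})) * \<Phi> (tau_rep X (prefix_list n u)) \<partial>b_samples n X)" (is "\<And>X. _ \<Longrightarrow> _ \<Longrightarrow> ?F X")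
proof -
  obtain \<gamma> m \<phi> where tf: "test_function n \<gamma> m \<phi>"
    and "\<Phi> = (\<lambda>X. \<Prod>I\<in>Pow {..<n} - {{}}. Phi_fun (\<gamma> I) (m I) (\<phi> I) (project_points I X))"
    by (rule Pi_tilde_cases[OF \<Phi> n]) blast
  interpret test_function n \<gamma> m \<phi> by (rule tf)
  have \<Phi>': "\<Phi> = Phi_n" unfolding Phi_n_def[abs_def] by fact
  note gen = generator_value[OF P, of K]
  show "Psi1 n \<Phi> \<in> generator_domain P N K" using gen unfolding generator_domain_def \<Phi>' by blast
  fix X :: "'a bmt" assume X: "X \<in> bm_trees" "b_mass X \<le> K"
  \<comment> \<open>The representative of \<open>bm_class X\<close> chosen by
    \<open>class_rep\<close> need not be X itself; \<open>JJ_class\<close> leads back to X.\<close>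
  have 1: "Psi1 n Phi_n (bm_class X) = JJ (\<lambda>_. 1) X"
    using Psi1_JJ[OF bm_class_rep(1)[OF bm_iso_refl[OF X(1)] X(1)]] JJ_class[OF X(1), of "\<lambda>_. 1"] by simp
  have "generator P N K (Psi1 n Phi_n) (bm_class X) = - JJ (\<lambda>x. x) X"
    using generator_unique[OF gen HKs_class[OF X]] JJ_class[OF X(1), of "\<lambda>x. x"] by simp
  then show "?F X"
    using jump_integral[OF X(1)] integral_mass_Phi_n[OF X(1)] unfolding \<Phi>' 1 by presburger
qed

theorem proposition3p7:
  fixes K :: real
    and P :: "point bmt \<Rightarrow> 'w measure"
    and N :: "point bmt \<Rightarrow> 'w \<Rightarrow> (real \<times> point) measure"
  assumes "K > 0"
    and "\<And>X. X \<in> bm_trees \<Longrightarrow> poisson_point_measure (P X) (N X) (pruning_intensity X)"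
  shows "F1_tilde \<subseteq> generator_domain P N K \<and>
    (\<forall>n\<ge>1. \<forall>\<Phi>\<in>Pi_tilde n. \<forall>X\<in>bm_trees. b_mass X \<le> K \<longrightarrow>
       integrable (b_nu X)
         (\<lambda>v. Psi1 n \<Phi> (bm_class (prune X {v})) - Psi1 n \<Phi> (bm_class X)) \<and>
       generator P N K (Psi1 n \<Phi>) (bm_class X) =
         (\<integral>v. Psi1 n \<Phi> (bm_class (prune X {v})) - Psi1 n \<Phi> (bm_class X) \<partial>b_nu X) \<and>
       integrable (Pi\<^sub>M {..<n} (\<lambda>_. on_supp (b_metric X) (b_mu X)))
         (\<lambda>u. measure (b_nu X) (b_span X (u ` {..<n})) * \<Phi> (tau_rep X (prefix_list n u))) \<and>
       (\<integral>v. Psi1 n \<Phi> (bm_class (prune X {v})) - Psi1 n \<Phi> (bm_class X) \<partial>b_nu X) =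
         - (\<integral>u. measure (b_nu X) (b_span X (u ` {..<n})) * \<Phi> (tau_rep X (prefix_list n u))
              \<partial>Pi\<^sub>M {..<n} (\<lambda>_. on_supp (b_metric X) (b_mu X))))"
  using generator_formula[OF assms(2)] unfolding F1_tilde_def by blast

end
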